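(* There exists a (small) constant $C_0>0$, depending only on the equation (that is, on $m$ and the coefficients $\alpha_k,\beta_k$ of the nonlinear terms), such that the following holds. Suppose that $(u_0,v_0)\in H^1(\mathbb{R})$ and $\|u_0\|_{L^2(\mathbb{R})}^2+\|v_0\|_{L^2(\mathbb{R})}^2\le C_0$. Then the Cauchy problem $$i(u_t+u_x)=-mv+N_1(u,v),\qquad i(v_t-v_x)=-mu+N_2(u,v),\qquad (u,v)|_{t=0}=(u_0,v_0),$$ admits a unique global solution $(u,v)\in C([0,\infty);H^1(\mathbb{R}))\cap C^1([0,\infty);L^2(\mathbb{R}))$.
   Context: The unknowns $u,v$ are complex-valued functions of $(t,x)$, $t\ge 0$, $x\in\mathbb{R}$, and $m\ge 0$ is a constant. $\Re Z$ denotes the real part of $Z\in\mathbb{C}$. The nonlinear terms $N_1,N_2$ are fixed and satisfy: (A1) $N_1(u,v)=(\alpha_1u+\alpha_2\overline{u})(\alpha_3|v|^2+\alpha_4v^2+\alpha_5\overline{v}^2)$ and $N_2(u,v)=(\beta_1v+\beta_2\overline{v})(\beta_3|u|^2+\beta_4u^2+\beta_5\overline{u}^2)$, where $\alpha_k,\beta_k$ ($k=1,\dots,5$) are (complex) constants; (A2) for all $(u,v)\in\mathbb{C}^2$, $\Re\big(i\overline{u}N_1(u,v)+i\overline{v}N_2(u,v)\big)=0$. *)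

theory Defs
  imports "HOL-Analysis.Analysis"
begin

text \<open>Elements of \<open>L\<^sup>2(\<real>)\<close> and \<open>H\<^sup>1(\<real>)\<close> are represented by Borel functions; every equality
  between them is understood almost everywhere. This loses nothing, since every Lebesgue measurable
  function agrees almost everywhere with a Borel one.\<close>

definition L2 :: "(real \<Rightarrow> complex) set" where
  "L2 = {f. f \<in> borel_measurable lborel \<and> integrable lborel (\<lambda>x. (cmod (f x))\<^sup>2)}"

definition L2_norm :: "(real \<Rightarrow> complex) \<Rightarrow> real" where
  "L2_norm f = sqrt (LINT x|lborel. (cmod (f x))\<^sup>2)"

definition test_function :: "(real \<Rightarrow> real) \<Rightarrow> bool" where
  "test_function \<phi> \<longleftrightarrow>
     (\<forall>n. (deriv ^^ n) \<phi> differentiable_on UNIV) \<and> compact (closure {x. \<phi> x \<noteq> 0})"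

definition has_weak_deriv :: "(real \<Rightarrow> complex) \<Rightarrow> (real \<Rightarrow> complex) \<Rightarrow> bool" where
  "has_weak_deriv f g \<longleftrightarrow>
     (\<forall>\<phi>. test_function \<phi> \<longrightarrow>
       (LINT x|lborel. f x * of_real (deriv \<phi> x)) = - (LINT x|lborel. g x * of_real (\<phi> x)))"

definition H1 :: "(real \<Rightarrow> complex) set" where
  "H1 = {f \<in> L2. \<exists>g \<in> L2. has_weak_deriv f g}"

text \<open>For \<open>f \<in> H1\<close> the choice below is unique up to a null set, so \<open>H1_norm\<close> and the almost
  everywhere equations in \<open>solution\<close> do not depend on it.\<close>

definition weak_deriv :: "(real \<Rightarrow> complex) \<Rightarrow> real \<Rightarrow> complex" where
  "weak_deriv f = (SOME g. g \<in> L2 \<and> has_weak_deriv f g)"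

definition H1_norm :: "(real \<Rightarrow> complex) \<Rightarrow> real" where
  "H1_norm f = sqrt ((L2_norm f)\<^sup>2 + (L2_norm (weak_deriv f))\<^sup>2)"

text \<open>\<open>C([0,\<infinity>);X)\<close> for a space \<open>X\<close> with norm \<open>N\<close>; a curve is written \<open>u t x\<close>, and its values
  at negative times are irrelevant.\<close>

definition cont_curve ::
  "(real \<Rightarrow> complex) set \<Rightarrow> ((real \<Rightarrow> complex) \<Rightarrow> real) \<Rightarrow> (real \<Rightarrow> real \<Rightarrow> complex) \<Rightarrow> bool" where
  "cont_curve X N u \<longleftrightarrow>
     (\<forall>t\<ge>0. u t \<in> X) \<and>
     (\<forall>t\<ge>0. ((\<lambda>s. N (\<lambda>x. u s x - u t x)) \<longlongrightarrow> 0) (at t within {0..}))"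

text \<open>\<open>u \<in> C\<^sup>1([0,\<infinity>);L\<^sup>2)\<close> with time derivative \<open>u'\<close> (one-sided at \<open>t = 0\<close>).\<close>

definition C1_L2_curve :: "(real \<Rightarrow> real \<Rightarrow> complex) \<Rightarrow> (real \<Rightarrow> real \<Rightarrow> complex) \<Rightarrow> bool" where
  "C1_L2_curve u u' \<longleftrightarrow>
     cont_curve L2 L2_norm u \<and> cont_curve L2 L2_norm u' \<and>
     (\<forall>t\<ge>0. ((\<lambda>s. L2_norm (\<lambda>x. (u s x - u t x) / of_real (s - t) - u' t x)) \<longlongrightarrow> 0)
             (at t within {0..}))"

definition N1 :: "(nat \<Rightarrow> complex) \<Rightarrow> complex \<Rightarrow> complex \<Rightarrow> complex" where
  "N1 \<alpha> u v = (\<alpha> 1 * u + \<alpha> 2 * cnj u) *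
     (\<alpha> 3 * of_real ((cmod v)\<^sup>2) + \<alpha> 4 * v\<^sup>2 + \<alpha> 5 * (cnj v)\<^sup>2)"

definition N2 :: "(nat \<Rightarrow> complex) \<Rightarrow> complex \<Rightarrow> complex \<Rightarrow> complex" where
  "N2 \<beta> u v = (\<beta> 1 * v + \<beta> 2 * cnj v) *
     (\<beta> 3 * of_real ((cmod u)\<^sup>2) + \<beta> 4 * u\<^sup>2 + \<beta> 5 * (cnj u)\<^sup>2)"

definition solution ::
  "real \<Rightarrow> (nat \<Rightarrow> complex) \<Rightarrow> (nat \<Rightarrow> complex) \<Rightarrow> (real \<Rightarrow> complex) \<Rightarrow> (real \<Rightarrow> complex) \<Rightarrow>
   (real \<Rightarrow> real \<Rightarrow> complex) \<Rightarrow> (real \<Rightarrow> real \<Rightarrow> complex) \<Rightarrow> bool" where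
  "solution m \<alpha> \<beta> u0 v0 u v \<longleftrightarrow>
     cont_curve H1 H1_norm u \<and> cont_curve H1 H1_norm v \<and>
     (AE x in lborel. u 0 x = u0 x \<and> v 0 x = v0 x) \<and>
     (\<exists>u' v'. C1_L2_curve u u' \<and> C1_L2_curve v v' \<and>
       (\<forall>t\<ge>0. AE x in lborel.
          \<i> * (u' t x + weak_deriv (u t) x) = - of_real m * v t x + N1 \<alpha> (u t x) (v t x) \<and>
          \<i> * (v' t x - weak_deriv (v t) x) = - of_real m * u t x + N2 \<beta> (u t x) (v t x)))"

end

theory Submission
  imports Defs
begin

text \<open>Both equations are transport equations, with speeds \<open>1\<close> and \<open>-1\<close>, and every cubic term of
  the first one contains \<open>u\<close> once and \<open>v\<close> twice, of the second one \<open>v\<close> once and \<open>u\<close> twice.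
  The proof rests on what this structure gives along the characteristics.

  \<^bold>\<open>An a priori bound.\<close> The hypothesis on the nonlinearity says that
  \<open>(\<partial>\<^sub>t + \<partial>\<^sub>x) |u|\<^sup>2 = H = - (\<partial>\<^sub>t - \<partial>\<^sub>x) |v|\<^sup>2\<close> for some \<open>H\<close>. Integrated over a characteristic
  triangle, this local conservation law bounds the flux of \<open>|v|\<^sup>2\<close> through a characteristic of the
  first equation by half of the initial charge, and likewise that of \<open>|u|\<^sup>2\<close> through a
  characteristic of the second (\<open>characteristic_flux\<close>). But along a characteristic of the first
  equation the modulus of \<open>u\<close> grows at a rate of at most \<open>m |v| + C |u| |v|\<^sup>2\<close>, and the integral of \<open>|v|\<^sup>2\<close>
  along it has just been seen to be small: the cubic term is absorbed, and \<open>|u|\<close> and \<open>|v|\<close> are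
  bounded by a linear function of time (\<open>small_flux_bound\<close>, \<open>sup_bound_from_flux\<close>).

  \<^bold>\<open>Existence.\<close> Scaling the arguments of the cubic terms back to a bounded set makes the system
  globally Lipschitz without destroying the conservation law. Picard iteration solves the cut-off
  system for all times, in the form integrated along characteristics
  (\<open>Lipschitz_system_solution\<close>). The a priori bound does not depend on the cut-off, which is
  therefore placed beyond the bound and never becomes active (\<open>global_bounded_solution\<close>).

  \<^bold>\<open>Regularity.\<close> The solution obtained so far is continuous and locally bounded. A function is in
  \<open>H\<^sup>1\<close> exactly if its difference quotients converge in \<open>L\<^sup>2\<close> (\<open>H1_diff_quot_limit\<close>,
  \<open>H1_if_diff_quot_limit\<close>). The difference quotients of the solution satisfy transport systems whose
  sources are bounded by a multiple of the unknowns, and for such systems the growth of the \<open>L\<^sup>2\<close>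
  norm is under control (\<open>L2_mild_estimate\<close>). The difference of two difference quotients satisfies
  the linearised system up to a small remainder, so that they are Cauchy, uniformly on
  bounded time intervals (\<open>diff_quot_Cauchy\<close>). Uniformity makes the solution a continuous curve in
  \<open>H\<^sup>1\<close>, and a difference quotient in time is, by the integrated equation, one in space plus an
  average of the source (\<open>mild_curve_regularity\<close>).

  \<^bold>\<open>Uniqueness.\<close> Functions in \<open>H\<^sup>1\<close> are bounded, the nonlinearity is Lipschitz on bounded sets, and
  \<open>Re \<langle>d, \<partial>\<^sub>x d\<rangle> = 0\<close>; so the squared \<open>L\<^sup>2\<close> distance of two solutions grows at most exponentially from
  zero (\<open>solution_unique\<close>).\<close>

section \<open>The space of square integrable functions\<close>

lemma L2_measurable: "f \<in> L2 \<Longrightarrow> f \<in> borel_measurable borel"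
  by (simp add: L2_def)

lemma L2_integrable: "f \<in> L2 \<Longrightarrow> integrable lborel (\<lambda>x. (cmod (f x))\<^sup>2)"
  by (simp add: L2_def)

lemma L2_norm_nonneg [simp]: "0 \<le> L2_norm f"
  by (simp add: L2_norm_def)

lemma L2_norm_sq: "(L2_norm f)\<^sup>2 = (LINT x|lborel. (cmod (f x))\<^sup>2)"
  by (simp add: L2_norm_def)

lemma L2_norm_cong_AE:
  assumes "f \<in> borel_measurable borel" "g \<in> borel_measurable borel" "AE x in lborel. f x = g x"
  shows "L2_norm f = L2_norm g"
  unfolding L2_norm_def using assms by (auto intro!: arg_cong[where f=sqrt] integral_cong_AE)

lemma L2_cong_AE:
  assumes "f \<in> L2" "g \<in> borel_measurable borel" "AE x in lborel. f x = g x"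
  shows "g \<in> L2"
proof -
  have "integrable lborel (\<lambda>x. (cmod (g x))\<^sup>2) \<longleftrightarrow> integrable lborel (\<lambda>x. (cmod (f x))\<^sup>2)"
    using assms L2_measurable[OF assms(1)] by (intro integrable_cong_AE) auto
  then show ?thesis using assms by (simp add: L2_def)
qed

text \<open>Square integrability is decided, and norms are estimated, in \<open>ennreal\<close>, where no
  integrability side conditions arise.\<close>

definition energy :: "(real \<Rightarrow> complex) \<Rightarrow> ennreal" where
  "energy f = (\<integral>\<^sup>+x. ennreal ((cmod (f x))\<^sup>2) \<partial>lborel)"

lemma energy_L2: "f \<in> L2 \<Longrightarrow> energy f = ennreal ((L2_norm f)\<^sup>2)"
  unfolding energy_def L2_norm_sq by (rule nn_integral_eq_integral) (auto simp: L2_integrable)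

lemma L2_energyI:
  assumes "f \<in> borel_measurable borel" "energy f \<le> ennreal c"
  shows "f \<in> L2"
proof -
  have "integrable lborel (\<lambda>x. (cmod (f x))\<^sup>2)"
    using assms by (intro integrableI_bounded) (auto simp: energy_def intro: le_less_trans)
  then show ?thesis using assms by (simp add: L2_def)
qed

lemma L2_norm_le_energy:
  assumes "f \<in> borel_measurable borel" "energy f \<le> ennreal (c\<^sup>2)" "0 \<le> c"
  shows "L2_norm f \<le> c"
proof -
  have "ennreal ((L2_norm f)\<^sup>2) \<le> ennreal (c\<^sup>2)"
    using energy_L2[OF L2_energyI[OF assms(1,2)]] assms(2) by simp
  then have "(L2_norm f)\<^sup>2 \<le> c\<^sup>2" by (simp add: ennreal_le_iff)
  then show ?thesis using assms(3) power2_le_imp_le by blast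
qed

lemma energy_le_norm: "f \<in> L2 \<Longrightarrow> L2_norm f \<le> c \<Longrightarrow> energy f \<le> ennreal (c\<^sup>2)"
  by (simp add: energy_L2 ennreal_leI power_mono)

lemma L2_dominated:
  assumes "g \<in> L2" "f \<in> borel_measurable borel" "\<And>x. cmod (f x) \<le> c * cmod (g x)"
  shows "f \<in> L2"
proof -
  have "integrable lborel (\<lambda>x. c\<^sup>2 * (cmod (g x))\<^sup>2)"
    using L2_integrable[OF assms(1)] by (rule integrable_mult_right)
  moreover have "(cmod (f x))\<^sup>2 \<le> c\<^sup>2 * (cmod (g x))\<^sup>2" for x
    using power_mono[OF assms(3)[of x], of 2] by (simp add: power_mult_distrib)
  ultimately have "integrable lborel (\<lambda>x. (cmod (f x))\<^sup>2)"
    using assms(2) by (rule_tac Bochner_Integration.integrable_bound[of lborel "\<lambda>x. c\<^sup>2 * (cmod (g x))\<^sup>2"]) auto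
  then show ?thesis using assms by (simp add: L2_def)
qed

lemma L2_norm_mono:
  assumes "g \<in> L2" "f \<in> borel_measurable borel" "\<And>x. cmod (f x) \<le> cmod (g x)"
  shows "L2_norm f \<le> L2_norm g"
proof -
  have "f \<in> L2" using L2_dominated[OF assms(1,2), of 1] assms(3) by simp
  then show ?thesis
    unfolding L2_norm_def using assms
    by (intro real_sqrt_le_mono integral_mono L2_integrable) (auto intro: power_mono)
qed

lemma L2_zero [simp]: "(\<lambda>x. 0) \<in> L2" and L2_norm_zero [simp]: "L2_norm (\<lambda>x. 0) = 0"
  by (simp_all add: L2_def L2_norm_def)

lemma L2_cmult:
  assumes "f \<in> L2" shows "(\<lambda>x. c * f x) \<in> L2"
  by (rule L2_dominated[OF assms, of _ "cmod c"]) (use L2_measurable[OF assms] in \<open>auto simp: norm_mult\<close>)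

lemma L2_norm_cmult: "L2_norm (\<lambda>x. c * f x) = cmod c * L2_norm f"
  by (simp add: L2_norm_def norm_mult power_mult_distrib real_sqrt_mult)

lemma L2_uminus: "f \<in> L2 \<Longrightarrow> (\<lambda>x. - f x) \<in> L2"
  using L2_cmult[of f "-1"] by simp

lemma L2_norm_minus_commute: "L2_norm (\<lambda>x. f x - g x) = L2_norm (\<lambda>x. g x - f x)"
  by (simp add: L2_norm_def norm_minus_commute)

lemma L2_cnj: assumes "f \<in> L2" shows "(\<lambda>x. cnj (f x)) \<in> L2"
proof -
  have "(\<lambda>x. cnj (f x)) \<in> borel_measurable borel"
    using L2_measurable[OF assms] borel_measurable_continuous_onI[OF continuous_on_cnj[OF continuous_on_id]]
    by (rule measurable_compose)
  then show ?thesis by (intro L2_dominated[OF assms, of _ 1]) auto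
qed

lemma L2_add: assumes "f \<in> L2" "g \<in> L2" shows "(\<lambda>x. f x + g x) \<in> L2"
proof -
  note [measurable] = L2_measurable[OF assms(1)] L2_measurable[OF assms(2)]
  have "integrable lborel (\<lambda>x. 2 * (cmod (f x))\<^sup>2 + 2 * (cmod (g x))\<^sup>2)"
    using L2_integrable assms by auto
  moreover have "(cmod (f x + g x))\<^sup>2 \<le> 2 * (cmod (f x))\<^sup>2 + 2 * (cmod (g x))\<^sup>2" for x
  proof -
    have "(cmod (f x + g x))\<^sup>2 \<le> (cmod (f x) + cmod (g x))\<^sup>2"
      by (intro power_mono norm_triangle_ineq) auto
    also have "\<dots> \<le> 2 * (cmod (f x))\<^sup>2 + 2 * (cmod (g x))\<^sup>2"
      using zero_le_power2[of "cmod (f x) - cmod (g x)"] by (simp add: power2_eq_square algebra_simps)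
    finally show ?thesis .
  qed
  ultimately have "integrable lborel (\<lambda>x. (cmod (f x + g x))\<^sup>2)"
    by (intro Bochner_Integration.integrable_bound[of lborel _ "\<lambda>x. (cmod (f x + g x))\<^sup>2"]) auto
  then show ?thesis by (simp add: L2_def)
qed

lemma L2_diff: "f \<in> L2 \<Longrightarrow> g \<in> L2 \<Longrightarrow> (\<lambda>x. f x - g x) \<in> L2"
  using L2_add[OF _ L2_uminus, of f g] by simp

lemma L2_mult_integrable:
  assumes "f \<in> L2" "g \<in> L2" shows "integrable lborel (\<lambda>x. f x * g x)"
proof -
  note [measurable] = L2_measurable[OF assms(1)] L2_measurable[OF assms(2)]
  have "integrable lborel (\<lambda>x. (cmod (f x))\<^sup>2 + (cmod (g x))\<^sup>2)"
    using L2_integrable assms by auto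
  moreover have "cmod (f x * g x) \<le> (cmod (f x))\<^sup>2 + (cmod (g x))\<^sup>2" for x
  proof -
    have "2 * (cmod (f x) * cmod (g x)) \<le> (cmod (f x))\<^sup>2 + (cmod (g x))\<^sup>2"
      using zero_le_power2[of "cmod (f x) - cmod (g x)"] by (simp add: power2_eq_square algebra_simps)
    moreover have "0 \<le> cmod (f x) * cmod (g x)" by simp
    ultimately show ?thesis unfolding norm_mult by linarith
  qed
  ultimately show ?thesis
    by (intro Bochner_Integration.integrable_bound[of lborel _ "\<lambda>x. f x * g x"]) auto
qed

text \<open>The integrand is nonnegative for every real \<open>t\<close>, so the discriminant of the quadratic
  polynomial in \<open>t\<close> is nonpositive.\<close>

lemma L2_Cauchy_Schwarz_abs:
  assumes "f \<in> L2" "g \<in> L2"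
  shows "(LINT x|lborel. cmod (f x) * cmod (g x)) \<le> L2_norm f * L2_norm g"
proof -
  define a b c where "a = (L2_norm g)\<^sup>2" and "b = (LINT x|lborel. cmod (f x) * cmod (g x))"
    and "c = (L2_norm f)\<^sup>2"
  have int: "integrable lborel (\<lambda>x. cmod (f x) * cmod (g x))"
    using integrable_norm[OF L2_mult_integrable[OF assms]] by (simp add: norm_mult)
  have *: "0 \<le> c + 2 * t * b + t\<^sup>2 * a" for t
  proof -
    have "0 \<le> (LINT x|lborel. (cmod (f x) + t * cmod (g x))\<^sup>2)"
      by (intro integral_nonneg_AE) auto
    also have "(LINT x|lborel. (cmod (f x) + t * cmod (g x))\<^sup>2)
      = (LINT x|lborel. (cmod (f x))\<^sup>2 + (2 * t * (cmod (f x) * cmod (g x)) + t\<^sup>2 * (cmod (g x))\<^sup>2))"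
      by (intro Bochner_Integration.integral_cong) (auto simp: power2_eq_square algebra_simps)
    also have "\<dots> = c + (2 * t * b + t\<^sup>2 * a)"
      unfolding a_def b_def c_def L2_norm_sq using int L2_integrable[OF assms(1)] L2_integrable[OF assms(2)]
      by (subst Bochner_Integration.integral_add; simp)+
    finally show ?thesis by simp
  qed
  have "b\<^sup>2 \<le> a * c"
  proof (cases "a = 0")
    case True
    have "b = 0"
    proof (rule ccontr)
      assume "b \<noteq> 0"
      then show False using *[of "- (c + 1) / (2 * b)"] True by (simp add: field_simps)
    qed
    then show ?thesis using True by simp
  next
    case False
    then have "a > 0" unfolding a_def by simp
    have "0 \<le> (c + 2 * (- b / a) * b + (- b / a)\<^sup>2 * a) * a"
      using *[of "- b / a"] \<open>a > 0\<close> by (intro mult_nonneg_nonneg) auto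
    also have "\<dots> = a * c - b\<^sup>2" using \<open>a > 0\<close> by (simp add: power2_eq_square field_simps)
    finally show ?thesis by simp
  qed
  then have "b\<^sup>2 \<le> (L2_norm f * L2_norm g)\<^sup>2" by (simp add: a_def c_def power_mult_distrib mult.commute)
  then show ?thesis unfolding b_def by (rule power2_le_imp_le) simp
qed

lemma L2_Cauchy_Schwarz:
  assumes "f \<in> L2" "g \<in> L2"
  shows "cmod (LINT x|lborel. f x * g x) \<le> L2_norm f * L2_norm g"
  using integral_norm_bound[of lborel "\<lambda>x. f x * g x"] L2_Cauchy_Schwarz_abs[OF assms]
  by (simp add: norm_mult)

lemma L2_norm_triangle:
  assumes "f \<in> L2" "g \<in> L2"
  shows "L2_norm (\<lambda>x. f x + g x) \<le> L2_norm f + L2_norm g"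
proof -
  note int = L2_integrable[OF assms(1)] L2_integrable[OF assms(2)]
  have int': "integrable lborel (\<lambda>x. cmod (f x) * cmod (g x))"
    using integrable_norm[OF L2_mult_integrable[OF assms]] by (simp add: norm_mult)
  have "(L2_norm (\<lambda>x. f x + g x))\<^sup>2 \<le> (LINT x|lborel. (cmod (f x))\<^sup>2 + (2 * (cmod (f x) * cmod (g x)) + (cmod (g x))\<^sup>2))"
    unfolding L2_norm_sq
  proof (intro integral_mono L2_integrable L2_add assms)
    show "(cmod (f x + g x))\<^sup>2 \<le> (cmod (f x))\<^sup>2 + (2 * (cmod (f x) * cmod (g x)) + (cmod (g x))\<^sup>2)" for x
      using power_mono[OF norm_triangle_ineq[of "f x" "g x"], of 2] by (simp add: power2_eq_square algebra_simps)
  qed (use int int' in auto)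
  also have "\<dots> = (L2_norm f)\<^sup>2 + (2 * (LINT x|lborel. cmod (f x) * cmod (g x)) + (L2_norm g)\<^sup>2)"
    unfolding L2_norm_sq using int int' by (subst Bochner_Integration.integral_add; simp)+
  also have "\<dots> \<le> (L2_norm f + L2_norm g)\<^sup>2"
    using L2_Cauchy_Schwarz_abs[OF assms] by (simp add: power2_eq_square algebra_simps)
  finally show ?thesis by (rule power2_le_imp_le) simp
qed

lemma L2_norm_triangle_diff:
  assumes "f \<in> L2" "g \<in> L2"
  shows "L2_norm (\<lambda>x. f x - g x) \<le> L2_norm f + L2_norm g"
  using L2_norm_triangle[OF assms(1) L2_uminus[OF assms(2)]] L2_norm_cmult[of "-1" g] by simp

lemma L2_norm_triangle3:
  assumes "f \<in> L2" "g \<in> L2" "h \<in> L2"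
  shows "L2_norm (\<lambda>x. f x - h x) \<le> L2_norm (\<lambda>x. f x - g x) + L2_norm (\<lambda>x. g x - h x)"
proof -
  have "(\<lambda>x. f x - h x) = (\<lambda>x. (f x - g x) + (g x - h x))" by (simp add: fun_eq_iff)
  then show ?thesis using L2_norm_triangle[OF L2_diff[OF assms(1,2)] L2_diff[OF assms(2,3)]] by metis
qed

lemma L2_norm_eq_0_AE:
  assumes "f \<in> L2" "L2_norm f = 0" shows "AE x in lborel. f x = 0"
proof -
  have "(LINT x|lborel. (cmod (f x))\<^sup>2) = 0" using assms(2) by (simp add: L2_norm_def)
  then show ?thesis
    using integral_nonneg_eq_0_iff_AE[OF L2_integrable[OF assms(1)]] by simp
qed

lemma energy_shift:
  assumes "f \<in> borel_measurable borel" shows "energy (\<lambda>x. f (x + h)) = energy f"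
  unfolding energy_def
  using nn_integral_real_affine[of "\<lambda>x. ennreal ((cmod (f x))\<^sup>2)" 1 h] assms
  by (simp add: add.commute)

lemma measurable_shift:
  fixes f :: "real \<Rightarrow> 'b::topological_space"
  assumes "f \<in> borel_measurable borel" shows "(\<lambda>x. f (x + h)) \<in> borel_measurable borel"
  using assms by measurable

lemma L2_shift:
  assumes "f \<in> L2" shows "(\<lambda>x. f (x + h)) \<in> L2"
  by (rule L2_energyI[where c="(L2_norm f)\<^sup>2"])
     (use measurable_shift L2_measurable[OF assms] energy_shift energy_L2[OF assms] in auto)

lemma L2_norm_shift:
  assumes "f \<in> L2" shows "L2_norm (\<lambda>x. f (x + h)) = L2_norm f"
proof -
  have "ennreal ((L2_norm (\<lambda>x. f (x + h)))\<^sup>2) = ennreal ((L2_norm f)\<^sup>2)"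
    using energy_L2[OF assms] energy_L2[OF L2_shift[OF assms]] energy_shift[OF L2_measurable[OF assms]]
    by metis
  then show ?thesis by (simp add: power2_eq_iff_nonneg)
qed

lemma L2_Fatou:
  assumes "\<And>n. f n \<in> L2" "\<And>n. L2_norm (f n) \<le> c" "g \<in> borel_measurable borel"
    and "AE x in lborel. (\<lambda>n. f n x) \<longlonglongrightarrow> g x"
  shows "g \<in> L2" "L2_norm g \<le> c"
proof -
  note [measurable] = L2_measurable[OF assms(1)] assms(3)
  have "0 \<le> c" using assms(2)[of 0] L2_norm_nonneg by (rule order_trans[rotated])
  have "energy g = (\<integral>\<^sup>+x. liminf (\<lambda>n. ennreal ((cmod (f n x))\<^sup>2)) \<partial>lborel)"
    unfolding energy_def
  proof (rule nn_integral_cong_AE)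
    show "AE x in lborel. ennreal ((cmod (g x))\<^sup>2) = liminf (\<lambda>n. ennreal ((cmod (f n x))\<^sup>2))"
      using assms(4)
    proof eventually_elim
      case (elim x)
      then have "(\<lambda>n. ennreal ((cmod (f n x))\<^sup>2)) \<longlonglongrightarrow> ennreal ((cmod (g x))\<^sup>2)"
        by (intro tendsto_intros tendsto_ennrealI)
      then show ?case by (intro lim_imp_Liminf[symmetric]) auto
    qed
  qed
  also have "\<dots> \<le> liminf (\<lambda>n. energy (f n))"
    unfolding energy_def by (rule nn_integral_liminf) auto
  also have "\<dots> \<le> liminf (\<lambda>n::nat. ennreal (c\<^sup>2))"
    by (intro Liminf_mono always_eventually allI energy_le_norm assms)
  finally have "energy g \<le> ennreal (c\<^sup>2)" by (simp add: Liminf_const)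
  then show "g \<in> L2" "L2_norm g \<le> c"
    using assms(3) \<open>0 \<le> c\<close> by (auto intro: L2_energyI L2_norm_le_energy)
qed

text \<open>The function \<open>\<Sum>\<^sub>n 2\<^sup>n |f\<^sub>n\<^sub>+\<^sub>1 - f\<^sub>n|\<^sup>2\<close> has a finite integral, hence is finite almost everywhere; at
  such points \<open>|f\<^sub>n\<^sub>+\<^sub>1 - f\<^sub>n|\<close> decays geometrically and the sequence converges. Fatou's lemma puts
  the limit into \<open>L\<^sup>2\<close>.\<close>

lemma L2_complete_fast:
  assumes "\<And>n. f n \<in> L2"
    and "\<And>n. L2_norm (\<lambda>x. f (Suc n) x - f n x) \<le> (1/2) ^ n"
  obtains g where "g \<in> L2" "AE x in lborel. (\<lambda>n. f n x) \<longlonglongrightarrow> g x"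
proof -
  note [measurable] = L2_measurable[OF assms(1)]
  have L2d: "(\<lambda>x. f (Suc n) x - f n x) \<in> L2" for n using assms(1) by (intro L2_diff)
  have "(\<integral>\<^sup>+x. (\<Sum>n. ennreal (2^n * (cmod (f (Suc n) x - f n x))\<^sup>2)) \<partial>lborel)
     = (\<Sum>n. \<integral>\<^sup>+x. ennreal (2^n * (cmod (f (Suc n) x - f n x))\<^sup>2) \<partial>lborel)"
    by (intro nn_integral_suminf) auto
  also have "\<dots> \<le> (\<Sum>n. ennreal ((1/2)^n))"
  proof (intro suminf_le)
    fix n
    have "(\<integral>\<^sup>+x. ennreal (2^n * (cmod (f (Suc n) x - f n x))\<^sup>2) \<partial>lborel) = ennreal (2^n) * energy (\<lambda>x. f (Suc n) x - f n x)"
      unfolding energy_def by (simp add: ennreal_mult nn_integral_cmult)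
    also have "\<dots> \<le> ennreal (2^n) * ennreal (((1/2)^n)\<^sup>2)"
      using energy_le_norm[OF L2d assms(2)] by (intro mult_left_mono) auto
    also have "\<dots> = ennreal ((1/2)^n)"
      by (simp add: ennreal_mult[symmetric] power2_eq_square power_divide)
    finally show "(\<integral>\<^sup>+x. ennreal (2^n * (cmod (f (Suc n) x - f n x))\<^sup>2) \<partial>lborel) \<le> ennreal ((1/2)^n)" .
  qed auto
  also have "\<dots> < \<infinity>"
    by (subst suminf_ennreal2) (auto intro: summable_geometric)
  finally have fin: "(\<integral>\<^sup>+x. (\<Sum>n. ennreal (2^n * (cmod (f (Suc n) x - f n x))\<^sup>2)) \<partial>lborel) < \<infinity>" .
  have "AE x in lborel. (\<Sum>n. ennreal (2^n * (cmod (f (Suc n) x - f n x))\<^sup>2)) \<noteq> \<infinity>"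
    using fin by (intro nn_integral_PInf_AE) auto
  moreover have conv: "convergent (\<lambda>n. f n x)" if "(\<Sum>n. ennreal (2^n * (cmod (f (Suc n) x - f n x))\<^sup>2)) \<noteq> \<infinity>" for x
  proof -
    define c where "c = enn2real (\<Sum>n. ennreal (2^n * (cmod (f (Suc n) x - f n x))\<^sup>2))"
    have c: "c \<ge> 0" "(\<Sum>n. ennreal (2^n * (cmod (f (Suc n) x - f n x))\<^sup>2)) = ennreal c"
      using that by (simp_all only: c_def enn2real_nonneg ennreal_enn2real infinity_ennreal_def less_top)
    have "2^n * (cmod (f (Suc n) x - f n x))\<^sup>2 \<le> c" for n
    proof -
      have "sum (\<lambda>n. ennreal (2^n * (cmod (f (Suc n) x - f n x))\<^sup>2)) {n} \<le> ennreal c"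
        unfolding c(2)[symmetric] by (intro sum_le_suminf) auto
      then show ?thesis using c by (simp add: ennreal_le_iff)
    qed
    then have "(cmod (f (Suc n) x - f n x))\<^sup>2 \<le> (sqrt c * (1 / sqrt 2)^n)\<^sup>2" for n
    proof -
      have "(1 / sqrt 2) ^ n * (1 / sqrt 2) ^ n = (1/2::real)^n"
        by (simp add: power_mult_distrib[symmetric])
      then have "(sqrt c * (1 / sqrt 2)^n)\<^sup>2 = c * (1/2)^n"
        using c by (simp add: power_mult_distrib) (simp add: power2_eq_square)
      moreover have "(cmod (f (Suc n) x - f n x))\<^sup>2 \<le> c * (1/2)^n"
        using \<open>2^n * (cmod (f (Suc n) x - f n x))\<^sup>2 \<le> c\<close> by (simp add: field_simps power_divide)
      ultimately show ?thesis by (simp only:)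
    qed
    then have "cmod (f (Suc n) x - f n x) \<le> sqrt c * (1 / sqrt 2)^n" for n
      by (rule power2_le_imp_le) (use c in auto)
    moreover have "summable (\<lambda>n. sqrt c * (1 / sqrt 2)^n)"
      by (intro summable_mult summable_geometric) auto
    ultimately have "summable (\<lambda>n. f (Suc n) x - f n x)"
      using summable_comparison_test'[of "\<lambda>n. sqrt c * (1 / sqrt 2)^n" 0 "\<lambda>n. f (Suc n) x - f n x"] by blast
    then have "(\<lambda>n. \<Sum>k<n. f (Suc k) x - f k x) \<longlonglongrightarrow> (\<Sum>k. f (Suc k) x - f k x)"
      by (rule summable_LIMSEQ)
    then have "(\<lambda>n. f n x - f 0 x) \<longlonglongrightarrow> (\<Sum>k. f (Suc k) x - f k x)"
      by (simp add: sum_lessThan_telescope[of "\<lambda>k. f k x"])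
    then have "(\<lambda>n. f n x - f 0 x + f 0 x) \<longlonglongrightarrow> (\<Sum>k. f (Suc k) x - f k x) + f 0 x"
      by (intro tendsto_intros)
    then show ?thesis by (auto simp: convergent_def)
  qed
  ultimately have ae: "AE x in lborel. convergent (\<lambda>n. f n x)" by auto
  define g where "g x = (if convergent (\<lambda>n. f n x) then lim (\<lambda>n. f n x) else 0)" for x
  have [measurable]: "Measurable.pred borel (\<lambda>x. convergent (\<lambda>n. f n x))"
  proof -
    have "Measurable.pred borel (\<lambda>x. Cauchy (\<lambda>n. f n x))"
      by measurable
    then show ?thesis by (simp add: Cauchy_convergent_iff)
  qed
  have [measurable]: "g \<in> borel_measurable borel" unfolding g_def lim_def[symmetric] by measurable
  have lim: "AE x in lborel. (\<lambda>n. f n x) \<longlonglongrightarrow> g x"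
    using ae by eventually_elim (auto simp: g_def convergent_LIMSEQ_iff)
  have norms: "L2_norm (\<lambda>x. f n x - f 0 x) \<le> 2 - 2 * (1/2)^n" for n
  proof (induction n)
    case (Suc n)
    have "L2_norm (\<lambda>x. f (Suc n) x - f 0 x) \<le> L2_norm (\<lambda>x. f (Suc n) x - f n x) + L2_norm (\<lambda>x. f n x - f 0 x)"
      by (intro L2_norm_triangle3 assms(1))
    also have "\<dots> \<le> (1/2)^n + (2 - 2 * (1/2)^n)" using Suc assms(2) by (intro add_mono)
    finally show ?case by simp
  qed simp
  have "(\<lambda>x. g x - f 0 x) \<in> L2"
  proof (rule L2_Fatou)
    show "L2_norm (\<lambda>x. f n x - f 0 x) \<le> 2" for n using norms[of n] by (rule order_trans) simp
    show "AE x in lborel. (\<lambda>n. f n x - f 0 x) \<longlonglongrightarrow> g x - f 0 x"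
      using lim by eventually_elim (intro tendsto_intros)
  qed (auto intro: L2_diff assms(1))
  then have "g \<in> L2" using L2_add[OF _ assms(1)[of 0], of "\<lambda>x. g x - f 0 x"] by simp
  then show ?thesis using that lim by blast
qed

text \<open>A sequence of parameters that tends to zero fast enough provides the limit; Fatou's lemma
  compares it with every member of the family.\<close>

lemma L2_complete_at_0:
  assumes "\<And>h. D h \<in> L2"
    and "\<And>\<epsilon>::real. \<epsilon> > 0 \<Longrightarrow> \<exists>\<delta>>0. \<forall>h k. 0 < \<bar>h\<bar> \<and> \<bar>h\<bar> < \<delta> \<and> 0 < \<bar>k\<bar> \<and> \<bar>k\<bar> < \<delta> \<longrightarrow> L2_norm (\<lambda>x. D h x - D k x) \<le> \<epsilon>"
  obtains g where "g \<in> L2" "((\<lambda>h::real. L2_norm (\<lambda>x. D h x - g x)) \<longlongrightarrow> 0) (at 0)"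
proof -
  have "\<forall>n. \<exists>\<delta>>0. \<forall>h k. 0 < \<bar>h\<bar> \<and> \<bar>h\<bar> < \<delta> \<and> 0 < \<bar>k\<bar> \<and> \<bar>k\<bar> < \<delta> \<longrightarrow> L2_norm (\<lambda>x. D h x - D k x) \<le> (1/2)^n"
    using assms(2)[of "(1/2)^_"] by simp
  then obtain \<delta> where \<delta>: "\<And>n. \<delta> n > 0"
    "\<And>n h k. 0 < \<bar>h\<bar> \<Longrightarrow> \<bar>h\<bar> < \<delta> n \<Longrightarrow> 0 < \<bar>k\<bar> \<Longrightarrow> \<bar>k\<bar> < \<delta> n \<Longrightarrow> L2_norm (\<lambda>x. D h x - D k x) \<le> (1/2)^n"
    by metis
  define h where "h n = Min (\<delta> ` {..n}) / 2" for n
  have h_pos: "h n > 0" for n using \<delta>(1) by (auto simp: h_def)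
  have h_abs: "\<bar>h n\<bar> = h n" for n using h_pos[of n] by simp
  have h_less: "h n < \<delta> m" if "m \<le> n" for m n
  proof -
    have "Min (\<delta> ` {..n}) \<le> \<delta> m" using that by (intro Min_le) auto
    then show ?thesis using \<delta>(1)[of m] unfolding h_def by linarith
  qed
  obtain g where g: "g \<in> L2" "AE x in lborel. (\<lambda>n. D (h n) x) \<longlonglongrightarrow> g x"
  proof (rule L2_complete_fast[of "\<lambda>n. D (h n)"])
    show "L2_norm (\<lambda>x. D (h (Suc n)) x - D (h n) x) \<le> (1/2)^n" for n
      by (intro \<delta>(2)) (simp_all only: h_abs h_pos h_less le_refl le_SucI)
  qed (use assms(1) in auto)
  have bound: "L2_norm (\<lambda>x. D k x - g x) \<le> (1/2)^n" if "0 < \<bar>k\<bar>" "\<bar>k\<bar> < \<delta> n" for k n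
  proof (rule L2_Fatou(2))
    show "L2_norm (\<lambda>x. D k x - D (h (m + n)) x) \<le> (1/2)^n" for m
      by (intro \<delta>(2) that) (simp_all only: h_abs h_pos h_less le_add2)
    show "AE x in lborel. (\<lambda>m. D k x - D (h (m + n)) x) \<longlonglongrightarrow> D k x - g x"
      using g(2) by eventually_elim (intro tendsto_intros, rule LIMSEQ_ignore_initial_segment)
    show "(\<lambda>x. D k x - g x) \<in> borel_measurable borel"
      using L2_measurable[OF assms(1)] L2_measurable[OF g(1)] by measurable
  qed (auto intro: L2_diff assms(1))
  have "((\<lambda>h. L2_norm (\<lambda>x. D h x - g x)) \<longlongrightarrow> 0) (at 0)"
  proof (rule LIM_I)
    fix e :: real assume "e > 0"
    then obtain n where n: "(1/2)^n < e" using real_arch_pow_inv[of e "1/2"] by auto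
    show "\<exists>s>0. \<forall>k. k \<noteq> 0 \<and> norm (k - 0) < s \<longrightarrow> norm (L2_norm (\<lambda>x. D k x - g x) - 0) < e"
      using bound[of _ n] n \<delta>(1)[of n] by (intro exI[of _ "\<delta> n"]) (auto intro: le_less_trans)
  qed
  then show ?thesis using that g(1) by blast
qed

text \<open>Cauchy--Schwarz against the indicator function of the interval.\<close>

lemma norm_integral_sq_le:
  fixes g :: "real \<Rightarrow> complex"
  assumes [measurable]: "g \<in> borel_measurable borel" and "a \<le> b"
  shows "ennreal ((cmod (LINT s:{a..b}|lborel. g s))\<^sup>2)
    \<le> ennreal (b - a) * (\<integral>\<^sup>+s. ennreal ((cmod (g s))\<^sup>2) * indicator {a..b} s \<partial>lborel)"
proof -
  define k where "k s = indicator {a..b} s *\<^sub>R g s" for s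
  define i where "i s = (indicator {a..b} s :: complex)" for s
  have [measurable]: "k \<in> borel_measurable borel" "i \<in> borel_measurable borel"
    unfolding k_def i_def by measurable
  have ek: "energy k = (\<integral>\<^sup>+s. ennreal ((cmod (g s))\<^sup>2) * indicator {a..b} s \<partial>lborel)"
    unfolding energy_def k_def by (intro nn_integral_cong) (auto simp: indicator_def)
  have "energy i = (\<integral>\<^sup>+s. indicator {a..b} s \<partial>lborel)"
    unfolding energy_def i_def by (intro nn_integral_cong) (auto simp: indicator_def)
  then have ei: "energy i = ennreal (b - a)" using \<open>a \<le> b\<close> by simp
  then have i: "i \<in> L2" by (intro L2_energyI[where c="b - a"]) auto
  have ni: "(L2_norm i)\<^sup>2 = b - a" using energy_L2[OF i] ei \<open>a \<le> b\<close> by simp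
  show ?thesis
  proof (cases "energy k = \<infinity>")
    case True
    show ?thesis
    proof (cases "a = b")
      \<comment> \<open>In \<open>ennreal\<close>, \<open>0 * \<infinity> = 0\<close>, so the degenerate interval is not covered by an infinite right-hand side.\<close>
      case True
      have "(LINT s:{a..b}|lborel. g s) = (LINT s:{}|lborel. g s)"
        unfolding set_lebesgue_integral_def
      proof (intro integral_cong_AE)
        show "AE x in lborel. indicat_real {a..b} x *\<^sub>R g x = indicat_real {} x *\<^sub>R g x"
          using AE_lborel_singleton[of a] by eventually_elim (auto simp: True indicator_def)
      qed auto
      then have "(LINT s:{a..b}|lborel. g s) = 0" by (simp add: set_lebesgue_integral_def)
      then show ?thesis by simp
    next
      case False
      then show ?thesis using \<open>energy k = \<infinity>\<close> \<open>a \<le> b\<close> unfolding ek[symmetric]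
        by (simp add: ennreal_mult_top)
    qed
  next
    case False
    define c where "c = enn2real (energy k)"
    have "energy k = ennreal c" using False by (simp add: c_def ennreal_enn2real less_top)
    then have k: "k \<in> L2" by (intro L2_energyI[where c=c]) auto
    have "(LINT s:{a..b}|lborel. g s) = (LINT s|lborel. i s * k s)"
      unfolding set_lebesgue_integral_def k_def i_def
      by (intro Bochner_Integration.integral_cong) (auto simp: indicator_def)
    then have "cmod (LINT s:{a..b}|lborel. g s) \<le> L2_norm i * L2_norm k"
      using L2_Cauchy_Schwarz[OF i k] by simp
    then have "(cmod (LINT s:{a..b}|lborel. g s))\<^sup>2 \<le> (b - a) * (L2_norm k)\<^sup>2"
      using power_mono[of _ "L2_norm i * L2_norm k" 2] ni by (simp add: power_mult_distrib)
    then show ?thesis unfolding ek[symmetric] energy_L2[OF k] using \<open>a \<le> b\<close>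
      by (simp add: ennreal_mult[symmetric] ennreal_leI)
  qed
qed

text \<open>Cauchy--Schwarz in the averaging variable and Tonelli's theorem.\<close>

lemma energy_average_le:
  fixes G :: "real \<Rightarrow> real \<Rightarrow> complex"
  assumes [measurable]: "(\<lambda>z. G (fst z) (snd z)) \<in> borel_measurable borel"
    and "\<And>s. s \<in> {0..1} \<Longrightarrow> energy (G s) \<le> ennreal c"
  shows "energy (\<lambda>x. LINT s:{0..1}|lborel. G s x) \<le> ennreal c"
proof -
  have [measurable]: "(\<lambda>z. G (fst z) (snd z)) \<in> borel_measurable (borel \<Otimes>\<^sub>M borel)"
    using assms(1) by (simp add: borel_prod)
  have [measurable]: "(\<lambda>s. G s x) \<in> borel_measurable borel" "G s \<in> borel_measurable borel" for x s
  proof -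
    have "(\<lambda>s. (s, x)) \<in> borel \<rightarrow>\<^sub>M borel \<Otimes>\<^sub>M borel" "(\<lambda>x. (s, x)) \<in> borel \<rightarrow>\<^sub>M borel \<Otimes>\<^sub>M borel"
      by measurable
    then show "(\<lambda>s. G s x) \<in> borel_measurable borel" "G s \<in> borel_measurable borel"
      using measurable_compose[of "\<lambda>s. (s, x)" borel "borel \<Otimes>\<^sub>M borel" "\<lambda>z. G (fst z) (snd z)"]
        measurable_compose[of "\<lambda>x. (s, x)" borel "borel \<Otimes>\<^sub>M borel" "\<lambda>z. G (fst z) (snd z)"] by auto
  qed
  have "energy (\<lambda>x. LINT s:{0..1}|lborel. G s x)
    \<le> (\<integral>\<^sup>+x. (\<integral>\<^sup>+s. ennreal ((cmod (G s x))\<^sup>2) * indicator {0..1} s \<partial>lborel) \<partial>lborel)"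
    unfolding energy_def using norm_integral_sq_le[of "\<lambda>s. G s _" 0 1] by (intro nn_integral_mono) auto
  also have "\<dots> = (\<integral>\<^sup>+s. (\<integral>\<^sup>+x. ennreal ((cmod (G s x))\<^sup>2) * indicator {0..1} s \<partial>lborel) \<partial>lborel)"
    by (rule lborel_pair.Fubini') measurable
  also have "\<dots> \<le> (\<integral>\<^sup>+s. ennreal c * indicator {0..1} s \<partial>(lborel::real measure))"
    using assms(2) by (intro nn_integral_mono) (auto simp: energy_def indicator_def)
  also have "\<dots> = ennreal c" by (simp add: nn_integral_cmult)
  finally show ?thesis .
qed

lemma L2_norm_tendsto_0_dominated:
  assumes "\<And>n. f n \<in> borel_measurable borel" and "integrable lborel w"
    and "\<And>n x. (cmod (f n x))\<^sup>2 \<le> w x" and "AE x in lborel. (\<lambda>n. f n x) \<longlonglongrightarrow> 0"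
  shows "(\<lambda>n. L2_norm (f n)) \<longlonglongrightarrow> 0"
proof -
  note [measurable] = assms(1)
  have "(\<lambda>n. LINT x|lborel. (cmod (f n x))\<^sup>2) \<longlonglongrightarrow> integral\<^sup>L lborel (\<lambda>x::real. 0::real)"
  proof (rule integral_dominated_convergence[of "\<lambda>x. 0" lborel "\<lambda>n x. (cmod (f n x))\<^sup>2" w])
    show "AE x in lborel. (\<lambda>n. (cmod (f n x))\<^sup>2) \<longlonglongrightarrow> 0"
      using assms(4)
    proof eventually_elim
      case (elim x)
      then have "(\<lambda>n. (cmod (f n x))\<^sup>2) \<longlonglongrightarrow> (cmod 0)\<^sup>2" by (intro tendsto_intros)
      then show ?case by simp
    qed
  qed (use assms in auto)
  then have "(\<lambda>n. sqrt (LINT x|lborel. (cmod (f n x))\<^sup>2)) \<longlonglongrightarrow> sqrt 0"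
    by (intro tendsto_intros) simp
  then show ?thesis by (simp add: L2_norm_def)
qed

text \<open>Truncation reduces the claim to bounded functions with bounded support. Such a function is an
  almost everywhere limit of continuous functions, which may be cut off to the same bound and almost
  the same support, so that dominated convergence applies.\<close>

lemma L2_approx_continuous:
  assumes "f \<in> L2" "\<epsilon> > 0"
  obtains g R where "continuous_on UNIV g" "\<And>x. \<bar>x\<bar> > R \<Longrightarrow> g x = 0" "g \<in> L2" "L2_norm (\<lambda>x. f x - g x) < \<epsilon>"
proof -
  note [measurable] = L2_measurable[OF assms(1)]
  define fn where "fn n x = (if \<bar>x\<bar> \<le> real n \<and> cmod (f x) \<le> real n then f x else 0)" for n x
  have [measurable]: "fn n \<in> borel_measurable borel" for n unfolding fn_def by measurable
  have "(\<lambda>n. L2_norm (\<lambda>x. f x - fn n x)) \<longlonglongrightarrow> 0"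
  proof (rule L2_norm_tendsto_0_dominated)
    show "integrable lborel (\<lambda>x. (cmod (f x))\<^sup>2)" by (rule L2_integrable[OF assms(1)])
    show "AE x in lborel. (\<lambda>n. f x - fn n x) \<longlonglongrightarrow> 0"
    proof (intro AE_I2 tendsto_eventually)
      fix x
      obtain N :: nat where "max \<bar>x\<bar> (cmod (f x)) \<le> real N" using real_arch_simple by blast
      then show "\<forall>\<^sub>F n in sequentially. f x - fn n x = 0"
        by (intro eventually_sequentiallyI[of N]) (auto simp: fn_def)
    qed
  qed (auto simp: fn_def)
  then have "\<forall>\<^sub>F n in sequentially. L2_norm (\<lambda>x. f x - fn n x) < \<epsilon> / 2"
    using assms(2) by (intro order_tendstoD) auto
  then have "\<forall>\<^sub>F n in sequentially. L2_norm (\<lambda>x. f x - fn n x) < \<epsilon> / 2 \<and> n \<ge> 1"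
    using eventually_ge_at_top by (rule eventually_conj)
  then obtain n where n: "L2_norm (\<lambda>x. f x - fn n x) < \<epsilon> / 2" "n \<ge> 1"
    by (auto simp: eventually_sequentially)
  have fnL2: "fn n \<in> L2"
    by (rule L2_dominated[OF assms(1), of _ 1]) (auto simp: fn_def)
  have "fn n measurable_on UNIV"
    by (intro lebesgue_measurable_imp_measurable_on measurable_completion) auto
  then obtain N g where N: "negligible N" and g: "\<And>k. continuous_on UNIV (g k)"
    and lim: "\<And>x. x \<notin> N \<Longrightarrow> (\<lambda>k. g k x) \<longlonglongrightarrow> fn n x"
    unfolding measurable_on_def by auto
  define cut where "cut x = max 0 (min 1 (real n + 1 - \<bar>x\<bar>))" for x :: real
  define cl where "cl z = (real n / max (real n) (cmod z)) *\<^sub>R z" for z :: complex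
  define gk where "gk k x = cut x *\<^sub>R cl (g k x)" for k x
  have pos: "0 < max (real n) (cmod z)" for z using n(2) by auto
  have ccl: "continuous_on UNIV cl" unfolding cl_def
    by (intro continuous_intros) (use pos in \<open>auto simp: less_le\<close>)
  have cgk: "continuous_on UNIV (gk k)" for k unfolding gk_def cut_def
    by (intro continuous_intros continuous_on_compose2[OF ccl g]) auto
  have clb: "cmod (cl z) \<le> real n" for z
    using pos[of z] by (simp add: cl_def divide_simps mult.commute[of _ "cmod z"]) (simp add: mult.commute mult_left_mono)
  have gkb: "cmod (gk k x) \<le> real n" for k x
  proof -
    have "cmod (gk k x) \<le> 1 * real n" unfolding gk_def norm_scaleR
      by (intro mult_mono clb) (auto simp: cut_def)
    then show ?thesis by simp
  qed
  have gk0: "gk k x = 0" if "\<bar>x\<bar> > real n + 1" for k x using that by (simp add: gk_def cut_def)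
  have [measurable]: "gk k \<in> borel_measurable borel" for k
    using cgk by (rule borel_measurable_continuous_onI)
  have clfn: "cut x *\<^sub>R cl (fn n x) = fn n x" for x using n(2) by (auto simp: fn_def cl_def cut_def)
  have bd: "(cmod (fn n x - gk k x))\<^sup>2 \<le> indicator {- (real n + 1)..real n + 1} x * (2 * real n)\<^sup>2" for k x
  proof (cases "\<bar>x\<bar> > real n + 1")
    case True
    then show ?thesis using gk0[OF True] by (simp add: fn_def)
  next
    case False
    have "cmod (fn n x - gk k x) \<le> real n + real n"
      by (rule order_trans[OF norm_triangle_ineq4]) (intro add_mono gkb, auto simp: fn_def)
    then have "(cmod (fn n x - gk k x))\<^sup>2 \<le> (2 * real n)\<^sup>2" by (intro power_mono) auto
    then show ?thesis using False by (simp add: indicator_def abs_le_iff) linarith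
  qed
  have "(\<lambda>k. L2_norm (\<lambda>x. fn n x - gk k x)) \<longlonglongrightarrow> 0"
  proof (rule L2_norm_tendsto_0_dominated[OF _ _ bd])
    have "AE x in lebesgue. x \<notin> N" using N by (simp add: AE_not_in negligible_iff_null_sets)
    then have "AE x in lborel. x \<notin> N" by (simp add: AE_completion_iff)
    then show "AE x in lborel. (\<lambda>k. fn n x - gk k x) \<longlonglongrightarrow> 0"
    proof eventually_elim
      case (elim x)
      have "isCont cl (fn n x)" using ccl by (simp add: continuous_on_eq_continuous_at)
      from isCont_tendsto_compose[OF this lim[OF elim]]
      have "(\<lambda>k. fn n x - cut x *\<^sub>R cl (g k x)) \<longlonglongrightarrow> fn n x - cut x *\<^sub>R cl (fn n x)"
        by (intro tendsto_intros)
      then show ?case by (simp add: clfn gk_def)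
    qed
  qed auto
  then have "\<forall>\<^sub>F k in sequentially. L2_norm (\<lambda>x. fn n x - gk k x) < \<epsilon> / 2"
    using assms(2) by (intro order_tendstoD) auto
  then obtain k where k: "L2_norm (\<lambda>x. fn n x - gk k x) < \<epsilon> / 2"
    by (auto simp: eventually_sequentially)
  have "integrable lborel (\<lambda>x. indicator {- (real n + 1)..real n + 1} x * (real n)\<^sup>2)"
    by (intro integrable_mult_left integrable_real_indicator) auto
  then have "integrable lborel (\<lambda>x. (cmod (gk k x))\<^sup>2)"
  proof (rule Bochner_Integration.integrable_bound)
    show "AE x in lborel. norm ((cmod (gk k x))\<^sup>2) \<le> norm (indicator {- (real n + 1)..real n + 1} x * (real n)\<^sup>2)"
      using gkb gk0 by (intro AE_I2) (force simp: indicator_def abs_le_iff power_mono)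
  qed auto
  then have gL2: "gk k \<in> L2" by (simp add: L2_def)
  have "L2_norm (\<lambda>x. f x - gk k x) < \<epsilon>"
    using L2_norm_triangle3[OF assms(1) fnL2 gL2] n k by linarith
  then show ?thesis using that[OF cgk gk0 gL2] by blast
qed

text \<open>For a continuous function with compact support this is uniform continuity; density and the
  shift invariance of the norm carry it over to \<open>L\<^sup>2\<close>.\<close>

theorem L2_shift_continuous:
  assumes "f \<in> L2"
  shows "((\<lambda>h. L2_norm (\<lambda>x. f (x + h) - f x)) \<longlongrightarrow> 0) (at 0)"
proof (rule LIM_I)
  fix e :: real assume "e > 0"
  then have "e / 4 > 0" by simp
  then obtain g R where g: "continuous_on UNIV g" "\<And>x. \<bar>x\<bar> > R \<Longrightarrow> g x = 0" "g \<in> L2"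
    "L2_norm (\<lambda>x. f x - g x) < e / 4"
    using L2_approx_continuous[OF assms] by blast
  define S where "S = max R 0 + 1"
  define \<eta> where "\<eta> = e / (4 * sqrt (2 * S))"
  have S: "S \<ge> 1" by (simp add: S_def)
  have \<eta>: "\<eta> > 0" using \<open>e > 0\<close> S by (simp add: \<eta>_def)
  have "uniformly_continuous_on {-S-1..S+1} g"
    by (intro compact_uniformly_continuous continuous_on_subset[OF g(1)]) auto
  then obtain d where d: "d > 0" "\<And>x y. x \<in> {-S-1..S+1} \<Longrightarrow> y \<in> {-S-1..S+1} \<Longrightarrow> dist x y < d \<Longrightarrow> dist (g x) (g y) < \<eta>"
    using \<eta> unfolding uniformly_continuous_on_def by blast
  have [measurable]: "g \<in> borel_measurable borel" using g(3) by (rule L2_measurable)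
  show "\<exists>s>0. \<forall>h. h \<noteq> 0 \<and> norm (h - 0) < s \<longrightarrow> norm (L2_norm (\<lambda>x. f (x + h) - f x) - 0) < e"
  proof (intro exI[of _ "min d 1"] conjI allI impI)
    fix h :: real assume "h \<noteq> 0 \<and> norm (h - 0) < min d 1"
    then have h: "\<bar>h\<bar> < d" "\<bar>h\<bar> < 1" by auto
    have pt: "ennreal ((cmod (g (x + h) - g x))\<^sup>2) \<le> ennreal (\<eta>\<^sup>2) * indicator {-S..S} x" for x
    proof (cases "x \<in> {-S..S}")
      case True
      have "dist (g (x + h)) (g x) < \<eta>"
        using True h by (intro d(2)) (auto simp: dist_real_def)
      then have "(cmod (g (x + h) - g x))\<^sup>2 \<le> \<eta>\<^sup>2" by (intro power_mono) (auto simp: dist_norm)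
      then show ?thesis using True by (simp add: ennreal_leI)
    next
      case False
      then have "\<bar>x\<bar> > S" by auto
      then have "g (x + h) = 0" "g x = 0" using h by (auto intro!: g(2) simp: S_def)
      then show ?thesis by simp
    qed
    have "energy (\<lambda>x. g (x + h) - g x) \<le> (\<integral>\<^sup>+x. ennreal (\<eta>\<^sup>2) * indicator {-S..S} x \<partial>lborel)"
      unfolding energy_def by (intro nn_integral_mono pt)
    also have "\<dots> = ennreal (\<eta>\<^sup>2 * (2 * S))" using S
      by (simp add: nn_integral_cmult ennreal_mult[symmetric])
    also have "\<eta>\<^sup>2 * (2 * S) = (e / 4)\<^sup>2" using S
      by (simp add: \<eta>_def power_divide power_mult_distrib)
    finally have *: "L2_norm (\<lambda>x. g (x + h) - g x) \<le> e / 4"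
      using \<open>e > 0\<close> by (intro L2_norm_le_energy) auto
    have "L2_norm (\<lambda>x. f (x + h) - f x) \<le> L2_norm (\<lambda>x. f (x + h) - g (x + h)) + L2_norm (\<lambda>x. g (x + h) - f x)"
      by (intro L2_norm_triangle3 L2_shift assms g(3))
    also have "L2_norm (\<lambda>x. f (x + h) - g (x + h)) = L2_norm (\<lambda>x. f x - g x)"
      by (rule L2_norm_shift[OF L2_diff[OF assms g(3)]])
    also have "L2_norm (\<lambda>x. g (x + h) - f x) \<le> L2_norm (\<lambda>x. g (x + h) - g x) + L2_norm (\<lambda>x. g x - f x)"
      by (intro L2_norm_triangle3 L2_shift assms g(3))
    finally have "L2_norm (\<lambda>x. f (x + h) - f x) < e"
      using * g(4) L2_norm_minus_commute[of g f] \<open>e > 0\<close> by linarith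
    then show "norm (L2_norm (\<lambda>x. f (x + h) - f x) - 0) < e" by simp
  qed (use d in auto)
qed

section \<open>Test functions and weak derivatives\<close>

text \<open>Differentiability up to order \<open>n\<close> in a form suited to induction: it peels the innermost
  derivative, while \<open>test_function\<close> iterates from the outside.\<close>

primrec smooth_upto :: "nat \<Rightarrow> (real \<Rightarrow> real) \<Rightarrow> bool" where
  "smooth_upto 0 f \<longleftrightarrow> f differentiable_on UNIV"
| "smooth_upto (Suc n) f \<longleftrightarrow> f differentiable_on UNIV \<and> smooth_upto n (deriv f)"

lemma smooth_upto_funpow: "smooth_upto n f \<longleftrightarrow> (\<forall>k\<le>n. (deriv ^^ k) f differentiable_on UNIV)"
proof (induction n arbitrary: f)
  case (Suc n)
  have "(\<forall>k\<le>Suc n. (deriv ^^ k) f differentiable_on UNIV)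
    \<longleftrightarrow> f differentiable_on UNIV \<and> (\<forall>k\<le>n. (deriv ^^ Suc k) f differentiable_on UNIV)"
    by (metis Suc_le_mono funpow_0 not0_implies_Suc zero_le)
  then show ?case using Suc by (simp add: funpow_Suc_right del: funpow.simps)
qed simp

lemma smooth_iff_smooth_upto: "(\<forall>n. (deriv ^^ n) f differentiable_on UNIV) \<longleftrightarrow> (\<forall>n. smooth_upto n f)"
  by (auto simp: smooth_upto_funpow)

lemma smooth_upto_Suc: "smooth_upto (Suc n) f \<Longrightarrow> smooth_upto n f"
  by (induction n arbitrary: f) auto

lemma differentiable_has_deriv:
  fixes f :: "real \<Rightarrow> real"
  assumes "f differentiable_on UNIV" shows "(f has_real_derivative deriv f x) (at x)"
proof -
  have "f differentiable (at x)" using assms by (simp add: differentiable_on_def)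
  then show ?thesis
    using field_differentiable_derivI real_differentiable_def by (metis field_differentiable_def)
qed

lemma differentiable_onI_real:
  "(\<And>x. (f has_real_derivative f' x) (at x)) \<Longrightarrow> f differentiable_on UNIV"
  unfolding differentiable_on_def real_differentiable_def by auto

lemma smooth_upto_SucI:
  assumes "\<And>x. (f has_real_derivative f' x) (at x)" "smooth_upto n f'"
  shows "smooth_upto (Suc n) f"
proof -
  have "deriv f = f'" using assms(1) by (auto intro!: DERIV_imp_deriv)
  moreover have "f differentiable_on UNIV"
    using assms(1) by (rule differentiable_onI_real)
  ultimately show ?thesis using assms(2) by simp
qed

lemma smooth_upto_const: "smooth_upto n (\<lambda>x. c)"
proof (induction n arbitrary: c)
  case (Suc n)
  show ?case by (rule smooth_upto_SucI[where f'="\<lambda>x. 0"]) (auto intro: Suc)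
qed simp

lemma smooth_upto_add: "smooth_upto n f \<Longrightarrow> smooth_upto n g \<Longrightarrow> smooth_upto n (\<lambda>x. f x + g x)"
proof (induction n arbitrary: f g)
  case (Suc n)
  then have d: "f differentiable_on UNIV" "g differentiable_on UNIV" by auto
  show ?case
    by (rule smooth_upto_SucI[where f'="\<lambda>x. deriv f x + deriv g x"])
       (use Suc in \<open>auto intro!: DERIV_add differentiable_has_deriv\<close>)
qed (auto intro!: derivative_intros)

lemma smooth_upto_mult: "smooth_upto n f \<Longrightarrow> smooth_upto n g \<Longrightarrow> smooth_upto n (\<lambda>x. f x * g x)"
proof (induction n arbitrary: f g)
  case (Suc n)
  then have d: "f differentiable_on UNIV" "g differentiable_on UNIV" by auto
  show ?case
  proof (rule smooth_upto_SucI)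
    show "((\<lambda>x. f x * g x) has_real_derivative deriv f x * g x + deriv g x * f x) (at x)" for x
      by (intro DERIV_mult differentiable_has_deriv d)
    show "smooth_upto n (\<lambda>x. deriv f x * g x + deriv g x * f x)"
      using Suc.prems by (intro smooth_upto_add Suc.IH) (auto intro: smooth_upto_Suc)
  qed
qed (auto intro!: derivative_intros)

lemma smooth_upto_affine: "smooth_upto n f \<Longrightarrow> smooth_upto n (\<lambda>x. f (a * x + b))"
proof (induction n arbitrary: f)
  case 0
  then have d: "f differentiable_on UNIV" by simp
  have "((\<lambda>x. f (a * x + b)) has_real_derivative deriv f (a * x + b) * a) (at x)" for x
    by (rule DERIV_chain2[OF differentiable_has_deriv[OF d]]) (auto intro!: derivative_eq_intros)
  then have "(\<lambda>x. f (a * x + b)) differentiable_on UNIV" by (rule differentiable_onI_real)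
  then show ?case by simp
next
  case (Suc n)
  then have d: "f differentiable_on UNIV" by auto
  show ?case
  proof (rule smooth_upto_SucI)
    show "((\<lambda>x. f (a * x + b)) has_real_derivative deriv f (a * x + b) * a) (at x)" for x
      by (rule DERIV_chain2[OF differentiable_has_deriv[OF d]]) (auto intro!: derivative_eq_intros)
    show "smooth_upto n (\<lambda>x. deriv f (a * x + b) * a)"
      using Suc by (intro smooth_upto_mult[OF _ smooth_upto_const] Suc.IH) auto
  qed
qed

text \<open>The functions \<open>x\<^sup>-\<^sup>k e\<^sup>-\<^sup>1\<^sup>/\<^sup>x\<close>, extended by zero, have derivatives in their own span.\<close>

definition flat :: "nat \<Rightarrow> real \<Rightarrow> real" where
  "flat k x = (if x > 0 then (1 / x) ^ k * exp (- (1 / x)) else 0)"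

lemma flat_has_derivative:
  "(flat k has_real_derivative (flat (k + 2) x + - real k * flat (k + 1) x)) (at x)"
proof (cases x "0::real" rule: linorder_cases)
  case less
  have "((\<lambda>x. 0) has_real_derivative 0) (at x)" by simp
  then have "(flat k has_real_derivative 0) (at x)"
    by (rule has_field_derivative_transform_within_open[where S="{..<0}"])
       (use less in \<open>auto simp: flat_def\<close>)
  then show ?thesis using less by (simp add: flat_def)
next
  case greater
  have "((\<lambda>x. (1 / x) ^ k * exp (- (1 / x))) has_real_derivative (flat (k + 2) x + - real k * flat (k + 1) x)) (at x)"
  proof (cases k)
    case 0
    then show ?thesis using greater
      by (auto intro!: derivative_eq_intros simp: flat_def power2_eq_square)
  next
    case (Suc j)
    have 1: "((\<lambda>x. 1 / x) has_real_derivative - (1 / x\<^sup>2)) (at x)"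
      using greater by (auto intro!: derivative_eq_intros simp: power2_eq_square)
    have 2: "((\<lambda>x. exp (- (1 / x))) has_real_derivative exp (- (1 / x)) * (1 / x\<^sup>2)) (at x)"
      using greater by (auto intro!: derivative_eq_intros simp: power2_eq_square)
    show ?thesis unfolding Suc
      by (rule DERIV_cong[OF DERIV_mult[OF DERIV_power_Suc[OF 1] 2]])
         (use greater in \<open>simp add: flat_def power2_eq_square field_simps\<close>)
  qed
  then show ?thesis
    by (rule has_field_derivative_transform_within_open[where S="{0<..}"])
       (use greater in \<open>auto simp: flat_def\<close>)
next
  case equal
  have "((\<lambda>h. flat k h / h) \<longlongrightarrow> 0) (at_right 0)"
  proof -
    have "((\<lambda>h. inverse h ^ (k + 1) / exp (inverse h)) \<longlongrightarrow> 0) (at_right (0::real))"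
      by (rule filterlim_compose[OF tendsto_power_div_exp_0 filterlim_inverse_at_top_right])
    then show ?thesis
      by (rule Lim_transform_eventually)
         (auto simp: eventually_at_filter flat_def exp_minus field_simps)
  qed
  moreover have "((\<lambda>h. flat k h / h) \<longlongrightarrow> 0) (at_left 0)"
    by (rule tendsto_eventually) (auto simp: eventually_at_filter flat_def)
  ultimately have "((\<lambda>h. flat k h / h) \<longlongrightarrow> 0) (at 0)" by (rule filterlim_split_at_real[OF _ _, rotated])
  then show ?thesis using equal by (simp add: DERIV_def flat_def)
qed

lemma smooth_upto_flat: "smooth_upto n (flat k)"
proof (induction n arbitrary: k)
  case 0
  have "flat k differentiable_on UNIV" using flat_has_derivative by (rule differentiable_onI_real)
  then show ?case by simp
next
  case (Suc n)
  show ?case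
    by (rule smooth_upto_SucI[OF flat_has_derivative])
       (intro smooth_upto_add smooth_upto_mult smooth_upto_const Suc)
qed

lemma flat_0_bounds: "0 \<le> flat 0 x" "flat 0 x \<le> 1"
  by (auto simp: flat_def)

lemma flat_0_limit:
  assumes "x > 0" shows "(\<lambda>n. flat 0 (real (Suc n) * x)) \<longlonglongrightarrow> 1"
proof -
  have "(\<lambda>n. exp (- (1 / x * inverse (real (Suc n))))) \<longlonglongrightarrow> exp (- (1 / x * 0))"
    by (intro tendsto_intros LIMSEQ_inverse_real_of_nat)
  moreover have "flat 0 (real (Suc n) * x) = exp (- (1 / x * inverse (real (Suc n))))" for n
  proof -
    have "real (Suc n) * x > 0" using assms by simp
    then show ?thesis unfolding flat_def by (simp add: field_simps)
  qed
  ultimately show ?thesis by simp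
qed

text \<open>Test functions increasing to the indicator function of an open interval.\<close>

definition bump :: "real \<Rightarrow> real \<Rightarrow> nat \<Rightarrow> real \<Rightarrow> real" where
  "bump a b n x = flat 0 (real (Suc n) * (x - a)) * flat 0 (real (Suc n) * (b - x))"

lemma bump_outside: "x \<notin> {a<..<b} \<Longrightarrow> bump a b n x = 0"
  by (auto simp: bump_def flat_def zero_less_mult_iff)

lemma bump_bounds: "0 \<le> bump a b n x" "bump a b n x \<le> 1"
  using flat_0_bounds by (auto simp: bump_def intro: mult_le_one)

lemma bump_limit: "(\<lambda>n. bump a b n x) \<longlonglongrightarrow> indicator {a<..<b} x"
proof (cases "x \<in> {a<..<b}")
  case True
  then have "(\<lambda>n. bump a b n x) \<longlonglongrightarrow> 1 * 1"
    unfolding bump_def by (intro tendsto_mult flat_0_limit) auto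
  then show ?thesis using True by simp
qed (simp add: bump_outside)

lemma test_function_support:
  assumes "test_function \<phi>" obtains R where "R > 0" "\<And>x. \<bar>x\<bar> \<ge> R \<Longrightarrow> \<phi> x = 0"
proof -
  have "bounded (closure {x. \<phi> x \<noteq> 0})" using assms by (auto simp: test_function_def compact_imp_bounded)
  then have "bounded {x. \<phi> x \<noteq> 0}" by (rule bounded_subset) (rule closure_subset)
  then obtain R where "R > 0" "\<forall>x\<in>{x. \<phi> x \<noteq> 0}. norm x \<le> R" by (auto simp: bounded_pos)
  then show ?thesis by (intro that[of "R + 1"]) force+
qed

lemma test_functionI:
  assumes "\<And>n. smooth_upto n \<phi>" "\<And>x. \<bar>x\<bar> > R \<Longrightarrow> \<phi> x = 0"
  shows "test_function \<phi>"
proof -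
  have "{x. \<phi> x \<noteq> 0} \<subseteq> {-R..R}" using assms(2) by (force simp: abs_le_iff not_less)
  then have "bounded {x. \<phi> x \<noteq> 0}" by (rule bounded_subset[rotated]) simp
  then show ?thesis using assms(1) smooth_iff_smooth_upto unfolding test_function_def by auto
qed

lemma test_function_smooth_upto: "test_function \<phi> \<Longrightarrow> smooth_upto n \<phi>"
  using smooth_iff_smooth_upto by (auto simp: test_function_def)

lemma test_function_bump: "test_function (bump a b n)"
proof (rule test_functionI)
  fix k
  have "smooth_upto k (\<lambda>x. flat 0 (real (Suc n) * x + - real (Suc n) * a) * flat 0 (- real (Suc n) * x + real (Suc n) * b))"
    by (intro smooth_upto_mult smooth_upto_affine smooth_upto_flat)
  then show "smooth_upto k (bump a b n)" by (simp add: bump_def[abs_def] algebra_simps)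
next
  show "\<bar>x\<bar> > max \<bar>a\<bar> \<bar>b\<bar> \<Longrightarrow> bump a b n x = 0" for x by (intro bump_outside) auto
qed

lemma test_function_has_deriv:
  "test_function \<phi> \<Longrightarrow> (\<phi> has_real_derivative deriv \<phi> x) (at x)"
  using test_function_smooth_upto[of \<phi> 0] by (intro differentiable_has_deriv) simp

lemma test_function_continuous: "test_function \<phi> \<Longrightarrow> continuous_on UNIV \<phi>"
  using test_function_smooth_upto[of \<phi> 0] by (simp add: differentiable_imp_continuous_on)

lemma test_function_deriv_continuous: "test_function \<phi> \<Longrightarrow> continuous_on UNIV (deriv \<phi>)"
  using test_function_smooth_upto[of \<phi> 1] by (simp add: differentiable_imp_continuous_on)

lemma continuous_compact_support_bounded:
  fixes f :: "real \<Rightarrow> 'a::real_normed_vector"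
  assumes "continuous_on UNIV f" "\<And>x. \<bar>x\<bar> \<ge> R \<Longrightarrow> f x = 0"
  obtains M where "M \<ge> 0" "\<And>x. norm (f x) \<le> M"
proof -
  have "compact (f ` {-R..R})"
    by (intro compact_continuous_image continuous_on_subset[OF assms(1)]) auto
  then obtain M where M: "\<And>x. x \<in> {-R..R} \<Longrightarrow> norm (f x) \<le> M"
    by (meson bounded_iff compact_imp_bounded imageI)
  have "norm (f x) \<le> max M 0" for x
    using M[of x] assms(2)[of x] by (cases "x \<in> {-R..R}") (auto simp: abs_le_iff not_le)
  then show ?thesis using that[of "max M 0"] by simp
qed

lemma test_function_deriv_support:
  assumes "test_function \<phi>" "\<And>x. \<bar>x\<bar> \<ge> R \<Longrightarrow> \<phi> x = 0" "\<bar>x\<bar> > R"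
  shows "deriv \<phi> x = 0"
proof -
  have "((\<lambda>x. 0) has_real_derivative 0) (at x)" by simp
  then have "(\<phi> has_real_derivative 0) (at x)"
  proof (rule has_field_derivative_transform_within_open)
    show "open {x. \<bar>x\<bar> > R}" by (intro open_Collect_less continuous_intros)
  qed (use assms in auto)
  then show ?thesis by (rule DERIV_imp_deriv)
qed

lemma test_function_bounded:
  assumes "test_function \<phi>"
  obtains M where "M \<ge> 0" "\<And>x. \<bar>\<phi> x\<bar> \<le> M" "\<And>x. \<bar>deriv \<phi> x\<bar> \<le> M"
proof -
  obtain R where R: "R > 0" "\<And>x. \<bar>x\<bar> \<ge> R \<Longrightarrow> \<phi> x = 0" using test_function_support[OF assms] by blast
  have R': "\<bar>x\<bar> \<ge> R + 1 \<Longrightarrow> deriv \<phi> x = 0" for x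
    by (rule test_function_deriv_support[OF assms R(2)]) auto
  obtain A where "A \<ge> 0" "\<And>x. norm (\<phi> x) \<le> A"
    using continuous_compact_support_bounded[OF test_function_continuous[OF assms] R(2)] by auto
  moreover obtain B where "B \<ge> 0" "\<And>x. norm (deriv \<phi> x) \<le> B"
    using continuous_compact_support_bounded[OF test_function_deriv_continuous[OF assms] R'] by auto
  ultimately show ?thesis using that[of "max A B"] by (force simp: le_max_iff_disj)
qed

lemma continuous_compact_support_L2:
  fixes f :: "real \<Rightarrow> complex"
  assumes "continuous_on UNIV f" "\<And>x. \<bar>x\<bar> > R \<Longrightarrow> f x = 0"
  shows "f \<in> L2"
proof -
  have [measurable]: "f \<in> borel_measurable borel" using assms(1) by (rule borel_measurable_continuous_onI)
  have "set_integrable lborel {-R..R} (\<lambda>x. (cmod (f x))\<^sup>2)"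
    by (intro borel_integrable_compact[unfolded set_integrable_def[symmetric]] continuous_intros
      continuous_on_subset[OF assms(1)]) auto
  moreover have "(\<lambda>x. indicator {-R..R} x *\<^sub>R (cmod (f x))\<^sup>2) = (\<lambda>x. (cmod (f x))\<^sup>2)"
    using assms(2) by (force simp: indicator_def abs_le_iff not_less)
  ultimately show ?thesis by (simp add: L2_def set_integrable_def)
qed

lemma test_function_L2:
  assumes "test_function \<phi>"
  shows "(\<lambda>x. of_real (\<phi> x)) \<in> L2" "(\<lambda>x. of_real (deriv \<phi> x)) \<in> L2"
proof -
  obtain R where R: "R > 0" "\<And>x. \<bar>x\<bar> \<ge> R \<Longrightarrow> \<phi> x = 0" using test_function_support[OF assms] by blast
  show "(\<lambda>x. of_real (\<phi> x)) \<in> L2"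
    using R by (intro continuous_compact_support_L2[of _ R] continuous_intros test_function_continuous[OF assms]) auto
  show "(\<lambda>x. of_real (deriv \<phi> x)) \<in> L2"
    using test_function_deriv_support[OF assms R(2)]
    by (intro continuous_compact_support_L2[of _ R] continuous_intros test_function_deriv_continuous[OF assms]) auto
qed

section \<open>Averages and primitives\<close>

definition average :: "real \<Rightarrow> (real \<Rightarrow> complex) \<Rightarrow> real \<Rightarrow> complex" where
  "average h g x = (LINT s:{0..1}|lborel. g (x + s * h))"

definition diff_quot :: "real \<Rightarrow> (real \<Rightarrow> complex) \<Rightarrow> real \<Rightarrow> complex" where
  "diff_quot h f x = (f (x + h) - f x) / of_real h"

definition primitive :: "(real \<Rightarrow> complex) \<Rightarrow> (real \<Rightarrow> complex) \<Rightarrow> bool" where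
  "primitive F g \<longleftrightarrow> (\<forall>a b. a \<le> b \<longrightarrow> F b - F a = (LINT z:{a..b}|lborel. g z))"

lemma L2_affine:
  assumes "g \<in> L2" "c \<noteq> 0" shows "(\<lambda>s. g (t + c * s)) \<in> L2"
proof -
  have [measurable]: "g \<in> borel_measurable borel" by (rule L2_measurable[OF assms(1)])
  show ?thesis
    using lborel_integrable_real_affine[OF L2_integrable[OF assms(1)] assms(2), of t]
    by (simp add: L2_def)
qed

lemma L2_indicator: "A \<in> sets borel \<Longrightarrow> g \<in> L2 \<Longrightarrow> (\<lambda>x. indicator A x *\<^sub>R g x) \<in> L2"
  by (rule L2_dominated[of g _ 1]) (auto simp: indicator_def dest: L2_measurable)

lemma L2_set_integrable:
  assumes "g \<in> L2" shows "set_integrable lborel {a..b} g"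
proof -
  have "integrable lborel (\<lambda>x. (cmod (indicator {a..b} x))\<^sup>2)"
    by (rule Bochner_Integration.integrable_cong[THEN iffD1, OF refl _ integrable_real_indicator[of "{a..b}" lborel]])
       (auto simp: indicator_def emeasure_lborel_Icc_eq)
  then have "(\<lambda>x. indicator {a..b} x :: complex) \<in> L2" by (simp add: L2_def)
  from L2_mult_integrable[OF this assms] show ?thesis
    unfolding set_integrable_def
    by (rule Bochner_Integration.integrable_cong[THEN iffD1, OF refl, rotated]) (auto simp: indicator_def)
qed

lemma diff_quot_L2: "f \<in> L2 \<Longrightarrow> diff_quot h f \<in> L2"
  using L2_cmult[OF L2_diff[OF L2_shift[of f h]], of f "inverse (of_real h)"]
  by (simp add: diff_quot_def[abs_def] divide_inverse mult.commute)

lemma measurable_average [measurable]: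
  assumes [measurable]: "g \<in> borel_measurable borel"
  shows "average h g \<in> borel_measurable borel"
  unfolding average_def[abs_def] set_lebesgue_integral_def by measurable

lemma average_minus:
  assumes "g \<in> L2" "h \<noteq> 0"
  shows "average h g x - g x = (LINT s:{0..1}|lborel. g (x + s * h) - g x)"
proof -
  have "set_integrable lborel {0..1} (\<lambda>s. g (x + h * s))"
    by (intro L2_set_integrable L2_affine assms)
  then have 1: "set_integrable lborel {0..1} (\<lambda>s. g (x + s * h))" by (simp add: mult.commute)
  have 2: "set_integrable lborel {0..1} (\<lambda>s::real. g x)"
    by (simp add: set_integrable_def)
  have "(LINT s:{0..1::real}|lborel. g x) = g x"
    by (simp add: set_lebesgue_integral_def)
  then show ?thesis using set_integral_diff(2)[OF 1 2] by (simp add: average_def)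
qed

text \<open>\<open>average h g - g\<close> is an average of differences between \<open>g\<close> and its small translates.\<close>

lemma L2_average_tendsto:
  assumes "g \<in> L2"
  shows "((\<lambda>h. L2_norm (\<lambda>x. average h g x - g x)) \<longlongrightarrow> 0) (at 0)"
proof (rule LIM_I)
  fix e :: real assume "e > 0"
  then have "e / 2 > 0" by simp
  have [measurable]: "g \<in> borel_measurable borel" by (rule L2_measurable[OF assms])
  obtain d where d: "d > 0" "\<And>k. k \<noteq> 0 \<Longrightarrow> \<bar>k\<bar> < d \<Longrightarrow> L2_norm (\<lambda>x. g (x + k) - g x) < e / 2"
    using LIM_D[OF L2_shift_continuous[OF assms] \<open>e / 2 > 0\<close>] by auto
  show "\<exists>s>0. \<forall>h. h \<noteq> 0 \<and> norm (h - 0) < s \<longrightarrow> norm (L2_norm (\<lambda>x. average h g x - g x) - 0) < e"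
  proof (intro exI[of _ d] conjI allI impI)
    fix h :: real assume "h \<noteq> 0 \<and> norm (h - 0) < d"
    then have h: "h \<noteq> 0" "\<bar>h\<bar> < d" by auto
    have "energy (\<lambda>x. LINT s:{0..1}|lborel. g (x + s * h) - g x) \<le> ennreal ((e / 2)\<^sup>2)"
    proof (rule energy_average_le)
      show "(\<lambda>z. g (snd z + fst z * h) - g (snd z)) \<in> borel_measurable borel"
        unfolding borel_prod[symmetric] by measurable
      show "energy (\<lambda>x. g (x + s * h) - g x) \<le> ennreal ((e / 2)\<^sup>2)" if "s \<in> {0..1}" for s
      proof (cases "s * h = 0")
        case True
        show ?thesis unfolding True energy_def by simp
      next
        case False
        have "\<bar>s * h\<bar> \<le> 1 * \<bar>h\<bar>" using that unfolding abs_mult by (intro mult_right_mono) auto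
        then have "L2_norm (\<lambda>x. g (x + s * h) - g x) \<le> e / 2"
          using False h by (intro less_imp_le d(2)) auto
        then show ?thesis by (intro energy_le_norm L2_diff L2_shift assms)
      qed
    qed
    then have "energy (\<lambda>x. average h g x - g x) \<le> ennreal ((e / 2)\<^sup>2)"
      by (simp add: average_minus[OF assms h(1)])
    then have "L2_norm (\<lambda>x. average h g x - g x) \<le> e / 2"
      using \<open>e > 0\<close> by (intro L2_norm_le_energy) auto
    then show "norm (L2_norm (\<lambda>x. average h g x - g x) - 0) < e" using \<open>e > 0\<close> by simp
  qed (use d in auto)
qed

lemma average_L2:
  assumes "g \<in> L2" shows "average h g \<in> L2"
proof (rule L2_energyI)
  have [measurable]: "g \<in> borel_measurable borel" by (rule L2_measurable[OF assms])
  show "average h g \<in> borel_measurable borel" by measurable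
  show "energy (average h g) \<le> ennreal ((L2_norm g)\<^sup>2)"
    unfolding average_def[abs_def]
  proof (rule energy_average_le)
    show "(\<lambda>z. g (snd z + fst z * h)) \<in> borel_measurable borel"
      unfolding borel_prod[symmetric] by measurable
    show "energy (\<lambda>x. g (x + s * h)) \<le> ennreal ((L2_norm g)\<^sup>2)" for s
      using energy_shift[of g "s * h"] energy_L2[OF assms] by simp
  qed
qed

lemma interval_integral_eq_average:
  assumes "h \<noteq> 0"
  shows "(LINT z:{min x (x + h)..max x (x + h)}|lborel. g z) = \<bar>h\<bar> *\<^sub>R average h g x"
proof -
  let ?a = "min x (x + h)" and ?b = "max x (x + h)"
  have "(LINT z:{?a..?b}|lborel. g z) = \<bar>h\<bar> *\<^sub>R (LINT s|lborel. indicator {?a..?b} (x + h * s) *\<^sub>R g (x + h * s))"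
    unfolding set_lebesgue_integral_def using assms by (rule lborel_integral_real_affine)
  also have "(\<lambda>s. indicator {?a..?b} (x + h * s) *\<^sub>R g (x + h * s)) = (\<lambda>s. indicator {0..1} s *\<^sub>R g (x + s * h))"
  proof
    fix s
    have "x + h * s \<in> {?a..?b} \<longleftrightarrow> s \<in> {0..1}"
      using assms by (cases "h > 0") (auto simp: min_def max_def mult_le_cancel_left mult_le_0_iff zero_le_mult_iff)
    then show "indicator {?a..?b} (x + h * s) *\<^sub>R g (x + h * s) = indicator {0..1} s *\<^sub>R g (x + s * h)"
      by (simp add: indicator_def mult.commute)
  qed
  finally show ?thesis by (simp add: average_def set_lebesgue_integral_def)
qed

lemma average_primitive:
  assumes "primitive F g" "h \<noteq> 0"
  shows "average h g x = diff_quot h F x"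
proof -
  have "F (max x (x + h)) - F (min x (x + h)) = \<bar>h\<bar> *\<^sub>R average h g x"
    using assms(1) unfolding primitive_def interval_integral_eq_average[OF assms(2), symmetric]
    by (simp add: min_le_iff_disj)
  then show ?thesis using assms(2)
    by (cases "h > 0") (auto simp: diff_quot_def min_def max_def scaleR_conv_of_real field_simps)
qed

lemma primitive_diff_quot_L2_limit:
  assumes "primitive F g" "g \<in> L2"
  shows "((\<lambda>h. L2_norm (\<lambda>x. diff_quot h F x - g x)) \<longlongrightarrow> 0) (at 0)"
  by (rule Lim_transform_eventually[OF L2_average_tendsto[OF assms(2)]])
     (auto simp: eventually_at_filter average_primitive[OF assms(1)])

lemma primitive_holder:
  assumes "primitive F g" "g \<in> L2"
  shows "cmod (F y - F x) \<le> sqrt \<bar>y - x\<bar> * L2_norm g"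
proof -
  have *: "cmod (F b - F a) \<le> sqrt \<bar>b - a\<bar> * L2_norm g" if "a \<le> b" for a b
  proof -
    have "ennreal ((cmod (F b - F a))\<^sup>2) \<le> ennreal (b - a) * (\<integral>\<^sup>+s. ennreal ((cmod (g s))\<^sup>2) * indicator {a..b} s \<partial>lborel)"
      using norm_integral_sq_le[OF L2_measurable[OF assms(2)] that] assms(1) that
      by (simp add: primitive_def)
    also have "\<dots> \<le> ennreal (b - a) * energy g"
      unfolding energy_def by (intro mult_left_mono nn_integral_mono) (auto simp: indicator_def)
    also have "\<dots> = ennreal ((b - a) * (L2_norm g)\<^sup>2)"
      using that by (simp add: energy_L2[OF assms(2)] ennreal_mult)
    finally have "(cmod (F b - F a))\<^sup>2 \<le> (sqrt \<bar>b - a\<bar> * L2_norm g)\<^sup>2"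
      using that by (simp add: ennreal_le_iff power_mult_distrib)
    then show ?thesis by (rule power2_le_imp_le) simp
  qed
  show ?thesis
    using *[of x y] *[of y x] by (cases "x \<le> y") (auto simp: norm_minus_commute abs_minus_commute)
qed

lemma primitive_continuous:
  assumes "primitive F g" "g \<in> L2" shows "continuous_on UNIV F"
proof -
  have "(F \<longlongrightarrow> F x) (at x)" for x
  proof (rule LIM_zero_cancel, rule Lim_null_comparison)
    show "\<forall>\<^sub>F y in at x. norm (F y - F x) \<le> sqrt \<bar>y - x\<bar> * L2_norm g"
      using primitive_holder[OF assms] by simp
    have "((\<lambda>y. sqrt \<bar>y - x\<bar> * L2_norm g) \<longlongrightarrow> sqrt \<bar>x - x\<bar> * L2_norm g) (at x)"
      by (intro tendsto_intros)
    then show "((\<lambda>y. sqrt \<bar>y - x\<bar> * L2_norm g) \<longlongrightarrow> 0) (at x)" by simp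
  qed
  then show ?thesis by (simp add: continuous_on_def)
qed

lemma primitive_exists:
  assumes "g \<in> L2" obtains F where "primitive F g"
proof -
  define F where "F x = (if 0 \<le> x then (LINT z:{0..x}|lborel. g z) else - (LINT z:{x..0}|lborel. g z))" for x
  have split: "(LINT z:{a..c}|lborel. g z) = (LINT z:{a..b}|lborel. g z) + (LINT z:{b..c}|lborel. g z)"
    if "a \<le> b" "b \<le> c" for a b c
  proof -
    have "(LINT z:{a..c}|lborel. g z) = (LINT z:({a..b} \<union> {b..c})|lborel. g z)"
      using that by (simp add: ivl_disj_un_two_touch)
    also have "\<dots> = (LINT z:{a..b}|lborel. g z) + (LINT z:{b..c}|lborel. g z)"
    proof (rule set_integral_Un_AE)
      show "AE x in lborel. \<not> (x \<in> {a..b} \<and> x \<in> {b..c})"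
        using AE_lborel_singleton[of b] by eventually_elim auto
    qed (auto intro: L2_set_integrable assms)
    finally show ?thesis .
  qed
  have "primitive F g" unfolding primitive_def
  proof (intro allI impI)
    fix a b :: real assume "a \<le> b"
    consider "0 \<le> a" | "a < 0" "0 \<le> b" | "b < 0" by linarith
    then show "F b - F a = (LINT z:{a..b}|lborel. g z)"
    proof cases
      case 1
      then show ?thesis using \<open>a \<le> b\<close> split[of 0 a b] by (simp add: F_def)
    next
      case 2
      then show ?thesis using split[of a 0 b] by (simp add: F_def)
    next
      case 3
      then show ?thesis using \<open>a \<le> b\<close> split[of a b 0] by (simp add: F_def)
    qed
  qed
  then show ?thesis by (rule that)
qed

text \<open>A function with vanishing integrals over all intervals has zero averages, to which it is
  arbitrarily close.\<close>

lemma L2_AE_zero_if_integrals_zero: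
  assumes "g \<in> L2" "\<And>a b. a \<le> b \<Longrightarrow> (LINT z:{a..b}|lborel. g z) = 0"
  shows "AE x in lborel. g x = 0"
proof -
  have "primitive (\<lambda>x. 0) g" using assms(2) by (simp add: primitive_def)
  from primitive_diff_quot_L2_limit[OF this assms(1)]
  have "((\<lambda>h::real. L2_norm g) \<longlongrightarrow> 0) (at 0)"
    using L2_norm_cmult[of "-1" g] by (simp add: diff_quot_def)
  then have "L2_norm g = 0" by (simp add: tendsto_const_iff)
  then show ?thesis by (rule L2_norm_eq_0_AE[OF assms(1)])
qed

section \<open>The fundamental lemma of the calculus of variations\<close>

text \<open>The bumps are test functions converging boundedly to the indicator function of an interval, so
  that all integrals of \<open>g\<close> over intervals vanish. Square integrability is required only locally
  because \<open>g\<close> will be the difference of a function in \<open>L\<^sup>2\<close> and a primitive, which may be unbounded.\<close>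

lemma du_Bois_Reymond:
  assumes [measurable]: "g \<in> borel_measurable borel"
    and loc: "\<And>R. (\<lambda>x. indicator {-R..R} x *\<^sub>R g x) \<in> L2"
    and zero: "\<And>\<phi>. test_function \<phi> \<Longrightarrow> (LINT x|lborel. g x * of_real (\<phi> x)) = 0"
  shows "AE x in lborel. g x = 0"
proof -
  have "AE x in lborel. indicator {-real N..real N} x *\<^sub>R g x = 0" for N
  proof (rule L2_AE_zero_if_integrals_zero[OF loc])
    fix a b :: real
    define c d where "c = max a (- real N)" and "d = min b (real N)"
    have int: "integrable lborel (\<lambda>x. indicator {c..d} x *\<^sub>R g x)"
    proof -
      have "set_integrable lborel {c..d} (\<lambda>x. indicator {-real N..real N} x *\<^sub>R g x)"
        by (rule L2_set_integrable[OF loc])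
      then show ?thesis unfolding set_integrable_def
        by (rule Bochner_Integration.integrable_cong[THEN iffD1, OF refl, rotated]) (auto simp: indicator_def c_def d_def)
    qed
    have "(\<lambda>n. LINT x|lborel. g x * of_real (bump c d n x)) \<longlonglongrightarrow> (LINT x|lborel. g x * indicator {c<..<d} x)"
    proof (rule integral_dominated_convergence[OF _ _ integrable_norm[OF int]])
      show "AE x in lborel. (\<lambda>n. g x * of_real (bump c d n x)) \<longlonglongrightarrow> g x * indicator {c<..<d} x"
      proof (intro AE_I2 tendsto_mult tendsto_const)
        show "(\<lambda>n. of_real (bump c d n x)) \<longlonglongrightarrow> (indicator {c<..<d} x :: complex)" for x
          using tendsto_of_real[OF bump_limit[of c d x], where 'a=complex]
          by (cases "x \<in> {c<..<d}") auto
      qed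
      show "AE x in lborel. norm (g x * of_real (bump c d n x)) \<le> norm (indicator {c..d} x *\<^sub>R g x)" for n
      proof (intro AE_I2)
        fix x
        show "norm (g x * of_real (bump c d n x)) \<le> norm (indicator {c..d} x *\<^sub>R g x)"
          using bump_outside[of x c d n] bump_bounds[of c d n x]
          by (cases "x \<in> {c<..<d}") (auto simp: norm_mult mult_left_le)
      qed
      have "(\<lambda>x. of_real (bump c d n x) :: complex) \<in> borel_measurable borel" for n
        using L2_measurable[OF test_function_L2(1)[OF test_function_bump]] .
      then show "(\<lambda>x. g x * of_real (bump c d n x)) \<in> borel_measurable lborel" for n by simp
    qed auto
    then have "(LINT x|lborel. g x * indicator {c<..<d} x) = 0"
      by (simp add: zero[OF test_function_bump] LIMSEQ_const_iff)
    also have "(LINT x|lborel. g x * indicator {c<..<d} x) = (LINT z:{a..b}|lborel. indicator {-real N..real N} z *\<^sub>R g z)"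
      unfolding set_lebesgue_integral_def
    proof (rule integral_cong_AE)
      show "AE x in lborel. g x * indicator {c<..<d} x = indicator {a..b} x *\<^sub>R indicator {-real N..real N} x *\<^sub>R g x"
        using AE_lborel_singleton[of c] AE_lborel_singleton[of d]
        by eventually_elim (auto simp: indicator_def c_def d_def)
    qed auto
    finally show "(LINT z:{a..b}|lborel. indicator {-real N..real N} z *\<^sub>R g z) = 0" .
  qed
  then have "AE x in lborel. \<forall>N::nat. indicator {-real N..real N} x *\<^sub>R g x = 0"
    unfolding AE_all_countable by blast
  then show ?thesis
  proof eventually_elim
    case (elim x)
    obtain N :: nat where "\<bar>x\<bar> \<le> real N" using real_arch_simple by blast
    then have "x \<in> {-real N..real N}" by auto
    then show ?case using elim[rule_format, of N] by simp
  qed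
qed

lemma weak_deriv_unique:
  assumes "has_weak_deriv f g1" "has_weak_deriv f g2" "g1 \<in> L2" "g2 \<in> L2"
  shows "AE x in lborel. g1 x = g2 x"
proof -
  have L2: "(\<lambda>x. g1 x - g2 x) \<in> L2" by (intro L2_diff assms)
  have "AE x in lborel. g1 x - g2 x = 0"
  proof (rule du_Bois_Reymond)
    show "(LINT x|lborel. (g1 x - g2 x) * of_real (\<phi> x)) = 0" if "test_function \<phi>" for \<phi>
    proof -
      note int = L2_mult_integrable[OF assms(3) test_function_L2(1)[OF that]]
        L2_mult_integrable[OF assms(4) test_function_L2(1)[OF that]]
      have "(LINT x|lborel. (g1 x - g2 x) * of_real (\<phi> x))
        = (LINT x|lborel. g1 x * of_real (\<phi> x)) - (LINT x|lborel. g2 x * of_real (\<phi> x))"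
        unfolding left_diff_distrib by (rule Bochner_Integration.integral_diff[OF int])
      also have "(LINT x|lborel. g1 x * of_real (\<phi> x)) = (LINT x|lborel. g2 x * of_real (\<phi> x))"
        using assms(1)[unfolded has_weak_deriv_def, rule_format, OF that]
          assms(2)[unfolded has_weak_deriv_def, rule_format, OF that] by (simp only: neg_equal_iff_equal)
      also have "\<dots> - \<dots> = 0" by (rule diff_self)
      finally show ?thesis .
    qed
  qed (use L2 in \<open>auto intro: L2_indicator L2_measurable\<close>)
  then show ?thesis by simp
qed

section \<open>Difference quotients and the space \<open>H\<^sup>1\<close>\<close>

lemma L2_local_mult_integrable:
  assumes "\<And>R. (\<lambda>x. indicator {-R..R} x *\<^sub>R f x) \<in> L2" "g \<in> L2" "\<And>x. \<bar>x\<bar> > R \<Longrightarrow> g x = 0"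
  shows "integrable lborel (\<lambda>x. f x * g x)"
proof -
  have "(\<lambda>x. f x * g x) = (\<lambda>x. (indicator {-R..R} x *\<^sub>R f x) * g x)"
    using assms(3) by (force simp: indicator_def abs_le_iff not_less)
  then show ?thesis using L2_mult_integrable[OF assms(1)[of R] assms(2)] by simp
qed

lemma continuous_locally_L2:
  assumes "continuous_on UNIV f" shows "(\<lambda>x. indicator {-R..R} x *\<^sub>R f x) \<in> L2"
proof -
  have [measurable]: "f \<in> borel_measurable borel" using assms by (rule borel_measurable_continuous_onI)
  have "set_integrable lborel {-R..R} (\<lambda>x. (cmod (f x))\<^sup>2)"
    by (intro borel_integrable_compact[unfolded set_integrable_def[symmetric]] continuous_intros
      continuous_on_subset[OF assms]) auto
  moreover have "(\<lambda>x. indicator {-R..R} x *\<^sub>R (cmod (f x))\<^sup>2) = (\<lambda>x. (cmod (indicator {-R..R} x *\<^sub>R f x))\<^sup>2)"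
    by (auto simp: indicator_def)
  ultimately show ?thesis by (simp add: L2_def set_integrable_def)
qed

lemma inverse_Suc_filterlim_at_0: "filterlim (\<lambda>n. inverse (real (Suc n))) (at 0) sequentially"
  unfolding filterlim_at using LIMSEQ_inverse_real_of_nat by (auto simp del: of_nat_Suc)

text \<open>Summation by parts moves the difference quotient to the test function.\<close>

lemma diff_quot_limit_imp_weak_deriv:
  assumes [measurable]: "f \<in> borel_measurable borel"
    and loc: "\<And>R. (\<lambda>x. indicator {-R..R} x *\<^sub>R f x) \<in> L2"
    and g: "g \<in> L2" and L2: "\<And>h. h \<noteq> 0 \<Longrightarrow> (\<lambda>x. diff_quot h f x - g x) \<in> L2"
    and lim: "((\<lambda>h. L2_norm (\<lambda>x. diff_quot h f x - g x)) \<longlongrightarrow> 0) (at 0)"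
  shows "has_weak_deriv f g"
  unfolding has_weak_deriv_def
proof (intro allI impI)
  fix \<phi> assume \<phi>: "test_function \<phi>"
  obtain R where R: "R > 0" "\<And>x. \<bar>x\<bar> \<ge> R \<Longrightarrow> \<phi> x = 0" using test_function_support[OF \<phi>] by blast
  obtain M where M: "M \<ge> 0" "\<And>x. \<bar>\<phi> x\<bar> \<le> M" "\<And>x. \<bar>deriv \<phi> x\<bar> \<le> M"
    using test_function_bounded[OF \<phi>] by blast
  have [measurable]: "\<phi> \<in> borel_measurable borel"
    using test_function_continuous[OF \<phi>] by (rule borel_measurable_continuous_onI)
  define h where "h n = inverse (real (Suc n))" for n
  have h: "h n > 0" "h n \<le> 1" for n by (auto simp: h_def inverse_le_1_iff)
  have hn: "h n \<noteq> 0" for n using h(1)[of n] by simp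
  have hlim: "filterlim h (at 0) sequentially"
    unfolding h_def by (rule inverse_Suc_filterlim_at_0)
  note \<phi>L2 = test_function_L2(1)[OF \<phi>]
  have "(\<lambda>n. (LINT x|lborel. (diff_quot (h n) f x - g x) * of_real (\<phi> x)) + (LINT x|lborel. g x * of_real (\<phi> x)))
    \<longlonglongrightarrow> 0 + (LINT x|lborel. g x * of_real (\<phi> x))"
  proof (intro tendsto_add tendsto_const)
    show "(\<lambda>n. LINT x|lborel. (diff_quot (h n) f x - g x) * of_real (\<phi> x)) \<longlonglongrightarrow> 0"
    proof (rule Lim_null_comparison)
      show "\<forall>\<^sub>F n in sequentially. norm (LINT x|lborel. (diff_quot (h n) f x - g x) * of_real (\<phi> x))
        \<le> L2_norm (\<lambda>x. diff_quot (h n) f x - g x) * L2_norm (\<lambda>x. of_real (\<phi> x))"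
        by (intro always_eventually allI L2_Cauchy_Schwarz[OF L2 \<phi>L2] hn)
      show "(\<lambda>n. L2_norm (\<lambda>x. diff_quot (h n) f x - g x) * L2_norm (\<lambda>x. of_real (\<phi> x))) \<longlonglongrightarrow> 0"
        by (intro tendsto_mult_left_zero filterlim_compose[OF lim hlim])
    qed
  qed
  moreover have "(LINT x|lborel. (diff_quot (h n) f x - g x) * of_real (\<phi> x)) + (LINT x|lborel. g x * of_real (\<phi> x))
    = - (LINT x|lborel. f x * of_real ((\<phi> (x - h n) - \<phi> x) / - h n))" for n
  proof -
    have \<phi>h: "(\<lambda>x. of_real (\<phi> (x + - h n))) \<in> L2" by (rule L2_shift[OF \<phi>L2])
    have i1: "integrable lborel (\<lambda>x. f x * of_real (\<phi> x))"
      using R by (intro L2_local_mult_integrable[OF loc \<phi>L2, of R]) auto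
    have i2: "integrable lborel (\<lambda>x. f x * of_real (\<phi> (x + - h n)))"
      using R h[of n] by (intro L2_local_mult_integrable[OF loc \<phi>h, of "R + 1"]) auto
    have "(LINT x|lborel. f x * of_real (\<phi> (x + - h n))) = (LINT x|lborel. f (x + h n) * of_real (\<phi> x))"
      using lborel_integral_real_affine[of 1 "\<lambda>x. f x * of_real (\<phi> (x + - h n))" "h n"] by (simp add: add.commute)
    moreover have i3: "integrable lborel (\<lambda>x. f (x + h n) * of_real (\<phi> x))"
      using lborel_integrable_real_affine[OF i2, of 1 "h n"] by (simp add: add.commute)
    ultimately have "(LINT x|lborel. f x * of_real ((\<phi> (x - h n) - \<phi> x) / - h n))
      = - (LINT x|lborel. diff_quot (h n) f x * of_real (\<phi> x))"
      using i1 i2 hn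
      by (simp add: diff_quot_def left_diff_distrib right_diff_distrib diff_divide_distrib add_divide_distrib)
    moreover have "(LINT x|lborel. (diff_quot (h n) f x - g x) * of_real (\<phi> x)) + (LINT x|lborel. g x * of_real (\<phi> x))
      = (LINT x|lborel. (diff_quot (h n) f x - g x) * of_real (\<phi> x) + g x * of_real (\<phi> x))"
      by (rule Bochner_Integration.integral_add[symmetric]) (intro L2_mult_integrable L2 hn g \<phi>L2)+
    ultimately show ?thesis by (simp add: left_diff_distrib)
  qed
  ultimately have 1: "(\<lambda>n. - (LINT x|lborel. f x * of_real ((\<phi> (x - h n) - \<phi> x) / - h n))) \<longlonglongrightarrow> (LINT x|lborel. g x * of_real (\<phi> x))"
    by simp
  have iM: "integrable lborel (\<lambda>x. cmod (f x * (indicator {-(R+1)..R+1} x * of_real M)))"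
  proof (intro integrable_norm L2_local_mult_integrable[OF loc, of _ "R + 1"])
    have "(\<lambda>x. indicator {-(R+1)..R+1} x *\<^sub>R (of_real M :: complex)) \<in> L2"
      by (intro continuous_locally_L2 continuous_intros)
    then show "(\<lambda>x. indicator {-(R+1)..R+1} x * of_real M) \<in> L2"
      by (simp add: scaleR_conv_of_real of_real_indicator)
  qed (auto simp: indicator_def)
  have "(\<lambda>n. LINT x|lborel. f x * of_real ((\<phi> (x - h n) - \<phi> x) / - h n)) \<longlonglongrightarrow> (LINT x|lborel. f x * of_real (deriv \<phi> x))"
  proof (rule integral_dominated_convergence[OF _ _ iM])
    show "(\<lambda>x. f x * of_real (deriv \<phi> x)) \<in> borel_measurable lborel"
      using borel_measurable_continuous_onI[OF test_function_deriv_continuous[OF \<phi>]] by measurable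
    show "AE x in lborel. (\<lambda>n. f x * of_real ((\<phi> (x - h n) - \<phi> x) / - h n)) \<longlonglongrightarrow> f x * of_real (deriv \<phi> x)"
    proof (intro AE_I2 tendsto_intros)
      fix x
      have "((\<lambda>k. (\<phi> (x + k) - \<phi> x) / k) \<longlongrightarrow> deriv \<phi> x) (at 0)"
        using test_function_has_deriv[OF \<phi>] by (simp add: DERIV_def)
      moreover have "filterlim (\<lambda>n. - h n) (at 0) sequentially"
        using hlim tendsto_minus[of h 0 sequentially] unfolding filterlim_at by simp
      ultimately have "(\<lambda>n. (\<phi> (x + - h n) - \<phi> x) / - h n) \<longlonglongrightarrow> deriv \<phi> x" by (rule filterlim_compose)
      then show "(\<lambda>n. (\<phi> (x - h n) - \<phi> x) / - h n) \<longlonglongrightarrow> deriv \<phi> x" by simp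
    qed
    show "AE x in lborel. norm (f x * of_real ((\<phi> (x - h n) - \<phi> x) / - h n)) \<le> cmod (f x * (indicator {-(R+1)..R+1} x * of_real M))" for n
    proof (intro AE_I2)
      fix x
      have "\<bar>(\<phi> (x - h n) - \<phi> x) / - h n\<bar> \<le> indicator {-(R+1)..R+1} x * M"
      proof (cases "x \<in> {-(R+1)..R+1}")
        case True
        have "x - h n < x" using h(1)[of n] by simp
        from MVT2[OF this, of \<phi> "deriv \<phi>"] obtain z where "\<phi> x - \<phi> (x - h n) = (x - (x - h n)) * deriv \<phi> z"
          using test_function_has_deriv[OF \<phi>] by blast
        then have "(\<phi> (x - h n) - \<phi> x) / - h n = deriv \<phi> z" using h(1)[of n] by (simp add: field_simps)
        then show ?thesis using M(3) True by simp
      next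
        case False
        then have "\<bar>x\<bar> \<ge> R" "\<bar>x - h n\<bar> \<ge> R" using h[of n] by (auto simp: abs_if split: if_splits)
        then show ?thesis using False R(2) by simp
      qed
      then have "cmod (f x) * \<bar>(\<phi> (x - h n) - \<phi> x) / - h n\<bar> \<le> cmod (f x) * (indicator {-(R+1)..R+1} x * M)"
        by (intro mult_left_mono) auto
      moreover have "cmod (indicator {-(R+1)..R+1} x * of_real M) = indicator {-(R+1)..R+1} x * M"
        using M(1) by (simp add: indicator_def)
      ultimately show "norm (f x * of_real ((\<phi> (x - h n) - \<phi> x) / - h n)) \<le> cmod (f x * (indicator {-(R+1)..R+1} x * of_real M))"
        by (simp only: norm_mult norm_of_real)
    qed
  qed measurable
  then have "(\<lambda>n. - (LINT x|lborel. f x * of_real ((\<phi> (x - h n) - \<phi> x) / - h n))) \<longlonglongrightarrow> - (LINT x|lborel. f x * of_real (deriv \<phi> x))"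
    by (rule tendsto_minus)
  from LIMSEQ_unique[OF this 1]
  show "(LINT x|lborel. f x * of_real (deriv \<phi> x)) = - (LINT x|lborel. g x * of_real (\<phi> x))"
    by (metis minus_minus)
qed

lemma primitive_has_weak_deriv:
  assumes "primitive F g" "g \<in> L2" shows "has_weak_deriv F g"
proof (rule diff_quot_limit_imp_weak_deriv)
  have c: "continuous_on UNIV F" by (rule primitive_continuous[OF assms])
  show "F \<in> borel_measurable borel" by (rule borel_measurable_continuous_onI[OF c])
  show "(\<lambda>x. indicator {-R..R} x *\<^sub>R F x) \<in> L2" for R by (rule continuous_locally_L2[OF c])
  show "(\<lambda>x. diff_quot h F x - g x) \<in> L2" if "h \<noteq> 0" for h
    using L2_diff[OF average_L2[OF assms(2), of h] assms(2)] by (simp add: average_primitive[OF assms(1) that])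
qed (rule assms(2) primitive_diff_quot_L2_limit[OF assms])+

text \<open>The antiderivative that vanishes to the left of the support is constant to the right of it,
  and the zero mean makes this constant zero.\<close>

lemma test_function_antiderivative:
  assumes "test_function \<psi>" "(LINT x|lborel. \<psi> x) = 0"
  obtains \<phi> where "test_function \<phi>" "deriv \<phi> = \<psi>"
proof -
  have c: "continuous_on UNIV \<psi>" by (rule test_function_continuous[OF assms(1)])
  obtain R where R: "R > 0" "\<And>x. \<bar>x\<bar> \<ge> R \<Longrightarrow> \<psi> x = 0" using test_function_support[OF assms(1)] by blast
  obtain \<Phi> where \<Phi>: "\<And>x. (\<Phi> has_real_derivative \<psi> x) (at x)"
    using einterval_antiderivative[of "-\<infinity>" "\<infinity>" \<psi>] c
    by (auto simp: continuous_on_eq_continuous_at has_real_derivative_iff_has_vector_derivative)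
  have const: "\<Phi> y = \<Phi> x" if "x \<le> y" "\<And>z. x \<le> z \<Longrightarrow> z \<le> y \<Longrightarrow> \<psi> z = 0" for x y
  proof (cases "x = y")
    case False
    then have "x < y" using that(1) by simp
    from MVT2[OF this, of \<Phi> \<psi>] obtain z where "x < z" "z < y" "\<Phi> y - \<Phi> x = (y - x) * \<psi> z"
      using \<Phi> by blast
    then show ?thesis using that(2)[of z] by simp
  qed simp
  have "(\<psi> has_integral (\<Phi> R - \<Phi> (- R))) {-R..R}"
    using R(1) \<Phi> by (intro fundamental_theorem_of_calculus)
      (auto simp: has_real_derivative_iff_has_vector_derivative intro: has_vector_derivative_at_within)
  moreover have "(\<psi> has_integral 0) {-R..R}"
  proof -
    have si: "set_integrable lborel {-R..R} \<psi>" unfolding set_integrable_def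
      by (intro borel_integrable_compact continuous_on_subset[OF c]) auto
    have "(LINT x:{-R..R}|lborel. \<psi> x) = (LINT x|lborel. \<psi> x)"
      unfolding set_lebesgue_integral_def
      by (rule Bochner_Integration.integral_cong) (use R(2) in \<open>force simp: indicator_def\<close>)+
    then show ?thesis
      using set_borel_integral_eq_integral[OF si] assms(2) integrable_integral[of \<psi> "{-R..R}"] by simp
  qed
  ultimately have eq: "\<Phi> R = \<Phi> (- R)" using has_integral_unique[of \<psi>] by (metis right_minus_eq)
  define \<phi> where "\<phi> x = \<Phi> x - \<Phi> (- R)" for x
  have d: "(\<phi> has_real_derivative \<psi> x) (at x)" for x
    unfolding \<phi>_def by (auto intro!: derivative_eq_intros \<Phi>)
  have "test_function \<phi>"
  proof (rule test_functionI)
    show "smooth_upto n \<phi>" for n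
      by (rule smooth_upto_Suc, rule smooth_upto_SucI[OF d test_function_smooth_upto[OF assms(1)]])
    show "\<phi> x = 0" if "\<bar>x\<bar> > R" for x
    proof (cases "x > R")
      case True
      then show ?thesis using const[of R x] R eq by (simp add: \<phi>_def)
    next
      case False
      then show ?thesis using const[of x "- R"] R that by (simp add: \<phi>_def)
    qed
  qed
  moreover have "deriv \<phi> = \<psi>" using d by (auto intro!: DERIV_imp_deriv)
  ultimately show ?thesis by (rule that)
qed

lemma test_function_lincomb:
  assumes "test_function \<phi>" "test_function \<psi>" shows "test_function (\<lambda>x. \<phi> x + c * \<psi> x)"
proof -
  obtain R where R: "R > 0" "\<And>x. \<bar>x\<bar> \<ge> R \<Longrightarrow> \<phi> x = 0" using test_function_support[OF assms(1)] by blast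
  obtain S where S: "S > 0" "\<And>x. \<bar>x\<bar> \<ge> S \<Longrightarrow> \<psi> x = 0" using test_function_support[OF assms(2)] by blast
  show ?thesis using R S
    by (intro test_functionI[where R="max R S"] smooth_upto_add smooth_upto_mult[OF smooth_upto_const]
        test_function_smooth_upto[OF assms(1)] test_function_smooth_upto[OF assms(2)]) auto
qed

lemma test_function_integrable:
  assumes "test_function \<phi>" shows "integrable lborel \<phi>"
proof -
  have c: "continuous_on UNIV \<phi>" by (rule test_function_continuous[OF assms])
  obtain R where R: "R > 0" "\<And>x. \<bar>x\<bar> \<ge> R \<Longrightarrow> \<phi> x = 0" using test_function_support[OF assms] by blast
  have "integrable lborel (\<lambda>x. indicator {-R..R} x *\<^sub>R \<phi> x)"
    by (intro borel_integrable_compact continuous_on_subset[OF c]) auto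
  moreover have "(\<lambda>x. indicator {-R..R} x *\<^sub>R \<phi> x) = \<phi>" using R(2) by (force simp: indicator_def)
  ultimately show ?thesis by simp
qed

lemma test_function_nonzero_mean:
  obtains \<theta> where "test_function \<theta>" "(LINT x|lborel. \<theta> x) \<noteq> 0"
proof -
  have "(\<lambda>n. LINT x|lborel. bump 0 1 n x) \<longlonglongrightarrow> (LINT x|lborel. indicator {0<..<1::real} x)"
  proof (rule integral_dominated_convergence)
    show "integrable lborel (indicator {0..1::real} :: real \<Rightarrow> real)"
      by (rule integrable_real_indicator) (auto simp: emeasure_lborel_Icc_eq)
    show "AE x in lborel. norm (bump 0 1 n x) \<le> indicator {0..1} x" for n
    proof (intro AE_I2)
      show "norm (bump 0 1 n x) \<le> indicator {0..1} x" for x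
        using bump_outside[of x 0 1 n] bump_bounds[of 0 1 n x] by (auto simp: indicator_def)
    qed
    show "bump 0 1 n \<in> borel_measurable lborel" for n
      using borel_measurable_continuous_onI[OF test_function_continuous[OF test_function_bump]] by simp
  qed (auto intro: bump_limit)
  then have "(\<lambda>n. LINT x|lborel. bump 0 1 n x) \<longlonglongrightarrow> 1" by simp
  then have "\<forall>\<^sub>F n in sequentially. (LINT x|lborel. bump 0 1 n x) > 0" by (rule order_tendstoD) simp
  then obtain n where "(LINT x|lborel. bump 0 1 n x) > 0" by (auto simp: eventually_sequentially)
  then show ?thesis using that[OF test_function_bump[of 0 1 n]] by simp
qed

text \<open>The difference of \<open>f\<close> and a primitive of its weak derivative is annihilated by all test
  functions of zero mean, hence is constant.\<close>

lemma weak_deriv_imp_primitive: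
  assumes f: "f \<in> L2" and g: "g \<in> L2" and fg: "has_weak_deriv f g"
  obtains F where "primitive F g" "AE x in lborel. f x = F x"
proof -
  obtain F where F: "primitive F g" using primitive_exists[OF g] .
  have c: "continuous_on UNIV F" by (rule primitive_continuous[OF F g])
  have [measurable]: "F \<in> borel_measurable borel" "f \<in> borel_measurable borel"
    by (rule borel_measurable_continuous_onI[OF c] L2_measurable[OF f])+
  define d where "d x = f x - F x" for x
  have [measurable]: "d \<in> borel_measurable borel" unfolding d_def by measurable
  have locF: "(\<lambda>x. indicator {-R..R} x *\<^sub>R F x) \<in> L2" for R by (rule continuous_locally_L2[OF c])
  have loc: "(\<lambda>x. indicator {-R..R} x *\<^sub>R (d x - k)) \<in> L2" for R k
  proof -
    have "(\<lambda>x. indicator {-R..R} x *\<^sub>R (F x + k)) \<in> L2"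
      by (intro continuous_locally_L2 continuous_intros c)
    from L2_diff[OF L2_indicator[OF _ f, of "{-R..R}"] this] show ?thesis
      by (simp add: d_def algebra_simps)
  qed
  have int: "integrable lborel (\<lambda>x. (d x - k) * of_real (\<phi> x))" if \<phi>: "test_function \<phi>" for \<phi> k
  proof -
    obtain R where R: "R > 0" "\<And>x. \<bar>x\<bar> \<ge> R \<Longrightarrow> \<phi> x = 0" using test_function_support[OF \<phi>] by blast
    then show ?thesis by (intro L2_local_mult_integrable[OF loc test_function_L2(1)[OF \<phi>], of R]) auto
  qed
  have zero: "(LINT x|lborel. d x * of_real (\<psi> x)) = 0" if \<psi>: "test_function \<psi>" and mean: "(LINT x|lborel. \<psi> x) = 0" for \<psi>
  proof -
    obtain \<phi> where \<phi>: "test_function \<phi>" "deriv \<phi> = \<psi>" using test_function_antiderivative[OF \<psi> mean] .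
    obtain R where R: "R > 0" "\<And>x. \<bar>x\<bar> \<ge> R \<Longrightarrow> \<psi> x = 0" using test_function_support[OF \<psi>] by blast
    have 1: "integrable lborel (\<lambda>x. f x * of_real (\<psi> x))"
      by (rule L2_mult_integrable[OF f test_function_L2(1)[OF \<psi>]])
    have 2: "integrable lborel (\<lambda>x. F x * of_real (\<psi> x))"
      using R by (intro L2_local_mult_integrable[OF locF test_function_L2(1)[OF \<psi>], of R]) auto
    have "(LINT x|lborel. d x * of_real (\<psi> x)) = (LINT x|lborel. f x * of_real (\<psi> x)) - (LINT x|lborel. F x * of_real (\<psi> x))"
      unfolding d_def left_diff_distrib by (rule Bochner_Integration.integral_diff[OF 1 2])
    also have "\<dots> = 0"
      using fg[unfolded has_weak_deriv_def, rule_format, OF \<phi>(1)]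
        primitive_has_weak_deriv[OF F g, unfolded has_weak_deriv_def, rule_format, OF \<phi>(1)]
      unfolding \<phi>(2) by simp
    finally show ?thesis .
  qed
  \<comment> \<open>Subtracting a multiple of the fixed test function \<open>\<theta>\<close> gives every test function zero mean; the
      constant \<open>k\<close> is what this correction leaves behind.\<close>
  obtain \<theta> where \<theta>: "test_function \<theta>" "(LINT x|lborel. \<theta> x) \<noteq> 0" using test_function_nonzero_mean .
  define k where "k = (LINT x|lborel. d x * of_real (\<theta> x)) / of_real (LINT x|lborel. \<theta> x)"
  have "AE x in lborel. d x - k = 0"
  proof (rule du_Bois_Reymond[OF _ loc])
    fix \<psi> assume \<psi>: "test_function \<psi>"
    define r where "r = - (LINT x|lborel. \<psi> x) / (LINT x|lborel. \<theta> x)"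
    have "(LINT x|lborel. \<psi> x + r * \<theta> x) = (LINT x|lborel. \<psi> x) + r * (LINT x|lborel. \<theta> x)"
      using test_function_integrable[OF \<psi>] test_function_integrable[OF \<theta>(1)] by simp
    also have "\<dots> = 0" using \<theta>(2) by (simp add: r_def)
    finally have "(LINT x|lborel. d x * of_real (\<psi> x + r * \<theta> x)) = 0"
      by (intro zero test_function_lincomb \<psi> \<theta>(1))
    moreover have "(LINT x|lborel. d x * of_real (\<psi> x + r * \<theta> x))
      = (LINT x|lborel. d x * of_real (\<psi> x)) + of_real r * (LINT x|lborel. d x * of_real (\<theta> x))"
      using int[OF \<psi>, of 0] int[OF \<theta>(1), of 0] by (simp add: distrib_left mult.left_commute)
    ultimately have "(LINT x|lborel. d x * of_real (\<psi> x)) = k * of_real (LINT x|lborel. \<psi> x)"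
      using \<theta>(2) by (simp add: k_def r_def field_simps add_eq_0_iff)
    moreover have "(LINT x|lborel. (d x - k) * of_real (\<psi> x)) = (LINT x|lborel. d x * of_real (\<psi> x)) - k * of_real (LINT x|lborel. \<psi> x)"
      using int[OF \<psi>, of 0] test_function_integrable[OF \<psi>]
      by (simp add: left_diff_distrib integral_of_real)
    ultimately show "(LINT x|lborel. (d x - k) * of_real (\<psi> x)) = 0" by simp
  qed measurable
  then have "AE x in lborel. f x = F x + k" by (simp add: d_def algebra_simps)
  moreover have "primitive (\<lambda>x. F x + k) g" using F by (simp add: primitive_def)
  ultimately show ?thesis using that by blast
qed

lemma H1_L2: "f \<in> H1 \<Longrightarrow> f \<in> L2"
  by (simp add: H1_def)

lemma weak_deriv_props:
  assumes "f \<in> H1" shows "weak_deriv f \<in> L2" "has_weak_deriv f (weak_deriv f)"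
proof -
  have "\<exists>g. g \<in> L2 \<and> has_weak_deriv f g" using assms by (auto simp: H1_def)
  from someI_ex[OF this] show "weak_deriv f \<in> L2" "has_weak_deriv f (weak_deriv f)"
    by (auto simp: weak_deriv_def)
qed

lemma weak_deriv_AE:
  assumes "f \<in> L2" "g \<in> L2" "has_weak_deriv f g"
  shows "f \<in> H1" "AE x in lborel. weak_deriv f x = g x"
proof -
  show "f \<in> H1" using assms by (auto simp: H1_def)
  then show "AE x in lborel. weak_deriv f x = g x"
    using weak_deriv_unique weak_deriv_props assms by blast
qed

lemma has_weak_deriv_diff:
  assumes "f1 \<in> L2" "f2 \<in> L2" "g1 \<in> L2" "g2 \<in> L2" "has_weak_deriv f1 g1" "has_weak_deriv f2 g2"
  shows "has_weak_deriv (\<lambda>x. f1 x - f2 x) (\<lambda>x. g1 x - g2 x)"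
  unfolding has_weak_deriv_def
proof (intro allI impI)
  fix \<phi> assume \<phi>: "test_function \<phi>"
  note L2 = test_function_L2[OF \<phi>]
  show "(LINT x|lborel. (f1 x - f2 x) * of_real (deriv \<phi> x)) = - (LINT x|lborel. (g1 x - g2 x) * of_real (\<phi> x))"
    using assms(5,6) \<phi> unfolding has_weak_deriv_def left_diff_distrib
    by (simp add: Bochner_Integration.integral_diff[OF L2_mult_integrable[OF assms(1) L2(2)] L2_mult_integrable[OF assms(2) L2(2)]]
      Bochner_Integration.integral_diff[OF L2_mult_integrable[OF assms(3) L2(1)] L2_mult_integrable[OF assms(4) L2(1)]])
qed

lemma H1_diff:
  assumes "f \<in> H1" "g \<in> H1"
  shows "(\<lambda>x. f x - g x) \<in> H1"
    and "AE x in lborel. weak_deriv (\<lambda>x. f x - g x) x = weak_deriv f x - weak_deriv g x"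
proof -
  have "has_weak_deriv (\<lambda>x. f x - g x) (\<lambda>x. weak_deriv f x - weak_deriv g x)"
    by (intro has_weak_deriv_diff H1_L2 weak_deriv_props assms)
  from weak_deriv_AE[OF L2_diff L2_diff this]
  show "(\<lambda>x. f x - g x) \<in> H1" "AE x in lborel. weak_deriv (\<lambda>x. f x - g x) x = weak_deriv f x - weak_deriv g x"
    using assms by (auto intro: H1_L2 weak_deriv_props)
qed

lemma L2_norm_weak_deriv_diff:
  assumes "f \<in> H1" "g \<in> H1"
  shows "L2_norm (weak_deriv (\<lambda>x. f x - g x)) = L2_norm (\<lambda>x. weak_deriv f x - weak_deriv g x)"
  using assms by (intro L2_norm_cong_AE H1_diff L2_measurable L2_diff weak_deriv_props)

lemma H1_norm_bounds:
  "L2_norm f \<le> H1_norm f" "L2_norm (weak_deriv f) \<le> H1_norm f"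
  "H1_norm f \<le> L2_norm f + L2_norm (weak_deriv f)" "0 \<le> H1_norm f"
  by (auto simp: H1_norm_def real_le_rsqrt sqrt_sum_squares_le_sum)

lemma H1_norm_le_diff:
  assumes "f \<in> H1" "g \<in> H1"
  shows "H1_norm f \<le> 2 * (H1_norm (\<lambda>x. f x - g x) + H1_norm g)"
proof -
  have "L2_norm f \<le> L2_norm (\<lambda>x. f x - g x) + L2_norm g"
    using L2_norm_triangle[OF L2_diff[OF H1_L2 H1_L2] H1_L2] assms by fastforce
  moreover have "L2_norm (weak_deriv f) \<le> L2_norm (weak_deriv (\<lambda>x. f x - g x)) + L2_norm (weak_deriv g)"
    using L2_norm_triangle[OF L2_diff[OF weak_deriv_props(1) weak_deriv_props(1)] weak_deriv_props(1)] assms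
    unfolding L2_norm_weak_deriv_diff[OF assms] by fastforce
  ultimately have "L2_norm f + L2_norm (weak_deriv f)
      \<le> (L2_norm (\<lambda>x. f x - g x) + L2_norm g) + (L2_norm (weak_deriv (\<lambda>x. f x - g x)) + L2_norm (weak_deriv g))"
    by (rule add_mono)
  also have "\<dots> \<le> (H1_norm (\<lambda>x. f x - g x) + H1_norm g) + (H1_norm (\<lambda>x. f x - g x) + H1_norm g)"
    by (intro add_mono H1_norm_bounds)
  finally have "L2_norm f + L2_norm (weak_deriv f) \<le> 2 * (H1_norm (\<lambda>x. f x - g x) + H1_norm g)"
    by simp
  then show ?thesis using H1_norm_bounds(3)[of f] by (rule order_trans[rotated])
qed

text \<open>The Hoelder bound controls the continuous representative by its mean over an interval of
  length one, and the mean by the \<open>L\<^sup>2\<close> norm.\<close>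

lemma primitive_L2_bounded:
  assumes F: "primitive F g" "g \<in> L2" "F \<in> L2"
  shows "cmod (F x) \<le> L2_norm F + L2_norm g"
proof -
  have [measurable]: "F \<in> borel_measurable borel" by (rule L2_measurable[OF F(3)])
  have int: "set_integrable lborel {x..x+1} F" by (rule L2_set_integrable[OF F(3)])
  have const: "set_integrable lborel {x..x+1} (\<lambda>y. c)" for c :: real
    by (simp add: set_integrable_def)
  have "ennreal ((cmod (LINT y:{x..x+1}|lborel. F y))\<^sup>2) \<le> ennreal (x + 1 - x) * (\<integral>\<^sup>+s. ennreal ((cmod (F s))\<^sup>2) * indicator {x..x+1} s \<partial>lborel)"
    by (rule norm_integral_sq_le) auto
  also have "\<dots> \<le> energy F"
    unfolding energy_def by (simp, intro nn_integral_mono) (auto simp: indicator_def)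
  finally have "(cmod (LINT y:{x..x+1}|lborel. F y))\<^sup>2 \<le> (L2_norm F)\<^sup>2"
    by (simp add: energy_L2[OF F(3)] ennreal_le_iff)
  then have mean: "cmod (LINT y:{x..x+1}|lborel. F y) \<le> L2_norm F" by (rule power2_le_imp_le) simp
  have cint: "set_integrable lborel {x..x+1} (\<lambda>y. F x)"
    by (simp add: set_integrable_def)
  have "(LINT y:{x..x+1}|lborel. F x) = F x" by (simp add: set_lebesgue_integral_def)
  then have "F x - (LINT y:{x..x+1}|lborel. F y) = (LINT y:{x..x+1}|lborel. F x - F y)"
    using set_integral_diff(2)[OF cint int] by simp
  also have "cmod \<dots> \<le> (LINT y:{x..x+1}|lborel. cmod (F x - F y))"
    by (rule set_integral_norm_bound[OF set_integral_diff(1)[OF cint int]])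
  also have "\<dots> \<le> (LINT y:{x..x+1}|lborel. L2_norm g)"
  proof (rule set_integral_mono[OF set_integrable_norm[OF set_integral_diff(1)[OF cint int]] const])
    fix y assume "y \<in> {x..x+1}"
    then have "sqrt \<bar>x - y\<bar> * L2_norm g \<le> 1 * L2_norm g" by (intro mult_right_mono) auto
    then show "cmod (F x - F y) \<le> L2_norm g" using primitive_holder[OF F(1,2), of x y] by simp
  qed
  also have "\<dots> = L2_norm g" by (simp add: set_lebesgue_integral_def)
  finally have "cmod (F x - (LINT y:{x..x+1}|lborel. F y)) \<le> L2_norm g" .
  then show ?thesis using mean norm_triangle_sub[of "F x" "LINT y:{x..x+1}|lborel. F y"] by linarith
qed

lemma H1_continuous_representative:
  assumes "f \<in> H1"
  obtains F where "primitive F (weak_deriv f)" "continuous_on UNIV F" "F \<in> L2"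
    "AE x in lborel. f x = F x" "\<And>x. cmod (F x) \<le> 2 * H1_norm f"
proof -
  obtain F where F: "primitive F (weak_deriv f)" "AE x in lborel. f x = F x"
    using weak_deriv_imp_primitive H1_L2 weak_deriv_props assms by metis
  have c: "continuous_on UNIV F" by (rule primitive_continuous[OF F(1) weak_deriv_props(1)[OF assms]])
  have [measurable]: "F \<in> borel_measurable borel" by (rule borel_measurable_continuous_onI[OF c])
  have L2: "F \<in> L2" using F(2) by (intro L2_cong_AE[OF H1_L2[OF assms]]) auto
  have "L2_norm F = L2_norm f"
    using F(2) L2_measurable[OF H1_L2[OF assms]] by (intro L2_norm_cong_AE[symmetric]) auto
  then have "cmod (F x) \<le> 2 * H1_norm f" for x
    using primitive_L2_bounded[OF F(1) weak_deriv_props(1)[OF assms] L2, of x] H1_norm_bounds[of f] by linarith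
  then show ?thesis using that F c L2 by blast
qed

lemma H1_AE_bounded: "f \<in> H1 \<Longrightarrow> AE x in lborel. cmod (f x) \<le> 2 * H1_norm f"
proof -
  assume "f \<in> H1"
  then obtain F where "AE x in lborel. f x = F x" "\<And>x. cmod (F x) \<le> 2 * H1_norm f"
    using H1_continuous_representative by metis
  then show ?thesis by auto
qed

lemma diff_quot_cong_AE:
  assumes "AE x in lborel. f x = F x"
  shows "AE x in lborel. diff_quot h f x = diff_quot h F x"
proof -
  have "AE x in lborel. f (x + h) = F (x + h)"
  proof -
    have "AE x in distr lborel borel ((+) h). f x = F x"
      using assms unfolding lborel_distr_plus .
    from AE_distrD[OF _ this] show ?thesis by (simp add: add.commute)
  qed
  then show ?thesis using assms by eventually_elim (simp add: diff_quot_def)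
qed

text \<open>The difference quotients of a primitive are the averages of its derivative.\<close>

theorem H1_diff_quot_limit:
  assumes "f \<in> H1"
  shows "((\<lambda>h. L2_norm (\<lambda>x. diff_quot h f x - weak_deriv f x)) \<longlongrightarrow> 0) (at 0)"
proof -
  obtain F where F: "primitive F (weak_deriv f)" "F \<in> L2" "AE x in lborel. f x = F x"
    using H1_continuous_representative[OF assms] by metis
  have "L2_norm (\<lambda>x. diff_quot h f x - weak_deriv f x) = L2_norm (\<lambda>x. diff_quot h F x - weak_deriv f x)" for h
  proof (rule L2_norm_cong_AE)
    show "AE x in lborel. diff_quot h f x - weak_deriv f x = diff_quot h F x - weak_deriv f x"
      using diff_quot_cong_AE[OF F(3), of h] by eventually_elim simp
  qed (intro L2_measurable L2_diff diff_quot_L2 H1_L2 weak_deriv_props assms F)+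
  then show ?thesis using primitive_diff_quot_L2_limit[OF F(1) weak_deriv_props(1)[OF assms]] by simp
qed

theorem H1_if_diff_quot_limit:
  assumes "f \<in> L2" "g \<in> L2" "((\<lambda>h. L2_norm (\<lambda>x. diff_quot h f x - g x)) \<longlongrightarrow> 0) (at 0)"
  shows "f \<in> H1" "AE x in lborel. weak_deriv f x = g x"
proof -
  have "has_weak_deriv f g"
  proof (rule diff_quot_limit_imp_weak_deriv)
    show "(\<lambda>x. indicator {-R..R} x *\<^sub>R f x) \<in> L2" for R by (rule L2_indicator[OF _ assms(1)]) simp
    show "(\<lambda>x. diff_quot h f x - g x) \<in> L2" for h by (intro L2_diff diff_quot_L2 assms)
  qed (use assms L2_measurable in auto)
  from weak_deriv_AE[OF assms(1,2) this] show "f \<in> H1" "AE x in lborel. weak_deriv f x = g x" .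
qed

text \<open>\<open>h Re \<langle>f, D\<^sub>h f\<rangle> = Re \<langle>f, f(\<cdot> + h)\<rangle> - \<parallel>f\<parallel>\<^sup>2 \<le> 0\<close> for both signs of \<open>h\<close>, so the limit of
  \<open>Re \<langle>f, D\<^sub>h f\<rangle>\<close> as \<open>h \<longrightarrow> 0\<close> can only be zero.\<close>

lemma H1_Re_integral_weak_deriv:
  assumes "f \<in> H1"
  shows "Re (LINT x|lborel. cnj (f x) * weak_deriv f x) = 0"
proof -
  note f = H1_L2[OF assms] and g = weak_deriv_props(1)[OF assms]
  note cf = L2_cnj[OF f]
  define I where "I h = Re (LINT x|lborel. cnj (f x) * diff_quot h f x)" for h
  have lim: "(I \<longlongrightarrow> Re (LINT x|lborel. cnj (f x) * weak_deriv f x)) (at 0)"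
  proof (rule LIM_zero_cancel, rule Lim_null_comparison)
    show "\<forall>\<^sub>F h in at 0. norm (I h - Re (LINT x|lborel. cnj (f x) * weak_deriv f x))
      \<le> L2_norm (\<lambda>x. cnj (f x)) * L2_norm (\<lambda>x. diff_quot h f x - weak_deriv f x)"
    proof (intro always_eventually allI)
      fix h
      have "I h - Re (LINT x|lborel. cnj (f x) * weak_deriv f x)
        = Re (LINT x|lborel. cnj (f x) * (diff_quot h f x - weak_deriv f x))"
        unfolding I_def right_diff_distrib
        by (subst Bochner_Integration.integral_diff[OF L2_mult_integrable[OF cf diff_quot_L2[OF f]] L2_mult_integrable[OF cf g]]) simp
      also have "\<bar>\<dots>\<bar> \<le> L2_norm (\<lambda>x. cnj (f x)) * L2_norm (\<lambda>x. diff_quot h f x - weak_deriv f x)"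
        by (rule order_trans[OF abs_Re_le_cmod]) (intro L2_Cauchy_Schwarz cf L2_diff diff_quot_L2 f g)
      finally show "norm (I h - Re (LINT x|lborel. cnj (f x) * weak_deriv f x))
        \<le> L2_norm (\<lambda>x. cnj (f x)) * L2_norm (\<lambda>x. diff_quot h f x - weak_deriv f x)" by simp
    qed
    show "((\<lambda>h. L2_norm (\<lambda>x. cnj (f x)) * L2_norm (\<lambda>x. diff_quot h f x - weak_deriv f x)) \<longlongrightarrow> 0) (at 0)"
      by (intro tendsto_mult_right_zero H1_diff_quot_limit assms)
  qed
  have sign: "h * I h \<le> 0" if "h \<noteq> 0" for h
  proof -
    have "of_real h * (LINT x|lborel. cnj (f x) * diff_quot h f x) = (LINT x|lborel. cnj (f x) * f (x + h) - cnj (f x) * f x)"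
      unfolding integral_mult_right_zero[symmetric] using that
      by (intro Bochner_Integration.integral_cong) (auto simp: diff_quot_def field_simps)
    also have "\<dots> = (LINT x|lborel. cnj (f x) * f (x + h)) - (LINT x|lborel. cnj (f x) * f x)"
      by (rule Bochner_Integration.integral_diff[OF L2_mult_integrable[OF cf L2_shift[OF f]] L2_mult_integrable[OF cf f]])
    also have "(LINT x|lborel. cnj (f x) * f x) = of_real ((L2_norm f)\<^sup>2)"
      unfolding L2_norm_sq integral_complex_of_real[symmetric]
      by (intro Bochner_Integration.integral_cong) (simp_all only: complex_norm_square mult.commute)
    finally have *: "of_real h * (LINT x|lborel. cnj (f x) * diff_quot h f x)
      = (LINT x|lborel. cnj (f x) * f (x + h)) - of_real ((L2_norm f)\<^sup>2)" .
    have "h * I h = Re (of_real h * (LINT x|lborel. cnj (f x) * diff_quot h f x))"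
      by (simp add: I_def)
    also have "\<dots> = Re (LINT x|lborel. cnj (f x) * f (x + h)) - (L2_norm f)\<^sup>2"
      unfolding * minus_complex.sel Re_complex_of_real ..
    finally have "h * I h = Re (LINT x|lborel. cnj (f x) * f (x + h)) - (L2_norm f)\<^sup>2" .
    moreover have "Re (LINT x|lborel. cnj (f x) * f (x + h)) \<le> L2_norm (\<lambda>x. cnj (f x)) * L2_norm (\<lambda>x. f (x + h))"
      by (rule order_trans[OF complex_Re_le_cmod]) (intro L2_Cauchy_Schwarz cf L2_shift f)
    moreover have "L2_norm (\<lambda>x. cnj (f x)) = L2_norm f" by (simp add: L2_norm_def)
    ultimately show ?thesis by (simp add: L2_norm_shift[OF f] power2_eq_square)
  qed
  have "Re (LINT x|lborel. cnj (f x) * weak_deriv f x) \<le> 0"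
  proof (rule tendsto_upperbound[of I _ "at_right 0"])
    show "(I \<longlongrightarrow> Re (LINT x|lborel. cnj (f x) * weak_deriv f x)) (at_right 0)"
      using lim by (rule tendsto_mono[rotated]) (simp add: at_le)
    have "I h \<le> 0" if "0 < h" for h using sign[of h] that by (simp add: mult_le_0_iff)
    then show "\<forall>\<^sub>F h in at_right 0. I h \<le> 0" by (simp add: eventually_at_filter)
  qed simp
  moreover have "0 \<le> Re (LINT x|lborel. cnj (f x) * weak_deriv f x)"
  proof (rule tendsto_lowerbound[of I _ "at_left 0"])
    show "(I \<longlongrightarrow> Re (LINT x|lborel. cnj (f x) * weak_deriv f x)) (at_left 0)"
      using lim by (rule tendsto_mono[rotated]) (simp add: at_le)
    have "0 \<le> I h" if "h < 0" for h using sign[of h] that by (simp add: mult_le_0_iff)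
    then show "\<forall>\<^sub>F h in at_left 0. 0 \<le> I h" by (simp add: eventually_at_filter)
  qed simp
  ultimately show ?thesis by simp
qed

section \<open>Integrated transport equations\<close>

definition cont2 :: "(real \<Rightarrow> real \<Rightarrow> 'a::topological_space) \<Rightarrow> bool" where
  "cont2 p \<longleftrightarrow> continuous_on UNIV (\<lambda>z. p (fst z) (snd z))"

lemma cont2_compose:
  assumes "cont2 p" "continuous_on S a" "continuous_on S b"
  shows "continuous_on S (\<lambda>y. p (a y) (b y))"
  using continuous_on_compose2[OF assms(1)[unfolded cont2_def] continuous_on_Pair[OF assms(2,3)]] by simp

text \<open>The equation \<open>p\<^sub>t + c p\<^sub>x = f\<close>, integrated along the characteristics \<open>x - c t = const\<close>.\<close>

definition mild :: "real \<Rightarrow> (real \<Rightarrow> real \<Rightarrow> 'a::banach) \<Rightarrow> (real \<Rightarrow> real \<Rightarrow> 'a) \<Rightarrow> bool" where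
  "mild c p f \<longleftrightarrow> (\<forall>t\<ge>0. \<forall>x. p t x = p 0 (x - c * t) + integral {0..t} (\<lambda>s. f s (x - c * (t - s))))"

lemma mildD:
  "mild c p f \<Longrightarrow> 0 \<le> t \<Longrightarrow> p t x = p 0 (x - c * t) + integral {0..t} (\<lambda>s. f s (x - c * (t - s)))"
  unfolding mild_def by blast

lemma char_integrable:
  fixes f :: "real \<Rightarrow> real \<Rightarrow> 'a::banach"
  assumes "cont2 f" shows "(\<lambda>s. f s (x - c * (t - s))) integrable_on {a..b}"
  by (intro integrable_continuous_interval cont2_compose[OF assms] continuous_intros)

lemma mild_restart:
  assumes "mild c p f" "cont2 f" "0 \<le> s" "s \<le> t"
  shows "p t x = p s (x - c * (t - s)) + integral {s..t} (\<lambda>r. f r (x - c * (t - r)))"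
proof -
  have "p s (x - c * (t - s)) = p 0 (x - c * (t - s) - c * s) + integral {0..s} (\<lambda>r. f r (x - c * (t - s) - c * (s - r)))"
    by (rule mildD[OF assms(1,3)])
  also have "\<dots> = p 0 (x - c * t) + integral {0..s} (\<lambda>r. f r (x - c * (t - r)))"
    by (simp add: algebra_simps)
  finally have *: "p s (x - c * (t - s)) = p 0 (x - c * t) + integral {0..s} (\<lambda>r. f r (x - c * (t - r)))" .
  have "p t x = p 0 (x - c * t) + integral {0..t} (\<lambda>r. f r (x - c * (t - r)))"
    using assms by (intro mildD[OF assms(1)]) simp
  also have "integral {0..t} (\<lambda>r. f r (x - c * (t - r)))
    = integral {0..s} (\<lambda>r. f r (x - c * (t - r))) + integral {s..t} (\<lambda>r. f r (x - c * (t - r)))"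
    by (rule Henstock_Kurzweil_Integration.integral_combine[OF assms(3,4) char_integrable[OF assms(2)], symmetric])
  finally show ?thesis unfolding * by (simp only: add.assoc)
qed

lemma mild_along_characteristic:
  assumes "mild c p f" "0 \<le> s"
  shows "p s (y + c * s) = p 0 y + integral {0..s} (\<lambda>r. f r (y + c * r))"
  using mildD[OF assms, of "y + c * s"] by (simp only: right_diff_distrib) simp

lemma mildI_along_characteristic:
  assumes "\<And>s y. 0 \<le> s \<Longrightarrow> p s (y + c * s) = p 0 y + integral {0..s} (\<lambda>r. f r (y + c * r))"
  shows "mild c p f"
  unfolding mild_def
proof (intro allI impI)
  fix t x :: real assume "0 \<le> t"
  from assms[OF this, of "x - c * t"]
  show "p t x = p 0 (x - c * t) + integral {0..t} (\<lambda>s. f s (x - c * (t - s)))"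
    by (simp add: algebra_simps)
qed

lemma mild_has_derivative:
  assumes "mild c p f" "cont2 f" "s \<in> {0..t}"
  shows "((\<lambda>s. p s (y + c * s)) has_vector_derivative f s (y + c * s)) (at s within {0..t})"
proof -
  have "((\<lambda>s. p 0 y + integral {0..s} (\<lambda>r. f r (y + c * r))) has_vector_derivative f s (y + c * s)) (at s within {0..t})"
    by (rule has_vector_derivative_eq_rhs[OF has_vector_derivative_add[OF has_vector_derivative_const
          integral_has_vector_derivative[OF _ assms(3)]]])
       (intro cont2_compose[OF assms(2)] continuous_intros, simp)
  then show ?thesis
    by (rule has_vector_derivative_transform[rotated 2])
       (use assms mild_along_characteristic[OF assms(1)] in auto)
qed

text \<open>Along a characteristic the equation is an ordinary differential equation, so the product rule
  is available although \<open>p\<close> need not have partial derivatives.\<close>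

lemma mild_norm_sq:
  fixes p f :: "real \<Rightarrow> real \<Rightarrow> complex"
  assumes "mild c p f" "cont2 f"
  shows "mild c (\<lambda>t x. (cmod (p t x))\<^sup>2) (\<lambda>t x. 2 * Re (cnj (p t x) * f t x))"
proof (rule mildI_along_characteristic)
  fix t y :: real assume t: "0 \<le> t"
  have "((\<lambda>s. (cmod (p s (y + c * s)))\<^sup>2) has_vector_derivative 2 * Re (cnj (p s (y + c * s)) * f s (y + c * s))) (at s within {0..t})"
    if "s \<in> {0..t}" for s
  proof -
    have "((\<lambda>s. p s (y + c * s)) has_derivative (\<lambda>h. h *\<^sub>R f s (y + c * s))) (at s within {0..t})"
      using mild_has_derivative[OF assms that] by (simp add: has_vector_derivative_def)
    from has_derivative_inner[OF this this]
    have "((\<lambda>s. (cmod (p s (y + c * s)))\<^sup>2) has_derivative (\<lambda>h. h *\<^sub>R (2 * Re (cnj (p s (y + c * s)) * f s (y + c * s))))) (at s within {0..t})"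
      by (simp add: power2_norm_eq_inner inner_complex_def algebra_simps)
    then show ?thesis by (simp add: has_vector_derivative_def)
  qed
  from fundamental_theorem_of_calculus[OF t this]
  have "integral {0..t} (\<lambda>r. 2 * Re (cnj (p r (y + c * r)) * f r (y + c * r))) = (cmod (p t (y + c * t)))\<^sup>2 - (cmod (p 0 y))\<^sup>2"
    by (intro integral_unique) simp
  then show "(cmod (p t (y + c * t)))\<^sup>2 = (cmod (p 0 y))\<^sup>2 + integral {0..t} (\<lambda>r. 2 * Re (cnj (p r (y + c * r)) * f r (y + c * r)))"
    by simp
qed

lemma mild_reflect:
  assumes "mild c p f" shows "mild (- c) (\<lambda>t x. p t (- x)) (\<lambda>t x. f t (- x))"
  unfolding mild_def
proof (intro allI impI)
  fix t x :: real assume "0 \<le> t"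
  have *: "- (x - - c * r) = - x - c * r" for r by simp
  show "p t (- x) = p 0 (- (x - - c * t)) + integral {0..t} (\<lambda>s. f s (- (x - - c * (t - s))))"
    unfolding * by (rule mildD[OF assms \<open>0 \<le> t\<close>])
qed

text \<open>The integral along the characteristic with the interval of integration rescaled to
  \<open>{0..1}\<close>, which makes it jointly continuous on the whole plane.\<close>

definition duhamel :: "real \<Rightarrow> (real \<Rightarrow> real \<Rightarrow> 'a::banach) \<Rightarrow> real \<Rightarrow> real \<Rightarrow> 'a" where
  "duhamel c f t x = t *\<^sub>R integral {0..1} (\<lambda>\<sigma>. f (t * \<sigma>) (x - c * (t - t * \<sigma>)))"

lemma duhamel_eq:
  assumes "cont2 f" "0 \<le> t"
  shows "duhamel c f t x = integral {0..t} (\<lambda>s. f s (x - c * (t - s)))"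
proof (cases "t = 0")
  case False
  then have "t > 0" using assms by simp
  have "((\<lambda>s. f s (x - c * (t - s))) has_integral integral {0..t} (\<lambda>s. f s (x - c * (t - s)))) (cbox 0 t)"
    using char_integrable[OF assms(1)] integrable_integral by fastforce
  from has_integral_affinity'[OF this \<open>t > 0\<close>, of 0]
  have "((\<lambda>\<sigma>. f (t * \<sigma>) (x - c * (t - t * \<sigma>))) has_integral (integral {0..t} (\<lambda>s. f s (x - c * (t - s))) /\<^sub>R t)) {0..1}"
    using \<open>t > 0\<close> by simp
  then show ?thesis using \<open>t > 0\<close> by (simp add: duhamel_def integral_unique)
qed (simp add: duhamel_def)

lemma cont2_duhamel:
  assumes "cont2 f" shows "cont2 (duhamel c f)"
proof -
  have "continuous_on UNIV (\<lambda>z. integral (cbox 0 1) (\<lambda>\<sigma>. f (fst z * \<sigma>) (snd z - c * (fst z - fst z * \<sigma>))))"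
    by (rule integral_continuous_on_param)
       (auto simp: split_beta intro!: cont2_compose[OF assms] continuous_intros)
  then show ?thesis unfolding cont2_def duhamel_def by (auto intro!: continuous_intros)
qed

lemma integral_exp_bound:
  fixes g :: "real \<Rightarrow> 'a::banach"
  assumes "continuous_on {0..t} g" "0 \<le> t" "l > 0" "0 \<le> C" "\<And>s. s \<in> {0..t} \<Longrightarrow> norm (g s) \<le> C * exp (l * s)"
  shows "norm (integral {0..t} g) \<le> C / l * exp (l * t)"
proof -
  have "((\<lambda>s. C * exp (l * s)) has_integral (C / l * exp (l * t) - C / l * exp (l * 0))) {0..t}"
    using assms(2,3) by (intro fundamental_theorem_of_calculus)
      (auto intro!: derivative_eq_intros simp: has_real_derivative_iff_has_vector_derivative[symmetric])
  then have i: "(\<lambda>s. C * exp (l * s)) integrable_on {0..t}"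
    "integral {0..t} (\<lambda>s. C * exp (l * s)) = C / l * exp (l * t) - C / l * exp (l * 0)"
    by (rule has_integral_integrable, rule integral_unique)
  have "norm (integral {0..t} g) \<le> integral {0..t} (\<lambda>s. C * exp (l * s))"
    by (rule integral_norm_bound_integral[OF integrable_continuous_interval[OF assms(1)] i(1) assms(5)])
  also have "\<dots> \<le> C / l * exp (l * t)" unfolding i(2) using assms(3,4) by simp
  finally show ?thesis .
qed

section \<open>Global solutions for Lipschitz nonlinearities\<close>

text \<open>The Picard iterates contract by a factor \<open>1/2\<close> on \<open>[0,T]\<close> in the sup norm weighted by
  \<open>e\<^sup>-\<^sup>4\<^sup>L\<^sup>t\<close>, where \<open>L\<close> is the Lipschitz constant on \<open>[0,T]\<close>; so they converge locally uniformly
  in time although \<open>L\<close> may grow with \<open>T\<close>.\<close>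

theorem Lipschitz_system_solution:
  fixes F G :: "real \<Rightarrow> complex \<Rightarrow> complex \<Rightarrow> complex"
  assumes contF: "\<And>u v. cont2 u \<Longrightarrow> cont2 v \<Longrightarrow> cont2 (\<lambda>t x. F t (u t x) (v t x))"
    and contG: "\<And>u v. cont2 u \<Longrightarrow> cont2 v \<Longrightarrow> cont2 (\<lambda>t x. G t (u t x) (v t x))"
    and Lip: "\<And>T. T \<ge> 0 \<Longrightarrow> \<exists>L>0. \<forall>t\<in>{0..T}. \<forall>u v u' v'.
        cmod (F t u v - F t u' v') \<le> L * (cmod (u - u') + cmod (v - v')) \<and>
        cmod (G t u v - G t u' v') \<le> L * (cmod (u - u') + cmod (v - v'))"
    and zero: "\<And>t. F t 0 0 = 0" "\<And>t. G t 0 0 = 0"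
    and data: "continuous_on UNIV u0" "continuous_on UNIV v0" "\<And>x. cmod (u0 x) \<le> B" "\<And>x. cmod (v0 x) \<le> B"
  obtains u v where "cont2 u" "cont2 v" "u 0 = u0" "v 0 = v0"
    "mild 1 u (\<lambda>t x. F t (u t x) (v t x))" "mild (- 1) v (\<lambda>t x. G t (u t x) (v t x))"
proof -
  have "B \<ge> 0" using data(3) norm_ge_zero by (rule order_trans[rotated])
  define W where "W = rec_nat ((\<lambda>t x. 0), (\<lambda>t x. 0)) (\<lambda>n w.
    ((\<lambda>t x. u0 (x - t) + duhamel 1 (\<lambda>s y. F s (fst w s y) (snd w s y)) t x),
     (\<lambda>t x. v0 (x + t) + duhamel (- 1) (\<lambda>s y. G s (fst w s y) (snd w s y)) t x)))"
  define U where "U n = fst (W n)" for n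
  define V where "V n = snd (W n)" for n
  have U0: "U 0 = (\<lambda>t x. 0)" and V0: "V 0 = (\<lambda>t x. 0)" by (simp_all add: U_def V_def W_def)
  have US: "U (Suc n) = (\<lambda>t x. u0 (x - t) + duhamel 1 (\<lambda>s y. F s (U n s y) (V n s y)) t x)" for n
    by (simp add: U_def V_def W_def)
  have VS: "V (Suc n) = (\<lambda>t x. v0 (x + t) + duhamel (- 1) (\<lambda>s y. G s (U n s y) (V n s y)) t x)" for n
    by (simp add: U_def V_def W_def)
  have cu0: "cont2 (\<lambda>t x. u0 (x - t))" and cv0: "cont2 (\<lambda>t x. v0 (x + t))" unfolding cont2_def
    by (auto intro!: continuous_on_compose2[OF data(1)] continuous_on_compose2[OF data(2)] continuous_intros)
  have cadd: "cont2 (\<lambda>t x. f t x + g t x)" if "cont2 f" "cont2 g" for f g :: "real \<Rightarrow> real \<Rightarrow> complex"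
    using that unfolding cont2_def by (auto intro!: continuous_intros)
  have cUV: "cont2 (U n) \<and> cont2 (V n)" for n
  proof (induction n)
    case 0
    show ?case by (simp add: U0 V0 cont2_def)
  next
    case (Suc n)
    then show ?case unfolding US VS
      by (intro conjI cadd cu0 cv0 cont2_duhamel contF contG) auto
  qed
  have cF: "cont2 (\<lambda>t x. F t (U n t x) (V n t x))" and cG: "cont2 (\<lambda>t x. G t (U n t x) (V n t x))" for n
    using cUV[of n] contF contG by auto
  have decay: "\<exists>M. \<forall>t\<in>{0..T}. \<forall>x n. cmod (U (Suc n) t x - U n t x) \<le> M * (1/2)^n \<and> cmod (V (Suc n) t x - V n t x) \<le> M * (1/2)^n"
    if T0: "T \<ge> 0" for T
  proof -
    obtain L where L: "L > 0" and
      LF: "\<And>t u v u' v'. t \<in> {0..T} \<Longrightarrow> cmod (F t u v - F t u' v') \<le> L * (cmod (u - u') + cmod (v - v'))" and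
      LG: "\<And>t u v u' v'. t \<in> {0..T} \<Longrightarrow> cmod (G t u v - G t u' v') \<le> L * (cmod (u - u') + cmod (v - v'))"
      using Lip[OF T0] by blast
    have step: "cmod (duhamel c f t x - duhamel c g t x) \<le> B * (1/2)^Suc n * exp (4 * L * t)"
      if t: "t \<in> {0..T}" and fg: "cont2 f" "cont2 g"
        and d: "\<And>s y. s \<in> {0..T} \<Longrightarrow> cmod (f s y - g s y) \<le> L * (B * (1/2)^n * exp (4 * L * s) + B * (1/2)^n * exp (4 * L * s))"
      for c t x n and f g :: "real \<Rightarrow> real \<Rightarrow> complex"
    proof -
      have "duhamel c f t x - duhamel c g t x
        = integral {0..t} (\<lambda>s. f s (x - c * (t - s)) - g s (x - c * (t - s)))"
        using t by (simp add: duhamel_eq fg Henstock_Kurzweil_Integration.integral_diff[OF char_integrable char_integrable] fg)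
      also have "cmod \<dots> \<le> (2 * L * B * (1/2)^n) / (4 * L) * exp (4 * L * t)"
      proof (rule integral_exp_bound)
        show "continuous_on {0..t} (\<lambda>s. f s (x - c * (t - s)) - g s (x - c * (t - s)))"
          by (intro continuous_intros cont2_compose[OF fg(1)] cont2_compose[OF fg(2)])
        show "cmod (f s (x - c * (t - s)) - g s (x - c * (t - s))) \<le> 2 * L * B * (1/2)^n * exp (4 * L * s)"
          if "s \<in> {0..t}" for s
          using d[of s "x - c * (t - s)"] that t by (simp add: algebra_simps)
      qed (use t L \<open>B \<ge> 0\<close> in auto)
      also have "\<dots> = B * (1/2)^Suc n * exp (4 * L * t)" using L by simp
      finally show ?thesis .
    qed
    have main: "\<forall>t\<in>{0..T}. \<forall>x. cmod (U (Suc n) t x - U n t x) \<le> B * (1/2)^n * exp (4 * L * t)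
        \<and> cmod (V (Suc n) t x - V n t x) \<le> B * (1/2)^n * exp (4 * L * t)" for n
    proof (induction n)
      case 0
      show ?case
      proof (intro ballI allI conjI)
        fix t x assume t: "t \<in> {0..T}"
        have "B * 1 \<le> B * exp (4 * L * t)" using \<open>B \<ge> 0\<close> L t by (intro mult_left_mono) auto
        then show "cmod (U (Suc 0) t x - U 0 t x) \<le> B * (1/2)^0 * exp (4 * L * t)"
          "cmod (V (Suc 0) t x - V 0 t x) \<le> B * (1/2)^0 * exp (4 * L * t)"
          using data(3)[of "x - t"] data(4)[of "x + t"] by (simp_all add: US VS U0 V0 zero duhamel_def)
      qed
    next
      case (Suc n)
      show ?case
      proof (intro ballI allI conjI)
        fix t x assume t: "t \<in> {0..T}"
        have d: "cmod (F s (U (Suc n) s y) (V (Suc n) s y) - F s (U n s y) (V n s y))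
            \<le> L * (B * (1/2)^n * exp (4 * L * s) + B * (1/2)^n * exp (4 * L * s))"
          "cmod (G s (U (Suc n) s y) (V (Suc n) s y) - G s (U n s y) (V n s y))
            \<le> L * (B * (1/2)^n * exp (4 * L * s) + B * (1/2)^n * exp (4 * L * s))" if "s \<in> {0..T}" for s y
        proof -
          have "cmod (U (Suc n) s y - U n s y) + cmod (V (Suc n) s y - V n s y)
            \<le> B * (1/2)^n * exp (4 * L * s) + B * (1/2)^n * exp (4 * L * s)"
            using bspec[OF Suc that, THEN spec, of y] by (intro add_mono) simp_all
          note i = mult_left_mono[OF this less_imp_le[OF L]]
          show "cmod (F s (U (Suc n) s y) (V (Suc n) s y) - F s (U n s y) (V n s y))
            \<le> L * (B * (1/2)^n * exp (4 * L * s) + B * (1/2)^n * exp (4 * L * s))"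
            "cmod (G s (U (Suc n) s y) (V (Suc n) s y) - G s (U n s y) (V n s y))
            \<le> L * (B * (1/2)^n * exp (4 * L * s) + B * (1/2)^n * exp (4 * L * s))"
            by (rule order_trans[OF LF[OF that] i], rule order_trans[OF LG[OF that] i])
        qed
        show "cmod (U (Suc (Suc n)) t x - U (Suc n) t x) \<le> B * (1/2)^Suc n * exp (4 * L * t)"
          unfolding fun_cong[OF fun_cong[OF US[of "Suc n"]], of t x] fun_cong[OF fun_cong[OF US[of n]], of t x]
            add_diff_cancel_left by (rule step[OF t cF cF]) (erule d(1))
        show "cmod (V (Suc (Suc n)) t x - V (Suc n) t x) \<le> B * (1/2)^Suc n * exp (4 * L * t)"
          unfolding fun_cong[OF fun_cong[OF VS[of "Suc n"]], of t x] fun_cong[OF fun_cong[OF VS[of n]], of t x]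
            add_diff_cancel_left by (rule step[OF t cG cG]) (erule d(2))
      qed
    qed
    have "B * (1/2)^n * exp (4 * L * t) \<le> (B * exp (4 * L * T)) * (1/2)^n" if "t \<in> {0..T}" for n t
    proof -
      have "B * (1/2)^n * exp (4 * L * t) \<le> B * (1/2)^n * exp (4 * L * T)"
        using \<open>B \<ge> 0\<close> L that by (intro mult_left_mono) auto
      then show ?thesis by (simp add: mult_ac)
    qed
    then show ?thesis using main by (intro exI[of _ "B * exp (4 * L * T)"]) (meson order_trans)
  qed
  \<comment> \<open>The iterates converge for nonnegative times; freezing the limit at negative times
      keeps it continuous on the whole plane.\<close>
  define u where "u t x = (\<Sum>n. U (Suc n) (max t 0) x - U n (max t 0) x)" for t x
  define v where "v t x = (\<Sum>n. V (Suc n) (max t 0) x - V n (max t 0) x)" for t x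
  have tel: "(\<Sum>i<n. U (Suc i) t x - U i t x) = U n t x" "(\<Sum>i<n. V (Suc i) t x - V i t x) = V n t x" for n t x
    using sum_lessThan_telescope[of "\<lambda>k. U k t x" n] sum_lessThan_telescope[of "\<lambda>k. V k t x" n] by (auto simp: U0 V0)
  have unif: "uniform_limit ({0..T} \<times> UNIV) (\<lambda>n z. U n (fst z) (snd z)) (\<lambda>z. u (fst z) (snd z)) sequentially
      \<and> uniform_limit ({0..T} \<times> UNIV) (\<lambda>n z. V n (fst z) (snd z)) (\<lambda>z. v (fst z) (snd z)) sequentially"
    if T0: "T \<ge> 0" for T
  proof -
    obtain M where M: "\<And>t x n. t \<in> {0..T} \<Longrightarrow> cmod (U (Suc n) t x - U n t x) \<le> M * (1/2)^n"
      "\<And>t x n. t \<in> {0..T} \<Longrightarrow> cmod (V (Suc n) t x - V n t x) \<le> M * (1/2)^n"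
      using decay[OF T0] by blast
    have S: "summable (\<lambda>n. M * (1/2)^n)" by (intro summable_mult summable_geometric) auto
    have 1: "uniform_limit ({0..T} \<times> UNIV) (\<lambda>n z. \<Sum>i<n. U (Suc i) (fst z) (snd z) - U i (fst z) (snd z))
        (\<lambda>z. \<Sum>i. U (Suc i) (fst z) (snd z) - U i (fst z) (snd z)) sequentially"
      by (rule Weierstrass_m_test[OF _ S]) (use M in auto)
    have 2: "uniform_limit ({0..T} \<times> UNIV) (\<lambda>n z. \<Sum>i<n. V (Suc i) (fst z) (snd z) - V i (fst z) (snd z))
        (\<lambda>z. \<Sum>i. V (Suc i) (fst z) (snd z) - V i (fst z) (snd z)) sequentially"
      by (rule Weierstrass_m_test[OF _ S]) (use M in auto)
    have E: "uniform_limit ({0..T} \<times> UNIV) f (\<lambda>z. \<Sum>i. g i (fst z) (snd z)) sequentially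
        \<longleftrightarrow> uniform_limit ({0..T} \<times> UNIV) f (\<lambda>z. \<Sum>i. g i (max (fst z) 0) (snd z)) sequentially"
      for f :: "nat \<Rightarrow> real \<times> real \<Rightarrow> complex" and g :: "nat \<Rightarrow> real \<Rightarrow> real \<Rightarrow> complex"
      by (rule uniform_limit_cong') auto
    show ?thesis unfolding u_def v_def
      using E[of "\<lambda>n z. U n (fst z) (snd z)" "\<lambda>i t x. U (Suc i) t x - U i t x", THEN iffD1, OF 1[unfolded tel]]
        E[of "\<lambda>n z. V n (fst z) (snd z)" "\<lambda>i t x. V (Suc i) t x - V i t x", THEN iffD1, OF 2[unfolded tel]]
      by (rule conjI)
  qed
  have lim: "(\<lambda>n. U n t x) \<longlonglongrightarrow> u t x" "(\<lambda>n. V n t x) \<longlonglongrightarrow> v t x" if "t \<ge> 0" for t x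
    using tendsto_uniform_limitI[OF conjunct1[OF unif[OF that]], of "(t, x)"]
      tendsto_uniform_limitI[OF conjunct2[OF unif[OF that]], of "(t, x)"] that by simp_all
  have cont: "cont2 w" if neg: "\<And>t x. w t x = w (max t 0) x"
      and c: "\<And>T. T \<ge> 0 \<Longrightarrow> continuous_on ({0..T} \<times> UNIV) (\<lambda>z. w (fst z) (snd z))" for w :: "real \<Rightarrow> real \<Rightarrow> complex"
    unfolding cont2_def continuous_on_eq_continuous_at[OF open_UNIV]
  proof
    fix z0 :: "real \<times> real"
    define T where "T = \<bar>fst z0\<bar> + 1"
    have "T \<ge> 0" by (simp add: T_def)
    have "continuous_on {z :: real \<times> real. fst z < T} (\<lambda>z. w (fst (max (fst z) 0, snd z)) (snd (max (fst z) 0, snd z)))"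
      using \<open>T \<ge> 0\<close> by (intro continuous_on_compose2[OF c[OF \<open>T \<ge> 0\<close>]] continuous_intros) auto
    then have "continuous_on {z :: real \<times> real. fst z < T} (\<lambda>z. w (fst z) (snd z))"
      using neg by simp
    moreover have "open {z :: real \<times> real. fst z < T}" by (intro open_Collect_less continuous_intros)
    ultimately show "isCont (\<lambda>z. w (fst z) (snd z)) z0"
      using continuous_on_eq_continuous_at by (fastforce simp: T_def)
  qed
  have cU: "continuous_on A (\<lambda>z. U n (fst z) (snd z))" and cV: "continuous_on A (\<lambda>z. V n (fst z) (snd z))" for A n
    using cUV[of n] unfolding cont2_def by (auto intro: continuous_on_subset)
  have cu: "cont2 u"
    by (rule cont, simp add: u_def, rule uniform_limit_theorem[OF _ conjunct1[OF unif]]) (auto intro!: always_eventually cU)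
  have cv: "cont2 v"
    by (rule cont, simp add: v_def, rule uniform_limit_theorem[OF _ conjunct2[OF unif]]) (auto intro!: always_eventually cV)
  have limint: "(\<lambda>n. duhamel c (\<lambda>s y. H s (U n s y) (V n s y)) t x) \<longlonglongrightarrow> integral {0..t} (\<lambda>s. H s (u s (x - c * (t - s))) (v s (x - c * (t - s))))"
    if t0: "t \<ge> 0" and H: "H = F \<or> H = G" for t x c H
  proof -
    have cH: "cont2 (\<lambda>t x. H t (U n t x) (V n t x))" for n using H cF cG by auto
    obtain L where L: "L > 0" and
      LH: "\<And>s a b a' b'. s \<in> {0..t} \<Longrightarrow> cmod (H s a b - H s a' b') \<le> L * (cmod (a - a') + cmod (b - b'))"
      using Lip[OF t0] H by metis
    have H0: "H s 0 0 = 0" for s using H zero by auto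
    obtain M where M: "\<And>s x n. s \<in> {0..t} \<Longrightarrow> cmod (U (Suc n) s x - U n s x) \<le> M * (1/2)^n"
      "\<And>s x n. s \<in> {0..t} \<Longrightarrow> cmod (V (Suc n) s x - V n s x) \<le> M * (1/2)^n"
      using decay[OF t0] by blast
    have bd: "cmod (U n s y) \<le> M * (2 - 2 * (1/2)^n) \<and> cmod (V n s y) \<le> M * (2 - 2 * (1/2)^n)" if "s \<in> {0..t}" for n s y
    proof (induction n)
      case 0
      then show ?case by (simp add: U0 V0)
    next
      case (Suc n)
      have "M * (1/2)^n + M * (2 - 2 * (1/2)^n) = M * (2 - 2 * (1/2)^Suc n)" by (simp add: algebra_simps)
      moreover have "cmod (U (Suc n) s y) \<le> cmod (U (Suc n) s y - U n s y) + cmod (U n s y)"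
        "cmod (V (Suc n) s y) \<le> cmod (V (Suc n) s y - V n s y) + cmod (V n s y)"
        using norm_triangle_ineq[of "U (Suc n) s y - U n s y" "U n s y"]
          norm_triangle_ineq[of "V (Suc n) s y - V n s y" "V n s y"] by simp_all
      ultimately show ?case using M[OF that, of n y] Suc by linarith
    qed
    have "M \<ge> 0" using order_trans[OF norm_ge_zero M(1)[of 0 0 0]] t0 by simp
    have bd': "cmod (U n s y) + cmod (V n s y) \<le> 4 * M" if "s \<in> {0..t}" for n s y
    proof -
      have "M * (2 - 2 * (1/2)^n) \<le> M * 2" using \<open>M \<ge> 0\<close> by (intro mult_left_mono) auto
      then show ?thesis using bd[OF that, of n y] by linarith
    qed
    have "(\<lambda>n. integral {0..t} (\<lambda>s. H s (U n s (x - c * (t - s))) (V n s (x - c * (t - s)))))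
      \<longlonglongrightarrow> integral {0..t} (\<lambda>s. H s (u s (x - c * (t - s))) (v s (x - c * (t - s))))"
    proof (rule dominated_convergence(2)[where h="\<lambda>s. L * (4 * M)"])
      show "(\<lambda>s. H s (U n s (x - c * (t - s))) (V n s (x - c * (t - s)))) integrable_on {0..t}" for n
        by (rule char_integrable[OF cH])
      show "cmod (H s (U n s (x - c * (t - s))) (V n s (x - c * (t - s)))) \<le> L * (4 * M)" if "s \<in> {0..t}" for n s
        using order_trans[OF LH[OF that, of "U n s (x - c * (t - s))" "V n s (x - c * (t - s))" 0 0, unfolded H0 diff_zero]
            mult_left_mono[OF bd'[OF that, of n "x - c * (t - s)"] less_imp_le[OF L]]] .
      fix s assume s: "s \<in> {0..t}"
      define y where "y = x - c * (t - s)"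
      have "(\<lambda>n. H s (U n s y) (V n s y)) \<longlonglongrightarrow> H s (u s y) (v s y)"
      proof (rule LIM_zero_cancel, rule Lim_null_comparison)
        show "\<forall>\<^sub>F n in sequentially. norm (H s (U n s y) (V n s y) - H s (u s y) (v s y))
          \<le> L * (cmod (U n s y - u s y) + cmod (V n s y - v s y))"
          using LH[OF s] by simp
        have "(\<lambda>n. L * (cmod (U n s y - u s y) + cmod (V n s y - v s y))) \<longlonglongrightarrow> L * (cmod (u s y - u s y) + cmod (v s y - v s y))"
          using s by (intro tendsto_intros lim) auto
        then show "(\<lambda>n. L * (cmod (U n s y - u s y) + cmod (V n s y - v s y))) \<longlonglongrightarrow> 0" by simp
      qed
      then show "(\<lambda>n. H s (U n s (x - c * (t - s))) (V n s (x - c * (t - s)))) \<longlonglongrightarrow> H s (u s (x - c * (t - s))) (v s (x - c * (t - s)))"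
        by (simp add: y_def)
    qed (rule integrable_continuous_interval, simp)
    then show ?thesis by (simp add: duhamel_eq[OF cH t0])
  qed
  have eu: "u t x = u0 (x - t) + integral {0..t} (\<lambda>s. F s (u s (x - 1 * (t - s))) (v s (x - 1 * (t - s))))" if "t \<ge> 0" for t x
  proof (rule LIMSEQ_unique)
    show "(\<lambda>n. U (Suc n) t x) \<longlonglongrightarrow> u t x" using lim(1)[OF that] by (rule LIMSEQ_Suc)
    show "(\<lambda>n. U (Suc n) t x) \<longlonglongrightarrow> u0 (x - t) + integral {0..t} (\<lambda>s. F s (u s (x - 1 * (t - s))) (v s (x - 1 * (t - s))))"
      unfolding US by (intro tendsto_intros limint that) simp
  qed
  have ev: "v t x = v0 (x + t) + integral {0..t} (\<lambda>s. G s (u s (x - (-1) * (t - s))) (v s (x - (-1) * (t - s))))" if "t \<ge> 0" for t x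
  proof (rule LIMSEQ_unique)
    show "(\<lambda>n. V (Suc n) t x) \<longlonglongrightarrow> v t x" using lim(2)[OF that] by (rule LIMSEQ_Suc)
    show "(\<lambda>n. V (Suc n) t x) \<longlonglongrightarrow> v0 (x + t) + integral {0..t} (\<lambda>s. G s (u s (x - (-1) * (t - s))) (v s (x - (-1) * (t - s))))"
      unfolding VS by (intro tendsto_intros limint that) simp
  qed
  have u0: "u 0 = u0" and v0: "v 0 = v0" using eu[OF order_refl] ev[OF order_refl] by (auto simp: fun_eq_iff)
  show ?thesis
  proof (rule that[OF cu cv u0 v0])
    show "mild 1 u (\<lambda>t x. F t (u t x) (v t x))" unfolding mild_def u0
    proof (intro allI impI)
      fix t x :: real assume "0 \<le> t"
      then show "u t x = u0 (x - 1 * t) + integral {0..t} (\<lambda>s. F s (u s (x - 1 * (t - s))) (v s (x - 1 * (t - s))))"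
        using eu[of t x] by (simp only: mult_1)
    qed
    show "mild (- 1) v (\<lambda>t x. G t (u t x) (v t x))" unfolding mild_def v0
    proof (intro allI impI)
      fix t x :: real assume "0 \<le> t"
      then show "v t x = v0 (x - (- 1) * t) + integral {0..t} (\<lambda>s. G s (u s (x - (- 1) * (t - s))) (v s (x - (- 1) * (t - s))))"
        using ev[of t x] by (simp only: mult_minus1 diff_minus_eq_add)
    qed
  qed
qed

section \<open>Charge flux through characteristics\<close>

lemma integral_eq_lborel:
  fixes g :: "real \<Rightarrow> real"
  assumes "continuous_on {a..b} g"
  shows "integral {a..b} g = (LINT x|lborel. indicator {a..b} x *\<^sub>R g x)"
  using set_borel_integral_eq_integral(2)[OF borel_integrable_atLeastAtMost'[OF assms]]
  by (simp add: set_lebesgue_integral_def)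

text \<open>Both sides integrate \<open>K\<close> over the triangle \<open>r, s \<ge> 0, r + s \<le> t\<close>.\<close>

lemma integral_triangle_swap:
  fixes K :: "real \<Rightarrow> real \<Rightarrow> real"
  assumes K: "cont2 K" and "0 \<le> t"
    and c1: "continuous_on {0..t} (\<lambda>s. integral {0..t - s} (\<lambda>r. K r s))"
    and c2: "continuous_on {0..t} (\<lambda>s. integral {0..s} (\<lambda>r. K r (s - r)))"
  shows "integral {0..t} (\<lambda>s. integral {0..t - s} (\<lambda>r. K r s)) = integral {0..t} (\<lambda>s. integral {0..s} (\<lambda>r. K r (s - r)))"
proof -
  define A where "A = {z. 0 \<le> fst z \<and> 0 \<le> snd z \<and> fst z + snd z \<le> t}"
  define A' where "A' = {z. 0 \<le> fst z \<and> fst z \<le> snd z \<and> snd z \<le> t}"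
  have cA: "compact A" "compact A'"
  proof -
    have "A = cbox (0,0) (t,t) \<inter> {z. fst z + snd z \<le> t}"
      by (auto simp: A_def cbox_Pair_eq)
    then show "compact A" by (auto intro!: compact_Int_closed closed_Collect_le continuous_intros)
    have "A' = cbox (0,0) (t,t) \<inter> {z. fst z \<le> snd z}"
      by (auto simp: A'_def cbox_Pair_eq)
    then show "compact A'" by (auto intro!: compact_Int_closed closed_Collect_le continuous_intros)
  qed
  have i: "integrable (lborel \<Otimes>\<^sub>M lborel) (\<lambda>(r, s). indicator A (r, s) *\<^sub>R K r s)"
    using borel_integrable_compact[OF cA(1), of "\<lambda>z. K (fst z) (snd z)"] K
    by (auto simp: cont2_def lborel_prod split_beta' intro: continuous_on_subset)
  have "continuous_on A' (\<lambda>z. K (fst z) (snd z - fst z))"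
    by (intro cont2_compose[OF K] continuous_intros)
  then have i': "integrable (lborel \<Otimes>\<^sub>M lborel) (\<lambda>(r, s). indicator A' (r, s) *\<^sub>R K r (s - r))"
    using borel_integrable_compact[OF cA(2), of "\<lambda>z. K (fst z) (snd z - fst z)"]
    by (simp add: lborel_prod split_beta')
  have "integral {0..t} (\<lambda>s. integral {0..t - s} (\<lambda>r. K r s)) = (LINT s|lborel. (LINT r|lborel. indicator A (r, s) *\<^sub>R K r s))"
    unfolding integral_eq_lborel[OF c1]
  proof (intro Bochner_Integration.integral_cong refl)
    fix s
    have "continuous_on {0..t - s} (\<lambda>r. K r s)" by (intro cont2_compose[OF K] continuous_intros)
    moreover have "(\<lambda>r. indicator A (r, s) *\<^sub>R K r s) = (\<lambda>r. indicator {0..t} s *\<^sub>R indicator {0..t - s} r *\<^sub>R K r s)"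
      by (auto simp: A_def indicator_def le_diff_eq)
    ultimately show "indicator {0..t} s *\<^sub>R integral {0..t - s} (\<lambda>r. K r s) = (LINT r|lborel. indicator A (r, s) *\<^sub>R K r s)"
      by (simp add: integral_eq_lborel)
  qed
  also have "\<dots> = (LINT r|lborel. (LINT s|lborel. indicator A (r, s) *\<^sub>R K r s))"
    by (rule lborel_pair.Fubini_integral[OF i])
  also have "\<dots> = (LINT r|lborel. (LINT s|lborel. indicator A' (r, s) *\<^sub>R K r (s - r)))"
  proof (rule Bochner_Integration.integral_cong[OF refl])
    fix r
    have "(LINT s|lborel. indicator A' (r, s) *\<^sub>R K r (s - r)) = (LINT s|lborel. indicator A' (r, r + s) *\<^sub>R K r s)"
      using lborel_integral_real_affine[of 1 "\<lambda>s. indicator A' (r, s) *\<^sub>R K r (s - r)" r] by simp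
    moreover have "indicator A' (r, r + s) = (indicator A (r, s) :: real)" for s
      by (auto simp: A_def A'_def indicator_def)
    ultimately show "(LINT s|lborel. indicator A (r, s) *\<^sub>R K r s) = (LINT s|lborel. indicator A' (r, s) *\<^sub>R K r (s - r))"
      by simp
  qed
  also have "\<dots> = (LINT s|lborel. (LINT r|lborel. indicator A' (r, s) *\<^sub>R K r (s - r)))"
    by (rule lborel_pair.Fubini_integral[OF i', symmetric])
  also have "\<dots> = integral {0..t} (\<lambda>s. integral {0..s} (\<lambda>r. K r (s - r)))"
    unfolding integral_eq_lborel[OF c2]
  proof (intro Bochner_Integration.integral_cong refl)
    fix s
    have "continuous_on {0..s} (\<lambda>r. K r (s - r))" by (intro cont2_compose[OF K] continuous_intros)
    moreover have "(\<lambda>r. indicator A' (r, s) *\<^sub>R K r (s - r)) = (\<lambda>r. indicator {0..t} s *\<^sub>R indicator {0..s} r *\<^sub>R K r (s - r))"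
      by (auto simp: A'_def indicator_def)
    ultimately show "(LINT r|lborel. indicator A' (r, s) *\<^sub>R K r (s - r)) = indicator {0..t} s *\<^sub>R integral {0..s} (\<lambda>r. K r (s - r))"
      by (simp add: integral_eq_lborel)
  qed
  finally show ?thesis .
qed

text \<open>The local conservation law \<open>(P\<^sub>t + P\<^sub>x) + (R\<^sub>t - R\<^sub>x) = H - H = 0\<close>, integrated over the
  triangle with base \<open>[y, y + 2t]\<close> and apex \<open>(t, y + t)\<close>: the flux through the two
  characteristic sides equals the charge of the base.\<close>

lemma characteristic_flux:
  fixes P R H :: "real \<Rightarrow> real \<Rightarrow> real"
  assumes cont: "cont2 P" "cont2 R" "cont2 H"
    and P: "mild 1 P H" and R: "mild (- 1) R (\<lambda>t x. - H t x)"
    and nonneg: "\<And>t x. 0 \<le> P t x" and t: "0 \<le> t"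
  shows "integral {0..t} (\<lambda>s. R s (y + s)) \<le> integral {0..t} (\<lambda>s. P 0 (y + 2 * s) + R 0 (y + 2 * s))"
proof -
  define K where "K r s = H r (y + 2 * s + r)" for r s
  have K: "cont2 K" unfolding K_def cont2_def by (intro cont2_compose[OF cont(3)] continuous_intros)
  have R_eq: "integral {0..s} (\<lambda>r. K r (s - r)) = R 0 (y + 2 * s) - R s (y + s)" if "s \<in> {0..t}" for s
  proof -
    have "R s (y + s) = R 0 (y + s - - 1 * s) + integral {0..s} (\<lambda>r. - H r (y + s - - 1 * (s - r)))"
      using that by (intro mildD[OF R]) simp
    also have "(\<lambda>r. - H r (y + s - - 1 * (s - r))) = (\<lambda>r. - K r (s - r))"
      by (simp add: K_def fun_eq_iff algebra_simps)
    finally show ?thesis by (simp add: algebra_simps)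
  qed
  have P_eq: "integral {0..t - s} (\<lambda>r. K r s) = P (t - s) (y + t + s) - P 0 (y + 2 * s)" if "s \<in> {0..t}" for s
  proof -
    have "P (t - s) (y + t + s) = P 0 (y + t + s - 1 * (t - s)) + integral {0..t - s} (\<lambda>r. H r (y + t + s - 1 * (t - s - r)))"
      using that by (intro mildD[OF P]) simp
    also have "(\<lambda>r. H r (y + t + s - 1 * (t - s - r))) = (\<lambda>r. K r s)"
      by (simp add: K_def fun_eq_iff algebra_simps)
    finally show ?thesis by simp
  qed
  have cR: "continuous_on {0..t} (\<lambda>s. R s (y + s))" and cR0: "continuous_on {0..t} (\<lambda>s. R 0 (y + 2 * s))"
    by (intro cont2_compose[OF cont(2)] continuous_intros)+
  have cP: "continuous_on {0..t} (\<lambda>s. P (t - s) (y + t + s))" and cP0: "continuous_on {0..t} (\<lambda>s. P 0 (y + 2 * s))"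
    by (intro cont2_compose[OF cont(1)] continuous_intros)+
  have c1: "continuous_on {0..t} (\<lambda>s. integral {0..t - s} (\<lambda>r. K r s))"
    using continuous_on_diff[OF cP cP0] by (rule continuous_on_eq) (simp add: P_eq)
  have c2: "continuous_on {0..t} (\<lambda>s. integral {0..s} (\<lambda>r. K r (s - r)))"
    using continuous_on_diff[OF cR0 cR] by (rule continuous_on_eq) (simp add: R_eq)
  note int = integrable_continuous_interval
  have "integral {0..t} (\<lambda>s. P (t - s) (y + t + s)) - integral {0..t} (\<lambda>s. P 0 (y + 2 * s))
    = integral {0..t} (\<lambda>s. integral {0..t - s} (\<lambda>r. K r s))"
    unfolding Henstock_Kurzweil_Integration.integral_diff[OF int[OF cP] int[OF cP0], symmetric]
    by (rule Henstock_Kurzweil_Integration.integral_cong) (simp add: P_eq)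
  also have "\<dots> = integral {0..t} (\<lambda>s. integral {0..s} (\<lambda>r. K r (s - r)))"
    by (rule integral_triangle_swap[OF K t c1 c2])
  also have "\<dots> = integral {0..t} (\<lambda>s. R 0 (y + 2 * s)) - integral {0..t} (\<lambda>s. R s (y + s))"
    unfolding Henstock_Kurzweil_Integration.integral_diff[OF int[OF cR0] int[OF cR], symmetric]
    by (rule Henstock_Kurzweil_Integration.integral_cong) (simp add: R_eq)
  finally have "integral {0..t} (\<lambda>s. R s (y + s)) + integral {0..t} (\<lambda>s. P (t - s) (y + t + s))
    = integral {0..t} (\<lambda>s. P 0 (y + 2 * s) + R 0 (y + 2 * s))"
    by (simp add: Henstock_Kurzweil_Integration.integral_add[OF int[OF cP0] int[OF cR0]])
  moreover have "0 \<le> integral {0..t} (\<lambda>s. P (t - s) (y + t + s))"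
    by (rule Henstock_Kurzweil_Integration.integral_nonneg[OF int[OF cP]]) (rule nonneg)
  ultimately show ?thesis by linarith
qed

section \<open>The cubic nonlinearity\<close>

text \<open>The polarisation of \<open>N1\<close> in its quadratic argument, with which differences of the
  nonlinearity telescope.\<close>

definition trilinear :: "(nat \<Rightarrow> complex) \<Rightarrow> complex \<Rightarrow> complex \<Rightarrow> complex \<Rightarrow> complex" where
  "trilinear a u v w = (a 1 * u + a 2 * cnj u) * (a 3 * (v * cnj w) + a 4 * (v * w) + a 5 * (cnj v * cnj w))"

definition coeff_bound :: "(nat \<Rightarrow> complex) \<Rightarrow> real" where
  "coeff_bound a = (cmod (a 1) + cmod (a 2)) * (cmod (a 3) + cmod (a 4) + cmod (a 5))"

lemma coeff_bound_nonneg: "0 \<le> coeff_bound a"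
  by (simp add: coeff_bound_def)

lemma N1_trilinear: "N1 a u v = trilinear a u v v"
  unfolding N1_def trilinear_def complex_norm_square by (simp add: power2_eq_square)

lemma N2_eq_N1: "N2 b u v = N1 b v u"
  by (simp add: N1_def N2_def)

lemma trilinear_bound: "cmod (trilinear a u v w) \<le> coeff_bound a * (cmod u * cmod v * cmod w)"
proof -
  have 1: "cmod (a 1 * u + a 2 * cnj u) \<le> (cmod (a 1) + cmod (a 2)) * cmod u"
    using norm_triangle_ineq[of "a 1 * u" "a 2 * cnj u"] by (simp add: norm_mult distrib_right)
  have "cmod (a 3 * (v * cnj w) + a 4 * (v * w) + a 5 * (cnj v * cnj w))
    \<le> cmod (a 3 * (v * cnj w)) + cmod (a 4 * (v * w)) + cmod (a 5 * (cnj v * cnj w))"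
    by (intro order_trans[OF norm_triangle_ineq] add_mono norm_triangle_ineq order_refl)
  also have "\<dots> = (cmod (a 3) + cmod (a 4) + cmod (a 5)) * (cmod v * cmod w)"
    by (simp add: norm_mult algebra_simps)
  finally have "cmod (trilinear a u v w) \<le> ((cmod (a 1) + cmod (a 2)) * cmod u) * ((cmod (a 3) + cmod (a 4) + cmod (a 5)) * (cmod v * cmod w))"
    unfolding trilinear_def norm_mult using 1 by (intro mult_mono) auto
  then show ?thesis by (simp add: coeff_bound_def mult_ac)
qed

lemma trilinear_mono_bound:
  assumes "cmod u \<le> x" "cmod v \<le> y" "cmod w \<le> z"
  shows "cmod (trilinear a u v w) \<le> coeff_bound a * (x * y * z)"
proof -
  have "0 \<le> x" "0 \<le> y" using assms norm_ge_zero order_trans by blast+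
  then have "cmod u * cmod v * cmod w \<le> x * y * z" using assms by (intro mult_mono) auto
  then show ?thesis
    using trilinear_bound[of a u v w] coeff_bound_nonneg[of a] mult_left_mono order_trans by meson
qed

lemma N1_bound: "cmod (N1 a u v) \<le> coeff_bound a * (cmod u * (cmod v)\<^sup>2)"
  using trilinear_bound[of a u v v] by (simp add: N1_trilinear power2_eq_square mult.assoc)

lemma N1_scale: "N1 a (of_real k * u) (of_real k * v) = of_real (k ^ 3) * N1 a u v"
  unfolding N1_trilinear trilinear_def by (simp add: power3_eq_cube algebra_simps)

lemma N1_Lipschitz:
  assumes "cmod u \<le> R" "cmod v \<le> R" "cmod u' \<le> R" "cmod v' \<le> R"
  shows "cmod (N1 a u v - N1 a u' v') \<le> 2 * coeff_bound a * R\<^sup>2 * (cmod (u - u') + cmod (v - v'))"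
proof -
  have "N1 a u v - N1 a u' v' = trilinear a (u - u') v v + trilinear a u' (v - v') v + trilinear a u' v' (v - v')"
    unfolding N1_trilinear trilinear_def by (simp add: algebra_simps)
  also have "cmod \<dots> \<le> coeff_bound a * (cmod (u - u') * R * R) + coeff_bound a * (R * cmod (v - v') * R)
      + coeff_bound a * (R * R * cmod (v - v'))"
    by (intro order_trans[OF norm_triangle_ineq] add_mono trilinear_mono_bound assms order_refl)
  also have "\<dots> \<le> 2 * coeff_bound a * R\<^sup>2 * (cmod (u - u') + cmod (v - v'))"
    using mult_nonneg_nonneg[OF mult_nonneg_nonneg[OF coeff_bound_nonneg[of a] zero_le_power2[of R]] norm_ge_zero[of "u - u'"]]
    by (simp add: power2_eq_square algebra_simps)
  finally show ?thesis .
qed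

lemma continuous_on_N1 [continuous_intros]:
  assumes "continuous_on S f" "continuous_on S g"
  shows "continuous_on S (\<lambda>x. N1 a (f x) (g x))"
  unfolding N1_def by (intro continuous_intros assms)

section \<open>Global bounded solutions with small charge\<close>

text \<open>Solved for the derivative along the characteristics, both equations take this form; in the
  second one the unknowns change places.\<close>

definition rhs :: "real \<Rightarrow> (nat \<Rightarrow> complex) \<Rightarrow> complex \<Rightarrow> complex \<Rightarrow> complex" where
  "rhs m a u v = \<i> * (of_real m * v - N1 a u v)"

text \<open>Scaling both unknowns by the same real factor multiplies the cubic terms by its cube, so the
  cut-off system still conserves charge.\<close>

definition cutoff :: "real \<Rightarrow> complex \<Rightarrow> complex \<Rightarrow> real" where
  "cutoff k u v = k / max k (cmod u + cmod v)"

definition cut_rhs :: "real \<Rightarrow> (nat \<Rightarrow> complex) \<Rightarrow> real \<Rightarrow> complex \<Rightarrow> complex \<Rightarrow> complex" where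
  "cut_rhs m a k u v = \<i> * (of_real m * v - N1 a (of_real (cutoff k u v) * u) (of_real (cutoff k u v) * v))"

lemma cutoff_commute: "cutoff k u v = cutoff k v u"
  by (simp add: cutoff_def add.commute)

lemma cutoff_bounds:
  assumes "k > 0" shows "0 < cutoff k u v" "cutoff k u v \<le> 1" "cutoff k u v * (cmod u + cmod v) \<le> k"
proof -
  have "0 < max k (cmod u + cmod v)" using assms by simp
  then show "0 < cutoff k u v" "cutoff k u v \<le> 1" "cutoff k u v * (cmod u + cmod v) \<le> k"
    using assms by (auto simp: cutoff_def divide_simps mult_left_mono)
qed

lemma cutoff_eq_1: "k > 0 \<Longrightarrow> cmod u + cmod v \<le> k \<Longrightarrow> cutoff k u v = 1"
  by (simp add: cutoff_def)

lemma cutoff_component_le: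
  assumes "k > 0" shows "cmod (of_real (cutoff k u v) * u) \<le> k" "cmod (of_real (cutoff k u v) * v) \<le> k"
proof -
  have "cutoff k u v * cmod u + cutoff k u v * cmod v \<le> k"
    using cutoff_bounds(3)[OF assms, of u v] by (simp add: distrib_left)
  moreover have "0 \<le> cutoff k u v * cmod u" "0 \<le> cutoff k u v * cmod v"
    using cutoff_bounds(1)[OF assms, of u v] by simp_all
  ultimately have "cutoff k u v * cmod u \<le> k" "cutoff k u v * cmod v \<le> k" by linarith+
  then show "cmod (of_real (cutoff k u v) * u) \<le> k" "cmod (of_real (cutoff k u v) * v) \<le> k"
    using cutoff_bounds(1)[OF assms, of u v] by (simp_all add: norm_mult)
qed

text \<open>With \<open>s = |u| + |v|\<close>, the change of the scaling factor times the radius \<open>s'\<close> is at most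
  \<open>|s - s'|\<close>.\<close>

lemma cutoff_Lipschitz:
  assumes "k > 0"
  shows "cmod (of_real (cutoff k u v) * u - of_real (cutoff k u' v') * u')
      + cmod (of_real (cutoff k u v) * v - of_real (cutoff k u' v') * v')
    \<le> 2 * (cmod (u - u') + cmod (v - v'))"
proof -
  define s s' where "s = cmod u + cmod v" and "s' = cmod u' + cmod v'"
  define c c' where "c = cutoff k u v" and "c' = cutoff k u' v'"
  have c: "0 < c" "c \<le> 1" and c's': "c' * s' \<le> k"
    using cutoff_bounds[OF assms] by (auto simp: c_def c'_def s'_def)
  have M: "0 < max k s" "0 < max k s'" using assms by auto
  have ss: "\<bar>s - s'\<bar> \<le> cmod (u - u') + cmod (v - v')"
    using norm_triangle_ineq3[of u u'] norm_triangle_ineq3[of v v'] unfolding s_def s'_def by linarith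
  have "c - c' = k * (max k s' - max k s) / (max k s * max k s')"
    using M by (simp add: c_def c'_def cutoff_def s_def s'_def diff_frac_eq right_diff_distrib)
  then have "\<bar>c - c'\<bar> * s' = (k / max k s) * (s' / max k s') * \<bar>max k s' - max k s\<bar>"
    using M assms by (simp add: abs_mult s'_def)
  also have "\<dots> \<le> 1 * 1 * \<bar>s - s'\<bar>"
    using M assms by (intro mult_mono) (auto simp: s'_def)
  finally have cc: "\<bar>c - c'\<bar> * s' \<le> cmod (u - u') + cmod (v - v')" using ss by simp
  have comp: "cmod (of_real c * w - of_real c' * w') \<le> cmod (w - w') + \<bar>c - c'\<bar> * cmod w'" for w w'
  proof -
    have "of_real c * w - of_real c' * w' = of_real c * (w - w') + of_real (c - c') * w'"
      by (simp add: algebra_simps)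
    also have "cmod \<dots> \<le> c * cmod (w - w') + \<bar>c - c'\<bar> * cmod w'"
      using c by (intro order_trans[OF norm_triangle_ineq]) (simp add: norm_mult del: of_real_diff)
    also have "\<dots> \<le> cmod (w - w') + \<bar>c - c'\<bar> * cmod w'" using c by (simp add: mult_left_le_one_le)
    finally show ?thesis .
  qed
  have "cmod (of_real c * u - of_real c' * u') + cmod (of_real c * v - of_real c' * v')
    \<le> (cmod (u - u') + \<bar>c - c'\<bar> * cmod u') + (cmod (v - v') + \<bar>c - c'\<bar> * cmod v')"
    by (intro add_mono comp)
  also have "\<dots> = (cmod (u - u') + cmod (v - v')) + \<bar>c - c'\<bar> * s'" by (simp add: s'_def distrib_left)
  also have "\<dots> \<le> (cmod (u - u') + cmod (v - v')) + (cmod (u - u') + cmod (v - v'))"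
    using cc by (rule add_left_mono)
  finally show ?thesis unfolding c_def[symmetric] c'_def[symmetric] by simp
qed

lemma cut_rhs_Lipschitz:
  assumes "k > 0" "m \<ge> 0"
  shows "cmod (cut_rhs m a k u v - cut_rhs m a k u' v')
    \<le> (m + 4 * coeff_bound a * k\<^sup>2) * (cmod (u - u') + cmod (v - v'))"
proof -
  define x y x' y' where "x = of_real (cutoff k u v) * u" and "y = of_real (cutoff k u v) * v"
    and "x' = of_real (cutoff k u' v') * u'" and "y' = of_real (cutoff k u' v') * v'"
  have "cut_rhs m a k u v - cut_rhs m a k u' v' = \<i> * (of_real m * (v - v') - (N1 a x y - N1 a x' y'))"
    by (simp add: cut_rhs_def x_def y_def x'_def y'_def algebra_simps)
  then have "cmod (cut_rhs m a k u v - cut_rhs m a k u' v') = cmod (of_real m * (v - v') - (N1 a x y - N1 a x' y'))"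
    by (simp add: norm_mult)
  also have "\<dots> \<le> m * cmod (v - v') + cmod (N1 a x y - N1 a x' y')"
    using assms by (intro order_trans[OF norm_triangle_ineq4]) (simp add: norm_mult del: of_real_diff)
  also have "cmod (N1 a x y - N1 a x' y') \<le> 2 * coeff_bound a * k\<^sup>2 * (cmod (x - x') + cmod (y - y'))"
    unfolding x_def y_def x'_def y'_def by (intro N1_Lipschitz cutoff_component_le assms)
  also have "\<dots> \<le> 2 * coeff_bound a * k\<^sup>2 * (2 * (cmod (u - u') + cmod (v - v')))"
    unfolding x_def y_def x'_def y'_def
    by (intro mult_left_mono cutoff_Lipschitz assms) (simp add: coeff_bound_nonneg)
  finally have "cmod (cut_rhs m a k u v - cut_rhs m a k u' v')
    \<le> m * cmod (v - v') + 2 * coeff_bound a * k\<^sup>2 * (2 * (cmod (u - u') + cmod (v - v')))" by simp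
  also have "\<dots> \<le> (m + 4 * coeff_bound a * k\<^sup>2) * (cmod (u - u') + cmod (v - v'))"
    using mult_nonneg_nonneg[OF assms(2) norm_ge_zero[of "u - u'"]] by (simp add: algebra_simps)
  finally show ?thesis .
qed

text \<open>Unlike the Lipschitz constant, this bound is independent of the cut-off. It keeps the factor
  \<open>|v|\<^sup>2\<close> that the charge flux controls.\<close>

lemma cut_rhs_bound:
  assumes "k > 0" "m \<ge> 0"
  shows "cmod (cut_rhs m a k u v) \<le> m * cmod v + coeff_bound a * (cmod u * (cmod v)\<^sup>2)"
proof -
  have "cmod (cut_rhs m a k u v) = cmod (of_real m * v - of_real (cutoff k u v ^ 3) * N1 a u v)"
    by (simp add: cut_rhs_def N1_scale norm_mult)
  also have "\<dots> \<le> m * cmod v + cutoff k u v ^ 3 * cmod (N1 a u v)"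
    using assms cutoff_bounds(1)[OF assms(1), of u v]
    by (intro order_trans[OF norm_triangle_ineq4]) (simp add: norm_mult norm_power)
  also have "cutoff k u v ^ 3 * cmod (N1 a u v) \<le> 1 * (coeff_bound a * (cmod u * (cmod v)\<^sup>2))"
    using cutoff_bounds[OF assms(1), of u v] by (intro mult_mono N1_bound power_le_one) auto
  finally show ?thesis by simp
qed

lemma cut_rhs_eq_rhs: "k > 0 \<Longrightarrow> cmod u + cmod v \<le> k \<Longrightarrow> cut_rhs m a k u v = rhs m a u v"
  by (simp add: cut_rhs_def rhs_def cutoff_eq_1)

text \<open>The mass terms contribute \<open>\<i> m\<close> times the real number \<open>cnj u * v + cnj v * u\<close>, and the cubic
  terms a real multiple of the expression in the hypothesis.\<close>

lemma cut_rhs_charge: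
  assumes "\<And>u v. Re (\<i> * cnj u * N1 \<alpha> u v + \<i> * cnj v * N2 \<beta> u v) = 0"
  shows "Re (cnj v * cut_rhs m \<beta> k v u) = - Re (cnj u * cut_rhs m \<alpha> k u v)"
proof -
  define c where "c = cutoff k u v ^ 3"
  define Z where "Z = \<i> * cnj u * N1 \<alpha> u v + \<i> * cnj v * N2 \<beta> u v"
  have "cnj u * cut_rhs m \<alpha> k u v + cnj v * cut_rhs m \<beta> k v u
    = of_real m * (\<i> * (cnj u * v + cnj v * u)) - of_real c * Z"
    unfolding cut_rhs_def cutoff_commute[of k v u] N1_scale c_def Z_def N2_eq_N1 by (simp add: algebra_simps)
  moreover have "Re (of_real m * (\<i> * (cnj u * v + cnj v * u))) = 0" by simp
  moreover have "Re (of_real c * Z) = c * Re Z" by simp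
  moreover have "Re Z = 0" unfolding Z_def by (rule assms)
  ultimately have "Re (cnj u * cut_rhs m \<alpha> k u v + cnj v * cut_rhs m \<beta> k v u) = 0"
    by (simp only: minus_complex.sel mult_zero_right diff_self)
  then show ?thesis by (simp only: plus_complex.sel add_eq_0_iff)
qed

text \<open>Gronwall's inequality with a small kernel: at a maximum of \<open>\<phi>\<close> the cubic term is at most
  half of that maximum.\<close>

lemma small_flux_bound:
  fixes \<phi> \<psi> :: "real \<Rightarrow> real"
  assumes cont: "continuous_on {0..t} \<phi>" "continuous_on {0..t} \<psi>" and t: "0 \<le> t"
    and nonneg: "\<And>s. 0 \<le> \<phi> s" "\<And>s. 0 \<le> \<psi> s" "0 \<le> m" "0 \<le> C" "0 \<le> B"
    and ineq: "\<And>s. s \<in> {0..t} \<Longrightarrow> \<phi> s \<le> B + integral {0..s} (\<lambda>r. m * \<psi> r + C * (\<phi> r * (\<psi> r)\<^sup>2))"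
    and flux: "\<And>s. s \<in> {0..t} \<Longrightarrow> integral {0..s} (\<lambda>r. (\<psi> r)\<^sup>2) \<le> q" and small: "q \<le> 1" "C * q \<le> 1 / 2"
  shows "\<phi> t \<le> 2 * (B + m * (t + 1))"
proof -
  obtain \<tau> where \<tau>: "\<tau> \<in> {0..t}" "\<And>s. s \<in> {0..t} \<Longrightarrow> \<phi> s \<le> \<phi> \<tau>"
    using continuous_attains_sup[OF _ _ cont(1)] t by fastforce
  have sub: "{0..\<tau>} \<subseteq> {0..t}" using \<tau>(1) by auto
  note c = continuous_on_subset[OF cont(1) sub] continuous_on_subset[OF cont(2) sub]
  have i: "(\<lambda>r. (\<psi> r)\<^sup>2) integrable_on {0..\<tau>}" by (intro integrable_continuous_interval continuous_intros c)
  have "integral {0..\<tau>} (\<lambda>r. m * \<psi> r + C * (\<phi> r * (\<psi> r)\<^sup>2)) \<le> integral {0..\<tau>} (\<lambda>r. m + (m + C * \<phi> \<tau>) * (\<psi> r)\<^sup>2)"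
  proof (rule integral_le)
    show "(\<lambda>r. m * \<psi> r + C * (\<phi> r * (\<psi> r)\<^sup>2)) integrable_on {0..\<tau>}"
      by (intro integrable_continuous_interval continuous_intros c)
    show "(\<lambda>r. m + (m + C * \<phi> \<tau>) * (\<psi> r)\<^sup>2) integrable_on {0..\<tau>}"
      by (intro integrable_continuous_interval continuous_intros c)
    fix r assume "r \<in> {0..\<tau>}"
    then have "\<phi> r \<le> \<phi> \<tau>" using \<tau>(2) sub by auto
    then have "C * (\<phi> r * (\<psi> r)\<^sup>2) \<le> C * (\<phi> \<tau> * (\<psi> r)\<^sup>2)"
      using nonneg by (intro mult_left_mono mult_right_mono) auto
    moreover have "\<psi> r \<le> 1 + (\<psi> r)\<^sup>2"
      using zero_le_power2[of "\<psi> r - 1"] nonneg(2)[of r] by (simp add: power2_eq_square algebra_simps)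
    then have "m * \<psi> r \<le> m * (1 + (\<psi> r)\<^sup>2)" using nonneg(3) by (rule mult_left_mono)
    ultimately show "m * \<psi> r + C * (\<phi> r * (\<psi> r)\<^sup>2) \<le> m + (m + C * \<phi> \<tau>) * (\<psi> r)\<^sup>2"
      by (simp add: algebra_simps)
  qed
  also have "\<dots> = m * \<tau> + (m + C * \<phi> \<tau>) * integral {0..\<tau>} (\<lambda>r. (\<psi> r)\<^sup>2)"
    using \<tau>(1) by (subst Henstock_Kurzweil_Integration.integral_add) (auto intro!: integrable_continuous_interval continuous_intros c)
  also have "\<dots> \<le> m * t + (m + C * \<phi> \<tau>) * q"
    using \<tau>(1) flux[OF \<tau>(1)] nonneg by (intro add_mono mult_left_mono) auto
  finally have "\<phi> \<tau> \<le> B + (m * t + (m + C * \<phi> \<tau>) * q)" using ineq[OF \<tau>(1)] by linarith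
  moreover have "m * q \<le> m * 1" using small(1) nonneg(3) by (rule mult_left_mono)
  moreover have "(C * q) * \<phi> \<tau> \<le> (1 / 2) * \<phi> \<tau>" using small(2) nonneg(1) by (rule mult_right_mono)
  ultimately have "\<phi> \<tau> \<le> 2 * (B + m * (t + 1))" by (simp add: algebra_simps)
  then show ?thesis using \<tau>(2)[of t] t by simp
qed

text \<open>A characteristic of \<open>p\<close> is crossed by the waves that make up \<open>q\<close>, so the flux hypothesis
  bounds the only factor of the cubic term that could make \<open>p\<close> grow.\<close>

lemma sup_bound_from_flux:
  fixes p q f :: "real \<Rightarrow> real \<Rightarrow> complex"
  assumes cont: "cont2 p" "cont2 q" "cont2 f" and mild: "mild c p f"
    and f: "\<And>t x. cmod (f t x) \<le> m * cmod (q t x) + C * (cmod (p t x) * (cmod (q t x))\<^sup>2)"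
    and data: "\<And>x. cmod (p 0 x) \<le> B"
    and flux: "\<And>s y. 0 \<le> s \<Longrightarrow> integral {0..s} (\<lambda>r. (cmod (q r (y + c * r)))\<^sup>2) \<le> \<kappa>"
    and nonneg: "0 \<le> m" "0 \<le> C" "0 \<le> B" and small: "\<kappa> \<le> 1" "C * \<kappa> \<le> 1 / 2" and t: "0 \<le> t"
  shows "cmod (p t x) \<le> 2 * (B + m * (t + 1))"
proof -
  define y where "y = x - c * t"
  have cp: "continuous_on A (\<lambda>s. p s (y + c * s))" and cq: "continuous_on A (\<lambda>s. q s (y + c * s))" for A
    by (intro cont2_compose[OF cont(1)] cont2_compose[OF cont(2)] continuous_intros)+
  have "cmod (p t (y + c * t)) \<le> 2 * (B + m * (t + 1))"
  proof (rule small_flux_bound[where C=C and q=\<kappa> and \<psi>="\<lambda>s. cmod (q s (y + c * s))"])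
    fix s assume s: "s \<in> {0..t}"
    have "p s (y + c * s) = p 0 y + integral {0..s} (\<lambda>r. f r (y + c * r))"
      using s by (intro mild_along_characteristic[OF mild]) simp
    also have "cmod \<dots> \<le> B + integral {0..s} (\<lambda>r. m * cmod (q r (y + c * r)) + C * (cmod (p r (y + c * r)) * (cmod (q r (y + c * r)))\<^sup>2))"
    proof (intro order_trans[OF norm_triangle_ineq] add_mono data integral_norm_bound_integral)
      show "(\<lambda>r. f r (y + c * r)) integrable_on {0..s}"
        by (intro integrable_continuous_interval cont2_compose[OF cont(3)] continuous_intros)
      show "(\<lambda>r. m * cmod (q r (y + c * r)) + C * (cmod (p r (y + c * r)) * (cmod (q r (y + c * r)))\<^sup>2)) integrable_on {0..s}"
        by (intro integrable_continuous_interval continuous_intros cp cq)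
    qed (rule f)
    finally show "cmod (p s (y + c * s)) \<le> B + integral {0..s} (\<lambda>r. m * cmod (q r (y + c * r)) + C * (cmod (p r (y + c * r)) * (cmod (q r (y + c * r)))\<^sup>2))" .
    show "integral {0..s} (\<lambda>r. (cmod (q r (y + c * r)))\<^sup>2) \<le> \<kappa>"
      using s by (intro flux) simp
  qed (use t small nonneg in \<open>auto intro!: continuous_intros cp cq\<close>)
  then show ?thesis by (simp add: y_def)
qed

text \<open>The cut-off level \<open>k t\<close> lies above the bound that every solution of the cut-off system
  obeys, whatever the level; so the cut-off is never active.\<close>

theorem global_bounded_solution:
  assumes m: "m \<ge> 0"
    and cons: "\<And>u v. Re (\<i> * cnj u * N1 \<alpha> u v + \<i> * cnj v * N2 \<beta> u v) = 0"
    and data: "continuous_on UNIV u0" "continuous_on UNIV v0" "\<And>x. cmod (u0 x) \<le> B" "\<And>x. cmod (v0 x) \<le> B"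
    and charge: "\<And>a b. a \<le> b \<Longrightarrow> integral {a..b} (\<lambda>x. (cmod (u0 x))\<^sup>2 + (cmod (v0 x))\<^sup>2) \<le> Q"
    and small: "Q \<le> 1" "(coeff_bound \<alpha> + coeff_bound \<beta>) * Q \<le> 1"
  obtains u v where "cont2 u" "cont2 v" "u 0 = u0" "v 0 = v0"
    "mild 1 u (\<lambda>t x. rhs m \<alpha> (u t x) (v t x))" "mild (- 1) v (\<lambda>t x. rhs m \<beta> (v t x) (u t x))"
    "\<And>t x. t \<ge> 0 \<Longrightarrow> cmod (u t x) + cmod (v t x) \<le> 4 * (B + m * (t + 1))"
proof -
  have "B \<ge> 0" using data(3) norm_ge_zero by (rule order_trans[rotated])
  have "Q \<ge> 0" using charge[of 0 0] by simp
  define k where "k t = 4 * (B + m * (\<bar>t\<bar> + 1)) + 1" for t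
  have k_pos: "k t > 0" for t
  proof -
    have "0 \<le> 4 * (B + m * (\<bar>t\<bar> + 1))" using m \<open>B \<ge> 0\<close> by simp
    then show ?thesis unfolding k_def by (rule add_nonneg_pos) simp
  qed
  define F where "F t u v = cut_rhs m \<alpha> (k t) u v" for t u v
  define G where "G t u v = cut_rhs m \<beta> (k t) v u" for t u v
  have cont_cut: "cont2 (\<lambda>t x. cut_rhs m a (k t) (u t x) (v t x))" if "cont2 u" "cont2 v" for a u v
  proof -
    have "max (k t) (cmod u + cmod v) \<noteq> 0" for t u v using k_pos[of t] by (simp add: max_def)
    then show ?thesis using that unfolding cont2_def cut_rhs_def cutoff_def k_def
      by (intro continuous_intros) auto
  qed
  have Lip: "\<exists>L>0. \<forall>t\<in>{0..T}. \<forall>u v u' v'.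
        cmod (F t u v - F t u' v') \<le> L * (cmod (u - u') + cmod (v - v')) \<and>
        cmod (G t u v - G t u' v') \<le> L * (cmod (u - u') + cmod (v - v'))" if "T \<ge> 0" for T
  proof (intro exI[of _ "m + 4 * (coeff_bound \<alpha> + coeff_bound \<beta>) * (k T)\<^sup>2 + 1"] conjI ballI allI)
    have nn: "0 \<le> coeff_bound \<alpha> * (k t)\<^sup>2" "0 \<le> coeff_bound \<beta> * (k t)\<^sup>2" for t by (simp_all add: coeff_bound_nonneg)
    show "m + 4 * (coeff_bound \<alpha> + coeff_bound \<beta>) * (k T)\<^sup>2 + 1 > 0"
      using nn[of T] m by (simp add: algebra_simps)
    fix t u v u' v' assume t: "t \<in> {0..T}"
    have "k t \<le> k T" using t m unfolding k_def by (intro add_mono mult_left_mono) auto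
    then have "(k t)\<^sup>2 \<le> (k T)\<^sup>2" using k_pos[of t] by (intro power_mono) auto
    then have le: "m + 4 * coeff_bound \<alpha> * (k t)\<^sup>2 \<le> m + 4 * (coeff_bound \<alpha> + coeff_bound \<beta>) * (k T)\<^sup>2 + 1"
      "m + 4 * coeff_bound \<beta> * (k t)\<^sup>2 \<le> m + 4 * (coeff_bound \<alpha> + coeff_bound \<beta>) * (k T)\<^sup>2 + 1"
      using mult_left_mono[OF _ coeff_bound_nonneg[of \<alpha>], of "(k t)\<^sup>2" "(k T)\<^sup>2"]
        mult_left_mono[OF _ coeff_bound_nonneg[of \<beta>], of "(k t)\<^sup>2" "(k T)\<^sup>2"] nn[of T]
      by (simp_all add: distrib_left distrib_right)
    show "cmod (F t u v - F t u' v') \<le> (m + 4 * (coeff_bound \<alpha> + coeff_bound \<beta>) * (k T)\<^sup>2 + 1) * (cmod (u - u') + cmod (v - v'))"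
      unfolding F_def by (rule order_trans[OF cut_rhs_Lipschitz[OF k_pos m] mult_right_mono[OF le(1)]]) simp
    show "cmod (G t u v - G t u' v') \<le> (m + 4 * (coeff_bound \<alpha> + coeff_bound \<beta>) * (k T)\<^sup>2 + 1) * (cmod (u - u') + cmod (v - v'))"
      unfolding G_def add.commute[of "cmod (u - u')"]
      by (rule order_trans[OF cut_rhs_Lipschitz[OF k_pos m] mult_right_mono[OF le(2)]]) simp
  qed
  have cF: "cont2 (\<lambda>t x. F t (u t x) (v t x))" "cont2 (\<lambda>t x. G t (u t x) (v t x))" if "cont2 u" "cont2 v" for u v
    unfolding F_def G_def by (rule cont_cut[OF that], rule cont_cut[OF that(2,1)])
  have zero: "F t 0 0 = 0" "G t 0 0 = 0" for t
    by (simp_all add: F_def G_def cut_rhs_def N1_def)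
  obtain u v where u: "cont2 u" "u 0 = u0" "mild 1 u (\<lambda>t x. F t (u t x) (v t x))"
    and v: "cont2 v" "v 0 = v0" "mild (- 1) v (\<lambda>t x. G t (u t x) (v t x))"
    using Lipschitz_system_solution[OF cF Lip zero data] by blast
  define P where "P t x = (cmod (u t x))\<^sup>2" for t x
  define R where "R t x = (cmod (v t x))\<^sup>2" for t x
  define H where "H t x = 2 * Re (cnj (u t x) * F t (u t x) (v t x))" for t x
  have cP: "cont2 P" "cont2 R" "cont2 H"
    using u(1) v(1) cF[OF u(1) v(1)] unfolding cont2_def P_def R_def H_def by (auto intro!: continuous_intros)
  have mP: "mild 1 P H" unfolding P_def H_def by (rule mild_norm_sq[OF u(3) cF(1)[OF u(1) v(1)]])
  have "(\<lambda>t x. 2 * Re (cnj (v t x) * G t (u t x) (v t x))) = (\<lambda>t x. - H t x)"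
    unfolding H_def F_def G_def using cut_rhs_charge[OF cons] by (simp add: fun_eq_iff)
  then have mR: "mild (- 1) R (\<lambda>t x. - H t x)"
    using mild_norm_sq[OF v(3) cF(2)[OF u(1) v(1)]] unfolding R_def by simp
  \<comment> \<open>The base of the characteristic triangle is swept with speed two, which halves the charge.\<close>
  have half: "integral {0..s} (\<lambda>r. P 0 (y + 2 * r) + R 0 (y + 2 * r)) \<le> Q / 2" if "0 \<le> s" for s y
  proof -
    have "continuous_on {y..y + 2 * s} (\<lambda>x. P 0 x + R 0 x)"
      unfolding P_def R_def u(2) v(2) by (intro continuous_intros continuous_on_subset[OF data(1)] continuous_on_subset[OF data(2)]) auto
    then have "((\<lambda>x. P 0 x + R 0 x) has_integral integral {y..y + 2 * s} (\<lambda>x. P 0 x + R 0 x)) (cbox y (y + 2 * s))"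
      using integrable_continuous_interval integrable_integral by fastforce
    from has_integral_affinity'[OF this, of 2 y]
    have "((\<lambda>r. P 0 (2 * r + y) + R 0 (2 * r + y)) has_integral (integral {y..y + 2 * s} (\<lambda>x. P 0 x + R 0 x) / 2)) {0..s}"
      by (simp add: field_simps)
    then have "integral {0..s} (\<lambda>r. P 0 (y + 2 * r) + R 0 (y + 2 * r)) = integral {y..y + 2 * s} (\<lambda>x. P 0 x + R 0 x) / 2"
      by (simp add: add.commute integral_unique)
    then show ?thesis using charge[of y "y + 2 * s"] that by (simp add: P_def R_def u(2) v(2))
  qed
  have flux_v: "integral {0..s} (\<lambda>r. R r (y + r)) \<le> Q / 2" if "0 \<le> s" for s y
    by (rule order_trans[OF characteristic_flux[OF cP mP mR _ that] half[OF that]]) (simp add: P_def)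
  \<comment> \<open>Reflection in space exchanges the roles of the two equations.\<close>
  have flux_u: "integral {0..s} (\<lambda>r. P r (y - r)) \<le> Q / 2" if s: "0 \<le> s" for s y
  proof -
    have cont_reflect: "cont2 (\<lambda>t x. f t (- x))" if "cont2 f" for f :: "real \<Rightarrow> real \<Rightarrow> real"
      unfolding cont2_def by (intro cont2_compose[OF that] continuous_intros)
    have c': "cont2 (\<lambda>t x. - H t (- x))"
      using cont_reflect[OF cP(3)] unfolding cont2_def by (intro continuous_intros)
    have m1: "mild 1 (\<lambda>t x. R t (- x)) (\<lambda>t x. - H t (- x))"
      using mild_reflect[OF mR] by simp
    have m2: "mild (- 1) (\<lambda>t x. P t (- x)) (\<lambda>t x. - (- H t (- x)))"
      using mild_reflect[OF mP] by simp
    have "integral {0..s} (\<lambda>r. P r (- (- y + r))) \<le> integral {0..s} (\<lambda>r. R 0 (- (- y + 2 * r)) + P 0 (- (- y + 2 * r)))"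
      by (rule characteristic_flux[OF cont_reflect[OF cP(2)] cont_reflect[OF cP(1)] c' m1 m2 _ s]) (simp add: R_def)
    also have "\<dots> = integral {0..s} (\<lambda>r. (\<lambda>r. P 0 ((y - 2 * s) + 2 * r) + R 0 ((y - 2 * s) + 2 * r)) (s - r))"
      by (simp add: algebra_simps)
    also have "\<dots> = integral {0..s} (\<lambda>r. P 0 ((y - 2 * s) + 2 * r) + R 0 ((y - 2 * s) + 2 * r))" (is "_ = integral _ ?g")
    proof -
      have "continuous_on {0..s} ?g"
        by (intro continuous_intros cont2_compose[OF cP(1)] cont2_compose[OF cP(2)])
      then have "(?g has_integral integral {0..s} ?g) (cbox 0 s)"
        using integrable_continuous_interval integrable_integral by fastforce
      from has_integral_affinity'[OF this, of 1 s]
      have "integral {- s..0} (\<lambda>r. ?g (r + s)) = integral {0..s} ?g" by (simp add: integral_unique)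
      then show ?thesis
        using Henstock_Kurzweil_Integration.integral_reflect_real[of 0 "- s" "\<lambda>r. ?g (r + s)"] by simp
    qed
    also have "\<dots> \<le> Q / 2" by (rule half[OF s])
    finally show ?thesis by simp
  qed
  have bound_u: "cmod (u t x) \<le> 2 * (B + m * (t + 1))" if "t \<ge> 0" for t x
  proof (rule sup_bound_from_flux[OF u(1) v(1) cF(1)[OF u(1) v(1)] u(3), where C="coeff_bound \<alpha>" and \<kappa>="Q / 2"])
    show "cmod (F t (u t x) (v t x)) \<le> m * cmod (v t x) + coeff_bound \<alpha> * (cmod (u t x) * (cmod (v t x))\<^sup>2)" for t x
      unfolding F_def by (rule cut_rhs_bound[OF k_pos m])
    show "integral {0..s} (\<lambda>r. (cmod (v r (y + 1 * r)))\<^sup>2) \<le> Q / 2" if "0 \<le> s" for s y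
      using flux_v[OF that, of y] by (simp add: R_def)
    show "coeff_bound \<alpha> * (Q / 2) \<le> 1 / 2"
      using small(2) mult_nonneg_nonneg[OF coeff_bound_nonneg[of \<beta>] \<open>Q \<ge> 0\<close>] by (simp add: distrib_right)
  qed (use that small(1) m \<open>B \<ge> 0\<close> \<open>Q \<ge> 0\<close> data(3) in \<open>auto simp: u(2) coeff_bound_nonneg\<close>)
  have bound_v: "cmod (v t x) \<le> 2 * (B + m * (t + 1))" if "t \<ge> 0" for t x
  proof (rule sup_bound_from_flux[OF v(1) u(1) cF(2)[OF u(1) v(1)] v(3), where C="coeff_bound \<beta>" and \<kappa>="Q / 2"])
    show "cmod (G t (u t x) (v t x)) \<le> m * cmod (u t x) + coeff_bound \<beta> * (cmod (v t x) * (cmod (u t x))\<^sup>2)" for t x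
      unfolding G_def by (rule cut_rhs_bound[OF k_pos m])
    show "integral {0..s} (\<lambda>r. (cmod (u r (y + - 1 * r)))\<^sup>2) \<le> Q / 2" if "0 \<le> s" for s y
      using flux_u[OF that, of y] by (simp add: P_def)
    show "coeff_bound \<beta> * (Q / 2) \<le> 1 / 2"
      using small(2) mult_nonneg_nonneg[OF coeff_bound_nonneg[of \<alpha>] \<open>Q \<ge> 0\<close>] by (simp add: distrib_right)
  qed (use that small(1) m \<open>B \<ge> 0\<close> \<open>Q \<ge> 0\<close> data(4) in \<open>auto simp: v(2) coeff_bound_nonneg\<close>)
  have bound: "cmod (u t x) + cmod (v t x) \<le> 4 * (B + m * (t + 1))" if "t \<ge> 0" for t x
    using bound_u[OF that, of x] bound_v[OF that, of x] by linarith
  have inactive: "F t (u t x) (v t x) = rhs m \<alpha> (u t x) (v t x)" "G t (u t x) (v t x) = rhs m \<beta> (v t x) (u t x)"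
    if "t \<ge> 0" for t x
  proof -
    have le: "cmod (u t x) + cmod (v t x) \<le> k t" using bound[OF that, of x] that by (simp add: k_def)
    show "F t (u t x) (v t x) = rhs m \<alpha> (u t x) (v t x)"
      unfolding F_def by (rule cut_rhs_eq_rhs[OF k_pos le])
    show "G t (u t x) (v t x) = rhs m \<beta> (v t x) (u t x)"
      unfolding G_def using le by (intro cut_rhs_eq_rhs[OF k_pos]) (simp only: add.commute)
  qed
  have mild_cong: "mild c p f'" if "mild c p f" "\<And>t x. t \<ge> 0 \<Longrightarrow> f t x = f' t x" for c p and f f' :: "real \<Rightarrow> real \<Rightarrow> complex"
    unfolding mild_def
  proof (intro allI impI)
    fix t x :: real assume "0 \<le> t"
    have "integral {0..t} (\<lambda>s. f s (x - c * (t - s))) = integral {0..t} (\<lambda>s. f' s (x - c * (t - s)))"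
      using that(2) by (intro Henstock_Kurzweil_Integration.integral_cong) auto
    then show "p t x = p 0 (x - c * t) + integral {0..t} (\<lambda>s. f' s (x - c * (t - s)))"
      using mildD[OF that(1) \<open>0 \<le> t\<close>, of x] by simp
  qed
  show ?thesis
    by (rule that[OF u(1) v(1) u(2) v(2) mild_cong[OF u(3) inactive(1)] mild_cong[OF v(3) inactive(2)] bound])
qed

section \<open>Growth estimates for integrated transport systems\<close>

text \<open>Gronwall's inequality without any measurability of \<open>E\<close>: the least constant \<open>c\<close> with
  \<open>E t \<le> c e\<^sup>l\<^sup>t\<close> satisfies \<open>c \<le> a + c/2\<close>.\<close>

lemma exponential_bootstrap:
  fixes E :: "real \<Rightarrow> real"
  assumes bounded: "\<And>t. t \<in> {0..T} \<Longrightarrow> E t \<le> M" and nonneg: "\<And>t. t \<in> {0..T} \<Longrightarrow> 0 \<le> E t"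
    and a: "0 \<le> a" and l: "0 \<le> l"
    and step: "\<And>c t. 0 \<le> c \<Longrightarrow> (\<And>s. s \<in> {0..T} \<Longrightarrow> E s \<le> c * exp (l * s)) \<Longrightarrow> t \<in> {0..T}
      \<Longrightarrow> E t \<le> a + c / 2 * exp (l * t)"
    and t: "t \<in> {0..T}"
  shows "E t \<le> 2 * a * exp (l * t)"
proof -
  define w where "w s = E s * exp (- (l * s))" for s
  define c where "c = (SUP s\<in>{0..T}. w s)"
  have Ew: "E s = w s * exp (l * s)" for s by (simp add: w_def exp_minus)
  have bdd: "bdd_above (w ` {0..T})"
  proof (rule bdd_aboveI2)
    fix s assume s: "s \<in> {0..T}"
    have "w s \<le> E s * 1" unfolding w_def using nonneg[OF s] s l by (intro mult_left_mono) auto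
    then show "w s \<le> M" using bounded[OF s] by simp
  qed
  have wc: "w s \<le> c" if "s \<in> {0..T}" for s unfolding c_def by (rule cSUP_upper[OF that bdd])
  have "0 \<le> w t" using nonneg[OF t] by (simp add: w_def)
  then have c: "0 \<le> c" using wc[OF t] by simp
  have Ec: "E s \<le> c * exp (l * s)" if "s \<in> {0..T}" for s
    unfolding Ew[of s] using wc[OF that] by (rule mult_right_mono) simp
  have "(SUP s\<in>{0..T}. w s) \<le> a + c / 2"
  proof (rule cSUP_least)
    show "{0..T} \<noteq> {}" using t by auto
    fix s assume s: "s \<in> {0..T}"
    have "E s \<le> a + c / 2 * exp (l * s)" by (rule step[OF c _ s]) (rule Ec)
    then have "w s \<le> (a + c / 2 * exp (l * s)) * exp (- (l * s))"
      unfolding w_def by (rule mult_right_mono) simp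
    also have "\<dots> = a * exp (- (l * s)) + c / 2" by (simp add: distrib_right exp_minus)
    also have "\<dots> \<le> a * 1 + c / 2" using a l s by (intro add_mono mult_left_mono) auto
    finally show "w s \<le> a + c / 2" by simp
  qed
  then have "c \<le> 2 * a" unfolding c_def[symmetric] by simp
  then have "c * exp (l * t) \<le> 2 * a * exp (l * t)" by (rule mult_right_mono) simp
  then show ?thesis using Ec[OF t] by (rule order_trans[rotated])
qed

lemma cont2_measurable:
  fixes f :: "real \<Rightarrow> real \<Rightarrow> 'a::{second_countable_topology, real_normed_vector}"
  assumes "cont2 f"
  shows "f t \<in> borel_measurable borel" "(\<lambda>z. f (fst z) (snd z)) \<in> borel_measurable (borel \<Otimes>\<^sub>M borel)"
proof -
  have "continuous_on UNIV (\<lambda>x. f t x)" by (intro cont2_compose[OF assms] continuous_intros)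
  then show "f t \<in> borel_measurable borel" by (rule borel_measurable_continuous_onI)
  show "(\<lambda>z. f (fst z) (snd z)) \<in> borel_measurable (borel \<Otimes>\<^sub>M borel)"
    unfolding borel_prod using assms unfolding cont2_def by (rule borel_measurable_continuous_onI)
qed

text \<open>Backward cones are invariant under following characteristics of speed at most one into the
  past, and over them all energies are finite a priori.\<close>

definition cone_energy :: "real \<Rightarrow> (real \<Rightarrow> real \<Rightarrow> complex) \<Rightarrow> real \<Rightarrow> ennreal" where
  "cone_energy R f t = (\<integral>\<^sup>+x. ennreal ((cmod (f t x))\<^sup>2) * indicator {- (R - t)..R - t} x \<partial>lborel)"

lemma integral_eq_set_lborel:
  fixes g :: "real \<Rightarrow> complex"
  assumes "continuous_on {a..b} g" shows "integral {a..b} g = (LINT x:{a..b}|lborel. g x)"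
  using set_borel_integral_eq_integral(2)[OF borel_integrable_atLeastAtMost'[OF assms]] by simp

text \<open>Squaring the integrated equation leaves \<open>|p|\<^sup>2 \<le> 2 |p\<^sub>0|\<^sup>2 + 2 t \<integral> |f|\<^sup>2\<close>, where \<open>f\<close> is evaluated only inside
  the cone; integration over the section of the cone and Tonelli's theorem give the claim.\<close>

lemma cone_energy_mild:
  assumes p: "cont2 p" and f: "cont2 f" and mild: "mild c p f" and t: "0 \<le> t" and c: "\<bar>c\<bar> \<le> 1"
    and \<phi>: "continuous_on {0..t} \<phi>" "\<And>s. s \<in> {0..t} \<Longrightarrow> 0 \<le> \<phi> s"
      "\<And>s. s \<in> {0..t} \<Longrightarrow> cone_energy R f s \<le> ennreal (\<phi> s)"
  shows "cone_energy R p t \<le> 2 * energy (p 0) + ennreal (2 * t * integral {0..t} \<phi>)"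
proof -
  note [measurable] = cont2_measurable[OF p] cont2_measurable[OF f]
  have [measurable]: "{z :: real \<times> real. \<bar>snd z\<bar> \<le> R - fst z} \<in> sets (borel \<Otimes>\<^sub>M borel)"
    unfolding borel_prod by (intro borel_closed closed_Collect_le continuous_intros)
  define k where "k s x = ennreal ((cmod (f s x))\<^sup>2) * indicator {z. \<bar>snd z\<bar> \<le> R - fst z} (s, x)" for s x
  have k_cone: "(\<integral>\<^sup>+x. k s x \<partial>lborel) = cone_energy R f s" for s
    unfolding cone_energy_def k_def by (intro nn_integral_cong) (auto simp: indicator_def abs_le_iff)
  have [measurable]: "(\<lambda>z. k (fst z) (snd z)) \<in> borel_measurable (borel \<Otimes>\<^sub>M borel)"
    unfolding k_def by (simp add: prod.collapse)
  have km: "(\<lambda>x. k s x) \<in> borel_measurable borel" for s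
  proof -
    have "(\<lambda>x. (s, x)) \<in> borel \<rightarrow>\<^sub>M borel \<Otimes>\<^sub>M borel" by measurable
    from measurable_compose[OF this, of "\<lambda>z. k (fst z) (snd z)" borel] show ?thesis by simp
  qed
  have km2: "(\<lambda>z. k (snd z) (fst z - c * (t - snd z))) \<in> borel_measurable (borel \<Otimes>\<^sub>M borel)"
  proof -
    have "(\<lambda>z. (snd z, fst z - c * (t - snd z))) \<in> borel \<Otimes>\<^sub>M borel \<rightarrow>\<^sub>M borel \<Otimes>\<^sub>M borel" by measurable
    from measurable_compose[OF this, of "\<lambda>z. k (fst z) (snd z)" borel] show ?thesis by simp
  qed
  have pt: "ennreal ((cmod (p t x))\<^sup>2) * indicator {- (R - t)..R - t} x
    \<le> 2 * ennreal ((cmod (p 0 (x + - c * t)))\<^sup>2)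
      + ennreal (2 * t) * (\<integral>\<^sup>+s. k s (x - c * (t - s)) * indicator {0..t} s \<partial>lborel)" for x
  proof (cases "x \<in> {- (R - t)..R - t}")
    case True
    define g where "g s = f s (x - c * (t - s))" for s
    have cg: "continuous_on A g" for A unfolding g_def by (intro cont2_compose[OF f] continuous_intros)
    have [measurable]: "g \<in> borel_measurable borel" by (rule borel_measurable_continuous_onI[OF cg])
    define J where "J = (LINT s:{0..t}|lborel. g s)"
    have "p t x = p 0 (x - c * t) + J"
      unfolding J_def integral_eq_set_lborel[OF cg, symmetric] g_def by (rule mildD[OF mild t])
    then have "(cmod (p t x))\<^sup>2 \<le> (cmod (p 0 (x - c * t)) + cmod J)\<^sup>2"
      by (simp add: power_mono norm_triangle_ineq)
    also have "\<dots> \<le> 2 * (cmod (p 0 (x - c * t)))\<^sup>2 + 2 * (cmod J)\<^sup>2"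
      using zero_le_power2[of "cmod (p 0 (x - c * t)) - cmod J"] by (simp add: power2_eq_square algebra_simps)
    finally have "ennreal ((cmod (p t x))\<^sup>2) \<le> ennreal (2 * (cmod (p 0 (x - c * t)))\<^sup>2 + 2 * (cmod J)\<^sup>2)"
      by (rule ennreal_leI)
    also have "\<dots> = 2 * ennreal ((cmod (p 0 (x + - c * t)))\<^sup>2) + 2 * ennreal ((cmod J)\<^sup>2)"
      by (simp add: ennreal_mult)
    also have "ennreal ((cmod J)\<^sup>2) \<le> ennreal (t - 0) * (\<integral>\<^sup>+s. ennreal ((cmod (g s))\<^sup>2) * indicator {0..t} s \<partial>lborel)"
      unfolding J_def by (rule norm_integral_sq_le) (use t in auto)
    also have "(\<integral>\<^sup>+s. ennreal ((cmod (g s))\<^sup>2) * indicator {0..t} s \<partial>lborel) = (\<integral>\<^sup>+s. k s (x - c * (t - s)) * indicator {0..t} s \<partial>lborel)"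
    proof (rule nn_integral_cong)
      fix s
      have "\<bar>x - c * (t - s)\<bar> \<le> R - s" if "s \<in> {0..t}"
      proof -
        have "\<bar>c * (t - s)\<bar> \<le> 1 * (t - s)" unfolding abs_mult using c that by (intro mult_mono) auto
        then have "c * (t - s) \<le> t - s" "- (c * (t - s)) \<le> t - s" by (simp_all add: abs_le_iff)
        then show ?thesis using True by auto
      qed
      then show "ennreal ((cmod (g s))\<^sup>2) * indicator {0..t} s = k s (x - c * (t - s)) * indicator {0..t} s"
        by (auto simp: k_def g_def indicator_def)
    qed
    finally show ?thesis using True t by (simp add: ennreal_mult mult.assoc add_left_mono mult_left_mono)
  qed simp
  have "cone_energy R p t \<le> (\<integral>\<^sup>+x. 2 * ennreal ((cmod (p 0 (x + - c * t)))\<^sup>2)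
      + ennreal (2 * t) * (\<integral>\<^sup>+s. k s (x - c * (t - s)) * indicator {0..t} s \<partial>lborel) \<partial>lborel)"
    unfolding cone_energy_def by (intro nn_integral_mono pt)
  also have "\<dots> = 2 * (\<integral>\<^sup>+x. ennreal ((cmod (p 0 (x + - c * t)))\<^sup>2) \<partial>lborel)
      + ennreal (2 * t) * (\<integral>\<^sup>+x. (\<integral>\<^sup>+s. k s (x - c * (t - s)) * indicator {0..t} s \<partial>lborel) \<partial>lborel)"
  proof -
    have [measurable]: "(\<lambda>x. \<integral>\<^sup>+s. k s (x - c * (t - s)) * indicator {0..t} s \<partial>lborel) \<in> borel_measurable borel"
      using km2 by (intro lborel.borel_measurable_nn_integral[where N=borel, simplified]) (simp add: split_beta')
    show ?thesis by (simp add: nn_integral_add nn_integral_cmult)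
  qed
  also have "(\<integral>\<^sup>+x. ennreal ((cmod (p 0 (x + - c * t)))\<^sup>2) \<partial>lborel) = energy (p 0)"
    using energy_shift[of "p 0" "- c * t"] by (simp add: energy_def)
  finally have *: "cone_energy R p t \<le> 2 * energy (p 0)
      + ennreal (2 * t) * (\<integral>\<^sup>+x. (\<integral>\<^sup>+s. k s (x - c * (t - s)) * indicator {0..t} s \<partial>lborel) \<partial>lborel)" .
  have "(\<integral>\<^sup>+x. (\<integral>\<^sup>+s. k s (x - c * (t - s)) * indicator {0..t} s \<partial>lborel) \<partial>lborel)
     = (\<integral>\<^sup>+s. (\<integral>\<^sup>+x. k s (x - c * (t - s)) * indicator {0..t} s \<partial>lborel) \<partial>lborel)"
  proof (rule lborel_pair.Fubini')
    have "(\<lambda>z. (fst z, snd z - c * (t - fst z))) \<in> borel \<Otimes>\<^sub>M borel \<rightarrow>\<^sub>M borel \<Otimes>\<^sub>M borel" by measurable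
    from measurable_compose[OF this, of "\<lambda>z. k (fst z) (snd z)" borel]
    have [measurable]: "(\<lambda>z. k (fst z) (snd z - c * (t - fst z))) \<in> borel_measurable (borel \<Otimes>\<^sub>M borel)" by simp
    have "(\<lambda>z. k (fst z) (snd z - c * (t - fst z)) * indicator {0..t} (fst z)) \<in> borel_measurable (borel \<Otimes>\<^sub>M borel)"
      by measurable
    then show "(\<lambda>(s, x). k s (x - c * (t - s)) * indicator {0..t} s) \<in> borel_measurable (lborel \<Otimes>\<^sub>M lborel)"
      by (simp add: split_beta' cong: measurable_cong_sets)
  qed
  also have "\<dots> = (\<integral>\<^sup>+s. cone_energy R f s * indicator {0..t} s \<partial>lborel)"
  proof (rule nn_integral_cong)
    fix s
    have "(\<integral>\<^sup>+x. k s (x - c * (t - s)) \<partial>lborel) = cone_energy R f s"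
      using nn_integral_real_affine[OF km[of s], of 1 "- c * (t - s)"] k_cone[of s] by (simp add: add.commute)
    moreover have "(\<lambda>x. k s (x - c * (t - s))) \<in> borel_measurable borel"
      using measurable_shift[OF km[of s], of "- c * (t - s)"] by simp
    ultimately show "(\<integral>\<^sup>+x. k s (x - c * (t - s)) * indicator {0..t} s \<partial>lborel) = cone_energy R f s * indicator {0..t} s"
      by (simp add: nn_integral_multc)
  qed
  also have "\<dots> \<le> (\<integral>\<^sup>+s. ennreal (indicator {0..t} s * \<phi> s) \<partial>lborel)"
    using \<phi>(2,3) by (intro nn_integral_mono) (auto simp: indicator_def)
  also have "\<dots> = ennreal (LINT s|lborel. indicator {0..t} s * \<phi> s)"
    using borel_integrable_atLeastAtMost'[OF \<phi>(1)] \<phi>(2)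
    by (intro nn_integral_eq_integral) (auto simp: set_integrable_def indicator_def)
  also have "(LINT s|lborel. indicator {0..t} s * \<phi> s) = integral {0..t} \<phi>"
    using integral_eq_lborel[OF \<phi>(1)] by simp
  finally have "(\<integral>\<^sup>+x. (\<integral>\<^sup>+s. k s (x - c * (t - s)) * indicator {0..t} s \<partial>lborel) \<partial>lborel)
    \<le> ennreal (integral {0..t} \<phi>)" .
  from order_trans[OF * add_left_mono[OF mult_left_mono[OF this]]]
  show ?thesis
    using t Henstock_Kurzweil_Integration.integral_nonneg[OF integrable_continuous_interval[OF \<phi>(1)] \<phi>(2)]
    by (simp add: ennreal_mult)
qed

lemma cone_energy_limit:
  assumes "cont2 p" "\<And>n::nat. cone_energy (real n) p t \<le> C" shows "energy (p t) \<le> C"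
proof -
  note [measurable] = cont2_measurable[OF assms(1)]
  have "energy (p t) = (\<integral>\<^sup>+x. liminf (\<lambda>n. ennreal ((cmod (p t x))\<^sup>2) * indicator {- (real n - t)..real n - t} x) \<partial>lborel)"
    unfolding energy_def
  proof (rule nn_integral_cong)
    fix x
    obtain N :: nat where N: "\<bar>x\<bar> + t \<le> real N" using real_arch_simple by blast
    have "(\<lambda>n. ennreal ((cmod (p t x))\<^sup>2) * indicator {- (real n - t)..real n - t} x) \<longlonglongrightarrow> ennreal ((cmod (p t x))\<^sup>2)"
    proof (rule tendsto_eventually, rule eventually_sequentiallyI[of N])
      fix n assume "N \<le> n"
      then have "real N \<le> real n" by simp
      then have "x \<in> {- (real n - t)..real n - t}" using N by auto
      then show "ennreal ((cmod (p t x))\<^sup>2) * indicator {- (real n - t)..real n - t} x = ennreal ((cmod (p t x))\<^sup>2)" by simp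
    qed
    then show "ennreal ((cmod (p t x))\<^sup>2) = liminf (\<lambda>n. ennreal ((cmod (p t x))\<^sup>2) * indicator {- (real n - t)..real n - t} x)"
      by (intro lim_imp_Liminf[symmetric]) auto
  qed
  also have "\<dots> \<le> liminf (\<lambda>n. cone_energy (real n) p t)"
    unfolding cone_energy_def by (rule nn_integral_liminf) measurable
  also have "\<dots> \<le> liminf (\<lambda>n::nat. C)" by (intro Liminf_mono always_eventually allI assms(2))
  finally show ?thesis by (simp add: Liminf_const)
qed

lemma cone_energy_bounded:
  assumes "cont2 p" obtains M where "M \<ge> 0" "\<And>t. t \<in> {0..T} \<Longrightarrow> cone_energy R p t \<le> ennreal M"
proof -
  define S where "S = \<bar>R\<bar> + \<bar>T\<bar>"
  have S0: "0 \<le> S" by (simp add: S_def)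
  have "compact ((\<lambda>z. p (fst z) (snd z)) ` cbox (0, - S) (T, S))"
    using assms unfolding cont2_def by (intro compact_continuous_image) (auto intro: continuous_on_subset)
  then obtain M where M: "\<And>z. z \<in> cbox (0, - S) (T, S) \<Longrightarrow> cmod (p (fst z) (snd z)) \<le> M"
    by (meson bounded_iff compact_imp_bounded imageI)
  have "cone_energy R p t \<le> ennreal (M\<^sup>2 * (2 * S))" if t: "t \<in> {0..T}" for t
  proof -
    have "cone_energy R p t \<le> (\<integral>\<^sup>+x. ennreal (M\<^sup>2) * indicator {- S..S} x \<partial>lborel)"
      unfolding cone_energy_def
    proof (rule nn_integral_mono)
      fix x
      show "ennreal ((cmod (p t x))\<^sup>2) * indicator {- (R - t)..R - t} x \<le> ennreal (M\<^sup>2) * indicator {- S..S} x"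
      proof (cases "x \<in> {- (R - t)..R - t}")
        case True
        then have x: "x \<in> {- S..S}" using t by (auto simp: S_def)
        then have "cmod (p t x) \<le> M" using M[of "(t, x)"] t by (simp add: cbox_Pair_eq)
        then show ?thesis using True x by (simp add: ennreal_leI power_mono)
      qed simp
    qed
    also have "\<dots> = ennreal (M\<^sup>2 * (2 * S))"
      using S0 by (simp add: nn_integral_cmult ennreal_mult)
    finally show ?thesis .
  qed
  then show ?thesis by (intro that[of "M\<^sup>2 * (2 * S)"]) (auto simp: S_def)
qed

text \<open>The exponential rate \<open>24 T K\<^sup>2 + 1\<close> is chosen such that the part of the source that is
  proportional to the unknowns contributes at most half of the energy.\<close>

definition growth :: "real \<Rightarrow> real \<Rightarrow> real" where
  "growth K T = sqrt (2 * exp ((24 * T * K\<^sup>2 + 1) * T) * (4 + 12 * T\<^sup>2))"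

text \<open>Squaring the integrated equations and integrating over a cone gives an integral inequality
  for the cone energy whose constants do not depend on the size of the cone.\<close>

theorem L2_mild_estimate:
  fixes r :: "real \<Rightarrow> real \<Rightarrow> real"
  assumes cont: "cont2 p" "cont2 q" "cont2 f" "cont2 g" "cont2 r"
    and mild: "mild 1 p f" "mild (- 1) q g" and K: "0 \<le> K" and T: "0 \<le> T"
    and bound: "\<And>t x. t \<in> {0..T} \<Longrightarrow> cmod (f t x) \<le> K * (cmod (p t x) + cmod (q t x)) + r t x"
      "\<And>t x. t \<in> {0..T} \<Longrightarrow> cmod (g t x) \<le> K * (cmod (p t x) + cmod (q t x)) + r t x"
    and data: "energy (p 0) \<le> ennreal (a\<^sup>2)" "energy (q 0) \<le> ennreal (a\<^sup>2)" "0 \<le> a"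
    and r: "\<And>t. t \<in> {0..T} \<Longrightarrow> energy (\<lambda>x. of_real (r t x)) \<le> ennreal (\<rho>\<^sup>2)" "0 \<le> \<rho>"
    and t: "t \<in> {0..T}"
  shows "p t \<in> L2" "q t \<in> L2" "L2_norm (p t) \<le> growth K T * (a + \<rho>)" "L2_norm (q t) \<le> growth K T * (a + \<rho>)"
proof -
  note [measurable] = cont[THEN cont2_measurable(1)]
  define l where "l = 24 * T * K\<^sup>2 + 1"
  have l: "l > 0" using T unfolding l_def by (intro add_nonneg_pos) auto
  define b where "b = 4 * a\<^sup>2 + 12 * T\<^sup>2 * \<rho>\<^sup>2"
  have cone: "cone_energy R p t + cone_energy R q t \<le> ennreal (2 * b * exp (l * t))" if t: "t \<in> {0..T}" for R t
  proof -
    define e where "e t = cone_energy R p t + cone_energy R q t" for t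
    obtain M1 where M1: "M1 \<ge> 0" "\<And>t. t \<in> {0..T} \<Longrightarrow> cone_energy R p t \<le> ennreal M1"
      using cone_energy_bounded[OF cont(1)] by blast
    obtain M2 where M2: "M2 \<ge> 0" "\<And>t. t \<in> {0..T} \<Longrightarrow> cone_energy R q t \<le> ennreal M2"
      using cone_energy_bounded[OF cont(2)] by blast
    have eM: "e s \<le> ennreal (M1 + M2)" if "s \<in> {0..T}" for s
      unfolding e_def using M1 M2 that by (simp add: add_mono)
    have eE: "ennreal (enn2real (e s)) = e s" if "s \<in> {0..T}" for s
      using eM[OF that] by (intro ennreal_enn2real) (auto simp: less_top[symmetric] top_unique)
    have "enn2real (e t) \<le> 2 * b * exp (l * t)"
    proof (rule exponential_bootstrap[OF _ _ _ _ _ t])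
      show "enn2real (e s) \<le> M1 + M2" if "s \<in> {0..T}" for s
        using eM[OF that] M1(1) M2(1) by (intro enn2real_leI) auto
      show "0 \<le> b" by (simp add: b_def)
      fix c t assume c: "0 \<le> c" and IH: "\<And>s. s \<in> {0..T} \<Longrightarrow> enn2real (e s) \<le> c * exp (l * s)" and t: "t \<in> {0..T}"
      define \<phi> where "\<phi> s = 3 * K\<^sup>2 * (c * exp (l * s)) + 3 * \<rho>\<^sup>2" for s
      have c\<phi>: "continuous_on {0..t} \<phi>" unfolding \<phi>_def by (intro continuous_intros)
      have \<phi>0: "0 \<le> \<phi> s" for s using c by (simp add: \<phi>_def)
      have sq: "(K * (x + y) + z)\<^sup>2 \<le> 3 * K\<^sup>2 * (x\<^sup>2 + y\<^sup>2) + 3 * z\<^sup>2" for x y z :: real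
      proof -
        have "0 \<le> (K * x - K * y)\<^sup>2 + (K * x - z)\<^sup>2 + (K * y - z)\<^sup>2" by simp
        then show ?thesis by (simp add: power2_eq_square algebra_simps)
      qed
      have src: "cone_energy R h s \<le> ennreal (\<phi> s)"
        if s: "s \<in> {0..t}" and h: "\<And>x. cmod (h s x) \<le> K * (cmod (p s x) + cmod (q s x)) + r s x" for h s
      proof -
        have sT: "s \<in> {0..T}" using s t by auto
        have "cone_energy R h s \<le> (\<integral>\<^sup>+x. ennreal (3 * K\<^sup>2) * (ennreal ((cmod (p s x))\<^sup>2) * indicator {- (R - s)..R - s} x)
            + (ennreal (3 * K\<^sup>2) * (ennreal ((cmod (q s x))\<^sup>2) * indicator {- (R - s)..R - s} x)
            + ennreal 3 * ennreal ((r s x)\<^sup>2)) \<partial>lborel)"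
          unfolding cone_energy_def
        proof (rule nn_integral_mono)
          fix x
          have "(cmod (h s x))\<^sup>2 \<le> (K * (cmod (p s x) + cmod (q s x)) + r s x)\<^sup>2"
            using h[of x] by (intro power_mono) auto
          also note sq
          finally have "ennreal ((cmod (h s x))\<^sup>2) \<le> ennreal (3 * K\<^sup>2 * (cmod (p s x))\<^sup>2 + (3 * K\<^sup>2 * (cmod (q s x))\<^sup>2 + 3 * (r s x)\<^sup>2))"
            by (intro ennreal_leI) (simp add: algebra_simps)
          also have "\<dots> = ennreal (3 * K\<^sup>2) * ennreal ((cmod (p s x))\<^sup>2) + (ennreal (3 * K\<^sup>2) * ennreal ((cmod (q s x))\<^sup>2) + ennreal 3 * ennreal ((r s x)\<^sup>2))"
            using K by (simp add: ennreal_mult)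
          finally show "ennreal ((cmod (h s x))\<^sup>2) * indicator {- (R - s)..R - s} x
            \<le> ennreal (3 * K\<^sup>2) * (ennreal ((cmod (p s x))\<^sup>2) * indicator {- (R - s)..R - s} x)
            + (ennreal (3 * K\<^sup>2) * (ennreal ((cmod (q s x))\<^sup>2) * indicator {- (R - s)..R - s} x)
            + ennreal 3 * ennreal ((r s x)\<^sup>2))"
            by (cases "x \<in> {- (R - s)..R - s}") auto
        qed
        also have "\<dots> = ennreal (3 * K\<^sup>2) * e s + ennreal 3 * energy (\<lambda>x. of_real (r s x))"
        proof -
          have m: "(\<lambda>x. ennreal ((cmod (p s x))\<^sup>2) * indicator {- (R - s)..R - s} x) \<in> borel_measurable lborel"
            "(\<lambda>x. ennreal ((cmod (q s x))\<^sup>2) * indicator {- (R - s)..R - s} x) \<in> borel_measurable lborel"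
            "(\<lambda>x. ennreal ((r s x)\<^sup>2)) \<in> borel_measurable lborel" by measurable
          have "energy (\<lambda>x. of_real (r s x)) = (\<integral>\<^sup>+x. ennreal ((r s x)\<^sup>2) \<partial>lborel)"
            unfolding energy_def by simp
          moreover have "(\<integral>\<^sup>+x. k * A x + (k * B x + l * C x) \<partial>lborel)
              = k * (\<integral>\<^sup>+x. A x \<partial>lborel) + (k * (\<integral>\<^sup>+x. B x \<partial>lborel) + l * (\<integral>\<^sup>+x. C x \<partial>lborel))"
            if "A \<in> borel_measurable lborel" "B \<in> borel_measurable lborel" "C \<in> borel_measurable lborel"
            for A B C :: "real \<Rightarrow> ennreal" and k l
            using that by (simp add: nn_integral_add nn_integral_cmult)
          note this[OF m]
          ultimately show ?thesis
            unfolding e_def cone_energy_def distrib_left add.assoc by (simp only:)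
        qed
        also have "\<dots> \<le> ennreal (3 * K\<^sup>2) * ennreal (c * exp (l * s)) + ennreal 3 * ennreal (\<rho>\<^sup>2)"
        proof (intro add_mono mult_left_mono r(1)[OF sT])
          show "e s \<le> ennreal (c * exp (l * s))"
            using ennreal_leI[OF IH[OF sT]] by (simp only: eE[OF sT])
        qed auto
        also have "\<dots> = ennreal (\<phi> s)"
          unfolding \<phi>_def using c by (simp add: ennreal_mult)
        finally show ?thesis .
      qed
      have t0: "0 \<le> t" using t by simp
      have 1: "cone_energy R p t \<le> 2 * energy (p 0) + ennreal (2 * t * integral {0..t} \<phi>)"
        using t by (intro cone_energy_mild[OF cont(1,3) mild(1) t0 _ c\<phi> \<phi>0 src] bound(1)) auto
      have 2: "cone_energy R q t \<le> 2 * energy (q 0) + ennreal (2 * t * integral {0..t} \<phi>)"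
        using t by (intro cone_energy_mild[OF cont(2,4) mild(2) t0 _ c\<phi> \<phi>0 src] bound(2)) auto
      have i\<phi>: "0 \<le> integral {0..t} \<phi>"
        by (intro Henstock_Kurzweil_Integration.integral_nonneg integrable_continuous_interval c\<phi> \<phi>0)
      have I0: "integral {0..t} \<phi> = integral {0..t} (\<lambda>s. 3 * K\<^sup>2 * c * exp (l * s)) + integral {0..t} (\<lambda>s. 3 * \<rho>\<^sup>2)"
        unfolding \<phi>_def by (subst Henstock_Kurzweil_Integration.integral_add[symmetric])
          (auto intro!: integrable_continuous_interval continuous_intros simp: mult.assoc)
      have "norm (integral {0..t} (\<lambda>s. 3 * K\<^sup>2 * c * exp (l * s))) \<le> 3 * K\<^sup>2 * c / l * exp (l * t)"
        by (rule integral_exp_bound) (use t0 l c in \<open>auto intro!: continuous_intros\<close>)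
      then have I1: "integral {0..t} (\<lambda>s. 3 * K\<^sup>2 * c * exp (l * s)) \<le> 3 * K\<^sup>2 * c / l * exp (l * t)"
        unfolding real_norm_def by (rule abs_le_D1)
      have "3 * \<rho>\<^sup>2 * t \<le> 3 * \<rho>\<^sup>2 * T" using t by (intro mult_left_mono) auto
      then have I2: "integral {0..t} (\<lambda>s. 3 * \<rho>\<^sup>2) \<le> 3 * \<rho>\<^sup>2 * T" using t by (simp add: mult_ac)
      have I: "integral {0..t} \<phi> \<le> 3 * K\<^sup>2 * c / l * exp (l * t) + 3 * \<rho>\<^sup>2 * T"
        unfolding I0 using I1 I2 by (rule add_mono)
      have "e t \<le> (2 * energy (p 0) + ennreal (2 * t * integral {0..t} \<phi>)) + (2 * energy (q 0) + ennreal (2 * t * integral {0..t} \<phi>))"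
        unfolding e_def by (intro add_mono 1 2)
      also have "\<dots> \<le> (2 * ennreal (a\<^sup>2) + ennreal (2 * t * integral {0..t} \<phi>)) + (2 * ennreal (a\<^sup>2) + ennreal (2 * t * integral {0..t} \<phi>))"
        by (intro add_mono mult_left_mono data order_refl) auto
      also have "\<dots> = ennreal (4 * a\<^sup>2 + 4 * t * integral {0..t} \<phi>)"
      proof -
        have "2 * ennreal (a\<^sup>2) = ennreal (2 * a\<^sup>2)" by (simp add: ennreal_mult)
        then show ?thesis using t0 i\<phi> by (simp add: ennreal_plus[symmetric] del: ennreal_plus)
      qed
      finally have "enn2real (e t) \<le> 4 * a\<^sup>2 + 4 * t * integral {0..t} \<phi>"
        using t0 i\<phi> by (intro enn2real_leI) auto
      also have "\<dots> \<le> 4 * a\<^sup>2 + 4 * T * (3 * K\<^sup>2 * c / l * exp (l * t) + 3 * \<rho>\<^sup>2 * T)"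
        using t I i\<phi> T by (intro add_left_mono mult_mono) auto
      also have "\<dots> = b + (12 * T * K\<^sup>2 / l) * (c * exp (l * t))"
        by (simp add: b_def power2_eq_square algebra_simps)
      also have "\<dots> \<le> b + (1 / 2) * (c * exp (l * t))"
      proof (intro add_left_mono mult_right_mono)
        show "12 * T * K\<^sup>2 / l \<le> 1 / 2" using l by (simp add: divide_simps l_def)
      qed (use c in simp)
      finally show "enn2real (e t) \<le> b + c / 2 * exp (l * t)" by simp
    qed (use l in auto)
    then have "ennreal (enn2real (e t)) \<le> ennreal (2 * b * exp (l * t))" by (rule ennreal_leI)
    then show ?thesis unfolding eE[OF t] unfolding e_def .
  qed
  have g2: "2 * b * exp (l * t) \<le> (growth K T * (a + \<rho>))\<^sup>2" if "t \<in> {0..T}" for t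
  proof -
    have "a\<^sup>2 \<le> (a + \<rho>)\<^sup>2" "\<rho>\<^sup>2 \<le> (a + \<rho>)\<^sup>2" using data(3) r(2) by (auto intro!: power_mono)
    then have "b \<le> 4 * (a + \<rho>)\<^sup>2 + 12 * T\<^sup>2 * (a + \<rho>)\<^sup>2" unfolding b_def by (intro add_mono mult_left_mono) auto
    also have "\<dots> = (4 + 12 * T\<^sup>2) * (a + \<rho>)\<^sup>2" by (simp add: algebra_simps)
    finally have b: "b \<le> (4 + 12 * T\<^sup>2) * (a + \<rho>)\<^sup>2" .
    have b0: "0 \<le> b" by (simp add: b_def)
    have "2 * b * exp (l * t) = 2 * exp (l * t) * b" by simp
    also have "\<dots> \<le> 2 * exp (l * T) * ((4 + 12 * T\<^sup>2) * (a + \<rho>)\<^sup>2)"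
      using b b0 l that by (intro mult_mono) auto
    also have "\<dots> = (growth K T * (a + \<rho>))\<^sup>2"
      unfolding growth_def l_def[symmetric] power_mult_distrib by (subst real_sqrt_pow2) auto
    finally show ?thesis .
  qed
  have gnn: "0 \<le> growth K T * (a + \<rho>)" using data(3) r(2) by (simp add: growth_def)
  have both: "cone_energy R p t + cone_energy R q t \<le> ennreal ((growth K T * (a + \<rho>))\<^sup>2)" for R
    by (rule order_trans[OF cone[OF t] ennreal_leI[OF g2[OF t]]])
  have "cone_energy R p t \<le> ennreal ((growth K T * (a + \<rho>))\<^sup>2)" for R
    by (rule order_trans[OF _ both[of R]]) simp
  then have ep: "energy (p t) \<le> ennreal ((growth K T * (a + \<rho>))\<^sup>2)"
    by (rule cone_energy_limit[OF cont(1)])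
  have "cone_energy R q t \<le> ennreal ((growth K T * (a + \<rho>))\<^sup>2)" for R
    by (rule order_trans[OF _ both[of R]]) simp
  then have eq: "energy (q t) \<le> ennreal ((growth K T * (a + \<rho>))\<^sup>2)"
    by (rule cone_energy_limit[OF cont(2)])
  show "p t \<in> L2" "q t \<in> L2" using ep eq by (auto intro: L2_energyI)
  show "L2_norm (p t) \<le> growth K T * (a + \<rho>)" "L2_norm (q t) \<le> growth K T * (a + \<rho>)"
    using ep eq gnn by (auto intro: L2_norm_le_energy)
qed

text \<open>The same bootstrap in the sup norm: with the rate \<open>4 K + 1\<close> the two sources contribute at most
  half.\<close>

theorem sup_mild_estimate:
  assumes cont: "cont2 f" "cont2 g"
    and mild: "mild 1 p f" "mild (- 1) q g" and K: "0 \<le> K"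
    and bounded: "\<And>t x. t \<in> {0..T} \<Longrightarrow> cmod (p t x) + cmod (q t x) \<le> M"
    and bound: "\<And>t x. t \<in> {0..T} \<Longrightarrow> cmod (f t x) \<le> K * (cmod (p t x) + cmod (q t x))"
      "\<And>t x. t \<in> {0..T} \<Longrightarrow> cmod (g t x) \<le> K * (cmod (p t x) + cmod (q t x))"
    and data: "\<And>x. cmod (p 0 x) \<le> a" "\<And>x. cmod (q 0 x) \<le> a"
    and t: "t \<in> {0..T}"
  shows "cmod (p t x) + cmod (q t x) \<le> 4 * a * exp ((4 * K + 1) * T)"
proof -
  define E where "E t = (SUP x. cmod (p t x) + cmod (q t x))" for t
  define l where "l = 4 * K + 1"
  have l: "l > 0" using K by (simp add: l_def)
  have a: "0 \<le> a" using data(1) norm_ge_zero by (rule order_trans[rotated])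
  have bdd: "bdd_above (range (\<lambda>x. cmod (p s x) + cmod (q s x)))" if "s \<in> {0..T}" for s
    using bounded[OF that] by (intro bdd_aboveI2)
  have upper: "cmod (p s x) + cmod (q s x) \<le> E s" if "s \<in> {0..T}" for s x
    unfolding E_def by (rule cSUP_upper[OF _ bdd[OF that]]) simp
  have "E t \<le> 2 * (2 * a) * exp (l * t)"
  proof (rule exponential_bootstrap[OF _ _ _ _ _ t])
    show "E s \<le> M" if "s \<in> {0..T}" for s unfolding E_def using bounded[OF that] by (intro cSUP_least) auto
    show "0 \<le> E s" if "s \<in> {0..T}" for s
      by (rule order_trans[OF _ upper[OF that, of 0]]) simp
    fix c t assume c: "0 \<le> c" and IH: "\<And>s. s \<in> {0..T} \<Longrightarrow> E s \<le> c * exp (l * s)" and t: "t \<in> {0..T}"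
    have comp: "cmod (integral {0..t} (\<lambda>s. h s (x - d * (t - s)))) \<le> K * c / l * exp (l * t)"
      if h: "cont2 h" "\<And>s x. s \<in> {0..T} \<Longrightarrow> cmod (h s x) \<le> K * (cmod (p s x) + cmod (q s x))"
      for h d x
    proof (rule integral_exp_bound)
      show "continuous_on {0..t} (\<lambda>s. h s (x - d * (t - s)))"
        by (intro cont2_compose[OF h(1)] continuous_intros)
      fix s assume "s \<in> {0..t}"
      then have s: "s \<in> {0..T}" using t by auto
      have "cmod (h s (x - d * (t - s))) \<le> K * (c * exp (l * s))"
        using h(2)[OF s] mult_left_mono[OF order_trans[OF upper[OF s] IH[OF s]] K] by (rule order_trans)
      then show "cmod (h s (x - d * (t - s))) \<le> K * c * exp (l * s)" by (simp add: mult.assoc)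
    qed (use t l K c in auto)
    have half: "K * c / l * exp (l * t) + K * c / l * exp (l * t) \<le> c / 2 * exp (l * t)"
    proof -
      have "2 * K / l \<le> 1 / 2" using l by (simp add: divide_simps l_def)
      then have "(2 * K / l) * (c * exp (l * t)) \<le> (1 / 2) * (c * exp (l * t))" using c by (intro mult_right_mono) auto
      then show ?thesis by simp
    qed
    show "E t \<le> 2 * a + c / 2 * exp (l * t)"
      unfolding E_def
    proof (rule cSUP_least)
      fix x
      have "cmod (p t x) \<le> a + K * c / l * exp (l * t)"
        unfolding mildD[OF mild(1) t[THEN atLeastAtMost_iff[THEN iffD1, THEN conjunct1]], of x]
        by (rule order_trans[OF norm_triangle_ineq add_mono[OF data(1) comp[OF cont(1) bound(1)]]])
      moreover have "cmod (q t x) \<le> a + K * c / l * exp (l * t)"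
        unfolding mildD[OF mild(2) t[THEN atLeastAtMost_iff[THEN iffD1, THEN conjunct1]], of x]
        by (rule order_trans[OF norm_triangle_ineq add_mono[OF data(2) comp[OF cont(2) bound(2)]]])
      ultimately show "cmod (p t x) + cmod (q t x) \<le> 2 * a + c / 2 * exp (l * t)"
        using half by linarith
    qed simp
  qed (use a l in auto)
  also have "\<dots> \<le> 2 * (2 * a) * exp (l * T)" using a l t by (intro mult_left_mono) auto
  finally show ?thesis using upper[OF t, of x] by (simp add: l_def)
qed

section \<open>From uniform difference quotients to differentiability in time\<close>

lemma continuous_set_integrable:
  fixes g :: "real \<Rightarrow> complex"
  assumes "continuous_on UNIV g" shows "set_integrable lborel {a..b} g"
  by (rule borel_integrable_atLeastAtMost'[OF continuous_on_subset[OF assms]]) simp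

text \<open>Rescaling the time interval to \<open>{0..1}\<close> treats both signs of \<open>h\<close> alike and displays the source
  term as \<open>h\<close> times an average.\<close>

lemma mild_step:
  fixes p f :: "real \<Rightarrow> real \<Rightarrow> complex"
  assumes "mild c p f" "cont2 f" "0 \<le> t" "0 \<le> t + h" "h \<noteq> 0"
  shows "p (t + h) x = p t (x - c * h) + of_real h * (LINT \<theta>:{0..1}|lborel. f (t + \<theta> * h) (x - c * (h - \<theta> * h)))"
proof -
  define g where "g r = f r (x - c * (t + h - r))" for r
  have cg: "continuous_on A g" for A unfolding g_def by (intro cont2_compose[OF assms(2)] continuous_intros)
  have g_average: "average h g t = (LINT \<theta>:{0..1}|lborel. f (t + \<theta> * h) (x - c * (h - \<theta> * h)))"
    by (simp add: average_def g_def)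
  show ?thesis unfolding g_average[symmetric]
  proof (cases "h > 0")
    case True
    have "p (t + h) x = p t (x - c * (t + h - t)) + integral {t..t + h} g"
      unfolding g_def using True assms by (intro mild_restart) auto
    also have "integral {t..t + h} g = of_real h * average h g t"
      using interval_integral_eq_average[OF assms(5), of t g] True integral_eq_set_lborel[OF cg, of t "t + h"]
      by (simp add: scaleR_conv_of_real min_def max_def)
    finally show "p (t + h) x = p t (x - c * h) + of_real h * average h g t" by simp
  next
    case False
    then have h: "h < 0" using assms(5) by simp
    have "p t (x - c * h) = p (t + h) (x - c * h - c * (t - (t + h))) + integral {t + h..t} (\<lambda>r. f r (x - c * h - c * (t - r)))"
      using h assms by (intro mild_restart) auto
    also have "(\<lambda>r. f r (x - c * h - c * (t - r))) = g"
      by (simp add: g_def fun_eq_iff algebra_simps)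
    also have "integral {t + h..t} g = - of_real h * average h g t"
      using interval_integral_eq_average[OF assms(5), of t g] h integral_eq_set_lborel[OF cg, of "t + h" t]
      by (simp add: scaleR_conv_of_real min_def max_def)
    finally have "p t (x - c * h) = p (t + h) x - of_real h * average h g t" by simp
    then show "p (t + h) x = p t (x - c * h) + of_real h * average h g t" by simp
  qed
qed

lemma time_between_nonneg:
  fixes t h \<theta> :: real
  assumes "0 \<le> t" "0 \<le> t + h" "\<theta> \<in> {0..1}" shows "0 \<le> t + \<theta> * h"
proof -
  have "t + \<theta> * h = (1 - \<theta>) * t + \<theta> * (t + h)" by (simp add: algebra_simps)
  then show ?thesis using assms by simp
qed

lemma L2_Minkowski_average:
  assumes "cont2 G" "\<And>s. s \<in> {0..1} \<Longrightarrow> G s \<in> L2 \<and> L2_norm (G s) \<le> \<rho>" "0 \<le> \<rho>"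
  shows "(\<lambda>x. LINT s:{0..1}|lborel. G s x) \<in> L2" "L2_norm (\<lambda>x. LINT s:{0..1}|lborel. G s x) \<le> \<rho>"
proof -
  have e: "energy (\<lambda>x. LINT s:{0..1}|lborel. G s x) \<le> ennreal (\<rho>\<^sup>2)"
  proof (rule energy_average_le)
    show "(\<lambda>z. G (fst z) (snd z)) \<in> borel_measurable borel"
      using assms(1) unfolding cont2_def by (rule borel_measurable_continuous_onI)
    show "energy (G s) \<le> ennreal (\<rho>\<^sup>2)" if "s \<in> {0..1}" for s
      using assms(2)[OF that] by (intro energy_le_norm) auto
  qed
  have [measurable]: "(\<lambda>z. G (fst z) (snd z)) \<in> borel_measurable (borel \<Otimes>\<^sub>M borel)"
    by (rule cont2_measurable(2)[OF assms(1)])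
  have "(\<lambda>z. (snd z, fst z)) \<in> borel \<Otimes>\<^sub>M borel \<rightarrow>\<^sub>M borel \<Otimes>\<^sub>M (borel :: real measure)" by measurable
  from measurable_compose[OF this, of "\<lambda>z. G (fst z) (snd z)" borel]
  have [measurable]: "(\<lambda>z. G (snd z) (fst z)) \<in> borel_measurable (borel \<Otimes>\<^sub>M borel)" by simp
  have "(\<lambda>z. indicator {0..1} (snd z) *\<^sub>R G (snd z) (fst z)) \<in> borel_measurable (borel \<Otimes>\<^sub>M borel)" by measurable
  then have m: "(\<lambda>x. LINT s:{0..1}|lborel. G s x) \<in> borel_measurable borel"
    unfolding set_lebesgue_integral_def
    by (intro lborel.borel_measurable_lebesgue_integral) (simp add: split_beta' cong: measurable_cong_sets)
  show "(\<lambda>x. LINT s:{0..1}|lborel. G s x) \<in> L2" by (rule L2_energyI[OF m e])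
  show "L2_norm (\<lambda>x. LINT s:{0..1}|lborel. G s x) \<le> \<rho>" by (rule L2_norm_le_energy[OF m e assms(3)])
qed

lemma cont_curve_L2_near:
  assumes "cont_curve L2 L2_norm p" "t \<ge> 0" "\<epsilon> > 0"
  shows "\<exists>\<delta>>0. \<forall>s\<ge>0. \<bar>s - t\<bar> < \<delta> \<longrightarrow> L2_norm (\<lambda>x. p s x - p t x) < \<epsilon>"
proof -
  have "((\<lambda>s. L2_norm (\<lambda>x. p s x - p t x)) \<longlongrightarrow> 0) (at t within {0..})"
    using assms(1,2) unfolding cont_curve_def by blast
  from tendstoD[OF this assms(3)] obtain d where d: "d > 0"
    "\<And>s. s \<in> {0..} \<Longrightarrow> s \<noteq> t \<Longrightarrow> dist s t < d \<Longrightarrow> dist (L2_norm (\<lambda>x. p s x - p t x)) 0 < \<epsilon>"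
    unfolding eventually_at by auto
  have "L2_norm (\<lambda>x. p s x - p t x) < \<epsilon>" if "s \<ge> 0" "\<bar>s - t\<bar> < d" for s
    using d(2)[of s] that \<open>\<epsilon> > 0\<close> by (cases "s = t") (auto simp: dist_real_def)
  then show ?thesis using d(1) by blast
qed

text \<open>By \<open>mild_step\<close>, the increment quotient of \<open>p\<close> in time with step \<open>h\<close> is \<open>- c\<close> times its
  difference quotient in space with step \<open>- c h\<close>, plus an average of the source near time \<open>t\<close>. The
  difference quotients approximate the weak derivatives uniformly in time, which makes the latter
  continuous in time.\<close>

lemma mild_curve_regularity:
  fixes p f :: "real \<Rightarrow> real \<Rightarrow> complex"
  assumes cont: "cont2 p" "cont2 f" and mild: "mild c p f" and c: "c = 1 \<or> c = - 1"
    and pH1: "\<And>t. t \<ge> 0 \<Longrightarrow> p t \<in> H1" and fL2: "\<And>t. t \<ge> 0 \<Longrightarrow> f t \<in> L2"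
    and p_cont: "cont_curve L2 L2_norm p"
    and f_cont: "\<And>t \<epsilon>. t \<ge> 0 \<Longrightarrow> \<epsilon> > 0 \<Longrightarrow>
      \<exists>\<delta>>0. \<forall>r y. 0 \<le> r \<and> \<bar>r - t\<bar> < \<delta> \<and> \<bar>y\<bar> < \<delta> \<longrightarrow> L2_norm (\<lambda>x. f r (x + y) - f t x) \<le> \<epsilon>"
    and unif: "\<And>T \<epsilon>. T \<ge> 0 \<Longrightarrow> \<epsilon> > 0 \<Longrightarrow>
      \<exists>\<delta>>0. \<forall>h t. 0 < \<bar>h\<bar> \<and> \<bar>h\<bar> < \<delta> \<and> t \<in> {0..T} \<longrightarrow> L2_norm (\<lambda>x. diff_quot h (p t) x - weak_deriv (p t) x) \<le> \<epsilon>"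
  shows "cont_curve H1 H1_norm p" "C1_L2_curve p (\<lambda>t x. f t x - of_real c * weak_deriv (p t) x)"
proof -
  have pL2: "t \<ge> 0 \<Longrightarrow> p t \<in> L2" and wL2: "t \<ge> 0 \<Longrightarrow> weak_deriv (p t) \<in> L2" for t
    using pH1 H1_L2 weak_deriv_props by auto
  note p_eps = cont_curve_L2_near[OF p_cont]
  \<comment> \<open>A fixed small step of the difference quotient approximates the weak derivatives at all
      nearby times, and for a fixed step the difference quotient depends continuously on time.\<close>
  have w_eps: "\<exists>\<delta>>0. \<forall>s\<ge>0. \<bar>s - t\<bar> < \<delta> \<longrightarrow> L2_norm (\<lambda>x. weak_deriv (p s) x - weak_deriv (p t) x) \<le> \<epsilon>"
    if t: "t \<ge> 0" and e: "\<epsilon> > 0" for t \<epsilon>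
  proof -
    have "t + 1 \<ge> 0" "\<epsilon> / 3 > 0" using t e by auto
    from unif[OF this] obtain d where d: "d > 0"
      "\<And>h s. 0 < \<bar>h\<bar> \<Longrightarrow> \<bar>h\<bar> < d \<Longrightarrow> s \<in> {0..t + 1} \<Longrightarrow> L2_norm (\<lambda>x. diff_quot h (p s) x - weak_deriv (p s) x) \<le> \<epsilon> / 3"
      by blast
    define h where "h = d / 2"
    have h: "0 < h" "\<bar>h\<bar> < d" using d(1) by (auto simp: h_def)
    have "\<epsilon> / 3 * h / 2 > 0" using e h by simp
    from p_eps[OF t this] obtain d' where d': "d' > 0"
      "\<And>s. s \<ge> 0 \<Longrightarrow> \<bar>s - t\<bar> < d' \<Longrightarrow> L2_norm (\<lambda>x. p s x - p t x) < \<epsilon> / 3 * h / 2" by blast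
    have "L2_norm (\<lambda>x. weak_deriv (p s) x - weak_deriv (p t) x) \<le> \<epsilon>" if s: "s \<ge> 0" "\<bar>s - t\<bar> < min d' 1" for s
    proof -
      note L2s = pL2[OF s(1)] pL2[OF t] wL2[OF s(1)] wL2[OF t]
      have h0: "0 < \<bar>h\<bar>" using h(1) by simp
      have times: "s \<in> {0..t + 1}" "t \<in> {0..t + 1}" using s t by auto
      note 1 = d(2)[OF h0 h(2) times(1)] d(2)[OF h0 h(2) times(2)]
      have dL2: "(\<lambda>x. p s x - p t x) \<in> L2" by (intro L2_diff L2s)
      have "(\<lambda>x. diff_quot h (p s) x - diff_quot h (p t) x)
        = (\<lambda>x. (1 / of_real h) * ((p s (x + h) - p t (x + h)) - (p s x - p t x)))"
        by (simp add: diff_quot_def fun_eq_iff diff_divide_distrib)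
      then have "L2_norm (\<lambda>x. diff_quot h (p s) x - diff_quot h (p t) x)
        = L2_norm (\<lambda>x. (1 / of_real h) * ((p s (x + h) - p t (x + h)) - (p s x - p t x)))" by (simp only:)
      also have "\<dots> = 1 / h * L2_norm (\<lambda>x. (p s (x + h) - p t (x + h)) - (p s x - p t x))"
        unfolding L2_norm_cmult using h by (simp add: norm_divide)
      also have "\<dots> \<le> 1 / h * (\<epsilon> / 3 * h)"
      proof (rule mult_left_mono)
        have "L2_norm (\<lambda>x. (p s (x + h) - p t (x + h)) - (p s x - p t x))
          \<le> L2_norm (\<lambda>x. p s (x + h) - p t (x + h)) + L2_norm (\<lambda>x. p s x - p t x)"
          by (rule L2_norm_triangle_diff[OF L2_shift[OF dL2] dL2])
        also have "\<dots> = 2 * L2_norm (\<lambda>x. p s x - p t x)" using L2_norm_shift[OF dL2, of h] by simp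
        also have "\<dots> \<le> \<epsilon> / 3 * h" using d'(2)[OF s(1)] s(2) by simp
        finally show "L2_norm (\<lambda>x. (p s (x + h) - p t (x + h)) - (p s x - p t x)) \<le> \<epsilon> / 3 * h" .
      qed (use h in simp)
      also have "1 / h * (\<epsilon> / 3 * h) = \<epsilon> / 3" using h by simp
      finally have 2: "L2_norm (\<lambda>x. diff_quot h (p s) x - diff_quot h (p t) x) \<le> \<epsilon> / 3" .
      have "L2_norm (\<lambda>x. weak_deriv (p s) x - weak_deriv (p t) x)
        \<le> L2_norm (\<lambda>x. weak_deriv (p s) x - diff_quot h (p s) x) + L2_norm (\<lambda>x. diff_quot h (p s) x - weak_deriv (p t) x)"
        by (intro L2_norm_triangle3 diff_quot_L2 L2s)
      also have "L2_norm (\<lambda>x. diff_quot h (p s) x - weak_deriv (p t) x)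
        \<le> L2_norm (\<lambda>x. diff_quot h (p s) x - diff_quot h (p t) x) + L2_norm (\<lambda>x. diff_quot h (p t) x - weak_deriv (p t) x)"
        by (intro L2_norm_triangle3 diff_quot_L2 L2s)
      finally show ?thesis
        using 1 2 L2_norm_minus_commute[of "weak_deriv (p s)" "diff_quot h (p s)"] by linarith
    qed
    then show ?thesis using d'(1) by (intro exI[of _ "min d' 1"]) auto
  qed
  have lim_from_eps: "((\<lambda>s. n s) \<longlongrightarrow> 0) (at t within {0..})"
    if "\<And>\<epsilon>. \<epsilon> > 0 \<Longrightarrow> \<exists>\<delta>>0. \<forall>s\<ge>0. s \<noteq> t \<and> \<bar>s - t\<bar> < \<delta> \<longrightarrow> n s \<le> \<epsilon>" "\<And>s. 0 \<le> n s" for n :: "real \<Rightarrow> real" and t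
  proof (rule tendstoI)
    fix e :: real assume "e > 0"
    then have "e / 2 > 0" by simp
    from that(1)[OF this] obtain d where d: "d > 0" "\<And>s. s \<ge> 0 \<Longrightarrow> s \<noteq> t \<Longrightarrow> \<bar>s - t\<bar> < d \<Longrightarrow> n s \<le> e / 2" by blast
    have "dist (n s) 0 < e" if "s \<in> {0..}" "s \<noteq> t" "dist s t < d" for s
      using d(2)[of s] that \<open>\<And>s. 0 \<le> n s\<close>[of s] \<open>e > 0\<close> by (simp add: dist_real_def)
    then show "\<forall>\<^sub>F s in at t within {0..}. dist (n s) 0 < e"
      unfolding eventually_at using d(1) by blast
  qed
  have norm_H1: "H1_norm (\<lambda>x. p s x - p t x) \<le> L2_norm (\<lambda>x. p s x - p t x) + L2_norm (\<lambda>x. weak_deriv (p s) x - weak_deriv (p t) x)"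
    if "s \<ge> 0" "t \<ge> 0" for s t
    using H1_norm_bounds(3)[of "\<lambda>x. p s x - p t x"] L2_norm_weak_deriv_diff[OF pH1[OF that(1)] pH1[OF that(2)]] by simp
  show "cont_curve H1 H1_norm p"
    unfolding cont_curve_def
  proof (intro conjI allI impI pH1 lim_from_eps)
    fix t \<epsilon> :: real assume t: "0 \<le> t" and "0 < \<epsilon>"
    then have "\<epsilon> / 2 > 0" by simp
    obtain d1 where d1: "d1 > 0" "\<And>s. s \<ge> 0 \<Longrightarrow> \<bar>s - t\<bar> < d1 \<Longrightarrow> L2_norm (\<lambda>x. p s x - p t x) < \<epsilon> / 2"
      using p_eps[OF t \<open>\<epsilon> / 2 > 0\<close>] by blast
    obtain d2 where d2: "d2 > 0" "\<And>s. s \<ge> 0 \<Longrightarrow> \<bar>s - t\<bar> < d2 \<Longrightarrow> L2_norm (\<lambda>x. weak_deriv (p s) x - weak_deriv (p t) x) \<le> \<epsilon> / 2"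
      using w_eps[OF t \<open>\<epsilon> / 2 > 0\<close>] by blast
    have "H1_norm (\<lambda>x. p s x - p t x) \<le> \<epsilon>" if "s \<ge> 0" "\<bar>s - t\<bar> < min d1 d2" for s
      using norm_H1[OF that(1) t] d1(2)[OF that(1)] d2(2)[OF that(1)] that(2) by simp
    then show "\<exists>\<delta>>0. \<forall>s\<ge>0. s \<noteq> t \<and> \<bar>s - t\<bar> < \<delta> \<longrightarrow> H1_norm (\<lambda>x. p s x - p t x) \<le> \<epsilon>"
      using d1(1) d2(1) by (intro exI[of _ "min d1 d2"]) auto
  qed (assumption | rule H1_norm_bounds(4))+
  have cc: "cmod (of_real c) = 1" using c by auto
  have p'L2: "(\<lambda>x. f t x - of_real c * weak_deriv (p t) x) \<in> L2" if "t \<ge> 0" for t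
    using that by (intro L2_diff fL2 L2_cmult wL2)
  have "cont_curve L2 L2_norm (\<lambda>t x. f t x - of_real c * weak_deriv (p t) x)"
    unfolding cont_curve_def
  proof (intro conjI allI impI p'L2 lim_from_eps)
    fix t \<epsilon> :: real assume t: "0 \<le> t" and "0 < \<epsilon>"
    then have e2: "\<epsilon> / 2 > 0" by simp
    obtain d1 where d1: "d1 > 0" "\<And>r y. 0 \<le> r \<Longrightarrow> \<bar>r - t\<bar> < d1 \<Longrightarrow> \<bar>y\<bar> < d1 \<Longrightarrow> L2_norm (\<lambda>x. f r (x + y) - f t x) \<le> \<epsilon> / 2"
      using f_cont[OF t e2] by blast
    obtain d2 where d2: "d2 > 0" "\<And>s. s \<ge> 0 \<Longrightarrow> \<bar>s - t\<bar> < d2 \<Longrightarrow> L2_norm (\<lambda>x. weak_deriv (p s) x - weak_deriv (p t) x) \<le> \<epsilon> / 2"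
      using w_eps[OF t e2] by blast
    have "L2_norm (\<lambda>x. f s x - of_real c * weak_deriv (p s) x - (f t x - of_real c * weak_deriv (p t) x)) \<le> \<epsilon>"
      if s: "s \<ge> 0" "\<bar>s - t\<bar> < min d1 d2" for s
    proof -
      have "(\<lambda>x. f s x - of_real c * weak_deriv (p s) x - (f t x - of_real c * weak_deriv (p t) x))
        = (\<lambda>x. (f s x - f t x) - of_real c * (weak_deriv (p s) x - weak_deriv (p t) x))"
        by (simp add: fun_eq_iff algebra_simps)
      then have "L2_norm (\<lambda>x. f s x - of_real c * weak_deriv (p s) x - (f t x - of_real c * weak_deriv (p t) x))
        \<le> L2_norm (\<lambda>x. f s x - f t x) + L2_norm (\<lambda>x. of_real c * (weak_deriv (p s) x - weak_deriv (p t) x))"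
        using L2_norm_triangle_diff[OF L2_diff[OF fL2[OF s(1)] fL2[OF t]] L2_cmult[OF L2_diff[OF wL2[OF s(1)] wL2[OF t]]]] by simp
      also have "\<dots> \<le> \<epsilon> / 2 + \<epsilon> / 2"
        unfolding L2_norm_cmult cc using d1(2)[OF s(1), of 0] d2(2)[OF s(1)] s(2) d1(1) by (intro add_mono) auto
      finally show ?thesis by simp
    qed
    then show "\<exists>\<delta>>0. \<forall>s\<ge>0. s \<noteq> t \<and> \<bar>s - t\<bar> < \<delta> \<longrightarrow>
      L2_norm (\<lambda>x. f s x - of_real c * weak_deriv (p s) x - (f t x - of_real c * weak_deriv (p t) x)) \<le> \<epsilon>"
      using d1(1) d2(1) by (intro exI[of _ "min d1 d2"]) auto
  qed simp_all
  moreover have "((\<lambda>s. L2_norm (\<lambda>x. (p s x - p t x) / of_real (s - t) - (f t x - of_real c * weak_deriv (p t) x))) \<longlongrightarrow> 0)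
      (at t within {0..})" if t: "t \<ge> 0" for t
  proof (rule lim_from_eps)
    fix \<epsilon> :: real assume "0 < \<epsilon>"
    then have e2: "\<epsilon> / 2 > 0" by simp
    obtain d1 where d1: "d1 > 0" "\<And>r y. 0 \<le> r \<Longrightarrow> \<bar>r - t\<bar> < d1 \<Longrightarrow> \<bar>y\<bar> < d1 \<Longrightarrow> L2_norm (\<lambda>x. f r (x + y) - f t x) \<le> \<epsilon> / 2"
      using f_cont[OF t e2] by blast
    obtain d2 where d2: "d2 > 0" "\<And>h s. 0 < \<bar>h\<bar> \<Longrightarrow> \<bar>h\<bar> < d2 \<Longrightarrow> s \<in> {0..t} \<Longrightarrow> L2_norm (\<lambda>x. diff_quot h (p s) x - weak_deriv (p s) x) \<le> \<epsilon> / 2"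
      using unif[OF t e2] by blast
    have "L2_norm (\<lambda>x. (p s x - p t x) / of_real (s - t) - (f t x - of_real c * weak_deriv (p t) x)) \<le> \<epsilon>"
      if s: "s \<ge> 0" "s \<noteq> t" "\<bar>s - t\<bar> < min d1 d2" for s
    proof -
      define h where "h = s - t"
      have h: "h \<noteq> 0" "\<bar>h\<bar> < d1" "\<bar>h\<bar> < d2" "s = t + h" "0 \<le> t + h" using s by (auto simp: h_def)
      define G where "G \<theta> x = f (t + \<theta> * h) (x - c * (h - \<theta> * h)) - f t x" for \<theta> x
      have cG: "cont2 G" unfolding G_def cont2_def by (intro continuous_intros cont2_compose[OF cont(2)])
      note nn = time_between_nonneg[OF t h(5)]
      have G: "G \<theta> \<in> L2 \<and> L2_norm (G \<theta>) \<le> \<epsilon> / 2" if "\<theta> \<in> {0..1}" for \<theta>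
      proof
        show "G \<theta> \<in> L2" unfolding G_def using L2_shift[OF fL2[OF nn[OF that]], of "- c * (h - \<theta> * h)"]
          by (intro L2_diff fL2 t) simp
        have "\<bar>\<theta> * h\<bar> \<le> 1 * \<bar>h\<bar>" "\<bar>(1 - \<theta>) * h\<bar> \<le> 1 * \<bar>h\<bar>"
          unfolding abs_mult using that by (auto intro!: mult_left_le_one_le)
        moreover have "\<bar>- c * (h - \<theta> * h)\<bar> = \<bar>(1 - \<theta>) * h\<bar>" using c by (auto simp: algebra_simps)
        ultimately have "L2_norm (\<lambda>x. f (t + \<theta> * h) (x + - c * (h - \<theta> * h)) - f t x) \<le> \<epsilon> / 2"
          using h(2) by (intro d1(2) nn[OF that]) auto
        then show "L2_norm (G \<theta>) \<le> \<epsilon> / 2" by (simp add: G_def[abs_def])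
      qed
      have eq: "(p s x - p t x) / of_real (s - t) - (f t x - of_real c * weak_deriv (p t) x)
        = (- of_real c) * (diff_quot (- c * h) (p t) x - weak_deriv (p t) x) + (LINT \<theta>:{0..1}|lborel. G \<theta> x)" for x
      proof -
        have "(LINT \<theta>:{0..1}|lborel. f (t + \<theta> * h) (x - c * (h - \<theta> * h))) = (LINT \<theta>:{0..1}|lborel. G \<theta> x + f t x)"
          by (simp add: G_def)
        also have "\<dots> = (LINT \<theta>:{0..1}|lborel. G \<theta> x) + (LINT \<theta>:{0..1::real}|lborel. f t x)"
          by (intro set_integral_add continuous_set_integrable cont2_compose[OF cG] continuous_intros)
        also have "(LINT \<theta>:{0..1::real}|lborel. f t x) = f t x" by (simp add: set_lebesgue_integral_def)
        finally have "p s x = p t (x - c * h) + of_real h * ((LINT \<theta>:{0..1}|lborel. G \<theta> x) + f t x)"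
          unfolding h(4) mild_step[OF mild cont(2) t h(5,1)] by simp
        moreover have "s - t = h" by (simp add: h_def)
        ultimately show ?thesis using h(1) c by (auto simp: diff_quot_def field_simps)
      qed
      have L1: "(\<lambda>x. diff_quot (- c * h) (p t) x - weak_deriv (p t) x) \<in> L2"
        by (intro L2_diff diff_quot_L2 pL2 wL2 t)
      have "\<bar>- c * h\<bar> = \<bar>h\<bar>" using c by auto
      then have "L2_norm (\<lambda>x. diff_quot (- c * h) (p t) x - weak_deriv (p t) x) \<le> \<epsilon> / 2"
        using h t by (intro d2(2)) auto
      moreover have "L2_norm (\<lambda>x. LINT \<theta>:{0..1}|lborel. G \<theta> x) \<le> \<epsilon> / 2"
        by (rule L2_Minkowski_average(2)[OF cG G]) (use e2 in auto)
      moreover have "L2_norm (\<lambda>x. (- of_real c) * (diff_quot (- c * h) (p t) x - weak_deriv (p t) x) + (LINT \<theta>:{0..1}|lborel. G \<theta> x))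
        \<le> L2_norm (\<lambda>x. (- of_real c) * (diff_quot (- c * h) (p t) x - weak_deriv (p t) x)) + L2_norm (\<lambda>x. LINT \<theta>:{0..1}|lborel. G \<theta> x)"
        by (rule L2_norm_triangle[OF L2_cmult[OF L1] L2_Minkowski_average(1)[OF cG G]]) (use e2 in auto)
      ultimately show ?thesis unfolding eq L2_norm_cmult norm_minus_cancel cc by linarith
    qed
    then show "\<exists>\<delta>>0. \<forall>s\<ge>0. s \<noteq> t \<and> \<bar>s - t\<bar> < \<delta> \<longrightarrow>
      L2_norm (\<lambda>x. (p s x - p t x) / of_real (s - t) - (f t x - of_real c * weak_deriv (p t) x)) \<le> \<epsilon>"
      using d1(1) d2(1) by (intro exI[of _ "min d1 d2"]) auto
  qed simp
  ultimately show "C1_L2_curve p (\<lambda>t x. f t x - of_real c * weak_deriv (p t) x)"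
    using p_cont unfolding C1_L2_curve_def by blast
qed

section \<open>Regularity of bounded solutions\<close>

lemma L2_norm_le_sum:
  assumes a: "a \<in> L2" and b: "b \<in> L2" and f: "f \<in> borel_measurable borel"
    and le: "\<And>x. cmod (f x) \<le> L * (cmod (a x) + cmod (b x))" and L: "0 \<le> L"
  shows "f \<in> L2" "L2_norm f \<le> L * (L2_norm a + L2_norm b)"
proof -
  have abs: "(\<lambda>x. of_real (cmod (w x)) :: complex) \<in> L2" if "w \<in> L2" for w
    by (rule L2_dominated[OF that, of _ 1]) (use L2_measurable[OF that] in auto)
  have absn: "L2_norm (\<lambda>x. of_real (cmod (w x))) = L2_norm w" for w by (simp add: L2_norm_def)
  have s: "(\<lambda>x. of_real (cmod (a x)) + of_real (cmod (b x)) :: complex) \<in> L2"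
    by (intro L2_add abs a b)
  have Ls: "(\<lambda>x. of_real L * (of_real (cmod (a x)) + of_real (cmod (b x)))) \<in> L2" by (rule L2_cmult[OF s])
  have le': "cmod (f x) \<le> cmod (of_real L * (of_real (cmod (a x)) + of_real (cmod (b x))))" for x
    using le[of x] L by (simp add: norm_mult flip: of_real_add)
  show "f \<in> L2" by (rule L2_dominated[OF Ls f, of 1]) (use le' in simp)
  have "L2_norm f \<le> L2_norm (\<lambda>x. of_real L * (of_real (cmod (a x)) + of_real (cmod (b x))))"
    by (rule L2_norm_mono[OF Ls f le'])
  also have "\<dots> = L * L2_norm (\<lambda>x. of_real (cmod (a x)) + of_real (cmod (b x)))"
    unfolding L2_norm_cmult using L by simp
  also have "\<dots> \<le> L * (L2_norm a + L2_norm b)"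
    using L2_norm_triangle[OF abs[OF a] abs[OF b]] L unfolding absn by (rule mult_left_mono)
  finally show "L2_norm f \<le> L * (L2_norm a + L2_norm b)" .
qed

lemma cont2_diff_quot:
  assumes "cont2 p" shows "cont2 (\<lambda>t. diff_quot h (p t))"
  unfolding diff_quot_def divide_inverse cont2_def
  by (intro continuous_intros cont2_compose[OF assms])

lemma mild_diff:
  fixes f g :: "real \<Rightarrow> real \<Rightarrow> 'a::banach"
  assumes "mild c p f" "mild c q g" "cont2 f" "cont2 g"
  shows "mild c (\<lambda>t x. p t x - q t x) (\<lambda>t x. f t x - g t x)"
  unfolding mild_def
proof (intro allI impI)
  fix t x :: real assume t: "0 \<le> t"
  show "p t x - q t x = p 0 (x - c * t) - q 0 (x - c * t)
    + integral {0..t} (\<lambda>s. f s (x - c * (t - s)) - g s (x - c * (t - s)))"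
    unfolding Henstock_Kurzweil_Integration.integral_diff[OF char_integrable[OF assms(3)] char_integrable[OF assms(4)]]
      mildD[OF assms(1) t, of x] mildD[OF assms(2) t, of x] by simp
qed

lemma mild_diff_quot:
  assumes "mild c p f" "cont2 f"
  shows "mild c (\<lambda>t. diff_quot h (p t)) (\<lambda>t. diff_quot h (f t))"
proof -
  have shift: "mild c (\<lambda>t x. p t (x + h)) (\<lambda>t x. f t (x + h))"
    unfolding mild_def
  proof (intro allI impI)
    fix t x :: real assume t: "0 \<le> t"
    have *: "x + h - y = x - y + h" for y by simp
    show "p t (x + h) = p 0 (x - c * t + h) + integral {0..t} (\<lambda>s. f s (x - c * (t - s) + h))"
      using mildD[OF assms(1) t, of "x + h"] unfolding * .
  qed
  have "cont2 (\<lambda>t x. f t (x + h))" unfolding cont2_def by (intro cont2_compose[OF assms(2)] continuous_intros)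
  from mild_diff[OF shift assms(1) this assms(2)]
  have d: "mild c (\<lambda>t x. p t (x + h) - p t x) (\<lambda>t x. f t (x + h) - f t x)" .
  show ?thesis unfolding mild_def diff_quot_def
  proof (intro allI impI)
    fix t x :: real assume t: "0 \<le> t"
    show "(p t (x + h) - p t x) / of_real h = (p 0 (x - c * t + h) - p 0 (x - c * t)) / of_real h
      + integral {0..t} (\<lambda>s. (f s (x - c * (t - s) + h) - f s (x - c * (t - s))) / of_real h)"
      unfolding mildD[OF d t, of x] by (simp add: add_divide_distrib)
  qed
qed

text \<open>Between two times the solution is translated, which is continuous in \<open>L\<^sup>2\<close>, and a source of
  bounded norm acts for a short time.\<close>

lemma mild_L2_continuous:
  assumes cont: "cont2 f" and mild: "mild c p f"
    and pL2: "\<And>t. t \<ge> 0 \<Longrightarrow> p t \<in> L2"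
    and fL2: "\<And>T. T \<ge> 0 \<Longrightarrow> \<exists>B\<ge>0. \<forall>t\<in>{0..T}. f t \<in> L2 \<and> L2_norm (f t) \<le> B"
  shows "cont_curve L2 L2_norm p"
  unfolding cont_curve_def
proof (intro conjI allI impI pL2)
  fix t :: real assume t: "0 \<le> t"
  then have "t + 1 \<ge> 0" by simp
  from fL2[OF this] obtain B where B: "B \<ge> 0" "\<And>s. s \<in> {0..t + 1} \<Longrightarrow> f s \<in> L2 \<and> L2_norm (f s) \<le> B" by blast
  have main: "L2_norm (\<lambda>x. p s x - p t x) \<le> L2_norm (\<lambda>x. p t (x + - c * (s - t)) - p t x) + \<bar>s - t\<bar> * B"
    if s: "s \<ge> 0" "s \<noteq> t" "\<bar>s - t\<bar> < 1" for s
  proof -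
    define h where "h = s - t"
    have h: "h \<noteq> 0" "0 \<le> t + h" "s = t + h" "\<bar>h\<bar> < 1" using s by (auto simp: h_def)
    define G where "G \<theta> x = f (t + \<theta> * h) (x + - c * (h - \<theta> * h))" for \<theta> x
    have cG: "cont2 G" unfolding G_def cont2_def by (intro continuous_intros cont2_compose[OF cont])
    have G: "G \<theta> \<in> L2 \<and> L2_norm (G \<theta>) \<le> B" if "\<theta> \<in> {0..1}" for \<theta>
    proof -
      have "\<theta> * h \<le> 1 * 1" using that h(4) by (intro order_trans[OF mult_left_mono mult_right_mono]) auto
      then have "f (t + \<theta> * h) \<in> L2 \<and> L2_norm (f (t + \<theta> * h)) \<le> B"
        using time_between_nonneg[OF t h(2) that] by (intro B(2)) simp
      then show ?thesis
        unfolding G_def using L2_shift[of "f (t + \<theta> * h)" "- c * (h - \<theta> * h)"]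
          L2_norm_shift[of "f (t + \<theta> * h)" "- c * (h - \<theta> * h)"] by simp
    qed
    have eq: "p s x - p t x = (p t (x + - c * (s - t)) - p t x) + of_real h * (LINT \<theta>:{0..1}|lborel. G \<theta> x)" for x
      unfolding h(3) mild_step[OF mild cont t h(2,1), of x] by (simp add: G_def)
    have "L2_norm (\<lambda>x. p s x - p t x) \<le> L2_norm (\<lambda>x. p t (x + - c * (s - t)) - p t x)
        + L2_norm (\<lambda>x. of_real h * (LINT \<theta>:{0..1}|lborel. G \<theta> x))"
      unfolding eq by (intro L2_norm_triangle L2_diff L2_shift L2_cmult L2_Minkowski_average(1)[OF cG G] pL2 t B)
    moreover have "L2_norm (\<lambda>x. of_real h * (LINT \<theta>:{0..1}|lborel. G \<theta> x)) \<le> \<bar>h\<bar> * B"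
      unfolding L2_norm_cmult norm_of_real by (intro mult_left_mono L2_Minkowski_average(2)[OF cG G] B) auto
    ultimately show ?thesis by (simp add: h_def)
  qed
  have lim: "((\<lambda>y. L2_norm (\<lambda>x. p t (x + y) - p t x)) \<longlongrightarrow> 0) (nhds 0)"
  proof -
    have "L2_norm (\<lambda>x. p t (x + 0) - p t x) = 0" by simp
    then show ?thesis using L2_shift_continuous[OF pL2[OF t]] by (simp add: tendsto_nhds_iff)
  qed
  show "((\<lambda>s. L2_norm (\<lambda>x. p s x - p t x)) \<longlongrightarrow> 0) (at t within {0..})"
  proof (rule Lim_null_comparison)
    show "\<forall>\<^sub>F s in at t within {0..}. norm (L2_norm (\<lambda>x. p s x - p t x))
      \<le> L2_norm (\<lambda>x. p t (x + - c * (s - t)) - p t x) + \<bar>s - t\<bar> * B"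
      unfolding eventually_at using main by (intro exI[of _ 1]) (auto simp: dist_real_def)
    have "((\<lambda>s. - c * (s - t)) \<longlongrightarrow> - c * (t - t)) (at t within {0..})" by (intro tendsto_intros)
    then have "filterlim (\<lambda>s. - c * (s - t)) (nhds 0) (at t within {0..})" by simp
    from filterlim_compose[OF lim this]
    have "((\<lambda>s. L2_norm (\<lambda>x. p t (x + - c * (s - t)) - p t x) + \<bar>s - t\<bar> * B) \<longlongrightarrow> 0 + \<bar>t - t\<bar> * B) (at t within {0..})"
      by (intro tendsto_intros)
    then show "((\<lambda>s. L2_norm (\<lambda>x. p t (x + - c * (s - t)) - p t x) + \<bar>s - t\<bar> * B) \<longlongrightarrow> 0) (at t within {0..})" by simp
  qed
qed

lemma rhs_Lipschitz:
  assumes "cmod u \<le> R" "cmod v \<le> R" "cmod u' \<le> R" "cmod v' \<le> R" "m \<ge> 0"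
  shows "cmod (rhs m a u v - rhs m a u' v') \<le> (m + 2 * coeff_bound a * R\<^sup>2) * (cmod (u - u') + cmod (v - v'))"
proof -
  have "rhs m a u v - rhs m a u' v' = \<i> * (of_real m * (v - v') - (N1 a u v - N1 a u' v'))"
    by (simp add: rhs_def algebra_simps)
  then have "cmod (rhs m a u v - rhs m a u' v') = cmod (of_real m * (v - v') - (N1 a u v - N1 a u' v'))"
    by (simp add: norm_mult)
  also have "\<dots> \<le> m * cmod (v - v') + 2 * coeff_bound a * R\<^sup>2 * (cmod (u - u') + cmod (v - v'))"
  proof (rule order_trans[OF norm_triangle_ineq4 add_mono])
    show "cmod (of_real m * (v - v')) \<le> m * cmod (v - v')" unfolding norm_mult norm_of_real using assms(5) by simp
  qed (rule N1_Lipschitz[OF assms(1-4)])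
  also have "\<dots> \<le> (m + 2 * coeff_bound a * R\<^sup>2) * (cmod (u - u') + cmod (v - v'))"
    using mult_nonneg_nonneg[OF assms(5) norm_ge_zero[of "u - u'"]] by (simp add: algebra_simps)
  finally show ?thesis .
qed

text \<open>The derivative of \<open>rhs\<close>, a real-linear map of the last two arguments.\<close>

definition rhs_deriv :: "real \<Rightarrow> (nat \<Rightarrow> complex) \<Rightarrow> complex \<Rightarrow> complex \<Rightarrow> complex \<Rightarrow> complex \<Rightarrow> complex" where
  "rhs_deriv m a u v x y = \<i> * (of_real m * y - (trilinear a x v v + trilinear a u y v + trilinear a u v y))"

lemma rhs_deriv_diff: "rhs_deriv m a u v (x - x') (y - y') = rhs_deriv m a u v x y - rhs_deriv m a u v x' y'"
  unfolding rhs_deriv_def trilinear_def by (simp add: algebra_simps)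

lemma rhs_deriv_scale: "rhs_deriv m a u v (of_real k * x) (of_real k * y) = of_real k * rhs_deriv m a u v x y"
  unfolding rhs_deriv_def trilinear_def by (simp add: algebra_simps)

lemma rhs_deriv_bound:
  assumes "cmod u \<le> R" "cmod v \<le> R" "m \<ge> 0"
  shows "cmod (rhs_deriv m a u v x y) \<le> (m + 2 * coeff_bound a * R\<^sup>2) * (cmod x + cmod y)"
proof -
  have "cmod (rhs_deriv m a u v x y) = cmod (of_real m * y - (trilinear a x v v + trilinear a u y v + trilinear a u v y))"
    unfolding rhs_deriv_def norm_mult by simp
  also have "\<dots> \<le> m * cmod y + (coeff_bound a * (cmod x * R * R) + coeff_bound a * (R * cmod y * R) + coeff_bound a * (R * R * cmod y))"
  proof (rule order_trans[OF norm_triangle_ineq4 add_mono])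
    show "cmod (of_real m * y) \<le> m * cmod y" unfolding norm_mult norm_of_real using assms(3) by simp
    show "cmod (trilinear a x v v + trilinear a u y v + trilinear a u v y)
      \<le> coeff_bound a * (cmod x * R * R) + coeff_bound a * (R * cmod y * R) + coeff_bound a * (R * R * cmod y)"
      by (intro order_trans[OF norm_triangle_ineq] add_mono trilinear_mono_bound assms order_refl)
  qed
  also have "\<dots> \<le> (m + 2 * coeff_bound a * R\<^sup>2) * (cmod x + cmod y)"
    using mult_nonneg_nonneg[OF assms(3) norm_ge_zero[of x]]
      mult_nonneg_nonneg[OF mult_nonneg_nonneg[OF coeff_bound_nonneg[of a] zero_le_power2[of R]] norm_ge_zero[of x]]
    by (simp add: power2_eq_square algebra_simps)
  finally show ?thesis .
qed

lemma rhs_taylor: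
  assumes "cmod u \<le> R" "cmod v \<le> R" "cmod x \<le> 2 * R" "cmod y \<le> 2 * R"
  shows "cmod (rhs m a (u + x) (v + y) - rhs m a u v - rhs_deriv m a u v x y)
    \<le> 3 * coeff_bound a * R * (cmod x + cmod y)\<^sup>2"
proof -
  have "rhs m a (u + x) (v + y) - rhs m a u v - rhs_deriv m a u v x y
    = - \<i> * (trilinear a x y v + trilinear a x v y + trilinear a u y y + trilinear a x y y)"
    unfolding rhs_def N1_trilinear rhs_deriv_def trilinear_def by (simp add: algebra_simps)
  then have "cmod (rhs m a (u + x) (v + y) - rhs m a u v - rhs_deriv m a u v x y)
    = cmod (trilinear a x y v + trilinear a x v y + trilinear a u y y + trilinear a x y y)"
    by (simp only: norm_mult norm_minus_cancel norm_ii mult_1)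
  also have "\<dots> \<le> coeff_bound a * (cmod x * cmod y * R) + coeff_bound a * (cmod x * R * cmod y)
      + coeff_bound a * (R * cmod y * cmod y) + coeff_bound a * (2 * R * cmod y * cmod y)"
    by (intro order_trans[OF norm_triangle_ineq] add_mono trilinear_mono_bound assms order_refl)
  also have "\<dots> \<le> 3 * coeff_bound a * R * (cmod x + cmod y)\<^sup>2"
  proof -
    have "0 \<le> coeff_bound a * R" using coeff_bound_nonneg[of a] order_trans[OF norm_ge_zero assms(1)] by simp
    then have "0 \<le> (coeff_bound a * R) * (3 * (cmod x * cmod x) + 4 * (cmod x * cmod y))"
      by (rule mult_nonneg_nonneg) (intro add_nonneg_nonneg mult_nonneg_nonneg norm_ge_zero, auto)
    then show ?thesis by (simp add: power2_eq_square algebra_simps)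
  qed
  finally show ?thesis .
qed

lemma L2_mild_estimate_homogeneous:
  assumes "cont2 p" "cont2 q" "cont2 f" "cont2 g" "mild 1 p f" "mild (- 1) q g" "0 \<le> K" "0 \<le> T"
    and "\<And>t x. t \<in> {0..T} \<Longrightarrow> cmod (f t x) \<le> K * (cmod (p t x) + cmod (q t x))"
      "\<And>t x. t \<in> {0..T} \<Longrightarrow> cmod (g t x) \<le> K * (cmod (p t x) + cmod (q t x))"
    and "energy (p 0) \<le> ennreal (a\<^sup>2)" "energy (q 0) \<le> ennreal (a\<^sup>2)" "0 \<le> a" and "t \<in> {0..T}"
  shows "p t \<in> L2" "q t \<in> L2" "L2_norm (p t) \<le> growth K T * a" "L2_norm (q t) \<le> growth K T * a"
proof -
  have c: "cont2 (\<lambda>t x. 0 :: real)" by (simp add: cont2_def)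
  have e: "energy (\<lambda>x. of_real 0) \<le> ennreal (0\<^sup>2)" by (simp add: energy_def)
  have b: "cmod (f t x) \<le> K * (cmod (p t x) + cmod (q t x)) + 0" "cmod (g t x) \<le> K * (cmod (p t x) + cmod (q t x)) + 0"
    if "t \<in> {0..T}" for t x using assms(9,10)[OF that] by simp_all
  note est = L2_mild_estimate[OF assms(1-4) c assms(5-8) b assms(11-13) e order_refl assms(14)]
  show "p t \<in> L2" "q t \<in> L2" by (rule est(1), assumption+) (rule est(2), assumption+)
  show "L2_norm (p t) \<le> growth K T * a" using est(3) by simp
  show "L2_norm (q t) \<le> growth K T * a" using est(4) by simp
qed

text \<open>A locally bounded solution of the integrated system with data in \<open>H\<^sup>1\<close>. The Hoelder condition
  holds for the continuous representatives of such data, with the \<open>L\<^sup>2\<close> norms of the weak derivatives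
  as constants.\<close>

locale bounded_mild_solution =
  fixes m :: real and \<alpha> \<beta> :: "nat \<Rightarrow> complex" and u v :: "real \<Rightarrow> real \<Rightarrow> complex"
    and bd :: "real \<Rightarrow> real" and A :: real
  assumes m: "m \<ge> 0" and cu: "cont2 u" and cv: "cont2 v"
    and mild_u: "mild 1 u (\<lambda>t x. rhs m \<alpha> (u t x) (v t x))"
    and mild_v: "mild (- 1) v (\<lambda>t x. rhs m \<beta> (v t x) (u t x))"
    and bound: "\<And>T t x. t \<in> {0..T} \<Longrightarrow> cmod (u t x) + cmod (v t x) \<le> bd T"
    and H1_data: "u 0 \<in> H1" "v 0 \<in> H1"
    and Hoelder_data: "\<And>x y. cmod (u 0 x - u 0 y) \<le> sqrt \<bar>x - y\<bar> * A" "\<And>x y. cmod (v 0 x - v 0 y) \<le> sqrt \<bar>x - y\<bar> * A"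
begin

definition f where "f t x = rhs m \<alpha> (u t x) (v t x)"
definition g where "g t x = rhs m \<beta> (v t x) (u t x)"
definition lip where "lip T = m + 2 * (coeff_bound \<alpha> + coeff_bound \<beta>) * (bd T)\<^sup>2"

lemma cf: "cont2 f" and cg: "cont2 g"
  using cu cv unfolding cont2_def f_def g_def rhs_def by (intro continuous_intros; simp)+

lemma mild_uf: "mild 1 u f" and mild_vg: "mild (- 1) v g"
  using mild_u mild_v by (simp_all add: f_def[abs_def] g_def[abs_def])

lemma component_bounds:
  assumes "t \<in> {0..T}" shows "cmod (u t x) \<le> bd T" "cmod (v t x) \<le> bd T" "0 \<le> bd T"
  using bound[OF assms, of x] norm_ge_zero[of "u t x"] norm_ge_zero[of "v t x"] by linarith+

lemma A_nonneg: "0 \<le> A"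
  using order_trans[OF norm_ge_zero Hoelder_data(1)[of 1 0]] by simp

lemma lip_le: "m + 2 * coeff_bound \<alpha> * (bd T)\<^sup>2 \<le> lip T" "m + 2 * coeff_bound \<beta> * (bd T)\<^sup>2 \<le> lip T"
  and lip_nonneg: "0 \<le> lip T"
  using m mult_nonneg_nonneg[OF coeff_bound_nonneg[of \<alpha>] zero_le_power2[of "bd T"]]
    mult_nonneg_nonneg[OF coeff_bound_nonneg[of \<beta>] zero_le_power2[of "bd T"]]
  by (simp_all add: lip_def algebra_simps)

lemma source_Lipschitz:
  assumes "t \<in> {0..T}" "s \<in> {0..T}"
  shows "cmod (f t x - f s y) \<le> lip T * (cmod (u t x - u s y) + cmod (v t x - v s y))"
    and "cmod (g t x - g s y) \<le> lip T * (cmod (u t x - u s y) + cmod (v t x - v s y))"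
proof -
  note b = component_bounds[OF assms(1)] component_bounds[OF assms(2)]
  show "cmod (f t x - f s y) \<le> lip T * (cmod (u t x - u s y) + cmod (v t x - v s y))"
    unfolding f_def
    by (rule order_trans[OF rhs_Lipschitz[OF b(1,2) b(4,5) m] mult_right_mono[OF lip_le(1)]]) simp
  show "cmod (g t x - g s y) \<le> lip T * (cmod (u t x - u s y) + cmod (v t x - v s y))"
    unfolding g_def add.commute[of "cmod (u t x - u s y)"]
    by (rule order_trans[OF rhs_Lipschitz[OF b(2,1) b(5,4) m] mult_right_mono[OF lip_le(2)]]) simp
qed

lemma source_bound:
  assumes "t \<in> {0..T}"
  shows "cmod (f t x) \<le> lip T * (cmod (u t x) + cmod (v t x))"
    and "cmod (g t x) \<le> lip T * (cmod (u t x) + cmod (v t x))"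
proof -
  note b = component_bounds(1)[OF assms, of x] component_bounds(2)[OF assms, of x] component_bounds(3)[OF assms]
  have z: "cmod 0 \<le> bd T" using b(3) by simp
  have r0: "rhs m a 0 0 = 0" for a by (simp add: rhs_def N1_def)
  show "cmod (f t x) \<le> lip T * (cmod (u t x) + cmod (v t x))"
    using order_trans[OF rhs_Lipschitz[OF b(1,2) z z m, of \<alpha>] mult_right_mono[OF lip_le(1)]] by (simp add: f_def r0)
  show "cmod (g t x) \<le> lip T * (cmod (u t x) + cmod (v t x))"
    using order_trans[OF rhs_Lipschitz[OF b(2,1) z z m, of \<beta>] mult_right_mono[OF lip_le(2)]] by (simp add: g_def r0 add.commute)
qed

lemma L2_bounds:
  assumes T: "0 \<le> T"
  shows "\<exists>B\<ge>0. \<forall>t\<in>{0..T}. u t \<in> L2 \<and> v t \<in> L2 \<and> L2_norm (u t) \<le> B \<and> L2_norm (v t) \<le> B"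
proof -
  define a where "a = L2_norm (u 0) + L2_norm (v 0)"
  have a: "energy (u 0) \<le> ennreal (a\<^sup>2)" "energy (v 0) \<le> ennreal (a\<^sup>2)" "0 \<le> a"
    by (auto simp: a_def intro!: energy_le_norm H1_L2 H1_data)
  note est = L2_mild_estimate_homogeneous[OF cu cv cf cg mild_uf mild_vg lip_nonneg T source_bound a]
  have "0 \<le> growth (lip T) T * a" using a(3) by (simp add: growth_def)
  then show ?thesis using est by blast
qed

lemma uL2: "t \<ge> 0 \<Longrightarrow> u t \<in> L2" and vL2: "t \<ge> 0 \<Longrightarrow> v t \<in> L2"
  using L2_bounds[of t] by force+

lemma source_L2_bounds:
  assumes T: "0 \<le> T"
  shows "\<exists>B\<ge>0. \<forall>t\<in>{0..T}. f t \<in> L2 \<and> L2_norm (f t) \<le> B" "\<exists>B\<ge>0. \<forall>t\<in>{0..T}. g t \<in> L2 \<and> L2_norm (g t) \<le> B"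
proof -
  obtain B where B: "B \<ge> 0" "\<And>t. t \<in> {0..T} \<Longrightarrow> u t \<in> L2 \<and> v t \<in> L2 \<and> L2_norm (u t) \<le> B \<and> L2_norm (v t) \<le> B"
    using L2_bounds[OF T] by blast
  have le: "lip T * (L2_norm (u t) + L2_norm (v t)) \<le> lip T * (B + B)" if "t \<in> {0..T}" for t
    using B(2)[OF that] lip_nonneg by (intro mult_left_mono add_mono) auto
  have "f t \<in> L2 \<and> L2_norm (f t) \<le> lip T * (B + B)" "g t \<in> L2 \<and> L2_norm (g t) \<le> lip T * (B + B)" if t: "t \<in> {0..T}" for t
  proof -
    have uv: "u t \<in> L2" "v t \<in> L2" using B(2)[OF t] by auto
    show "f t \<in> L2 \<and> L2_norm (f t) \<le> lip T * (B + B)"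
      using L2_norm_le_sum[OF uv cont2_measurable(1)[OF cf] source_bound(1)[OF t] lip_nonneg] le[OF t] by auto
    show "g t \<in> L2 \<and> L2_norm (g t) \<le> lip T * (B + B)"
      using L2_norm_le_sum[OF uv cont2_measurable(1)[OF cg] source_bound(2)[OF t] lip_nonneg] le[OF t] by auto
  qed
  moreover have "0 \<le> lip T * (B + B)" using B(1) lip_nonneg by simp
  ultimately show "\<exists>B\<ge>0. \<forall>t\<in>{0..T}. f t \<in> L2 \<and> L2_norm (f t) \<le> B" "\<exists>B\<ge>0. \<forall>t\<in>{0..T}. g t \<in> L2 \<and> L2_norm (g t) \<le> B"
    by blast+
qed

lemma curves: "cont_curve L2 L2_norm u" "cont_curve L2 L2_norm v"
  by (rule mild_L2_continuous[OF cf mild_uf uL2 source_L2_bounds(1)], assumption+)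
     (rule mild_L2_continuous[OF cg mild_vg vL2 source_L2_bounds(2)], assumption+)

lemma diff_quot_source_bound:
  assumes "t \<in> {0..T}"
  shows "cmod (diff_quot h (f t) x) \<le> lip T * (cmod (diff_quot h (u t) x) + cmod (diff_quot h (v t) x))"
    and "cmod (diff_quot h (g t) x) \<le> lip T * (cmod (diff_quot h (u t) x) + cmod (diff_quot h (v t) x))"
  using source_Lipschitz[OF assms assms, of "x + h" x]
  by (simp_all add: diff_quot_def norm_divide add_divide_distrib[symmetric] divide_right_mono)

definition osc where "osc T = 4 * A * exp ((4 * lip T + 1) * T)"

lemma osc_nonneg: "0 \<le> osc T"
  using A_nonneg by (simp add: osc_def)

text \<open>The sources of the system that the difference quotients solve are at most a multiple of them,
  so the bound
  \<open>A / \<surd>|h|\<close> that the Hoelder condition gives at time zero is propagated.\<close>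

lemma oscillation:
  assumes t: "t \<in> {0..T}"
  shows "cmod (u t (x + h) - u t x) + cmod (v t (x + h) - v t x) \<le> osc T * sqrt \<bar>h\<bar>"
proof (cases "h = 0")
  case False
  have data: "cmod (diff_quot h (u 0) x) \<le> sqrt \<bar>h\<bar> * A / \<bar>h\<bar>" "cmod (diff_quot h (v 0) x) \<le> sqrt \<bar>h\<bar> * A / \<bar>h\<bar>" for x
    using Hoelder_data(1)[of "x + h" x] Hoelder_data(2)[of "x + h" x]
    by (simp_all add: diff_quot_def norm_divide divide_right_mono)
  have bdd: "cmod (diff_quot h (u t) x) + cmod (diff_quot h (v t) x) \<le> 2 * bd T / \<bar>h\<bar>" if "t \<in> {0..T}" for t x
  proof -
    have "cmod (u t (x + h) - u t x) + cmod (v t (x + h) - v t x) \<le> (cmod (u t (x + h)) + cmod (u t x)) + (cmod (v t (x + h)) + cmod (v t x))"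
      by (intro add_mono norm_triangle_ineq4)
    also have "\<dots> \<le> 2 * bd T" using bound[OF that, of x] bound[OF that, of "x + h"] by simp
    finally show ?thesis by (simp add: diff_quot_def norm_divide add_divide_distrib[symmetric] divide_right_mono)
  qed
  have "cmod (diff_quot h (u t) x) + cmod (diff_quot h (v t) x) \<le> 4 * (sqrt \<bar>h\<bar> * A / \<bar>h\<bar>) * exp ((4 * lip T + 1) * T)"
    by (rule sup_mild_estimate[OF cont2_diff_quot[OF cf] cont2_diff_quot[OF cg] mild_diff_quot[OF mild_uf cf]
          mild_diff_quot[OF mild_vg cg] lip_nonneg bdd diff_quot_source_bound data t])
  then have "(cmod (u t (x + h) - u t x) + cmod (v t (x + h) - v t x)) / \<bar>h\<bar> \<le> (osc T * sqrt \<bar>h\<bar>) / \<bar>h\<bar>"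
    by (simp add: diff_quot_def norm_divide add_divide_distrib osc_def mult_ac)
  then show ?thesis using False by (simp add: divide_le_cancel)
qed simp

lemma data_diff_quot_near:
  assumes "\<epsilon> > 0"
  shows "\<exists>\<delta>>0. \<forall>h. 0 < \<bar>h\<bar> \<and> \<bar>h\<bar> < \<delta> \<longrightarrow>
    L2_norm (\<lambda>x. diff_quot h (u 0) x - weak_deriv (u 0) x) < \<epsilon> \<and> L2_norm (\<lambda>x. diff_quot h (v 0) x - weak_deriv (v 0) x) < \<epsilon>"
proof -
  obtain d1 where d1: "d1 > 0" "\<And>h. h \<noteq> 0 \<Longrightarrow> \<bar>h\<bar> < d1 \<Longrightarrow> L2_norm (\<lambda>x. diff_quot h (u 0) x - weak_deriv (u 0) x) < \<epsilon>"
    using LIM_D[OF H1_diff_quot_limit[OF H1_data(1)] assms] by auto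
  obtain d2 where d2: "d2 > 0" "\<And>h. h \<noteq> 0 \<Longrightarrow> \<bar>h\<bar> < d2 \<Longrightarrow> L2_norm (\<lambda>x. diff_quot h (v 0) x - weak_deriv (v 0) x) < \<epsilon>"
    using LIM_D[OF H1_diff_quot_limit[OF H1_data(2)] assms] by auto
  show ?thesis using d1 d2 by (intro exI[of _ "min d1 d2"]) auto
qed

text \<open>At time zero the difference quotients are close to the weak derivatives, and the \<open>L\<^sup>2\<close>
  estimate propagates the resulting bound.\<close>

lemma diff_quot_bounded:
  assumes T: "0 \<le> T"
  shows "\<exists>D\<ge>0. \<exists>\<delta>>0. \<forall>h. 0 < \<bar>h\<bar> \<and> \<bar>h\<bar> < \<delta> \<longrightarrow> (\<forall>t\<in>{0..T}. L2_norm (diff_quot h (u t)) \<le> D \<and> L2_norm (diff_quot h (v t)) \<le> D)"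
proof -
  define a where "a = L2_norm (weak_deriv (u 0)) + L2_norm (weak_deriv (v 0)) + 1"
  have a: "0 \<le> a" by (simp add: a_def add_nonneg_nonneg)
  obtain \<delta> where \<delta>: "\<delta> > 0" "\<And>h. 0 < \<bar>h\<bar> \<Longrightarrow> \<bar>h\<bar> < \<delta> \<Longrightarrow>
    L2_norm (\<lambda>x. diff_quot h (u 0) x - weak_deriv (u 0) x) < 1 \<and> L2_norm (\<lambda>x. diff_quot h (v 0) x - weak_deriv (v 0) x) < 1"
    using data_diff_quot_near[of 1] by auto
  have near: "L2_norm w \<le> a" if "w \<in> L2" "z \<in> L2" "L2_norm (\<lambda>x. w x - z x) < 1" "L2_norm z + 1 \<le> a" for w z
    using L2_norm_triangle[OF L2_diff[OF that(1,2)] that(2)] that(3,4) by simp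
  have est: "L2_norm (diff_quot h (u t)) \<le> growth (lip T) T * a \<and> L2_norm (diff_quot h (v t)) \<le> growth (lip T) T * a"
    if h: "0 < \<bar>h\<bar>" "\<bar>h\<bar> < \<delta>" and t: "t \<in> {0..T}" for h t
  proof -
    have "energy (diff_quot h (u 0)) \<le> ennreal (a\<^sup>2)"
      using \<delta>(2)[OF h] by (intro energy_le_norm near[of _ "weak_deriv (u 0)"] diff_quot_L2 weak_deriv_props H1_L2 H1_data)
        (auto simp: a_def)
    moreover have "energy (diff_quot h (v 0)) \<le> ennreal (a\<^sup>2)"
      using \<delta>(2)[OF h] by (intro energy_le_norm near[of _ "weak_deriv (v 0)"] diff_quot_L2 weak_deriv_props H1_L2 H1_data)
        (auto simp: a_def)
    ultimately show ?thesis
      using L2_mild_estimate_homogeneous(3,4)[OF cont2_diff_quot[OF cu] cont2_diff_quot[OF cv] cont2_diff_quot[OF cf] cont2_diff_quot[OF cg]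
          mild_diff_quot[OF mild_uf cf] mild_diff_quot[OF mild_vg cg] lip_nonneg T diff_quot_source_bound _ _ a t] by blast
  qed
  have "0 \<le> growth (lip T) T * a" using a by (simp add: growth_def)
  then show ?thesis using \<delta>(1) est by blast
qed

text \<open>The difference quotient of the source is its derivative applied to the difference quotients
  of the solution, up to a remainder made small by the modulus of continuity.\<close>

lemma diff_quot_source_taylor:
  assumes t: "t \<in> {0..T}" and h: "h \<noteq> 0"
  shows "cmod (diff_quot h (f t) x - rhs_deriv m \<alpha> (u t x) (v t x) (diff_quot h (u t) x) (diff_quot h (v t) x))
      \<le> 3 * (coeff_bound \<alpha> + coeff_bound \<beta>) * bd T * osc T * sqrt \<bar>h\<bar> * (cmod (diff_quot h (u t) x) + cmod (diff_quot h (v t) x))"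
    and "cmod (diff_quot h (g t) x - rhs_deriv m \<beta> (v t x) (u t x) (diff_quot h (v t) x) (diff_quot h (u t) x))
      \<le> 3 * (coeff_bound \<alpha> + coeff_bound \<beta>) * bd T * osc T * sqrt \<bar>h\<bar> * (cmod (diff_quot h (u t) x) + cmod (diff_quot h (v t) x))"
proof -
  define y z where "y = u t (x + h) - u t x" and "z = v t (x + h) - v t x"
  define d where "d = cmod y + cmod z"
  note b = component_bounds[OF t]
  have yz: "cmod y \<le> 2 * bd T" "cmod z \<le> 2 * bd T"
    unfolding y_def z_def using norm_triangle_ineq4[of "u t (x + h)" "u t x"] norm_triangle_ineq4[of "v t (x + h)" "v t x"]
      b(1)[of x] b(1)[of "x + h"] b(2)[of x] b(2)[of "x + h"] by linarith+
  have d: "0 \<le> d" "d \<le> osc T * sqrt \<bar>h\<bar>" using oscillation[OF t, of x h] by (auto simp: d_def y_def z_def)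
  have dq: "diff_quot h (u t) x = of_real (1 / h) * y" "diff_quot h (v t) x = of_real (1 / h) * z"
    by (simp_all add: diff_quot_def y_def z_def)
  have key: "cmod w / \<bar>h\<bar> \<le> 3 * (coeff_bound \<alpha> + coeff_bound \<beta>) * bd T * osc T * sqrt \<bar>h\<bar> * (d / \<bar>h\<bar>)"
    if w: "cmod w \<le> 3 * c * bd T * d\<^sup>2" and c: "c \<le> coeff_bound \<alpha> + coeff_bound \<beta>" for w c
  proof -
    have "cmod w \<le> 3 * (coeff_bound \<alpha> + coeff_bound \<beta>) * bd T * d\<^sup>2"
      using w by (rule order_trans) (intro mult_right_mono mult_left_mono c b(3), auto)
    also have "\<dots> = 3 * (coeff_bound \<alpha> + coeff_bound \<beta>) * bd T * d * d" by (simp add: power2_eq_square)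
    also have "\<dots> \<le> 3 * (coeff_bound \<alpha> + coeff_bound \<beta>) * bd T * (osc T * sqrt \<bar>h\<bar>) * d"
      using d b(3) coeff_bound_nonneg[of \<alpha>] coeff_bound_nonneg[of \<beta>] by (intro mult_right_mono mult_left_mono) auto
    finally have "cmod w / \<bar>h\<bar> \<le> (3 * (coeff_bound \<alpha> + coeff_bound \<beta>) * bd T * (osc T * sqrt \<bar>h\<bar>) * d) / \<bar>h\<bar>"
      by (rule divide_right_mono) simp
    then show ?thesis by (simp add: mult_ac)
  qed
  have nd: "cmod (diff_quot h (u t) x) + cmod (diff_quot h (v t) x) = d / \<bar>h\<bar>"
    unfolding dq by (simp add: norm_mult norm_divide d_def add_divide_distrib)
  have "diff_quot h (f t) x - rhs_deriv m \<alpha> (u t x) (v t x) (diff_quot h (u t) x) (diff_quot h (v t) x)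
    = (rhs m \<alpha> (u t x + y) (v t x + z) - rhs m \<alpha> (u t x) (v t x) - rhs_deriv m \<alpha> (u t x) (v t x) y z) / of_real h"
    unfolding dq rhs_deriv_scale by (simp add: diff_quot_def f_def y_def z_def diff_divide_distrib)
  then show "cmod (diff_quot h (f t) x - rhs_deriv m \<alpha> (u t x) (v t x) (diff_quot h (u t) x) (diff_quot h (v t) x))
      \<le> 3 * (coeff_bound \<alpha> + coeff_bound \<beta>) * bd T * osc T * sqrt \<bar>h\<bar> * (cmod (diff_quot h (u t) x) + cmod (diff_quot h (v t) x))"
    using key[OF rhs_taylor[OF b(1,2) yz, of m \<alpha> x x, folded d_def]] coeff_bound_nonneg[of \<beta>]
    unfolding nd by (simp add: norm_divide)
  have "diff_quot h (g t) x - rhs_deriv m \<beta> (v t x) (u t x) (diff_quot h (v t) x) (diff_quot h (u t) x)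
    = (rhs m \<beta> (v t x + z) (u t x + y) - rhs m \<beta> (v t x) (u t x) - rhs_deriv m \<beta> (v t x) (u t x) z y) / of_real h"
    unfolding dq rhs_deriv_scale by (simp add: diff_quot_def g_def y_def z_def diff_divide_distrib)
  then show "cmod (diff_quot h (g t) x - rhs_deriv m \<beta> (v t x) (u t x) (diff_quot h (v t) x) (diff_quot h (u t) x))
      \<le> 3 * (coeff_bound \<alpha> + coeff_bound \<beta>) * bd T * osc T * sqrt \<bar>h\<bar> * (cmod (diff_quot h (u t) x) + cmod (diff_quot h (v t) x))"
    using key[OF rhs_taylor[OF b(2,1) yz(2,1), of m \<beta> x x, unfolded add.commute[of "cmod z"], folded d_def]] coeff_bound_nonneg[of \<alpha>]
    unfolding nd by (simp add: norm_divide)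
qed

end

text \<open>Completeness of \<open>L\<^sup>2\<close> yields the limit at each time, and letting \<open>k \<longlongrightarrow> 0\<close> in the Cauchy condition
  keeps the rate uniform in time.\<close>

lemma uniform_diff_quot_H1:
  fixes p :: "real \<Rightarrow> real \<Rightarrow> complex"
  assumes L2: "\<And>t. t \<in> S \<Longrightarrow> p t \<in> L2"
    and Cauchy: "\<And>\<epsilon>. \<epsilon> > 0 \<Longrightarrow> \<exists>\<delta>>0. \<forall>h k. 0 < \<bar>h\<bar> \<and> \<bar>h\<bar> < \<delta> \<and> 0 < \<bar>k\<bar> \<and> \<bar>k\<bar> < \<delta> \<longrightarrow>
      (\<forall>t\<in>S. L2_norm (\<lambda>x. diff_quot h (p t) x - diff_quot k (p t) x) \<le> \<epsilon>)"
  shows "\<And>t. t \<in> S \<Longrightarrow> p t \<in> H1"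
    and "\<And>\<epsilon>. \<epsilon> > 0 \<Longrightarrow> \<exists>\<delta>>0. \<forall>h t. 0 < \<bar>h\<bar> \<and> \<bar>h\<bar> < \<delta> \<and> t \<in> S \<longrightarrow>
      L2_norm (\<lambda>x. diff_quot h (p t) x - weak_deriv (p t) x) \<le> \<epsilon>"
proof -
  show H1: "p t \<in> H1" if t: "t \<in> S" for t
  proof -
    have "\<exists>\<delta>>0. \<forall>h k. 0 < \<bar>h\<bar> \<and> \<bar>h\<bar> < \<delta> \<and> 0 < \<bar>k\<bar> \<and> \<bar>k\<bar> < \<delta> \<longrightarrow>
      L2_norm (\<lambda>x. diff_quot h (p t) x - diff_quot k (p t) x) \<le> \<epsilon>" if "\<epsilon> > 0" for \<epsilon> :: real
      using Cauchy[OF that] t by blast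
    from L2_complete_at_0[OF diff_quot_L2[OF L2[OF t]] this]
    obtain g where "g \<in> L2" "((\<lambda>h. L2_norm (\<lambda>x. diff_quot h (p t) x - g x)) \<longlongrightarrow> 0) (at 0)" by blast
    then show ?thesis by (rule H1_if_diff_quot_limit(1)[OF L2[OF t]])
  qed
  show "\<exists>\<delta>>0. \<forall>h t. 0 < \<bar>h\<bar> \<and> \<bar>h\<bar> < \<delta> \<and> t \<in> S \<longrightarrow>
      L2_norm (\<lambda>x. diff_quot h (p t) x - weak_deriv (p t) x) \<le> \<epsilon>" if e: "\<epsilon> > 0" for \<epsilon>
  proof -
    obtain \<delta> where \<delta>: "\<delta> > 0" "\<And>h k t. 0 < \<bar>h\<bar> \<Longrightarrow> \<bar>h\<bar> < \<delta> \<Longrightarrow> 0 < \<bar>k\<bar> \<Longrightarrow> \<bar>k\<bar> < \<delta> \<Longrightarrow> t \<in> S \<Longrightarrow>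
      L2_norm (\<lambda>x. diff_quot h (p t) x - diff_quot k (p t) x) \<le> \<epsilon>"
      using Cauchy[OF e] by blast
    have "L2_norm (\<lambda>x. diff_quot h (p t) x - weak_deriv (p t) x) \<le> \<epsilon>" if h: "0 < \<bar>h\<bar>" "\<bar>h\<bar> < \<delta>" and t: "t \<in> S" for h t
    proof (rule field_le_epsilon)
      fix e :: real assume "e > 0"
      from LIM_D[OF H1_diff_quot_limit[OF H1[OF t]] this] obtain d where d: "d > 0"
        "\<And>k. k \<noteq> 0 \<Longrightarrow> \<bar>k\<bar> < d \<Longrightarrow> L2_norm (\<lambda>x. diff_quot k (p t) x - weak_deriv (p t) x) < e" by auto
      define k where "k = min \<delta> d / 2"
      have k: "0 < \<bar>k\<bar>" "\<bar>k\<bar> < \<delta>" "\<bar>k\<bar> < d" "k \<noteq> 0" using \<delta>(1) d(1) by (auto simp: k_def)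
      have "L2_norm (\<lambda>x. diff_quot h (p t) x - weak_deriv (p t) x)
        \<le> L2_norm (\<lambda>x. diff_quot h (p t) x - diff_quot k (p t) x) + L2_norm (\<lambda>x. diff_quot k (p t) x - weak_deriv (p t) x)"
        by (intro L2_norm_triangle3 diff_quot_L2 weak_deriv_props L2 H1 t)
      then show "L2_norm (\<lambda>x. diff_quot h (p t) x - weak_deriv (p t) x) \<le> \<epsilon> + e"
        using \<delta>(2)[OF h k(1,2) t] d(2)[OF k(4,3)] by linarith
    qed
    then show ?thesis using \<delta>(1) by blast
  qed
qed

context bounded_mild_solution
begin

text \<open>The quotients with steps \<open>h\<close> and \<open>k\<close> obey the linearisation of the system at the same point
  \<open>(u, v)\<close>, so their difference solves that linear system with the two Taylor remainders as forcing.
  A remainder is the modulus of continuity \<open>\<surd>|h|\<close> times difference quotients of bounded norm, hence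
  small in \<open>L\<^sup>2\<close>, and the data differ little because the difference quotients of \<open>H\<^sup>1\<close> data converge.\<close>

lemma diff_quot_Cauchy:
  assumes T: "0 \<le> T" and e: "\<epsilon> > 0"
  shows "\<exists>\<delta>>0. \<forall>h k. 0 < \<bar>h\<bar> \<and> \<bar>h\<bar> < \<delta> \<and> 0 < \<bar>k\<bar> \<and> \<bar>k\<bar> < \<delta> \<longrightarrow>
    (\<forall>t\<in>{0..T}. L2_norm (\<lambda>x. diff_quot h (u t) x - diff_quot k (u t) x) \<le> \<epsilon>
      \<and> L2_norm (\<lambda>x. diff_quot h (v t) x - diff_quot k (v t) x) \<le> \<epsilon>)"
proof -
  define G where "G = growth (lip T) T"
  have G: "0 \<le> G" by (simp add: G_def growth_def)
  define M where "M = 3 * (coeff_bound \<alpha> + coeff_bound \<beta>) * bd T * osc T"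
  have "0 \<le> bd T" using component_bounds(3)[of 0 T] T by simp
  then have M: "0 \<le> M" unfolding M_def using coeff_bound_nonneg osc_nonneg by (simp add: add_nonneg_nonneg)
  obtain D \<delta>1 where D: "D \<ge> 0" "\<delta>1 > 0" "\<And>h t. 0 < \<bar>h\<bar> \<Longrightarrow> \<bar>h\<bar> < \<delta>1 \<Longrightarrow> t \<in> {0..T} \<Longrightarrow>
      L2_norm (diff_quot h (u t)) \<le> D \<and> L2_norm (diff_quot h (v t)) \<le> D"
    using diff_quot_bounded[OF T] by blast
  \<comment> \<open>\<open>\<eta>\<close> bounds both the data and the forcing, which enter the estimate with the factor \<open>G\<close>.\<close>
  define \<eta> where "\<eta> = \<epsilon> / (2 * (G + 1))"
  have \<eta>: "\<eta> > 0" using e G by (simp add: \<eta>_def)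
  then have "\<eta> / 2 > 0" by simp
  from data_diff_quot_near[OF this] obtain \<delta>2 where \<delta>2: "\<delta>2 > 0" "\<And>h. 0 < \<bar>h\<bar> \<Longrightarrow> \<bar>h\<bar> < \<delta>2 \<Longrightarrow>
      L2_norm (\<lambda>x. diff_quot h (u 0) x - weak_deriv (u 0) x) < \<eta> / 2 \<and> L2_norm (\<lambda>x. diff_quot h (v 0) x - weak_deriv (v 0) x) < \<eta> / 2"
    by blast
  \<comment> \<open>\<open>s\<close> bounds \<open>\<surd>|h|\<close> and \<open>\<surd>|k|\<close>; the norm of the forcing is then at most \<open>4 M D s\<close>.\<close>
  define s where "s = \<eta> / (4 * M * D + 1)"
  have MD: "0 \<le> M * D" using M D(1) by simp
  then have s: "s > 0" using \<eta> by (simp add: s_def add_nonneg_pos)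
  have sMD: "4 * M * D * s \<le> \<eta>"
  proof -
    have "0 < 4 * M * D + 1" using MD by linarith
    then have "s * (4 * M * D + 1) = \<eta>" by (simp add: s_def)
    then show ?thesis using s by (simp add: algebra_simps)
  qed
  define \<delta> where "\<delta> = min \<delta>1 (min \<delta>2 (s\<^sup>2))"
  have \<delta>: "\<delta> > 0" using D(2) \<delta>2(1) s by (simp add: \<delta>_def)
  have "L2_norm (\<lambda>x. diff_quot h (u t) x - diff_quot k (u t) x) \<le> \<epsilon> \<and> L2_norm (\<lambda>x. diff_quot h (v t) x - diff_quot k (v t) x) \<le> \<epsilon>"
    if hk: "0 < \<bar>h\<bar>" "\<bar>h\<bar> < \<delta>" "0 < \<bar>k\<bar>" "\<bar>k\<bar> < \<delta>" and t: "t \<in> {0..T}" for h k t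
  proof -
    have small: "\<bar>h\<bar> < \<delta>1" "\<bar>k\<bar> < \<delta>1" "\<bar>h\<bar> < \<delta>2" "\<bar>k\<bar> < \<delta>2" "\<bar>h\<bar> < s\<^sup>2" "\<bar>k\<bar> < s\<^sup>2" using hk by (auto simp: \<delta>_def)
    have hk0: "h \<noteq> 0" "k \<noteq> 0" using hk by auto
    have sq: "sqrt \<bar>h\<bar> \<le> s" "sqrt \<bar>k\<bar> \<le> s" using small s by (auto intro!: real_le_lsqrt)
    define rr where "rr h t x = M * sqrt \<bar>h\<bar> * (cmod (diff_quot h (u t) x) + cmod (diff_quot h (v t) x))" for h t x
    define r where "r t x = rr h t x + rr k t x" for t x
    have crr: "cont2 (rr h)" for h
      using cont2_diff_quot[OF cu, of h] cont2_diff_quot[OF cv, of h] unfolding cont2_def rr_def by (intro continuous_intros)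
    have cr: "cont2 r" using crr[of h] crr[of k] unfolding cont2_def r_def by (intro continuous_intros)
    have rrL2: "(\<lambda>x. of_real (rr j t x) :: complex) \<in> L2 \<and> L2_norm (\<lambda>x. of_real (rr j t x)) \<le> M * s * (2 * D)"
      if t: "t \<in> {0..T}" and j: "0 < \<bar>j\<bar>" "\<bar>j\<bar> < \<delta>1" "sqrt \<bar>j\<bar> \<le> s" for t j
    proof -
      have L: "diff_quot j (u t) \<in> L2" "diff_quot j (v t) \<in> L2" using t by (auto intro!: diff_quot_L2 uL2 vL2)
      have m: "(\<lambda>x. of_real (rr j t x) :: complex) \<in> borel_measurable borel"
        using cont2_measurable(1)[OF crr, of j t] by measurable
      have le: "cmod (of_real (rr j t x)) \<le> (M * sqrt \<bar>j\<bar>) * (cmod (diff_quot j (u t) x) + cmod (diff_quot j (v t) x))" for x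
      proof -
        have "0 \<le> rr j t x" using M by (simp add: rr_def)
        then show ?thesis unfolding norm_of_real by (simp add: rr_def[symmetric])
      qed
      have nn: "0 \<le> M * sqrt \<bar>j\<bar>" using M by simp
      note sum = L2_norm_le_sum[OF L m le nn]
      have "(M * sqrt \<bar>j\<bar>) * (L2_norm (diff_quot j (u t)) + L2_norm (diff_quot j (v t))) \<le> (M * s) * (2 * D)"
        using D(3)[OF j(1,2) t] j(3) M s by (intro mult_mono mult_left_mono) auto
      then show ?thesis using sum by auto
    qed
    have rE: "energy (\<lambda>x. of_real (r t x)) \<le> ennreal (\<eta>\<^sup>2)" if t: "t \<in> {0..T}" for t
    proof (rule energy_le_norm)
      note 1 = rrL2[OF t hk(1) small(1) sq(1)] and 2 = rrL2[OF t hk(3) small(2) sq(2)]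
      show "(\<lambda>x. of_real (r t x)) \<in> L2" unfolding r_def of_real_add by (intro L2_add conjunct1[OF 1] conjunct1[OF 2])
      have "L2_norm (\<lambda>x. of_real (r t x)) \<le> M * s * (2 * D) + M * s * (2 * D)"
        unfolding r_def of_real_add
        by (rule order_trans[OF L2_norm_triangle[OF conjunct1[OF 1] conjunct1[OF 2]] add_mono[OF conjunct2[OF 1] conjunct2[OF 2]]])
      also have "\<dots> = 4 * M * D * s" by simp
      finally show "L2_norm (\<lambda>x. of_real (r t x)) \<le> \<eta>" using sMD by simp
    qed
    define p where "p t x = diff_quot h (u t) x - diff_quot k (u t) x" for t x
    define q where "q t x = diff_quot h (v t) x - diff_quot k (v t) x" for t x
    define F where "F t x = diff_quot h (f t) x - diff_quot k (f t) x" for t x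
    define H where "H t x = diff_quot h (g t) x - diff_quot k (g t) x" for t x
    have cd: "cont2 (\<lambda>t x. diff_quot h (w t) x - diff_quot k (w t) x)" if "cont2 w" for w
      using cont2_diff_quot[OF that, of h] cont2_diff_quot[OF that, of k] unfolding cont2_def by (intro continuous_intros)
    have cont: "cont2 p" "cont2 q" "cont2 F" "cont2 H"
      unfolding p_def q_def F_def H_def using cd cu cv cf cg by auto
    have mp: "mild 1 p F" unfolding p_def F_def
      by (rule mild_diff[OF mild_diff_quot[OF mild_uf cf] mild_diff_quot[OF mild_uf cf] cont2_diff_quot[OF cf] cont2_diff_quot[OF cf]])
    have mq: "mild (- 1) q H" unfolding q_def H_def
      by (rule mild_diff[OF mild_diff_quot[OF mild_vg cg] mild_diff_quot[OF mild_vg cg] cont2_diff_quot[OF cg] cont2_diff_quot[OF cg]])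
    have split: "cmod (a - b) \<le> L + (R + S)" if "cmod (a' - b') \<le> L" "cmod (a - a') \<le> R" "cmod (b - b') \<le> S"
      for a b a' b' :: complex and L R S
    proof -
      have "a - b = (a' - b') + ((a - a') - (b - b'))" by simp
      then have "cmod (a - b) \<le> cmod (a' - b') + cmod ((a - a') - (b - b'))" by (metis norm_triangle_ineq)
      then show ?thesis using norm_triangle_ineq4[of "a - a'" "b - b'"] that by linarith
    qed
    have Fb: "cmod (F t x) \<le> lip T * (cmod (p t x) + cmod (q t x)) + r t x" if t: "t \<in> {0..T}" for t x
      unfolding F_def r_def rr_def M_def
    proof (rule split[OF _ diff_quot_source_taylor(1)[OF t hk0(1)] diff_quot_source_taylor(1)[OF t hk0(2)]])
      show "cmod (rhs_deriv m \<alpha> (u t x) (v t x) (diff_quot h (u t) x) (diff_quot h (v t) x)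
          - rhs_deriv m \<alpha> (u t x) (v t x) (diff_quot k (u t) x) (diff_quot k (v t) x)) \<le> lip T * (cmod (p t x) + cmod (q t x))"
        unfolding rhs_deriv_diff[symmetric] p_def[symmetric] q_def[symmetric]
        by (rule order_trans[OF rhs_deriv_bound[OF component_bounds(1,2)[OF t] m] mult_right_mono[OF lip_le(1)]]) simp
    qed
    have Hb: "cmod (H t x) \<le> lip T * (cmod (p t x) + cmod (q t x)) + r t x" if t: "t \<in> {0..T}" for t x
      unfolding H_def r_def rr_def M_def
    proof (rule split[OF _ diff_quot_source_taylor(2)[OF t hk0(1)] diff_quot_source_taylor(2)[OF t hk0(2)]])
      show "cmod (rhs_deriv m \<beta> (v t x) (u t x) (diff_quot h (v t) x) (diff_quot h (u t) x)
          - rhs_deriv m \<beta> (v t x) (u t x) (diff_quot k (v t) x) (diff_quot k (u t) x)) \<le> lip T * (cmod (p t x) + cmod (q t x))"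
        unfolding rhs_deriv_diff[symmetric] p_def[symmetric] q_def[symmetric] add.commute[of "cmod (p t x)"]
        by (rule order_trans[OF rhs_deriv_bound[OF component_bounds(2,1)[OF t] m] mult_right_mono[OF lip_le(2)]]) simp
    qed
    have data: "energy (\<lambda>x. diff_quot h w x - diff_quot k w x) \<le> ennreal (\<eta>\<^sup>2)"
      if "w \<in> H1" "L2_norm (\<lambda>x. diff_quot h w x - weak_deriv w x) < \<eta> / 2" "L2_norm (\<lambda>x. diff_quot k w x - weak_deriv w x) < \<eta> / 2" for w
    proof -
      note L = diff_quot_L2[OF H1_L2[OF that(1)]] weak_deriv_props(1)[OF that(1)]
      have "L2_norm (\<lambda>x. diff_quot h w x - diff_quot k w x) \<le> L2_norm (\<lambda>x. diff_quot h w x - weak_deriv w x) + L2_norm (\<lambda>x. weak_deriv w x - diff_quot k w x)"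
        by (intro L2_norm_triangle3 L)
      then have "L2_norm (\<lambda>x. diff_quot h w x - diff_quot k w x) \<le> \<eta>"
        using that(2,3) L2_norm_minus_commute[of "weak_deriv w" "diff_quot k w"] by simp
      then show ?thesis by (intro energy_le_norm L2_diff L)
    qed
    have p0: "energy (p 0) \<le> ennreal (\<eta>\<^sup>2)" unfolding p_def
      using data[OF H1_data(1)] \<delta>2(2)[OF hk(1) small(3)] \<delta>2(2)[OF hk(3) small(4)] by blast
    have q0: "energy (q 0) \<le> ennreal (\<eta>\<^sup>2)" unfolding q_def
      using data[OF H1_data(2)] \<delta>2(2)[OF hk(1) small(3)] \<delta>2(2)[OF hk(3) small(4)] by blast
    have "L2_norm (p t) \<le> G * (\<eta> + \<eta>)" "L2_norm (q t) \<le> G * (\<eta> + \<eta>)"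
      unfolding G_def using L2_mild_estimate(3,4)[OF cont cr mp mq lip_nonneg T Fb Hb p0 q0 _ rE _ t] \<eta> by auto
    moreover have "G * (\<eta> + \<eta>) \<le> \<epsilon>"
    proof -
      have "G + 1 \<noteq> 0" using G by linarith
      then have "(G + 1) * (\<eta> + \<eta>) = \<epsilon>" by (simp add: \<eta>_def divide_simps)
      then show ?thesis using \<eta> by (simp add: distrib_right)
    qed
    ultimately show ?thesis unfolding p_def[abs_def] q_def[abs_def] by simp
  qed
  then show ?thesis using \<delta> by blast
qed

lemma H1_values: "t \<ge> 0 \<Longrightarrow> u t \<in> H1" "t \<ge> 0 \<Longrightarrow> v t \<in> H1"
proof -
  assume t: "t \<ge> 0"
  show "u t \<in> H1"
  proof (rule uniform_diff_quot_H1(1)[of "{0..t}"])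
    show "\<exists>\<delta>>0. \<forall>h k. 0 < \<bar>h\<bar> \<and> \<bar>h\<bar> < \<delta> \<and> 0 < \<bar>k\<bar> \<and> \<bar>k\<bar> < \<delta> \<longrightarrow>
      (\<forall>t\<in>{0..t}. L2_norm (\<lambda>x. diff_quot h (u t) x - diff_quot k (u t) x) \<le> \<epsilon>)" if "\<epsilon> > 0" for \<epsilon>
      using diff_quot_Cauchy[OF t that] by blast
  qed (use t uL2 in auto)
  show "v t \<in> H1"
  proof (rule uniform_diff_quot_H1(1)[of "{0..t}"])
    show "\<exists>\<delta>>0. \<forall>h k. 0 < \<bar>h\<bar> \<and> \<bar>h\<bar> < \<delta> \<and> 0 < \<bar>k\<bar> \<and> \<bar>k\<bar> < \<delta> \<longrightarrow>
      (\<forall>t\<in>{0..t}. L2_norm (\<lambda>x. diff_quot h (v t) x - diff_quot k (v t) x) \<le> \<epsilon>)" if "\<epsilon> > 0" for \<epsilon>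
      using diff_quot_Cauchy[OF t that] by blast
  qed (use t vL2 in auto)
qed

lemma uniform_diff_quot:
  assumes T: "T \<ge> 0" and e: "\<epsilon> > 0"
  shows "\<exists>\<delta>>0. \<forall>h t. 0 < \<bar>h\<bar> \<and> \<bar>h\<bar> < \<delta> \<and> t \<in> {0..T} \<longrightarrow> L2_norm (\<lambda>x. diff_quot h (u t) x - weak_deriv (u t) x) \<le> \<epsilon>"
    and "\<exists>\<delta>>0. \<forall>h t. 0 < \<bar>h\<bar> \<and> \<bar>h\<bar> < \<delta> \<and> t \<in> {0..T} \<longrightarrow> L2_norm (\<lambda>x. diff_quot h (v t) x - weak_deriv (v t) x) \<le> \<epsilon>"
proof -
  show "\<exists>\<delta>>0. \<forall>h t. 0 < \<bar>h\<bar> \<and> \<bar>h\<bar> < \<delta> \<and> t \<in> {0..T} \<longrightarrow> L2_norm (\<lambda>x. diff_quot h (u t) x - weak_deriv (u t) x) \<le> \<epsilon>"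
  proof (rule uniform_diff_quot_H1(2)[OF _ _ e])
    show "\<exists>\<delta>>0. \<forall>h k. 0 < \<bar>h\<bar> \<and> \<bar>h\<bar> < \<delta> \<and> 0 < \<bar>k\<bar> \<and> \<bar>k\<bar> < \<delta> \<longrightarrow>
      (\<forall>t\<in>{0..T}. L2_norm (\<lambda>x. diff_quot h (u t) x - diff_quot k (u t) x) \<le> \<epsilon>)" if "\<epsilon> > 0" for \<epsilon>
      using diff_quot_Cauchy[OF T that] by blast
  qed (use uL2 in auto)
  show "\<exists>\<delta>>0. \<forall>h t. 0 < \<bar>h\<bar> \<and> \<bar>h\<bar> < \<delta> \<and> t \<in> {0..T} \<longrightarrow> L2_norm (\<lambda>x. diff_quot h (v t) x - weak_deriv (v t) x) \<le> \<epsilon>"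
  proof (rule uniform_diff_quot_H1(2)[OF _ _ e])
    show "\<exists>\<delta>>0. \<forall>h k. 0 < \<bar>h\<bar> \<and> \<bar>h\<bar> < \<delta> \<and> 0 < \<bar>k\<bar> \<and> \<bar>k\<bar> < \<delta> \<longrightarrow>
      (\<forall>t\<in>{0..T}. L2_norm (\<lambda>x. diff_quot h (v t) x - diff_quot k (v t) x) \<le> \<epsilon>)" if "\<epsilon> > 0" for \<epsilon>
      using diff_quot_Cauchy[OF T that] by blast
  qed (use vL2 in auto)
qed

lemma curve_translate_near:
  fixes p :: "real \<Rightarrow> real \<Rightarrow> complex"
  assumes "cont_curve L2 L2_norm p" and t: "t \<ge> 0" and e: "\<epsilon> > 0"
  shows "\<exists>\<delta>>0. \<forall>r y. 0 \<le> r \<and> \<bar>r - t\<bar> < \<delta> \<and> \<bar>y\<bar> < \<delta> \<longrightarrow> L2_norm (\<lambda>x. p r (x + y) - p t x) \<le> \<epsilon>"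
proof -
  have L2: "r \<ge> 0 \<Longrightarrow> p r \<in> L2" for r using assms(1) by (auto simp: cont_curve_def)
  have e2: "\<epsilon> / 2 > 0" using e by simp
  obtain d1 where d1: "d1 > 0" "\<And>s. s \<ge> 0 \<Longrightarrow> \<bar>s - t\<bar> < d1 \<Longrightarrow> L2_norm (\<lambda>x. p s x - p t x) < \<epsilon> / 2"
    using cont_curve_L2_near[OF assms(1) t e2] by blast
  obtain d2 where d2: "d2 > 0" "\<And>y. y \<noteq> 0 \<Longrightarrow> \<bar>y\<bar> < d2 \<Longrightarrow> L2_norm (\<lambda>x. p t (x + y) - p t x) < \<epsilon> / 2"
    using LIM_D[OF L2_shift_continuous[OF L2[OF t]] e2] by auto
  have 2: "L2_norm (\<lambda>x. p t (x + y) - p t x) \<le> \<epsilon> / 2" if "\<bar>y\<bar> < d2" for y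
    using d2(2)[of y] that e by (cases "y = 0") auto
  have "L2_norm (\<lambda>x. p r (x + y) - p t x) \<le> \<epsilon>" if r: "0 \<le> r" "\<bar>r - t\<bar> < min d1 d2" and y: "\<bar>y\<bar> < min d1 d2" for r y
  proof -
    have "L2_norm (\<lambda>x. p r (x + y) - p t x) \<le> L2_norm (\<lambda>x. p r (x + y) - p t (x + y)) + L2_norm (\<lambda>x. p t (x + y) - p t x)"
      by (intro L2_norm_triangle3 L2_shift L2 r t)
    also have "L2_norm (\<lambda>x. p r (x + y) - p t (x + y)) = L2_norm (\<lambda>x. p r x - p t x)"
      by (rule L2_norm_shift[OF L2_diff[OF L2[OF r(1)] L2[OF t]]])
    finally show ?thesis using d1(2)[OF r(1)] 2[of y] r(2) y by simp
  qed
  then show ?thesis using d1(1) d2(1) by (intro exI[of _ "min d1 d2"]) auto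
qed

lemma source_near:
  assumes t: "t \<ge> 0" and e: "\<epsilon> > 0"
  shows "\<exists>\<delta>>0. \<forall>r y. 0 \<le> r \<and> \<bar>r - t\<bar> < \<delta> \<and> \<bar>y\<bar> < \<delta> \<longrightarrow>
    L2_norm (\<lambda>x. f r (x + y) - f t x) \<le> \<epsilon> \<and> L2_norm (\<lambda>x. g r (x + y) - g t x) \<le> \<epsilon>"
proof -
  define \<eta> where "\<eta> = \<epsilon> / (2 * (lip (t + 1) + 1))"
  have l: "0 \<le> lip (t + 1)" by (rule lip_nonneg)
  then have \<eta>: "\<eta> > 0" using e by (simp add: \<eta>_def)
  have le: "lip (t + 1) * (\<eta> + \<eta>) \<le> \<epsilon>"
  proof -
    have "lip (t + 1) + 1 \<noteq> 0" using l by linarith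
    then have "(lip (t + 1) + 1) * (\<eta> + \<eta>) = \<epsilon>" by (simp add: \<eta>_def divide_simps)
    then show ?thesis using \<eta> by (simp add: distrib_right)
  qed
  obtain d1 where d1: "d1 > 0" "\<And>r y. 0 \<le> r \<Longrightarrow> \<bar>r - t\<bar> < d1 \<Longrightarrow> \<bar>y\<bar> < d1 \<Longrightarrow> L2_norm (\<lambda>x. u r (x + y) - u t x) \<le> \<eta>"
    using curve_translate_near[OF curves(1) t \<eta>] by blast
  obtain d2 where d2: "d2 > 0" "\<And>r y. 0 \<le> r \<Longrightarrow> \<bar>r - t\<bar> < d2 \<Longrightarrow> \<bar>y\<bar> < d2 \<Longrightarrow> L2_norm (\<lambda>x. v r (x + y) - v t x) \<le> \<eta>"
    using curve_translate_near[OF curves(2) t \<eta>] by blast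
  have "L2_norm (\<lambda>x. f r (x + y) - f t x) \<le> \<epsilon> \<and> L2_norm (\<lambda>x. g r (x + y) - g t x) \<le> \<epsilon>"
    if r: "0 \<le> r" "\<bar>r - t\<bar> < min 1 (min d1 d2)" and y: "\<bar>y\<bar> < min 1 (min d1 d2)" for r y
  proof -
    have T: "r \<in> {0..t + 1}" "t \<in> {0..t + 1}" using r t by auto
    have L: "(\<lambda>x. u r (x + y) - u t x) \<in> L2" "(\<lambda>x. v r (x + y) - v t x) \<in> L2"
      using r t by (auto intro!: L2_diff L2_shift uL2 vL2)
    have m: "(\<lambda>x. f r (x + y) - f t x) \<in> borel_measurable borel" "(\<lambda>x. g r (x + y) - g t x) \<in> borel_measurable borel"
      using measurable_shift[OF cont2_measurable(1)[OF cf]] measurable_shift[OF cont2_measurable(1)[OF cg]]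
        cont2_measurable(1)[OF cf] cont2_measurable(1)[OF cg] by (auto intro!: borel_measurable_diff)
    have "lip (t + 1) * (L2_norm (\<lambda>x. u r (x + y) - u t x) + L2_norm (\<lambda>x. v r (x + y) - v t x)) \<le> lip (t + 1) * (\<eta> + \<eta>)"
      using d1(2)[OF r(1), of y] d2(2)[OF r(1), of y] r(2) y l by (intro mult_left_mono add_mono) auto
    then show ?thesis
      using L2_norm_le_sum(2)[OF L m(1) source_Lipschitz(1)[OF T] l] L2_norm_le_sum(2)[OF L m(2) source_Lipschitz(2)[OF T] l] le by linarith
  qed
  then show ?thesis using d1(1) d2(1) by (intro exI[of _ "min 1 (min d1 d2)"]) auto
qed

theorem is_solution:
  assumes "AE x in lborel. u 0 x = u0 x \<and> v 0 x = v0 x"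
  shows "solution m \<alpha> \<beta> u0 v0 u v"
proof -
  have near: "\<exists>\<delta>>0. \<forall>r y. 0 \<le> r \<and> \<bar>r - t\<bar> < \<delta> \<and> \<bar>y\<bar> < \<delta> \<longrightarrow> L2_norm (\<lambda>x. f r (x + y) - f t x) \<le> \<epsilon>"
    "\<exists>\<delta>>0. \<forall>r y. 0 \<le> r \<and> \<bar>r - t\<bar> < \<delta> \<and> \<bar>y\<bar> < \<delta> \<longrightarrow> L2_norm (\<lambda>x. g r (x + y) - g t x) \<le> \<epsilon>" if "t \<ge> 0" "\<epsilon> > 0" for t \<epsilon>
    using source_near[OF that] by blast+
  have L2: "t \<ge> 0 \<Longrightarrow> f t \<in> L2" "t \<ge> 0 \<Longrightarrow> g t \<in> L2" for t using source_L2_bounds[of t] by force+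
  note ru = mild_curve_regularity[OF cu cf mild_uf _ H1_values(1) L2(1) curves(1) near(1) uniform_diff_quot(1)]
  note rv = mild_curve_regularity[OF cv cg mild_vg _ H1_values(2) L2(2) curves(2) near(2) uniform_diff_quot(2)]
  have "C1_L2_curve u (\<lambda>t x. f t x - of_real 1 * weak_deriv (u t) x)" by (rule ru(2)) auto
  moreover have "C1_L2_curve v (\<lambda>t x. g t x - of_real (- 1) * weak_deriv (v t) x)" by (rule rv(2)) auto
  moreover have "cont_curve H1 H1_norm u" by (rule ru(1)) auto
  moreover have "cont_curve H1 H1_norm v" by (rule rv(1)) auto
  moreover have "\<i> * (f t x - of_real 1 * weak_deriv (u t) x + weak_deriv (u t) x) = - of_real m * v t x + N1 \<alpha> (u t x) (v t x) \<and>
    \<i> * (g t x - of_real (- 1) * weak_deriv (v t) x - weak_deriv (v t) x) = - of_real m * u t x + N2 \<beta> (u t x) (v t x)" for t x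
    by (simp add: f_def g_def rhs_def N2_eq_N1 algebra_simps)
  ultimately show ?thesis unfolding solution_def using assms by blast
qed

end

section \<open>Uniqueness\<close>

lemma cont_curve_L2_diff:
  assumes "cont_curve L2 L2_norm a" "cont_curve L2 L2_norm b"
  shows "cont_curve L2 L2_norm (\<lambda>t x. a t x - b t x)"
  unfolding cont_curve_def
proof (intro conjI allI impI)
  have L2: "t \<ge> 0 \<Longrightarrow> a t \<in> L2" "t \<ge> 0 \<Longrightarrow> b t \<in> L2" for t using assms by (auto simp: cont_curve_def)
  show "t \<ge> 0 \<Longrightarrow> (\<lambda>x. a t x - b t x) \<in> L2" for t by (intro L2_diff L2)
  fix t :: real assume t: "t \<ge> 0"
  have "((\<lambda>s. L2_norm (\<lambda>x. a s x - a t x) + L2_norm (\<lambda>x. b s x - b t x)) \<longlongrightarrow> 0 + 0) (at t within {0..})"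
    using assms t by (intro tendsto_add) (auto simp: cont_curve_def)
  then have lim: "((\<lambda>s. L2_norm (\<lambda>x. a s x - a t x) + L2_norm (\<lambda>x. b s x - b t x)) \<longlongrightarrow> 0) (at t within {0..})" by simp
  show "((\<lambda>s. L2_norm (\<lambda>x. (a s x - b s x) - (a t x - b t x))) \<longlongrightarrow> 0) (at t within {0..})"
  proof (rule Lim_null_comparison[OF _ lim])
    have "norm (L2_norm (\<lambda>x. (a s x - b s x) - (a t x - b t x))) \<le> L2_norm (\<lambda>x. a s x - a t x) + L2_norm (\<lambda>x. b s x - b t x)"
      if "s \<in> {0..}" for s
    proof -
      have "(\<lambda>x. (a s x - b s x) - (a t x - b t x)) = (\<lambda>x. (a s x - a t x) - (b s x - b t x))"
        by (simp add: fun_eq_iff)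
      then show ?thesis
        using L2_norm_triangle_diff[OF L2_diff[OF L2(1) L2(1)[OF t]] L2_diff[OF L2(2) L2(2)[OF t]], of s s] that by simp
    qed
    then show "\<forall>\<^sub>F s in at t within {0..}. norm (L2_norm (\<lambda>x. (a s x - b s x) - (a t x - b t x)))
      \<le> L2_norm (\<lambda>x. a s x - a t x) + L2_norm (\<lambda>x. b s x - b t x)"
      by (simp add: eventually_at_filter)
  qed
qed

lemma C1_L2_curve_diff:
  assumes "C1_L2_curve a a'" "C1_L2_curve b b'"
  shows "C1_L2_curve (\<lambda>t x. a t x - b t x) (\<lambda>t x. a' t x - b' t x)"
proof -
  have c: "cont_curve L2 L2_norm a" "cont_curve L2 L2_norm a'" "cont_curve L2 L2_norm b" "cont_curve L2 L2_norm b'"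
    using assms by (auto simp: C1_L2_curve_def)
  have L2: "t \<ge> 0 \<Longrightarrow> a t \<in> L2" "t \<ge> 0 \<Longrightarrow> b t \<in> L2" "t \<ge> 0 \<Longrightarrow> a' t \<in> L2" "t \<ge> 0 \<Longrightarrow> b' t \<in> L2" for t
    using c by (auto simp: cont_curve_def)
  have "((\<lambda>s. L2_norm (\<lambda>x. ((a s x - b s x) - (a t x - b t x)) / of_real (s - t) - (a' t x - b' t x))) \<longlongrightarrow> 0) (at t within {0..})"
    if t: "t \<ge> 0" for t
  proof -
    define qa where "qa s x = (a s x - a t x) / of_real (s - t) - a' t x" for s x
    define qb where "qb s x = (b s x - b t x) / of_real (s - t) - b' t x" for s x
    have q: "qa s \<in> L2" "qb s \<in> L2" if "s \<ge> 0" for s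
      unfolding qa_def qb_def divide_inverse mult.commute[of _ "inverse _"]
      using that t by (auto intro!: L2_diff L2_cmult L2)
    have "((\<lambda>s. L2_norm (qa s) + L2_norm (qb s)) \<longlongrightarrow> 0 + 0) (at t within {0..})"
      using assms t unfolding qa_def qb_def by (intro tendsto_add) (auto simp: C1_L2_curve_def)
    then have lim: "((\<lambda>s. L2_norm (qa s) + L2_norm (qb s)) \<longlongrightarrow> 0) (at t within {0..})" by simp
    have eq: "(\<lambda>x. ((a s x - b s x) - (a t x - b t x)) / of_real (s - t) - (a' t x - b' t x)) = (\<lambda>x. qa s x - qb s x)" for s
      by (simp add: qa_def qb_def fun_eq_iff diff_divide_distrib)
    show ?thesis unfolding eq
    proof (rule Lim_null_comparison[OF _ lim])
      show "\<forall>\<^sub>F s in at t within {0..}. norm (L2_norm (\<lambda>x. qa s x - qb s x)) \<le> L2_norm (qa s) + L2_norm (qb s)"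
        using L2_norm_triangle_diff[OF q(1) q(2)] by (simp add: eventually_at_filter)
    qed
  qed
  then show ?thesis unfolding C1_L2_curve_def using cont_curve_L2_diff c by blast
qed

text \<open>With the increment quotient \<open>q\<close> and \<open>h = s - t\<close>, expand
  \<open>|d s|\<^sup>2 = |d t + h q|\<^sup>2 = |d t|\<^sup>2 + 2 h Re (cnj (d t) * q) + h\<^sup>2 |q|\<^sup>2\<close> and integrate; \<open>q\<close> stays bounded in
  \<open>L\<^sup>2\<close>.\<close>

lemma L2_norm_sq_has_derivative:
  assumes "C1_L2_curve d d'" and t: "t \<ge> 0"
  shows "((\<lambda>s. (L2_norm (d s))\<^sup>2) has_real_derivative 2 * Re (LINT x|lborel. cnj (d t x) * d' t x)) (at t within {0..})"
proof -
  have L2: "s \<ge> 0 \<Longrightarrow> d s \<in> L2" "s \<ge> 0 \<Longrightarrow> d' s \<in> L2" for s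
    using assms(1) by (auto simp: C1_L2_curve_def cont_curve_def)
  note cd = L2_cnj[OF L2(1)[OF t]]
  define q where "q s x = (d s x - d t x) / of_real (s - t)" for s x
  have q: "q s \<in> L2" if "s \<ge> 0" for s
    unfolding q_def divide_inverse mult.commute[of _ "inverse _"]
    using that t by (auto intro!: L2_diff L2_cmult L2)
  have lim: "((\<lambda>s. L2_norm (\<lambda>x. q s x - d' t x)) \<longlongrightarrow> 0) (at t within {0..})"
    using assms unfolding q_def by (simp add: C1_L2_curve_def)
  have quot: "((L2_norm (d s))\<^sup>2 - (L2_norm (d t))\<^sup>2) / (s - t) = 2 * Re (LINT x|lborel. cnj (d t x) * q s x) + (s - t) * (L2_norm (q s))\<^sup>2"
    if s: "s \<ge> 0" "s \<noteq> t" for s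
  proof -
    have pt: "(cmod (d s x))\<^sup>2 = (cmod (d t x))\<^sup>2 + (2 * (s - t) * Re (cnj (d t x) * q s x) + (s - t)\<^sup>2 * (cmod (q s x))\<^sup>2)" for x
    proof -
      have sq: "(cmod (a + of_real h * b))\<^sup>2 = (cmod a)\<^sup>2 + (2 * h * Re (cnj a * b) + h\<^sup>2 * (cmod b)\<^sup>2)" for a b h
        unfolding cmod_power2 by (simp add: power2_eq_square algebra_simps)
      have "d s x = d t x + of_real (s - t) * q s x" using s(2) by (simp add: q_def)
      then show ?thesis using sq[of "d t x" "s - t" "q s x"] by (simp only:)
    qed
    have i: "integrable lborel (\<lambda>x. Re (cnj (d t x) * q s x))"
      by (intro integrable_Re L2_mult_integrable cd q s)
    have "(L2_norm (d s))\<^sup>2 = (L2_norm (d t))\<^sup>2 + (2 * (s - t) * (LINT x|lborel. Re (cnj (d t x) * q s x)) + (s - t)\<^sup>2 * (L2_norm (q s))\<^sup>2)"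
      unfolding L2_norm_sq pt using i L2_integrable[OF L2(1)[OF t]] L2_integrable[OF q[OF s(1)]]
      by (subst Bochner_Integration.integral_add; simp)+
    also have "(LINT x|lborel. Re (cnj (d t x) * q s x)) = Re (LINT x|lborel. cnj (d t x) * q s x)"
      by (intro integral_Re L2_mult_integrable cd q s)
    finally show ?thesis using s(2) by (simp add: field_simps power2_eq_square)
  qed
  have lim1: "((\<lambda>s. Re (LINT x|lborel. cnj (d t x) * q s x)) \<longlongrightarrow> Re (LINT x|lborel. cnj (d t x) * d' t x)) (at t within {0..})"
  proof (rule LIM_zero_cancel, rule Lim_null_comparison)
    have "norm (Re (LINT x|lborel. cnj (d t x) * q s x) - Re (LINT x|lborel. cnj (d t x) * d' t x))
      \<le> L2_norm (\<lambda>x. cnj (d t x)) * L2_norm (\<lambda>x. q s x - d' t x)" if s: "s \<in> {0..}" for s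
    proof -
      have s0: "s \<ge> 0" using s by simp
      have "(LINT x|lborel. cnj (d t x) * q s x) - (LINT x|lborel. cnj (d t x) * d' t x) = (LINT x|lborel. cnj (d t x) * (q s x - d' t x))"
        unfolding right_diff_distrib
        by (rule Bochner_Integration.integral_diff[symmetric]) (intro L2_mult_integrable cd q s0 L2 t)+
      then show ?thesis
        using order_trans[OF abs_Re_le_cmod L2_Cauchy_Schwarz[OF cd L2_diff[OF q[OF s0] L2(2)[OF t]]]]
        by (metis minus_complex.sel(1) real_norm_def)
    qed
    then show "\<forall>\<^sub>F s in at t within {0..}. norm (Re (LINT x|lborel. cnj (d t x) * q s x) - Re (LINT x|lborel. cnj (d t x) * d' t x))
      \<le> L2_norm (\<lambda>x. cnj (d t x)) * L2_norm (\<lambda>x. q s x - d' t x)" by (simp add: eventually_at_filter)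
    show "((\<lambda>s. L2_norm (\<lambda>x. cnj (d t x)) * L2_norm (\<lambda>x. q s x - d' t x)) \<longlongrightarrow> 0) (at t within {0..})"
      by (intro tendsto_mult_right_zero lim)
  qed
  have lim2: "((\<lambda>s. (s - t) * (L2_norm (q s))\<^sup>2) \<longlongrightarrow> 0) (at t within {0..})"
  proof (rule Lim_null_comparison)
    have "norm ((s - t) * (L2_norm (q s))\<^sup>2) \<le> \<bar>s - t\<bar> * (L2_norm (\<lambda>x. q s x - d' t x) + L2_norm (d' t))\<^sup>2" if "s \<in> {0..}" for s
    proof -
      have "L2_norm (q s) \<le> L2_norm (\<lambda>x. q s x - d' t x) + L2_norm (d' t)"
        using L2_norm_triangle[OF L2_diff[OF q L2(2)[OF t]] L2(2)[OF t], of s] that by simp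
      then have "(L2_norm (q s))\<^sup>2 \<le> (L2_norm (\<lambda>x. q s x - d' t x) + L2_norm (d' t))\<^sup>2" by (intro power_mono) auto
      then show ?thesis by (simp add: abs_mult mult_left_mono)
    qed
    then show "\<forall>\<^sub>F s in at t within {0..}. norm ((s - t) * (L2_norm (q s))\<^sup>2) \<le> \<bar>s - t\<bar> * (L2_norm (\<lambda>x. q s x - d' t x) + L2_norm (d' t))\<^sup>2"
      by (simp add: eventually_at_filter)
    have "((\<lambda>s. \<bar>s - t\<bar> * (L2_norm (\<lambda>x. q s x - d' t x) + L2_norm (d' t))\<^sup>2) \<longlongrightarrow> \<bar>t - t\<bar> * (0 + L2_norm (d' t))\<^sup>2) (at t within {0..})"
      by (intro tendsto_intros lim)
    then show "((\<lambda>s. \<bar>s - t\<bar> * (L2_norm (\<lambda>x. q s x - d' t x) + L2_norm (d' t))\<^sup>2) \<longlongrightarrow> 0) (at t within {0..})" by simp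
  qed
  have "((\<lambda>s. 2 * Re (LINT x|lborel. cnj (d t x) * q s x) + (s - t) * (L2_norm (q s))\<^sup>2) \<longlongrightarrow> 2 * Re (LINT x|lborel. cnj (d t x) * d' t x) + 0) (at t within {0..})"
    by (intro tendsto_intros lim1 lim2)
  moreover have "\<forall>\<^sub>F s in at t within {0..}. 2 * Re (LINT x|lborel. cnj (d t x) * q s x) + (s - t) * (L2_norm (q s))\<^sup>2
    = ((L2_norm (d s))\<^sup>2 - (L2_norm (d t))\<^sup>2) / (s - t)"
    by (simp add: eventually_at_filter quot)
  ultimately show ?thesis unfolding has_field_derivative_iff
    using Lim_transform_eventually by fastforce
qed

text \<open>The transport term drops out of the energy balance because \<open>Re \<langle>d, \<partial>\<^sub>x d\<rangle> = 0\<close>.\<close>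

lemma energy_rate:
  assumes d: "d \<in> H1" and d': "d' \<in> L2" and e: "e \<in> L2" and L: "0 \<le> L"
    and ae: "AE x in lborel. cmod (d' x + of_real \<sigma> * weak_deriv d x) \<le> L * (cmod (d x) + cmod (e x))"
  shows "Re (LINT x|lborel. cnj (d x) * d' x) \<le> 2 * L * ((L2_norm d)\<^sup>2 + (L2_norm e)\<^sup>2)"
proof -
  note dL2 = H1_L2[OF d] and wL2 = weak_deriv_props(1)[OF d]
  note cd = L2_cnj[OF dL2]
  have [measurable]: "d \<in> borel_measurable borel" "d' \<in> borel_measurable borel" "weak_deriv d \<in> borel_measurable borel"
    using dL2 d' wL2 by (auto intro: L2_measurable)
  define w where "w x = d' x + of_real \<sigma> * weak_deriv d x" for x
  have w: "w \<in> L2" unfolding w_def by (intro L2_add L2_cmult d' wL2)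
  have "(LINT x|lborel. cnj (d x) * w x) = (LINT x|lborel. cnj (d x) * d' x + of_real \<sigma> * (cnj (d x) * weak_deriv d x))"
    by (simp add: w_def algebra_simps)
  also have "\<dots> = (LINT x|lborel. cnj (d x) * d' x) + of_real \<sigma> * (LINT x|lborel. cnj (d x) * weak_deriv d x)"
    using L2_mult_integrable[OF cd d'] L2_mult_integrable[OF cd wL2] by simp
  finally have "Re (LINT x|lborel. cnj (d x) * w x) = Re (LINT x|lborel. cnj (d x) * d' x) + \<sigma> * Re (LINT x|lborel. cnj (d x) * weak_deriv d x)"
    by simp
  then have "Re (LINT x|lborel. cnj (d x) * d' x) = Re (LINT x|lborel. cnj (d x) * w x)"
    by (simp add: H1_Re_integral_weak_deriv[OF d])
  also have "\<dots> \<le> (LINT x|lborel. cmod (cnj (d x) * w x))"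
    by (rule order_trans[OF complex_Re_le_cmod integral_norm_bound])
  also have "\<dots> \<le> (LINT x|lborel. 2 * L * ((cmod (d x))\<^sup>2 + (cmod (e x))\<^sup>2))"
  proof (rule integral_mono_AE)
    show "integrable lborel (\<lambda>x. cmod (cnj (d x) * w x))" by (intro integrable_norm L2_mult_integrable cd w)
    show "integrable lborel (\<lambda>x. 2 * L * ((cmod (d x))\<^sup>2 + (cmod (e x))\<^sup>2))"
      using L2_integrable[OF dL2] L2_integrable[OF e] by simp
    show "AE x in lborel. cmod (cnj (d x) * w x) \<le> 2 * L * ((cmod (d x))\<^sup>2 + (cmod (e x))\<^sup>2)"
      using ae
    proof eventually_elim
      case (elim x)
      have "cmod (cnj (d x) * w x) \<le> cmod (d x) * (L * (cmod (d x) + cmod (e x)))"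
        unfolding norm_mult using elim by (auto simp: w_def intro: mult_left_mono)
      also have "\<dots> = L * ((cmod (d x))\<^sup>2 + cmod (d x) * cmod (e x))" by (simp add: power2_eq_square algebra_simps)
      also have "\<dots> \<le> L * (2 * ((cmod (d x))\<^sup>2 + (cmod (e x))\<^sup>2))"
      proof (rule mult_left_mono[OF _ L])
        have "0 \<le> (cmod (d x) - cmod (e x))\<^sup>2 + (cmod (d x))\<^sup>2 + 3 * (cmod (e x))\<^sup>2" by simp
        then show "(cmod (d x))\<^sup>2 + cmod (d x) * cmod (e x) \<le> 2 * ((cmod (d x))\<^sup>2 + (cmod (e x))\<^sup>2)"
          by (simp add: power2_eq_square algebra_simps)
      qed
      finally show ?case by (simp add: mult_ac)
    qed
  qed
  also have "\<dots> = 2 * L * ((L2_norm d)\<^sup>2 + (L2_norm e)\<^sup>2)"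
    unfolding L2_norm_sq using L2_integrable[OF dL2] L2_integrable[OF e] by simp
  finally show ?thesis .
qed

text \<open>The norm is bounded near each time; bisection makes this a bound on the whole interval.\<close>

lemma H1_curve_bounded:
  assumes "cont_curve H1 H1_norm w" and T: "0 \<le> T"
  shows "\<exists>R. \<forall>t\<in>{0..T}. H1_norm (w t) \<le> R"
proof -
  have H1: "t \<ge> 0 \<Longrightarrow> w t \<in> H1" for t using assms(1) by (auto simp: cont_curve_def)
  have "\<exists>R. \<forall>s. s \<in> {0..T} \<and> 0 \<le> s \<longrightarrow> H1_norm (w s) \<le> R"
  proof (rule Bolzano[OF T, where P="\<lambda>a b. \<exists>R. \<forall>s. s \<in> {a..b} \<and> 0 \<le> s \<longrightarrow> H1_norm (w s) \<le> R"])
    fix a b c :: real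
    assume "\<exists>R. \<forall>s. s \<in> {a..b} \<and> 0 \<le> s \<longrightarrow> H1_norm (w s) \<le> R" "\<exists>R. \<forall>s. s \<in> {b..c} \<and> 0 \<le> s \<longrightarrow> H1_norm (w s) \<le> R"
    then obtain R S where "\<And>s. s \<in> {a..b} \<Longrightarrow> 0 \<le> s \<Longrightarrow> H1_norm (w s) \<le> R" "\<And>s. s \<in> {b..c} \<Longrightarrow> 0 \<le> s \<Longrightarrow> H1_norm (w s) \<le> S"
      by blast
    then have "\<forall>s. s \<in> {a..c} \<and> 0 \<le> s \<longrightarrow> H1_norm (w s) \<le> max R S"
      by (metis atLeastAtMost_iff le_max_iff_disj linear)
    then show "\<exists>R. \<forall>s. s \<in> {a..c} \<and> 0 \<le> s \<longrightarrow> H1_norm (w s) \<le> R" ..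
  next
    fix t assume t: "0 \<le> t" "t \<le> T"
    have "((\<lambda>s. H1_norm (\<lambda>x. w s x - w t x)) \<longlongrightarrow> 0) (at t within {0..})"
      using assms(1) t unfolding cont_curve_def by blast
    from tendstoD[OF this zero_less_one] obtain \<delta> where \<delta>: "\<delta> > 0"
      "\<And>s. s \<in> {0..} \<Longrightarrow> s \<noteq> t \<Longrightarrow> dist s t < \<delta> \<Longrightarrow> dist (H1_norm (\<lambda>x. w s x - w t x)) 0 < 1"
      unfolding eventually_at by auto
    have "H1_norm (w s) \<le> 2 * (1 + H1_norm (w t))" if s: "s \<ge> 0" "\<bar>s - t\<bar> < \<delta>" for s
    proof (cases "s = t")
      case True
      then show ?thesis using H1_norm_bounds(4)[of "w t"] by simp
    next
      case False
      then have "H1_norm (\<lambda>x. w s x - w t x) < 1" using \<delta>(2)[of s] s by (auto simp: dist_real_def)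
      then show ?thesis using H1_norm_le_diff[OF H1[OF s(1)] H1[OF t(1)]] by simp
    qed
    then show "\<exists>\<delta>>0. \<forall>a b. a \<le> t \<and> t \<le> b \<and> b - a < \<delta> \<longrightarrow> (\<exists>R. \<forall>s. s \<in> {a..b} \<and> 0 \<le> s \<longrightarrow> H1_norm (w s) \<le> R)"
      using \<delta>(1) by (intro exI[of _ \<delta>] conjI allI impI exI[of _ "2 * (1 + H1_norm (w t))"]) auto
  qed
  then show ?thesis by (metis atLeastAtMost_iff)
qed

text \<open>Both solutions are bounded on \<open>[0, T]\<close> because they are bounded in \<open>H\<^sup>1\<close>. There the sources are
  Lipschitz with constant \<open>L\<close>, and Gronwall's inequality applies to the squared distance \<open>N\<close>, which
  vanishes at time zero.\<close>

theorem solution_unique: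
  assumes m: "m \<ge> 0" and sol1: "solution m \<alpha> \<beta> u0 v0 u v" and sol2: "solution m \<alpha> \<beta> u0 v0 w z" and T: "T \<ge> 0"
  shows "AE x in lborel. w T x = u T x \<and> z T x = v T x"
proof -
  obtain u' v' where cu: "cont_curve H1 H1_norm u" "cont_curve H1 H1_norm v"
    and iu: "AE x in lborel. u 0 x = u0 x \<and> v 0 x = v0 x"
    and du: "C1_L2_curve u u'" "C1_L2_curve v v'"
    and eu: "\<And>t. t \<ge> 0 \<Longrightarrow> AE x in lborel. \<i> * (u' t x + weak_deriv (u t) x) = - of_real m * v t x + N1 \<alpha> (u t x) (v t x) \<and>
          \<i> * (v' t x - weak_deriv (v t) x) = - of_real m * u t x + N2 \<beta> (u t x) (v t x)"
    using sol1 unfolding solution_def by blast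
  obtain w' z' where cw: "cont_curve H1 H1_norm w" "cont_curve H1 H1_norm z"
    and iw: "AE x in lborel. w 0 x = u0 x \<and> z 0 x = v0 x"
    and dw: "C1_L2_curve w w'" "C1_L2_curve z z'"
    and ew: "\<And>t. t \<ge> 0 \<Longrightarrow> AE x in lborel. \<i> * (w' t x + weak_deriv (w t) x) = - of_real m * z t x + N1 \<alpha> (w t x) (z t x) \<and>
          \<i> * (z' t x - weak_deriv (z t) x) = - of_real m * w t x + N2 \<beta> (w t x) (z t x)"
    using sol2 unfolding solution_def by blast
  have H1: "t \<ge> 0 \<Longrightarrow> u t \<in> H1" "t \<ge> 0 \<Longrightarrow> v t \<in> H1" "t \<ge> 0 \<Longrightarrow> w t \<in> H1" "t \<ge> 0 \<Longrightarrow> z t \<in> H1" for t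
    using cu cw by (auto simp: cont_curve_def)
  define d where "d t x = w t x - u t x" for t x
  define e where "e t x = z t x - v t x" for t x
  define d' where "d' t x = w' t x - u' t x" for t x
  define e' where "e' t x = z' t x - v' t x" for t x
  have C1: "C1_L2_curve d d'" "C1_L2_curve e e'"
    unfolding d_def d'_def e_def e'_def using C1_L2_curve_diff du dw by blast+
  have deH1: "d t \<in> H1" "e t \<in> H1" if "t \<ge> 0" for t
    unfolding d_def e_def using H1_diff(1) H1[OF that] by blast+
  have de'L2: "d' t \<in> L2" "e' t \<in> L2" if "t \<ge> 0" for t
    using C1 that by (auto simp: C1_L2_curve_def cont_curve_def)
  obtain R1 R2 R3 R4 where R1234: "\<forall>t\<in>{0..T}. H1_norm (u t) \<le> R1" "\<forall>t\<in>{0..T}. H1_norm (v t) \<le> R2"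
    "\<forall>t\<in>{0..T}. H1_norm (w t) \<le> R3" "\<forall>t\<in>{0..T}. H1_norm (z t) \<le> R4"
    using H1_curve_bounded[OF cu(1) T] H1_curve_bounded[OF cu(2) T] H1_curve_bounded[OF cw(1) T] H1_curve_bounded[OF cw(2) T] by blast
  define R where "R = 2 * max (max R1 R2) (max R3 R4)"
  have R: "2 * H1_norm (u t) \<le> R" "2 * H1_norm (v t) \<le> R" "2 * H1_norm (w t) \<le> R" "2 * H1_norm (z t) \<le> R" if "t \<in> {0..T}" for t
    using R1234[rule_format, OF that] by (auto simp: R_def le_max_iff_disj)
  define L where "L = m + 2 * (coeff_bound \<alpha> + coeff_bound \<beta>) * R\<^sup>2"
  have nn: "0 \<le> coeff_bound \<alpha> * R\<^sup>2" "0 \<le> coeff_bound \<beta> * R\<^sup>2" by (simp_all add: coeff_bound_nonneg)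
  have L: "0 \<le> L" "m + 2 * coeff_bound \<alpha> * R\<^sup>2 \<le> L" "m + 2 * coeff_bound \<beta> * R\<^sup>2 \<le> L"
    using nn m by (simp_all add: L_def algebra_simps)
  have pde: "AE x in lborel. cmod (d' t x + of_real 1 * weak_deriv (d t) x) \<le> L * (cmod (d t x) + cmod (e t x)) \<and>
      cmod (e' t x + of_real (- 1) * weak_deriv (e t) x) \<le> L * (cmod (e t x) + cmod (d t x))" if t: "t \<in> {0..T}" for t
  proof -
    have t0: "t \<ge> 0" using t by simp
    have b: "AE x in lborel. cmod (y x) \<le> R" if "y \<in> H1" "2 * H1_norm y \<le> R" for y
      using H1_AE_bounded[OF that(1)] by eventually_elim (use that(2) in linarith)
    note bu = b[OF H1(1)[OF t0] R(1)[OF t]] and bv = b[OF H1(2)[OF t0] R(2)[OF t]]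
      and bw = b[OF H1(3)[OF t0] R(3)[OF t]] and bz = b[OF H1(4)[OF t0] R(4)[OF t]]
    have wd: "AE x in lborel. weak_deriv (d t) x = weak_deriv (w t) x - weak_deriv (u t) x"
      unfolding d_def by (rule H1_diff(2)[OF H1(3)[OF t0] H1(1)[OF t0]])
    have we: "AE x in lborel. weak_deriv (e t) x = weak_deriv (z t) x - weak_deriv (v t) x"
      unfolding e_def by (rule H1_diff(2)[OF H1(4)[OF t0] H1(2)[OF t0]])
    have solve: "a = rhs m c y p" if "\<i> * a = - of_real m * p + N1 c y p" for a c y p
    proof -
      have "a = - \<i> * (\<i> * a)" by simp
      then show ?thesis unfolding that by (simp add: rhs_def algebra_simps)
    qed
    show ?thesis
      using eu[OF t0] ew[OF t0] bu bv bw bz wd we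
    proof eventually_elim
      case (elim x)
      have s: "u' t x + weak_deriv (u t) x = rhs m \<alpha> (u t x) (v t x)" "v' t x - weak_deriv (v t) x = rhs m \<beta> (v t x) (u t x)"
        "w' t x + weak_deriv (w t) x = rhs m \<alpha> (w t x) (z t x)" "z' t x - weak_deriv (z t) x = rhs m \<beta> (z t x) (w t x)"
        using elim(1,2) unfolding N2_eq_N1 by (auto intro: solve)
      have 1: "d' t x + of_real 1 * weak_deriv (d t) x = rhs m \<alpha> (w t x) (z t x) - rhs m \<alpha> (u t x) (v t x)"
        unfolding elim(7) s(1,3)[symmetric] by (simp add: d'_def)
      have 2: "e' t x + of_real (- 1) * weak_deriv (e t) x = rhs m \<beta> (z t x) (w t x) - rhs m \<beta> (v t x) (u t x)"
        unfolding elim(8) s(2,4)[symmetric] by (simp add: e'_def)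
      show ?case unfolding 1 2 d_def e_def
        using order_trans[OF rhs_Lipschitz[OF elim(5,6,3,4) m] mult_right_mono[OF L(2)]]
          order_trans[OF rhs_Lipschitz[OF elim(6,5,4,3) m] mult_right_mono[OF L(3)]] by simp
    qed
  qed
  define N where "N t = (L2_norm (d t))\<^sup>2 + (L2_norm (e t))\<^sup>2" for t
  define N' where "N' t = 2 * Re (LINT x|lborel. cnj (d t x) * d' t x) + 2 * Re (LINT x|lborel. cnj (e t x) * e' t x)" for t
  have N_deriv: "(N has_real_derivative N' t) (at t within {0..})" if "t \<ge> 0" for t
    unfolding N_def[abs_def] N'_def by (intro DERIV_add L2_norm_sq_has_derivative C1 that)
  have N'_le: "N' t \<le> 8 * L * N t" if t: "t \<in> {0..T}" for t
  proof -
    have t0: "t \<ge> 0" using t by simp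
    have "Re (LINT x|lborel. cnj (d t x) * d' t x) \<le> 2 * L * ((L2_norm (d t))\<^sup>2 + (L2_norm (e t))\<^sup>2)"
      using pde[OF t] by (intro energy_rate[where \<sigma>=1] deH1 de'L2 H1_L2 t0 L(1)) auto
    moreover have "Re (LINT x|lborel. cnj (e t x) * e' t x) \<le> 2 * L * ((L2_norm (e t))\<^sup>2 + (L2_norm (d t))\<^sup>2)"
      using pde[OF t] by (intro energy_rate[where \<sigma>="- 1"] deH1 de'L2 H1_L2 t0 L(1)) auto
    ultimately show ?thesis unfolding N'_def N_def by (simp add: algebra_simps)
  qed
  define M where "M t = N t * exp (- (8 * L * t))" for t
  have M_deriv: "(M has_real_derivative (N' t - 8 * L * N t) * exp (- (8 * L * t))) (at t within {0..})" if "t \<ge> 0" for t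
    unfolding M_def[abs_def] by (rule derivative_eq_intros N_deriv that refl)+ (simp add: algebra_simps)
  have N0: "N 0 = 0"
  proof -
    have z: "L2_norm y = 0" if "y \<in> H1" "AE x in lborel. y x = 0" for y
      using L2_norm_cong_AE[OF L2_measurable[OF H1_L2[OF that(1)]], of "\<lambda>x. 0"] that(2) by simp
    have "AE x in lborel. d 0 x = 0" "AE x in lborel. e 0 x = 0"
      unfolding d_def e_def using iu iw by (eventually_elim; simp)+
    then show ?thesis unfolding N_def using z[of "d 0"] z[of "e 0"] deH1[of 0] by simp
  qed
  have "M T \<le> M 0"
  proof (rule DERIV_nonpos_imp_decreasing_open[OF T])
    show "\<exists>y. (M has_real_derivative y) (at t) \<and> y \<le> 0" if "0 < t" "t < T" for t
    proof (intro exI conjI)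
      have "at t within {0..} = at t" using that by (intro at_within_interior) simp
      then show "(M has_real_derivative (N' t - 8 * L * N t) * exp (- (8 * L * t))) (at t)"
        using M_deriv[of t] that by simp
      show "(N' t - 8 * L * N t) * exp (- (8 * L * t)) \<le> 0"
        using N'_le[of t] that by (intro mult_nonpos_nonneg) auto
    qed
    have "continuous_on {0..} M"
      using M_deriv by (intro DERIV_continuous_on) auto
    then show "continuous_on {0..T} M" by (rule continuous_on_subset) auto
qed
  then have "N T * exp (- (8 * L * T)) \<le> 0" by (simp add: M_def N0)
  then have "N T \<le> 0" by (simp add: mult_le_0_iff)
  then have "(L2_norm (d T))\<^sup>2 = 0" "(L2_norm (e T))\<^sup>2 = 0"
    unfolding N_def using zero_le_power2[of "L2_norm (d T)"] zero_le_power2[of "L2_norm (e T)"] by linarith+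
  then have "L2_norm (d T) = 0" "L2_norm (e T) = 0" by simp_all
  then have "AE x in lborel. d T x = 0" "AE x in lborel. e T x = 0"
    using L2_norm_eq_0_AE H1_L2 deH1[OF T] by blast+
  then show ?thesis by eventually_elim (simp add: d_def e_def)
qed

section \<open>Global well-posedness\<close>

theorem theorem1p1:
  fixes m :: real and \<alpha> \<beta> :: "nat \<Rightarrow> complex"
  assumes "m \<ge> 0"
    and "\<And>u v. Re (\<i> * cnj u * N1 \<alpha> u v + \<i> * cnj v * N2 \<beta> u v) = 0"
  shows "\<exists>C0>0. \<forall>u0\<in>H1. \<forall>v0\<in>H1. (L2_norm u0)\<^sup>2 + (L2_norm v0)\<^sup>2 \<le> C0 \<longrightarrow>
    (\<exists>u v. solution m \<alpha> \<beta> u0 v0 u v \<and>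
      (\<forall>w z. solution m \<alpha> \<beta> u0 v0 w z \<longrightarrow>
        (\<forall>t\<ge>0. AE x in lborel. w t x = u t x \<and> z t x = v t x)))"
proof -
  define CB where "CB = coeff_bound \<alpha> + coeff_bound \<beta>"
  have CB: "0 \<le> CB" by (simp add: CB_def coeff_bound_nonneg add_nonneg_nonneg)
  \<comment> \<open>Half of the charge passes through a characteristic, so \<open>CB * Q \<le> 1\<close> lets the cubic term be
      absorbed with the factor one half.\<close>
  define Q where "Q = 1 / (1 + CB)"
  have Q: "0 < Q" "Q \<le> 1" "CB * Q \<le> 1" using CB by (auto simp: Q_def divide_simps)
  show ?thesis
  proof (intro exI[of _ Q] conjI ballI impI Q)
    fix u0 v0 assume H: "u0 \<in> H1" "v0 \<in> H1" and small: "(L2_norm u0)\<^sup>2 + (L2_norm v0)\<^sup>2 \<le> Q"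
    obtain F where F: "primitive F (weak_deriv u0)" "continuous_on UNIV F" "F \<in> L2" "AE x in lborel. u0 x = F x"
      "\<And>x. cmod (F x) \<le> 2 * H1_norm u0"
      using H1_continuous_representative[OF H(1)] by blast
    obtain G where G: "primitive G (weak_deriv v0)" "continuous_on UNIV G" "G \<in> L2" "AE x in lborel. v0 x = G x"
      "\<And>x. cmod (G x) \<le> 2 * H1_norm v0"
      using H1_continuous_representative[OF H(2)] by blast
    define B where "B = 2 * H1_norm u0 + 2 * H1_norm v0"
    have B: "cmod (F x) \<le> B" "cmod (G x) \<le> B" for x
      using F(5)[of x] G(5)[of x] H1_norm_bounds(4)[of u0] H1_norm_bounds(4)[of v0] by (auto simp: B_def)
    have norms: "L2_norm F = L2_norm u0" "L2_norm G = L2_norm v0"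
      using F G H by (auto intro!: L2_norm_cong_AE[symmetric] L2_measurable H1_L2)
    have charge: "integral {a..b} (\<lambda>x. (cmod (F x))\<^sup>2 + (cmod (G x))\<^sup>2) \<le> Q" for a b
    proof -
      have c: "continuous_on {a..b} (\<lambda>x. (cmod (F x))\<^sup>2 + (cmod (G x))\<^sup>2)"
        by (intro continuous_intros continuous_on_subset[OF F(2)] continuous_on_subset[OF G(2)]) auto
      have i: "integrable lborel (\<lambda>x. (cmod (F x))\<^sup>2 + (cmod (G x))\<^sup>2)"
        by (intro Bochner_Integration.integrable_add L2_integrable F G)
      have "integral {a..b} (\<lambda>x. (cmod (F x))\<^sup>2 + (cmod (G x))\<^sup>2) = (LINT x|lborel. indicator {a..b} x *\<^sub>R ((cmod (F x))\<^sup>2 + (cmod (G x))\<^sup>2))"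
        by (rule integral_eq_lborel[OF c])
      also have "\<dots> \<le> (LINT x|lborel. (cmod (F x))\<^sup>2 + (cmod (G x))\<^sup>2)"
        using borel_integrable_atLeastAtMost'[OF c] i
        by (intro integral_mono) (auto simp: set_integrable_def indicator_def)
      also have "\<dots> = (L2_norm F)\<^sup>2 + (L2_norm G)\<^sup>2"
        unfolding L2_norm_sq by (intro Bochner_Integration.integral_add L2_integrable F G)
      finally show ?thesis using small norms by simp
    qed
    obtain u v where uv: "cont2 u" "cont2 v" "u 0 = F" "v 0 = G"
      "mild 1 u (\<lambda>t x. rhs m \<alpha> (u t x) (v t x))" "mild (- 1) v (\<lambda>t x. rhs m \<beta> (v t x) (u t x))"
      "\<And>t x. t \<ge> 0 \<Longrightarrow> cmod (u t x) + cmod (v t x) \<le> 4 * (B + m * (t + 1))"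
      using global_bounded_solution[OF assms F(2) G(2) B charge Q(2) Q(3)[unfolded CB_def]] by blast
    define A where "A = L2_norm (weak_deriv u0) + L2_norm (weak_deriv v0)"
    interpret bounded_mild_solution m \<alpha> \<beta> u v "\<lambda>T. 4 * (B + m * (T + 1))" A
    proof
      show "cmod (u t x) + cmod (v t x) \<le> 4 * (B + m * (T + 1))" if "t \<in> {0..T}" for T t x
      proof -
        have "m * (t + 1) \<le> m * (T + 1)" using that assms(1) by (intro mult_left_mono) auto
        then show ?thesis using uv(7)[of t x] that by auto
      qed
      show "u 0 \<in> H1" "v 0 \<in> H1"
        unfolding uv(3,4) using F G H weak_deriv_props primitive_has_weak_deriv weak_deriv_AE(1) by blast+
      show "cmod (u 0 x - u 0 y) \<le> sqrt \<bar>x - y\<bar> * A" "cmod (v 0 x - v 0 y) \<le> sqrt \<bar>x - y\<bar> * A" for x y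
      proof -
        have "sqrt \<bar>x - y\<bar> * L2_norm (weak_deriv u0) \<le> sqrt \<bar>x - y\<bar> * A"
          "sqrt \<bar>x - y\<bar> * L2_norm (weak_deriv v0) \<le> sqrt \<bar>x - y\<bar> * A"
          by (auto intro!: mult_left_mono simp: A_def)
        then show "cmod (u 0 x - u 0 y) \<le> sqrt \<bar>x - y\<bar> * A" "cmod (v 0 x - v 0 y) \<le> sqrt \<bar>x - y\<bar> * A"
          unfolding uv(3,4)
          using primitive_holder[OF F(1) weak_deriv_props(1)[OF H(1)], of x y]
            primitive_holder[OF G(1) weak_deriv_props(1)[OF H(2)], of x y] by linarith+
      qed
    qed (use assms(1) uv in auto)
    have "solution m \<alpha> \<beta> u0 v0 u v"
    proof (rule is_solution)
      show "AE x in lborel. u 0 x = u0 x \<and> v 0 x = v0 x"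
        unfolding uv(3,4) using F(4) G(4) by eventually_elim simp
    qed
    then show "\<exists>u v. solution m \<alpha> \<beta> u0 v0 u v \<and> (\<forall>w z. solution m \<alpha> \<beta> u0 v0 w z \<longrightarrow>
        (\<forall>t\<ge>0. AE x in lborel. w t x = u t x \<and> z t x = v t x))"
      using solution_unique[OF assms(1)] by blast
  qed
qed

end
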